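(* Let $0<\alpha<0.3$. For every integer $n\ge1$ and every $\sigma>0$, the interval $\mathtt{CI}_{z,\alpha}$ (constructed in the context) is a $(1-\alpha)$-level confidence interval for the minimizer, i.e. $\mathbb P_f(Z(f)\in\mathtt{CI}_{z,\alpha})\ge1-\alpha$ for all $f\in\mathcal F$, and its expected length satisfies $$\mathbb E_fL(\mathtt{CI}_{z,\alpha})\le C_{2,\alpha}\,\tilde L_{z,\alpha,n}(\sigma;f)\qquad\text{for all } f\in\mathcal F,$$ where $C_{2,\alpha}$ is a constant depending on $\alpha$ only.
   Context: $\Phi$ is the standard normal cdf, $z_\beta=\Phi^{-1}(1-\beta)$ (for a single subscript $\beta\in(0,1)$), $a\vee b=\max\{a,b\}$, $a\wedge b=\min\{a,b\}$. $\mathcal F$ is the collection of convex functions $f:[0,1]\to\mathbb R$ with a unique minimizer $Z(f)=\arg\min_{0\le t\le1}f(t)$. Nonparametric regression model: one observes $y_i=f(x_i)+\sigma\xi_i$, $i=0,1,\dots,n$, with $x_i=i/n$, $\xi_i$ i.i.d. $N(0,1)$ and $\sigma>0$ known; $\mathbb P_f,\mathbb E_f$ are probability and expectation under $f$ (including auxiliary randomness). $L(CI)$ is the length of an interval $CI$. Benchmark: $\tilde L_{z,\alpha,n}(\sigma;f)=\sup_{g\in\mathcal F}\inf_{CI\in\mathcal I_{z,\alpha,n}(\{f,g\})}\mathbb E_fL(CI)$, where $\mathcal I_{z,\alpha,n}(\{f,g\})$ is the collection of confidence intervals based on $y_0,\dots,y_n$ that contain $Z(h)$ with probability at least $1-\alpha$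 under $h$, for both $h=f$ and $h=g$. Construction of $\mathtt{CI}_{z,\alpha}$. Data splitting: let $z_{1,0},\dots,z_{1,n},z_{2,0},\dots,z_{2,n}$ be i.i.d. $N(0,1)$, independent of the data. For $i=0,\dots,n$ set $y_{l,i}=y_i+\frac{\sqrt2}{2}\sigma z_{1,i}+\frac{\sqrt6}{2}\sigma z_{2,i}$, $y_{s,i}=y_i+\frac{\sqrt2}{2}\sigma z_{1,i}-\frac{\sqrt6}{2}\sigma z_{2,i}$, $y_{e,i}=y_i-\sqrt2\,\sigma z_{1,i}$; set $y_{l,i}=y_{s,i}=y_{e,i}=+\infty$ for $i\notin\{0,\dots,n\}$. Blocks: let $J=\lfloor\log_2(n+1)\rfloor$. For $0\le j\le J$ the $i$-th block at level $j$ is $\{x_{(i-1)2^{J-j}},\dots,x_{i2^{J-j}-1}\}$. For $u\in\{l,s,e\}$ let $Y_{j,i,u}=\sum_{k=(i-1)2^{J-j}}^{i2^{J-j}-1}y_{u,k}$, which is $+\infty$ whenever the block is not entirely contained in the sample, i.e. whenever $i\notin\{1,\dots,\lfloor(n+1)/2^{J-j}\rfloor\}$. Localization: $\hat i_0=1$ and for $j=1,\dots,J$, $\hat i_j=\arg\min Y_{j,i,l}$ over $\max\{2\hat i_{j-1}-2,1\}\le i\le\min\{2\hat i_{j-1}+1,\lfloor(n+1)/2^{J-j}\rfloor\}$. Stopping: $T_j=\min\{Y_{j,\hat i_j+6,s}-Y_{j,\hat i_j+5,s},\ Y_{j,\hat i_j-6,s}-Y_{j,\hat i_j-5,s}\}$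 (with $+\infty-x=+\infty$ for all $x\le+\infty$), $\tilde\sigma_j^2=6\cdot2^{J-j}\sigma^2$. Let $\check j=\min\{j\in\{0,\dots,J\}:T_j\le2\tilde\sigma_j\}$ if this set is nonempty and $\check j=\infty$ otherwise; $\hat j=\min\{J,\check j\}$. Let $K_\beta=\lceil\log\beta/\log\Phi(-2)\rceil$. The confidence interval is $\mathtt{CI}_{z,\alpha}=[t_{lo}\wedge t_{hi},\,t_{hi}]$ with $t_{lo},t_{hi}$ as follows. Case $\check j<\infty$: with $\mathtt L=\max\{0,\hat i_{\hat j}-12\cdot2^{K_{\alpha/2}}+1\}$ and $\mathtt U=\min\{\lceil(n+1)2^{\hat j-J}\rceil,\hat i_{\hat j}+12\cdot2^{K_{\alpha/2}}-2\}$, $$t_{lo}=\frac{2^{J-\hat j}}n\mathtt L-\frac1{2n},\qquad t_{hi}=\frac{2^{J-\hat j}}n\mathtt U-\frac1{2n}.$$ Case $\check j=\infty$: set $L=\max\{1,\hat i_{\hat j}-12\cdot2^{K_{\alpha/2}}\}-1$, $U=\min\{n+1,\hat i_{\hat j}+12\cdot2^{K_{\alpha/2}}\}-1$, $\alpha_1=\alpha/8$, $\alpha_2=\alpha/24$. Generate $z_{3,0},\dots,z_{3,n}$ i.i.d. $N(0,1)$ independent of everything else. Write $p_i=y_{e,i}+\sqrt3\,\sigma z_{3,i}$, $q_i=y_{e,i}-\sqrt3\,\sigma z_{3,i}$ for $0\le i\le n$ (and $q_i=+\infty$ for $i\notin\{0,\dots,n\}$), and $c=2\sqrt6\,\sigma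 z_{\alpha_2}$. Ratios with denominator $+\infty$ are read as $0$. Let $$i_l=\min\big(\{U\}\cup\{i\in[L,U-1]:p_i-p_{i+1}\le2\sqrt3\,\sigma z_{\alpha_1}\}\big),\qquad i_r=\max\big(\{L-1\}\cup\{i\in[L,U-1]:p_i-p_{i+1}\ge-2\sqrt3\,\sigma z_{\alpha_1}\}\big).$$ Then execute in order (later assignments override earlier ones): (1) If $i_l=U$: if $i_l=n$ and $q_{n-2}-q_{n-1}+c>0$, set $t_{hi}=1$ and $$t_{lo}=\Big(\Big(-\frac{q_n-q_{n-1}+c}{n(q_{n-2}-q_{n-1}+c)}+\frac{n-1}n\Big)\vee\frac{n-1}n\Big)\wedge1;$$ otherwise set $t_{lo}=t_{hi}=U/n$. (2) If $i_r=L-1$: if $i_r=-1$ and $q_2-q_1+c>0$, set $t_{lo}=0$ and $$t_{hi}=\Big(\Big(\frac{q_0-q_1+c}{n(q_2-q_1+c)}+\frac1n\Big)\vee0\Big)\wedge\frac1n;$$ otherwise set $t_{lo}=t_{hi}=0$. (3) If $(i_l-U)(i_r-L+1)\ne0$: let $i_{lo}=(i_l-1)\vee L$, $i_{hi}=(i_r+2)\wedge U$. (3a) If $i_{hi}-i_{lo}\ge3$ or $(i_{hi}-n)i_{lo}=0$, set $t_{lo}=i_{lo}/n$, $t_{hi}=i_{hi}/n$. (3b) Else, if $q_{i_{hi}+1}-q_{i_{hi}}\le-c$ or $q_{i_{lo}-1}-q_{i_{lo}}\le-c$, set $t_{lo}=t_{hi}=(i_{hi}+i_{lo})/(2n)$.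 (3c) Else set $$t_{hi}=\Big(\Big(\frac{q_{i_{hi}-1}-q_{i_{hi}}+c}{n(q_{i_{hi}+1}-q_{i_{hi}}+c)}+\frac{i_{hi}}n\Big)\vee\frac{i_{hi}-1}n\Big)\wedge\frac{i_{hi}}n,$$ $$t_{lo}=\Big(\Big(-\frac{q_{i_{lo}+1}-q_{i_{lo}}+c}{n(q_{i_{lo}-1}-q_{i_{lo}}+c)}+\frac{i_{lo}}n\Big)\vee\frac{i_{lo}}n\Big)\wedge\frac{i_{lo}+1}n.$$ *)

theory Defs
  imports "HOL-Probability.Probability"
begin

section \<open>Normal quantiles\<close>

abbreviation Phi :: "real \<Rightarrow> real" where
  "Phi \<equiv> cdf std_normal_distribution"

definition z_quantile :: "real \<Rightarrow> real" where
  "z_quantile \<beta> = inv Phi (1 - \<beta>)"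


section \<open>Convex functions with a unique minimizer\<close>

text \<open>A function on the unit interval is a total function on the reals of which only the
  values on \<open>{0..1}\<close> are ever used.\<close>

definition convex_class :: "(real \<Rightarrow> real) set" where
  "convex_class = {f. convex_on {0..1} f \<and> (\<exists>!t. is_arg_min f (\<lambda>s. s \<in> {0..1}) t)}"

definition minimizer :: "(real \<Rightarrow> real) \<Rightarrow> real" where
  "minimizer f = (THE t. is_arg_min f (\<lambda>s. s \<in> {0..1}) t)"


section \<open>Regression model\<close>

text \<open>An outcome \<open>(y, z)\<close> consists of the observations \<open>y i\<close>, \<open>i = 0,\<dots>,n\<close>, and of the auxiliary
  variables \<open>z (k, i) = z\<^sub>k\<^sub>,\<^sub>i\<close>, \<open>k = 1,2,3\<close>, \<open>i = 0,\<dots>,n\<close>, which are standard normal and independent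
  of the observations.\<close>

type_synonym outcome = "(nat \<Rightarrow> real) \<times> (nat \<times> nat \<Rightarrow> real)"

definition obs_law :: "nat \<Rightarrow> real \<Rightarrow> (real \<Rightarrow> real) \<Rightarrow> (nat \<Rightarrow> real) measure" where
  "obs_law n \<sigma> f =
     distr (Pi\<^sub>M {0..n} (\<lambda>_. std_normal_distribution)) (Pi\<^sub>M {0..n} (\<lambda>_. borel))
       (\<lambda>\<xi>. \<lambda>i\<in>{0..n}. f (real i / real n) + \<sigma> * \<xi> i)"

definition aux_law :: "nat \<Rightarrow> (nat \<times> nat \<Rightarrow> real) measure" where
  "aux_law n = Pi\<^sub>M ({1..3} \<times> {0..n}) (\<lambda>_. std_normal_distribution)"

definition model :: "nat \<Rightarrow> real \<Rightarrow> (real \<Rightarrow> real) \<Rightarrow> outcome measure" where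
  "model n \<sigma> f = obs_law n \<sigma> f \<Otimes>\<^sub>M aux_law n"


section \<open>Confidence intervals and the benchmark\<close>

text \<open>A confidence interval is the map from outcomes to its pair of end points. Confidence intervals
  may use the auxiliary variables, that is, they may be randomized. Expected lengths are
  taken in \<^typ>\<open>ennreal\<close>, so they are meaningful without an integrability condition.\<close>

definition conf_intervals ::
  "nat \<Rightarrow> real \<Rightarrow> real \<Rightarrow> (real \<Rightarrow> real) set \<Rightarrow> (outcome \<Rightarrow> real \<times> real) set" where
  "conf_intervals n \<sigma> \<alpha> H =
     {CI. (\<forall>\<omega>. fst (CI \<omega>) \<le> snd (CI \<omega>)) \<and>
          (\<forall>h\<in>H. CI \<in> borel_measurable (model n \<sigma> h) \<and>
             measure (model n \<sigma> h)
               {\<omega> \<in> space (model n \<sigma> h). minimizer h \<in> {fst (CI \<omega>)..snd (CI \<omega>)}} \<ge> 1 - \<alpha>)}"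

definition expected_length ::
  "nat \<Rightarrow> real \<Rightarrow> (real \<Rightarrow> real) \<Rightarrow> (outcome \<Rightarrow> real \<times> real) \<Rightarrow> ennreal" where
  "expected_length n \<sigma> f CI = (\<integral>\<^sup>+\<omega>. ennreal (snd (CI \<omega>) - fst (CI \<omega>)) \<partial>model n \<sigma> f)"

definition benchmark :: "nat \<Rightarrow> real \<Rightarrow> real \<Rightarrow> (real \<Rightarrow> real) \<Rightarrow> ennreal" where
  "benchmark n \<sigma> \<alpha> f =
     (SUP g\<in>convex_class. INF CI\<in>conf_intervals n \<sigma> \<alpha> {f, g}. expected_length n \<sigma> f CI)"


section \<open>Data splitting and blocks\<close>

definition split_l :: "real \<Rightarrow> outcome \<Rightarrow> nat \<Rightarrow> real" where
  "split_l \<sigma> = (\<lambda>(y, z) i. y i + sqrt 2 / 2 * \<sigma> * z (1, i) + sqrt 6 / 2 * \<sigma> * z (2, i))"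

definition split_s :: "real \<Rightarrow> outcome \<Rightarrow> nat \<Rightarrow> real" where
  "split_s \<sigma> = (\<lambda>(y, z) i. y i + sqrt 2 / 2 * \<sigma> * z (1, i) - sqrt 6 / 2 * \<sigma> * z (2, i))"

definition split_e :: "real \<Rightarrow> outcome \<Rightarrow> nat \<Rightarrow> real" where
  "split_e \<sigma> = (\<lambda>(y, z) i. y i - sqrt 2 * \<sigma> * z (1, i))"

text \<open>Extension of a vector indexed by \<open>0,\<dots>,n\<close> to all integers by the value \<open>\<infinity>\<close>.\<close>

definition extend :: "nat \<Rightarrow> (nat \<Rightarrow> real) \<Rightarrow> int \<Rightarrow> ereal" where
  "extend n u i = (if 0 \<le> i \<and> i \<le> int n then ereal (u (nat i)) else \<infinity>)"

definition max_level :: "nat \<Rightarrow> nat" where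
  "max_level n = nat \<lfloor>log 2 (real n + 1)\<rfloor>"

text \<open>A sum in \<^typ>\<open>ereal\<close> with a summand \<open>\<infinity>\<close> is \<open>\<infinity>\<close>; hence so is the sum over a block that is not
  contained in the sample.\<close>

definition block_sum :: "nat \<Rightarrow> (nat \<Rightarrow> real) \<Rightarrow> nat \<Rightarrow> int \<Rightarrow> ereal" where
  "block_sum n u j i =
     (\<Sum>k\<in>{(i - 1) * 2 ^ (max_level n - j)..i * 2 ^ (max_level n - j) - 1}. extend n u k)"


section \<open>Localization and stopping\<close>

primrec loc_index :: "nat \<Rightarrow> real \<Rightarrow> outcome \<Rightarrow> nat \<Rightarrow> int" where
  "loc_index n \<sigma> \<omega> 0 = 1"
| "loc_index n \<sigma> \<omega> (Suc j) =
     arg_min_on (block_sum n (split_l \<sigma> \<omega>) (Suc j))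
       {max (2 * loc_index n \<sigma> \<omega> j - 2) 1 ..
        min (2 * loc_index n \<sigma> \<omega> j + 1) \<lfloor>(real n + 1) / 2 ^ (max_level n - Suc j)\<rfloor>}"

text \<open>In \<^typ>\<open>ereal\<close>, \<open>\<infinity> - x = \<infinity>\<close> for every \<open>x\<close>, including \<open>x = \<infinity>\<close>.\<close>

definition stop_stat :: "nat \<Rightarrow> real \<Rightarrow> outcome \<Rightarrow> nat \<Rightarrow> ereal" where
  "stop_stat n \<sigma> \<omega> j =
     (let i = loc_index n \<sigma> \<omega> j; Y = block_sum n (split_s \<sigma> \<omega>) j
      in min (Y (i + 6) - Y (i + 5)) (Y (i - 6) - Y (i - 5)))"

definition sigma_level :: "nat \<Rightarrow> real \<Rightarrow> nat \<Rightarrow> real" where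
  "sigma_level n \<sigma> j = sqrt (6 * 2 ^ (max_level n - j) * \<sigma>\<^sup>2)"

text \<open>The infimum of the empty set in \<^typ>\<open>enat\<close> is \<open>\<infinity>\<close>.\<close>

definition check_j :: "nat \<Rightarrow> real \<Rightarrow> outcome \<Rightarrow> enat" where
  "check_j n \<sigma> \<omega> =
     Inf (enat ` {j. j \<le> max_level n \<and> stop_stat n \<sigma> \<omega> j \<le> ereal (2 * sigma_level n \<sigma> j)})"

definition hat_j :: "nat \<Rightarrow> real \<Rightarrow> outcome \<Rightarrow> nat" where
  "hat_j n \<sigma> \<omega> = the_enat (min (enat (max_level n)) (check_j n \<sigma> \<omega>))"


section \<open>The confidence interval\<close>

definition K_const :: "real \<Rightarrow> int" where
  "K_const \<beta> = \<lceil>ln \<beta> / ln (Phi (-2))\<rceil>"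

text \<open>End points \<open>(t_lo, t_hi)\<close> when the stopping rule fires.\<close>

definition endpoints_stopped :: "nat \<Rightarrow> real \<Rightarrow> real \<Rightarrow> outcome \<Rightarrow> real \<times> real" where
  "endpoints_stopped n \<sigma> \<alpha> \<omega> =
     (let j = hat_j n \<sigma> \<omega>; i = loc_index n \<sigma> \<omega> j; w = 2 ^ (max_level n - j) :: real;
          r = 12 * 2 ^ nat (K_const (\<alpha> / 2)) :: int;
          L = max 0 (i - r + 1);
          U = min \<lceil>(real n + 1) / w\<rceil> (i + r - 2)
      in (w / real n * of_int L - 1 / (2 * real n), w / real n * of_int U - 1 / (2 * real n)))"

text \<open>In \<^typ>\<open>ereal\<close>, a quotient with finite numerator and denominator \<open>\<infinity>\<close> is \<open>0\<close>.\<close>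

definition ratio :: "ereal \<Rightarrow> ereal \<Rightarrow> real" where
  "ratio a b = real_of_ereal (a / b)"

text \<open>End points when the stopping rule never fires. Each of the three steps of
  the procedure sets both end points, so the order of the first two tests below, together
  with the exclusive third one, expresses that later assignments override earlier ones.\<close>

definition endpoints_unstopped :: "nat \<Rightarrow> real \<Rightarrow> real \<Rightarrow> outcome \<Rightarrow> real \<times> real" where
  "endpoints_unstopped n \<sigma> \<alpha> \<omega> =
     (let i = loc_index n \<sigma> \<omega> (hat_j n \<sigma> \<omega>);
          r = 12 * 2 ^ nat (K_const (\<alpha> / 2)) :: int;
          L = max 1 (i - r) - 1;
          U = min (int n + 1) (i + r) - 1;
          \<alpha>1 = \<alpha> / 8; \<alpha>2 = \<alpha> / 24;
          p = (\<lambda>k. split_e \<sigma> \<omega> (nat k) + sqrt 3 * \<sigma> * snd \<omega> (3, nat k));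
          q = extend n (\<lambda>k. split_e \<sigma> \<omega> k - sqrt 3 * \<sigma> * snd \<omega> (3, k));
          c = 2 * sqrt 6 * \<sigma> * z_quantile \<alpha>2;
          N = real n;
          il = Min ({U} \<union> {k \<in> {L..U - 1}. p k - p (k + 1) \<le> 2 * sqrt 3 * \<sigma> * z_quantile \<alpha>1});
          ir = Max ({L - 1} \<union> {k \<in> {L..U - 1}. p k - p (k + 1) \<ge> - (2 * sqrt 3 * \<sigma> * z_quantile \<alpha>1)});
          ilo = max (il - 1) L;
          ihi = min (ir + 2) U
      in if ir = L - 1 then
           (if ir = -1 \<and> q 2 - q 1 + c > 0
            then (0, min (max (ratio (q 0 - q 1 + c) (N * (q 2 - q 1 + c)) + 1 / N) 0) (1 / N))
            else (0, 0))
         else if il = U then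
           (if il = int n \<and> q (int n - 2) - q (int n - 1) + c > 0
            then (min (max (- ratio (q (int n) - q (int n - 1) + c)
                                    (N * (q (int n - 2) - q (int n - 1) + c)) + (N - 1) / N)
                           ((N - 1) / N)) 1, 1)
            else (of_int U / N, of_int U / N))
         else if ihi - ilo \<ge> 3 \<or> (ihi - int n) * ilo = 0 then
           (of_int ilo / N, of_int ihi / N)
         else if q (ihi + 1) - q ihi \<le> - ereal c \<or> q (ilo - 1) - q ilo \<le> - ereal c then
           (of_int (ihi + ilo) / (2 * N), of_int (ihi + ilo) / (2 * N))
         else
           (min (max (- ratio (q (ilo + 1) - q ilo + c) (N * (q (ilo - 1) - q ilo + c))
                      + of_int ilo / N) (of_int ilo / N)) (of_int (ilo + 1) / N),
            min (max (ratio (q (ihi - 1) - q ihi + c) (N * (q (ihi + 1) - q ihi + c))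
                      + of_int ihi / N) (of_int (ihi - 1) / N)) (of_int ihi / N)))"

definition CI_z :: "nat \<Rightarrow> real \<Rightarrow> real \<Rightarrow> outcome \<Rightarrow> real \<times> real" where
  "CI_z n \<sigma> \<alpha> \<omega> =
     (let (tlo, thi) = (if check_j n \<sigma> \<omega> < \<infinity> then endpoints_stopped n \<sigma> \<alpha> \<omega>
                        else endpoints_unstopped n \<sigma> \<alpha> \<omega>)
      in (min tlo thi, thi))"

end

theory Submission
  imports Defs
begin

text \<open>
  Two functions whose values on the grid differ by at most \<open>\<sigma>/10\<close> in the Euclidean norm cannot be told
  apart from the data, so an interval that covers both minimizers must have expected length
  comparable to their distance. Hence it suffices to bound the expected length by a multiple of a
  radius \<open>R\<close> such that every indistinguishable \<open>g\<close> has its minimizer within \<open>R\<close> of that of \<open>f\<close>.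
  Truncating \<open>f\<close> from below, and replacing it by a dip inside one grid cell, gives such functions
  \<open>g\<close>; therefore, at every scale above \<open>R\<close>, the increments of \<open>f\<close> away from its minimizer are large
  compared with the noise. By Chebyshev's inequality the probability that localization or stopping
  goes wrong at scale \<open>x\<close> is at most of order \<open>(R/x)\<^sup>2\<close>, and the sum over dyadic scales of \<open>x\<close> times
  \<open>min(1, (R/x)\<^sup>2)\<close> is at most of order \<open>R\<close>. If \<open>R\<close> is below the grid spacing, the same comparison
  is applied to the second differences that determine the refined interval.

  For the coverage, consider the first level at which the localization is so far off that the minimizer
  lies beyond the blocks compared by the stopping rule. It stays off from there on, and given the path
  of the localization, which is independent of the stopping sample, each later level fails to stop with
  probability at most \<open>\<Phi>(-2)\<close>. The blocks compared at different levels are disjoint, so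
  these events are independent and \<open>K\<close> of them have probability at most \<open>\<alpha>/2\<close>.
\<close>

section \<open>Convex functions on the unit interval\<close>

text \<open>The bound on \<alpha> matches the constant 1/5: an interval valid for two functions that
  cannot be told apart covers both minimizers at once with probability at least 1 - 2 \<alpha> -
  1/5, which exceeds 1/5. So R may be taken as 5 times the benchmark, plus something positive in
  case the benchmark vanishes. The obstacle in the upper bound is that the blocks being compared are
  random. Errors are therefore charged to all pairs of blocks at bounded offsets from the block that
  contains the minimizer. A wrong decision at block width w forces
  \<open>1 \<le> C * (n R / w)^2 * (1 + X^2 / w)\<close> for some noise difference X of such a pair.
  This holds outcome by outcome, so the length is dominated by a weighted sum of quadratic noise
  costs; its expectation takes only second moments and no independence between levels. Coverage is
  different: it multiplies probabilities over levels and therefore rests on exact independence of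
  the localization and the stopping samples. That is obtained by writing the four samples as an
  orthogonal transform of the observation noise and the auxiliary variables.\<close>

lemma minimizer_in: "f \<in> convex_class \<Longrightarrow> minimizer f \<in> {0..1}"
  and minimizer_less: "f \<in> convex_class \<Longrightarrow> s \<in> {0..1} \<Longrightarrow> s \<noteq> minimizer f \<Longrightarrow> f (minimizer f) < f s"
proof -
  assume "f \<in> convex_class"
  then have ex: "\<exists>!t. is_arg_min f (\<lambda>s. s \<in> {0..1}) t" by (simp add: convex_class_def)
  then have Z: "is_arg_min f (\<lambda>s. s \<in> {0..1}) (minimizer f)"
    unfolding minimizer_def by (rule theI')
  then show "minimizer f \<in> {0..1}" by (simp add: is_arg_min_def)
  assume s: "s \<in> {0..1}" "s \<noteq> minimizer f"
  show "f (minimizer f) < f s"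
  proof (rule ccontr)
    assume "\<not> ?thesis"
    then have "is_arg_min f (\<lambda>s. s \<in> {0..1}) s"
      using Z s(1) by (fastforce simp: is_arg_min_def)
    with ex Z s(2) show False by blast
  qed
qed

lemma minimizer_le: "f \<in> convex_class \<Longrightarrow> s \<in> {0..1} \<Longrightarrow> f (minimizer f) \<le> f s"
  using minimizer_less[of f s] by (cases "s = minimizer f") auto

lemma convex_classI:
  assumes "convex_on {0..1} g" "t \<in> {0..1}" "\<And>y. y \<in> {0..1} \<Longrightarrow> y \<noteq> t \<Longrightarrow> g t < g y"
  shows "g \<in> convex_class" "minimizer g = t"
proof -
  have 1: "is_arg_min g (\<lambda>s. s \<in> {0..1}) t"
    using assms(2,3) by (force simp: is_arg_min_def)
  have 2: "s = t" if "is_arg_min g (\<lambda>s. s \<in> {0..1}) s" for s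
    using that assms(2,3) by (auto simp: is_arg_min_def)
  show "g \<in> convex_class" unfolding convex_class_def using assms(1) 1 2 by blast
  show "minimizer g = t" unfolding minimizer_def using 1 2 by (rule the_equality)
qed

text \<open>Cross-multiplied, so that it holds for \<open>x = z\<close> as well and later arguments
  do without quotients.\<close>

lemma convex_on_three_points:
  fixes f :: "real \<Rightarrow> real"
  assumes "convex_on S f" "x \<in> S" "z \<in> S" "x \<le> y" "y \<le> z"
  shows "(z - x) * f y \<le> (z - y) * f x + (y - x) * f z"
proof (cases "x = z")
  case True then show ?thesis using assms by auto
next
  case False
  with assms have xz: "x < z" by auto
  define u where "u = (z - y) / (z - x)"
  define v where "v = (y - x) / (z - x)"
  have uv: "0 \<le> u" "0 \<le> v" "u + v = 1"
    using assms xz by (auto simp: u_def v_def add_divide_distrib[symmetric])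
  have "u * x + v * z = ((z - y) * x + (y - x) * z) / (z - x)"
    by (simp add: u_def v_def add_divide_distrib)
  also have "(z - y) * x + (y - x) * z = y * (z - x)" by algebra
  finally have y: "u * x + v * z = y" using xz by simp
  have "f (u *\<^sub>R x + v *\<^sub>R z) \<le> u * f x + v * f z"
    using assms(1-3) uv by (auto simp: convex_on_def)
  then have "f y \<le> u * f x + v * f z" using y by simp
  then have "(z - x) * f y \<le> (z - x) * (u * f x + v * f z)" using xz by simp
  also have "\<dots> = (z - y) * f x + (y - x) * f z"
    using xz by (simp add: u_def v_def distrib_left)
  finally show ?thesis .
qed

text \<open>The slope over \<open>[p, q]\<close> is compared with the slope over
  \<open>[p, q']\<close>, and the latter with the slope over \<open>[p', q']\<close>. Both
  comparisons are the three-point inequality, and the intervals may overlap.\<close>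

lemma convex_on_chord_mono:
  fixes f :: "real \<Rightarrow> real"
  assumes f: "convex_on S f" and S: "p \<in> S" "q' \<in> S"
    and le: "p \<le> p'" "q \<le> q'" "p < q" "p' < q'"
  shows "(f q - f p) * (q' - p') \<le> (f q' - f p') * (q - p)"
proof -
  have "(q' - p) * f q \<le> (q' - q) * f p + (q - p) * f q'"
    by (rule convex_on_three_points[OF f S]) (use le in auto)
  then have 1: "(f q - f p) * (q' - p) \<le> (f q' - f p) * (q - p)" by (simp add: algebra_simps)
  have "(q' - p) * f p' \<le> (q' - p') * f p + (p' - p) * f q'"
    by (rule convex_on_three_points[OF f S]) (use le in auto)
  then have 2: "(f q' - f p) * (q' - p') \<le> (f q' - f p') * (q' - p)" by (simp add: algebra_simps)
  have "(f q - f p) * (q' - p') * (q' - p) \<le> (f q' - f p) * (q - p) * (q' - p')"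
    using mult_right_mono[OF 1, of "q' - p'"] le by (simp add: algebra_simps)
  also have "\<dots> \<le> (f q' - f p') * (q' - p) * (q - p)"
    using mult_right_mono[OF 2, of "q - p"] le by (simp add: algebra_simps)
  finally have "((f q - f p) * (q' - p')) * (q' - p) \<le> ((f q' - f p') * (q - p)) * (q' - p)"
    by (simp add: algebra_simps)
  then show ?thesis using le by (metis diff_gt_0_iff_gt le_less_trans mult_le_cancel_right_pos order_less_le_trans)
qed

text \<open>Uniqueness of the minimizer makes the monotonicity strict: \<open>s\<close> lies below a
  chord whose left end has a value strictly smaller than \<open>f s\<close>, so the right end must
  be strictly higher.\<close>

lemma convex_class_strict_right:
  assumes f: "f \<in> convex_class" and st: "minimizer f \<le> s" "s < t" "t \<le> 1"
  shows "f s < f t"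
proof (cases "s = minimizer f")
  case True
  then show ?thesis using minimizer_less[OF f, of t] st minimizer_in[OF f] by auto
next
  case False
  let ?Z = "minimizer f"
  have Z: "?Z \<in> {0..1}" by (rule minimizer_in[OF f])
  have c: "convex_on {0..1} f" using f by (simp add: convex_class_def)
  have "(t - ?Z) * f s \<le> (t - s) * f ?Z + (s - ?Z) * f t"
    by (rule convex_on_three_points[OF c]) (use st Z in auto)
  moreover have "(t - s) * f ?Z < (t - s) * f s"
    using minimizer_less[OF f, of s] st False Z by simp
  ultimately have "(s - ?Z) * f s < (s - ?Z) * f t" by (simp add: algebra_simps)
  then show ?thesis using st False by simp
qed

text \<open>Used to obtain bounds to the left of the minimizer from those to the right.\<close>

lemma convex_class_reflect:
  assumes f: "f \<in> convex_class"
  shows "(\<lambda>y. f (1 - y)) \<in> convex_class" "minimizer (\<lambda>y. f (1 - y)) = 1 - minimizer f"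
proof -
  have c: "convex_on {0..1} f" using f by (simp add: convex_class_def)
  have "convex_on {0..1} (\<lambda>y. f (1 - y))"
  proof (rule convex_onI)
    fix t x y :: real assume a: "0 < t" "t < 1" "x \<in> {0..1}" "y \<in> {0..1}"
    have "f ((1 - t) *\<^sub>R (1 - x) + t *\<^sub>R (1 - y)) \<le> (1 - t) * f (1 - x) + t * f (1 - y)"
      by (rule convex_onD[OF c]) (use a in auto)
    then show "f (1 - ((1 - t) *\<^sub>R x + t *\<^sub>R y)) \<le> (1 - t) * f (1 - x) + t * f (1 - y)"
      by (simp add: algebra_simps)
  qed simp
  moreover have "1 - minimizer f \<in> {0..1}" using minimizer_in[OF f] by auto
  moreover have "f (1 - (1 - minimizer f)) < f (1 - y)" if "y \<in> {0..1}" "y \<noteq> 1 - minimizer f" for y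
    using minimizer_less[OF f, of "1 - y"] that by auto
  ultimately show "(\<lambda>y. f (1 - y)) \<in> convex_class" "minimizer (\<lambda>y. f (1 - y)) = 1 - minimizer f"
    using convex_classI[of "\<lambda>y. f (1 - y)" "1 - minimizer f"] by blast+
qed

lemma convex_class_strict_left:
  assumes f: "f \<in> convex_class" and st: "s < t" "t \<le> minimizer f" "0 \<le> s"
  shows "f t < f s"
  using convex_class_strict_right[OF convex_class_reflect(1)[OF f], of "1 - t" "1 - s"]
    convex_class_reflect(2)[OF f] st by auto

lemma convex_class_mono_right:
  "f \<in> convex_class \<Longrightarrow> minimizer f \<le> s \<Longrightarrow> s \<le> t \<Longrightarrow> t \<le> 1 \<Longrightarrow> f s \<le> f t"
  using convex_class_strict_right[of f s t] by (cases "s = t") auto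

lemma convex_class_mono_left:
  "f \<in> convex_class \<Longrightarrow> s \<le> t \<Longrightarrow> t \<le> minimizer f \<Longrightarrow> 0 \<le> s \<Longrightarrow> f t \<le> f s"
  using convex_class_strict_left[of f s t] by (cases "s = t") auto

text \<open>The pairs are intercepts and slopes. The alternatives that dip inside a grid cell are
  maxima of finitely many lines, and this settles their convexity.\<close>

lemma convex_on_Max_affine:
  fixes K :: "(real \<times> real) set"
  assumes "finite K" "K \<noteq> {}" "convex S"
  shows "convex_on S (\<lambda>y. Max ((\<lambda>(c, d). c + d * y) ` K))"
proof (rule convex_onI)
  let ?h = "\<lambda>y. Max ((\<lambda>(c, d). c + d * y) ` K)"
  fix t x y :: real assume t: "0 < t" "t < 1"
  have le: "c + d * z \<le> ?h z" if "(c, d) \<in> K" for c d z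
    by (rule Max_ge) (use assms(1) that in force)+
  have "c + d * ((1 - t) * x + t * y) \<le> (1 - t) * ?h x + t * ?h y" if k: "(c, d) \<in> K" for c d
  proof -
    have "c + d * ((1 - t) * x + t * y) = (1 - t) * (c + d * x) + t * (c + d * y)"
      by (simp add: algebra_simps)
    also have "\<dots> \<le> (1 - t) * ?h x + t * ?h y"
      by (intro add_mono mult_left_mono le k) (use t in auto)
    finally show ?thesis .
  qed
  then show "?h ((1 - t) *\<^sub>R x + t *\<^sub>R y) \<le> (1 - t) * ?h x + t * ?h y"
    using assms(1,2) by (subst Max_le_iff) auto
qed fact


lemma convex_on_max:
  fixes f g :: "real \<Rightarrow> real"
  assumes "convex_on S f" "convex_on S g"
  shows "convex_on S (\<lambda>x. max (f x) (g x))"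
proof (rule convex_onI)
  fix t x y :: real assume t: "0 < t" "t < 1" and xy: "x \<in> S" "y \<in> S"
  have *: "(1 - t) * f x + t * f y \<le> (1 - t) * max (f x) (g x) + t * max (f y) (g y)"
    "(1 - t) * g x + t * g y \<le> (1 - t) * max (f x) (g x) + t * max (f y) (g y)"
    using t by (auto intro!: add_mono mult_left_mono)
  show "max (f ((1 - t) *\<^sub>R x + t *\<^sub>R y)) (g ((1 - t) *\<^sub>R x + t *\<^sub>R y))
      \<le> (1 - t) * max (f x) (g x) + t * max (f y) (g y)"
    using convex_onD[OF assms(1), of t x y] convex_onD[OF assms(2), of t x y] t xy
      * by (intro max.boundedI) auto
qed (use assms(1) in \<open>simp add: convex_on_def\<close>)


section \<open>Functions that cannot be distinguished from the true one\<close>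

text \<open>The constant \<open>1/10\<close> keeps the total variation distance of the two laws below \<open>1/5\<close>.\<close>

definition radius_bound :: "nat \<Rightarrow> real \<Rightarrow> (real \<Rightarrow> real) \<Rightarrow> real \<Rightarrow> bool" where
  "radius_bound n \<sigma> f R \<longleftrightarrow>
     (\<forall>g\<in>convex_class. (\<Sum>i\<le>n. (f (real i / real n) - g (real i / real n))\<^sup>2) \<le> (\<sigma> / 10)\<^sup>2 \<longrightarrow>
        \<bar>minimizer f - minimizer g\<bar> \<le> R)"

text \<open>The grid is invariant under \<open>i\<close> to \<open>n - i\<close>, so reflecting both
  functions leaves their distance on the grid unchanged.\<close>

lemma radius_bound_reflect:
  assumes "radius_bound n \<sigma> f R" "f \<in> convex_class" "n \<ge> 1"
  shows "radius_bound n \<sigma> (\<lambda>y. f (1 - y)) R"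
  unfolding radius_bound_def
proof (intro ballI impI)
  fix g assume g: "g \<in> convex_class"
    and "(\<Sum>i\<le>n. (f (1 - real i / real n) - g (real i / real n))\<^sup>2) \<le> (\<sigma> / 10)\<^sup>2"
  moreover have "(\<Sum>i\<le>n. (f (1 - real i / real n) - g (real i / real n))\<^sup>2)
      = (\<Sum>i\<le>n. (f (real i / real n) - g (1 - real i / real n))\<^sup>2)"
    by (rule sum.reindex_bij_witness[of _ "\<lambda>i. n - i" "\<lambda>i. n - i"])
      (use assms(3) in \<open>auto simp: of_nat_diff diff_divide_distrib\<close>)
  ultimately have "\<bar>minimizer f - minimizer (\<lambda>y. g (1 - y))\<bar> \<le> R"
    using assms(1) convex_class_reflect(1)[OF g] unfolding radius_bound_def by auto
  then show "\<bar>minimizer (\<lambda>y. f (1 - y)) - minimizer g\<bar> \<le> R"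
    using convex_class_reflect(2)[OF g] convex_class_reflect(2)[OF assms(2)] by linarith
qed

text \<open>The alternative with minimizer \<open>t\<close> is \<open>h\<close> truncated from below at the level \<open>h t\<close>, tilted
  slightly to make the minimizer unique.\<close>

lemma radius_bound_truncate:
  assumes rb: "radius_bound n \<sigma> f R" and h: "convex_on {0..1} h"
    and hf: "\<And>i. i \<le> n \<Longrightarrow> h (real i / real n) = f (real i / real n)"
    and t: "t \<in> {0..1}" and e: "e = 1 \<or> e = (-1::real)"
    and strict: "\<And>y. y \<in> {0..1} \<Longrightarrow> e * (y - t) > 0 \<Longrightarrow> h t < h y"
    and S: "(\<Sum>i\<le>n. (max 0 (h t - f (real i / real n)))\<^sup>2) < (\<sigma> / 10)\<^sup>2"
  shows "\<bar>minimizer f - t\<bar> \<le> R"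
proof -
  define g where "g \<kappa> y = max (h y) (h t + \<kappa> * (e * (t - y)))" for \<kappa> y
  define T where "T \<kappa> = (\<Sum>i\<le>n. (f (real i / real n) - g \<kappa> (real i / real n))\<^sup>2)" for \<kappa>
  have T0: "T 0 = (\<Sum>i\<le>n. (max 0 (h t - f (real i / real n)))\<^sup>2)"
    unfolding T_def g_def by (rule sum.cong) (auto simp: hf max_def power2_commute)
  \<comment> \<open>At tilt 0 the function is the plain truncation, which by \<open>S\<close> is
    strictly within the budget; by continuity a small positive tilt is too. The tilt raises
    \<open>g\<close> on the side of \<open>t\<close> that \<open>strict\<close> does not
    cover.\<close>
  have "isCont T 0"
    unfolding T_def g_def by (intro continuous_intros)
  then have "(T \<longlongrightarrow> T 0) (at_right 0)"
    by (simp add: isCont_def filterlim_at_split)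
  then have "eventually (\<lambda>\<kappa>. T \<kappa> < (\<sigma> / 10)\<^sup>2) (at_right 0)"
    using S T0 by (auto dest: order_tendstoD)
  then have "eventually (\<lambda>\<kappa>. T \<kappa> < (\<sigma> / 10)\<^sup>2 \<and> \<kappa> > 0) (at_right 0)"
    by (rule eventually_conj) (simp add: eventually_at_right_less)
  then obtain \<kappa> where \<kappa>: "T \<kappa> < (\<sigma> / 10)\<^sup>2" "\<kappa> > 0"
    using eventually_happens trivial_limit_at_right_real by blast
  have "convex_on {0..1} (\<lambda>y. h t + \<kappa> * (e * (t - y)))"
    by (rule convex_onI) (auto simp: algebra_simps)
  then have "convex_on {0..1} (g \<kappa>)"
    unfolding g_def by (intro convex_on_max h)
  moreover have "g \<kappa> t < g \<kappa> y" if y: "y \<in> {0..1}" "y \<noteq> t" for y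
  proof (cases "e * (y - t) > 0")
    case True then show ?thesis using strict[OF y(1)] unfolding g_def less_max_iff_disj by simp
  next
    case False
    then have "e * (t - y) > 0" using y e by (auto simp: not_less)
    then have "0 < \<kappa> * (e * (t - y))" using \<kappa> by simp
    then show ?thesis unfolding g_def less_max_iff_disj by simp
  qed
  ultimately have "g \<kappa> \<in> convex_class" "minimizer (g \<kappa>) = t"
    using convex_classI t by blast+
  then show ?thesis using rb \<kappa>(1) unfolding radius_bound_def T_def by fastforce
qed

text \<open>Truncation of \<open>f\<close> itself. Seen from the minimizer, \<open>f\<close> is
  strictly monotone beyond \<open>t\<close>, and this decides the direction of the tilt.\<close>

lemma radius_bound_self:
  assumes rb: "radius_bound n \<sigma> f R" and f: "f \<in> convex_class" and t: "t \<in> {0..1}"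
    and S: "(\<Sum>i\<le>n. (max 0 (f t - f (real i / real n)))\<^sup>2) < (\<sigma> / 10)\<^sup>2"
  shows "\<bar>minimizer f - t\<bar> \<le> R"
proof -
  have c: "convex_on {0..1} f" using f by (simp add: convex_class_def)
  show ?thesis
  proof (cases "minimizer f \<le> t")
    case True
    show ?thesis
      by (rule radius_bound_truncate[OF rb c refl t, of 1])
        (use convex_class_strict_right[OF f] True S in auto)
  next
    case False
    show ?thesis
      by (rule radius_bound_truncate[OF rb c refl t, of "-1"])
        (use convex_class_strict_left[OF f] False S in auto)
  qed
qed

text \<open>An interval of length 4w contains at most 4w + 1 integers.\<close>

lemma card_near_le:
  fixes y :: real
  assumes "w \<ge> 1" "\<And>i. i \<in> P \<Longrightarrow> \<bar>real i - y\<bar> \<le> 2 * real w"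
  shows "real (card P) \<le> 5 * real w"
proof -
  have "int ` P \<subseteq> {\<lceil>y - 2 * real w\<rceil>..\<lfloor>y + 2 * real w\<rfloor>}"
  proof safe
    fix i assume "i \<in> P"
    then show "int i \<in> {\<lceil>y - 2 * real w\<rceil>..\<lfloor>y + 2 * real w\<rfloor>}"
      using assms(2)[of i] unfolding atLeastAtMost_iff ceiling_le_iff le_floor_iff by auto
  qed
  then have "card (int ` P) \<le> card {\<lceil>y - 2 * real w\<rceil>..\<lfloor>y + 2 * real w\<rfloor>}"
    by (rule card_mono[rotated]) simp
  also have "card (int ` P) = card P" by (rule card_image) simp
  finally have "int (card P) \<le> max 0 (\<lfloor>y + 2 * real w\<rfloor> - \<lceil>y - 2 * real w\<rceil> + 1)" by simp
  moreover have "real_of_int (\<lfloor>y + 2 * real w\<rfloor> - \<lceil>y - 2 * real w\<rceil> + 1) \<le> 4 * real w + 1"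
    by linarith
  ultimately show ?thesis using assms(1) by linarith
qed

lemma sum_deficit_le:
  fixes a :: "nat \<Rightarrow> real"
  assumes "w \<ge> 1" "\<And>i. i \<le> n \<Longrightarrow> b - a i \<le> h" "h \<ge> 0"
    "\<And>i. i \<le> n \<Longrightarrow> a i < b \<Longrightarrow> \<bar>real i - y\<bar> \<le> 2 * real w"
  shows "(\<Sum>i\<le>n. (max 0 (b - a i))\<^sup>2) \<le> 5 * real w * h\<^sup>2"
proof -
  let ?P = "{i. i \<le> n \<and> a i < b}"
  have "(\<Sum>i\<le>n. (max 0 (b - a i))\<^sup>2) = (\<Sum>i\<in>?P. (max 0 (b - a i))\<^sup>2)"
    by (rule sum.mono_neutral_right) auto
  also have "\<dots> \<le> (\<Sum>i\<in>?P. h\<^sup>2)"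
    by (intro sum_mono power_mono) (use assms in auto)
  also have "\<dots> = real (card ?P) * h\<^sup>2" by simp
  also have "\<dots> \<le> 5 * real w * h\<^sup>2"
    by (intro mult_right_mono card_near_le[where y = y]) (use assms in auto)
  finally show ?thesis .
qed

text \<open>If the function increased slowly to the right of its minimizer, then truncating it would move
  the minimizer by \<open>2R\<close> to the right, or to the left in case there are too many points below
  the truncation level on the left.\<close>

lemma increment_right:
  assumes f: "f \<in> convex_class" and rb: "radius_bound n \<sigma> f R" and pos: "\<sigma> > 0" "R > 0"
    and k: "minimizer f \<le> real k / real n" "k + w \<le> n" and w: "2 * real n * R < real w"
  shows "\<sigma> * sqrt (real w) / (60 * real n * R) \<le> f (real (k + w) / real n) - f (real k / real n)"
proof -
  let ?Z = "minimizer f" and ?\<Delta> = "f (real (k + w) / real n) - f (real k / real n)"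
  have c: "convex_on {0..1} f" using f by (simp add: convex_class_def)
  have Z: "?Z \<in> {0..1}" by (rule minimizer_in[OF f])
  have "0 < real w" using w pos by (smt (verit) mult_nonneg_nonneg of_nat_0_le_iff)
  then have w1: "w \<ge> 1" by simp
  then have n: "real n > 0" using k by simp
  have wn: "2 * R < real w / real n" using w n by (simp add: field_simps)
  define b where "b = ?Z + 2 * R"
  define b' where "b' = ?Z - 2 * R"
  define h where "h = f b - f ?Z"
  have kw: "real (k + w) / real n \<le> 1" using k n by simp
  have kw': "real (k + w) / real n = real k / real n + real w / real n"
    by (simp add: add_divide_distrib)
  have b: "b \<le> real (k + w) / real n" "b \<in> {0..1}"
    using Z wn kw kw' k pos unfolding b_def by auto
  have h0: "h \<ge> 0" unfolding h_def using minimizer_le[OF f b(2)] by simp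
  have "(f b - f ?Z) * (real (k + w) / real n - real k / real n) \<le> ?\<Delta> * (b - ?Z)"
    by (rule convex_on_chord_mono[OF c]) (use Z b kw k n w1 pos in \<open>auto simp: b_def divide_strict_right_mono\<close>)
  then have hD: "h * (real w / real n) \<le> ?\<Delta> * (2 * R)" using kw' by (simp add: h_def b_def)
  \<comment> \<open>The premise \<open>S\<close> will hold because truncation at distance 2R, which
    exceeds R, must be detectable, while it changes few values by at most \<open>h\<close>. Together
    with \<open>hD\<close> it gives \<sigma>^2 w \<le> 2000 (\<Delta> R n)^2, and 2000 \<le> 60^2
    explains the 60.\<close>
  have fin: ?thesis if S: "(\<sigma> / 10)\<^sup>2 \<le> 5 * real w * h\<^sup>2"
  proof -
    have h_le: "h \<le> ?\<Delta> * (2 * R) * real n / real w"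
      using hD w1 n by (simp add: field_simps)
    have D0: "0 \<le> ?\<Delta> * (2 * R)" using hD h0 by (smt (verit) divide_nonneg_nonneg mult_nonneg_nonneg of_nat_0_le_iff)
    have "h\<^sup>2 \<le> (?\<Delta> * (2 * R) * real n / real w)\<^sup>2"
      by (rule power_mono[OF h_le h0])
    then have "(\<sigma> / 10)\<^sup>2 \<le> 5 * real w * (?\<Delta> * (2 * R) * real n / real w)\<^sup>2"
      using S w1 by (smt (verit) mult_left_mono mult_nonneg_nonneg of_nat_0_le_iff)
    also have "\<dots> = 20 * (?\<Delta> * R * real n)\<^sup>2 / real w"
      using w1 by (simp add: power2_eq_square field_simps)
    finally have "\<sigma>\<^sup>2 * real w \<le> 2000 * (?\<Delta> * R * real n)\<^sup>2"
      using w1 by (simp add: power2_eq_square field_simps)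
    then have "(\<sigma> * sqrt (real w))\<^sup>2 \<le> 2000 * (?\<Delta> * R * real n)\<^sup>2"
      by (simp add: power_mult_distrib)
    also have "\<dots> \<le> (60 * (?\<Delta> * R * real n))\<^sup>2" by (simp only: power_mult_distrib) simp
    finally have "(\<sigma> * sqrt (real w))\<^sup>2 \<le> (60 * (?\<Delta> * R * real n))\<^sup>2" .
    then have "\<sigma> * sqrt (real w) \<le> 60 * (?\<Delta> * R * real n)"
    proof (rule power2_le_imp_le)
      show "0 \<le> 60 * (?\<Delta> * R * real n)"
      proof -
        have "0 \<le> (?\<Delta> * (2 * R)) * (30 * real n)" using D0 by (rule mult_nonneg_nonneg) simp
        also have "\<dots> = 60 * (?\<Delta> * R * real n)" by algebra
        finally show ?thesis .
      qed
    qed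
    then show ?thesis using pos n by (simp add: field_simps)
  qed
  have right: "real i / real n < b" if "f (real i / real n) < f b" "i \<le> n" "?Z \<le> real i / real n" for i
  proof (rule ccontr)
    assume "\<not> ?thesis"
    then have "f b \<le> f (real i / real n)"
      using convex_class_mono_right[OF f, of b "real i / real n"] that pos n by (simp add: b_def)
    with that show False by simp
  qed
  show ?thesis
  proof (cases "\<forall>i\<le>n. f (real i / real n) < f b \<longrightarrow> \<bar>real i - real n * ?Z\<bar> \<le> 2 * real w")
    case True
    have "(\<Sum>i\<le>n. (max 0 (f b - f (real i / real n)))\<^sup>2) \<le> 5 * real w * h\<^sup>2"
      by (rule sum_deficit_le[OF w1 _ h0])
        (use True minimizer_le[OF f] n in \<open>auto simp: h_def\<close>)
    moreover have "\<not> (\<Sum>i\<le>n. (max 0 (f b - f (real i / real n)))\<^sup>2) < (\<sigma> / 10)\<^sup>2"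
      using radius_bound_self[OF rb f b(2)] pos by (auto simp: b_def)
    ultimately show ?thesis using fin by linarith
  next
    \<comment> \<open>A far point on the left that is still below \<open>f b\<close> makes
      \<open>f\<close> flat there: by convexity \<open>b'\<close> is at most \<open>h\<close> above
      the minimum. Truncation at \<open>b'\<close> then affects only points between
      \<open>b'\<close> and \<open>b\<close>, so the counting works again.\<close>
    case False
    then obtain i0 where i0: "i0 \<le> n" "f (real i0 / real n) < f b" "\<bar>real i0 - real n * ?Z\<bar> > 2 * real w"
      by force
    have far: "real i0 < real n * ?Z - 2 * real w"
    proof (rule ccontr)
      assume "\<not> ?thesis"
      with i0 have "real i0 > real n * ?Z + 2 * real w" by linarith
      then have "(real n * ?Z + 2 * real w) / real n < real i0 / real n"
        using n by (intro divide_strict_right_mono)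
      then have "?Z + 2 * (real w / real n) < real i0 / real n"
        using n by (simp add: add_divide_distrib)
      moreover have "0 < real w / real n" using w1 n by simp
      moreover from calculation have "?Z \<le> real i0 / real n" by linarith
      then have "real i0 / real n < b" using right i0 by blast
      ultimately show False using wn unfolding b_def by linarith
    qed
    define x where "x = real i0 / real n"
    have x: "x < ?Z - 2 * (real w / real n)" "x \<ge> 0" using far n by (auto simp: x_def field_simps)
    have b': "x \<le> b'" "b' \<le> ?Z" "b' \<in> {0..1}" using x wn Z pos unfolding b'_def by auto
    have "(?Z - x) * f b' \<le> (?Z - b') * f x + (b' - x) * f ?Z"
      by (rule convex_on_three_points[OF c]) (use x b' Z in auto)
    then have "(?Z - x) * (f b' - f ?Z) \<le> (2 * R) * (f x - f ?Z)"
      by (simp add: algebra_simps b'_def)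
    also have "\<dots> \<le> (?Z - x) * h"
      by (rule mult_mono) (use x wn Z i0 pos minimizer_le[OF f, of x] b' in \<open>auto simp: x_def[symmetric] h_def\<close>)
    finally have h': "f b' - f ?Z \<le> h" using x wn pos by simp
    have near: "\<bar>real i - real n * ?Z\<bar> \<le> 2 * real w" if i: "i \<le> n" "f (real i / real n) < f b'" for i
    proof (cases "?Z \<le> real i / real n")
      case True
      have "f (real i / real n) < f b" using i h' by (simp add: h_def)
      then have "real i / real n < b" using right i True by blast
      then have "real i / real n < ?Z + real w / real n" using wn by (simp add: b_def)
      then have "real n * (real i / real n) < real n * (?Z + real w / real n)"
        using n by (intro mult_strict_left_mono)
      then have "real i < real n * ?Z + real w" using n by (simp add: distrib_left)
      moreover have "real n * ?Z \<le> real i" using True n by (simp add: field_simps)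
      ultimately show ?thesis by linarith
    next
      case False
      then have "b' < real i / real n"
        using convex_class_mono_left[OF f, of "real i / real n" b'] i b' by force
      then have "?Z - real w / real n < real i / real n" using wn by (simp add: b'_def)
      then have "real n * (?Z - real w / real n) < real n * (real i / real n)"
        using n by (intro mult_strict_left_mono)
      then have "real n * ?Z - real w < real i" using n by (simp add: right_diff_distrib)
      moreover have "real i \<le> real n * ?Z" using False n by (simp add: field_simps)
      ultimately show ?thesis by linarith
    qed
    have "(\<Sum>i\<le>n. (max 0 (f b' - f (real i / real n)))\<^sup>2) \<le> 5 * real w * h\<^sup>2"
    proof (rule sum_deficit_le[OF w1 _ h0])
      fix i assume "i \<le> n"
      then have "f ?Z \<le> f (real i / real n)" using minimizer_le[OF f] n by auto
      then show "f b' - f (real i / real n) \<le> h" using h' by simp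
    qed (use near in auto)
    moreover have "\<not> (\<Sum>i\<le>n. (max 0 (f b' - f (real i / real n)))\<^sup>2) < (\<sigma> / 10)\<^sup>2"
      using radius_bound_self[OF rb f b'(3)] pos by (auto simp: b'_def)
    ultimately show ?thesis using fin by linarith
  qed
qed

lemma increment_left:
  assumes f: "f \<in> convex_class" and rb: "radius_bound n \<sigma> f R" and pos: "\<sigma> > 0" "R > 0"
    and k: "real (k + w) / real n \<le> minimizer f" "k + w \<le> n" and w: "2 * real n * R < real w"
  shows "\<sigma> * sqrt (real w) / (60 * real n * R) \<le> f (real k / real n) - f (real (k + w) / real n)"
proof -
  have "0 < real w" using w pos by (smt (verit) mult_nonneg_nonneg of_nat_0_le_iff)
  then have n: "n \<ge> 1" using k by simp
  have eq: "1 - real (n - (k + w) + w) / real n = real k / real n"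
    "1 - real (n - (k + w)) / real n = real (k + w) / real n"
    using k n by (auto simp: of_nat_diff field_simps)
  have "\<sigma> * sqrt (real w) / (60 * real n * R)
      \<le> f (1 - real (n - (k + w) + w) / real n) - f (1 - real (n - (k + w)) / real n)"
    by (rule increment_right[OF convex_class_reflect(1)[OF f] radius_bound_reflect[OF rb f n] pos])
      (use k w eq convex_class_reflect(2)[OF f] in auto)
  then show ?thesis unfolding eq .
qed

section \<open>Alternatives that differ from the true function inside one grid cell\<close>

lemma convex_sequence:
  fixes a :: "nat \<Rightarrow> real"
  assumes "\<And>i j. i \<le> j \<Longrightarrow> j < n \<Longrightarrow> a (Suc i) - a i \<le> a (Suc j) - a j" "k < n" "j \<le> n"
  shows "a k + (a (Suc k) - a k) * (real j - real k) \<le> a j"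
proof (cases "k \<le> j")
  case True
  then have "j \<le> n \<longrightarrow> ?thesis"
  proof (induction j rule: dec_induct)
    case (step m)
    show ?case
    proof
      assume "Suc m \<le> n"
      then have "a (Suc k) - a k \<le> a (Suc m) - a m" using assms(1)[of k m] step by simp
      then show "a k + (a (Suc k) - a k) * (real (Suc m) - real k) \<le> a (Suc m)"
        using step \<open>Suc m \<le> n\<close> by (simp add: algebra_simps)
    qed
  qed simp
  then show ?thesis using assms by simp
next
  case False
  then have "j \<le> k" by simp
  then show ?thesis
  proof (induction j rule: inc_induct)
    case (step m)
    have "a (Suc m) - a m \<le> a (Suc k) - a k" using assms(1)[of m k] assms(2) step by simp
    then show ?case using step by (simp add: algebra_simps)
  qed simp
qed

lemma convex_on_increments_mono:
  fixes f :: "real \<Rightarrow> real"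
  assumes c: "convex_on {0..1} f" and ij: "i \<le> j" "j < n"
  shows "f (real (Suc i) / real n) - f (real i / real n)
      \<le> f (real (Suc j) / real n) - f (real j / real n)"
proof -
  have n: "real n > 0" using ij by simp
  have "(f (real (Suc i) / real n) - f (real i / real n)) * (real (Suc j) / real n - real j / real n)
      \<le> (f (real (Suc j) / real n) - f (real j / real n)) * (real (Suc i) / real n - real i / real n)"
    by (rule convex_on_chord_mono[OF c]) (use ij n in \<open>auto simp: divide_le_cancel divide_less_cancel\<close>)
  then show ?thesis using n by (simp add: diff_divide_distrib[symmetric] divide_le_cancel)
qed

text \<open>Within a grid cell next to the grid minimizer, a convex function that agrees with \<open>f\<close> on the grid
  may follow any line \<open>r\<close> that is not steeper than the chord over the next cell, as long as it stays
  above the minimum over the grid.\<close>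

lemma radius_bound_dip:
  assumes f: "f \<in> convex_class" and rb: "radius_bound n \<sigma> f R"
    and v: "v < n" "\<And>i. i \<le> n \<Longrightarrow> f (real v / real n) \<le> f (real i / real n)"
    and s: "s > 0" "f (real (Suc v) / real n) - s \<le> f (real v / real n)"
      "v + 2 \<le> n \<Longrightarrow> s \<le> f (real (v + 2) / real n) - f (real (Suc v) / real n)"
    and d: "0 \<le> d" "d \<le> 1"
    and u: "u = f (real (Suc v) / real n) - s * (1 - d)" "f (real v / real n) \<le> u"
    and S: "(\<Sum>i\<le>n. (max 0 (u - f (real i / real n)))\<^sup>2) < (\<sigma> / 10)\<^sup>2"
  shows "\<bar>minimizer f - (real v + d) / real n\<bar> \<le> R"
proof -
  define a where "a i = f (real i / real n)" for i
  have c: "convex_on {0..1} f" using f by (simp add: convex_class_def)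
  have n: "real n > 0" using v by simp
  have inc: "a (Suc i) - a i \<le> a (Suc j) - a j" if "i \<le> j" "j < n" for i j
    unfolding a_def by (rule convex_on_increments_mono[OF c that])
  have seq: "a k + (a (Suc k) - a k) * (real j - real k) \<le> a j" if "k < n" "j \<le> n" for j k
    by (rule convex_sequence[where a = a and n = n]) (use inc that in auto)
  have vmin: "a v \<le> a i" if "i \<le> n" for i using v(2)[OF that] by (simp add: a_def)
  have s': "s > 0" "a (Suc v) - s \<le> a v" "v + 2 \<le> n \<Longrightarrow> s \<le> a (v + 2) - a (Suc v)"
    using s by (auto simp: a_def)
  define line where "line k = (a k - (a (Suc k) - a k) * real k, (a (Suc k) - a k) * real n)" for k
  \<comment> \<open>The lines are the level of the grid minimum, the line \<open>r\<close> through
    the grid point \<open>v + 1\<close> with slope \<open>s\<close> per cell, and the chords of all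
    cells except the one starting at \<open>v\<close>. That chord is left out because it lies above
    \<open>r\<close> inside its cell.\<close>
  define K where "K = insert (a v, 0) (insert (a (Suc v) - s * real (Suc v), s * real n)
      (line ` ({..<n} - {v})))"
  define h where "h y = Max ((\<lambda>(c, d). c + d * y) ` K)" for y
  have finK: "finite K" "K \<noteq> {}" by (auto simp: K_def)
  have h: "convex_on {0..1} h" unfolding h_def by (rule convex_on_Max_affine) (use finK in auto)
  define t where "t = (real v + d) / real n"
  have t: "t \<in> {0..1}" using v d n by (auto simp: t_def)
  have nt: "real n * t = real v + d" using n by (simp add: t_def)
  have h_ge: "c + d * y \<le> h y" if "(c, d) \<in> K" for c d y
    unfolding h_def by (rule Max_ge) (use finK that in force)+
  have h_le: "h y \<le> b" if "a v \<le> b" "a (Suc v) + s * (real n * y - real (Suc v)) \<le> b"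
    "\<And>k. k < n \<Longrightarrow> k \<noteq> v \<Longrightarrow> a k + (a (Suc k) - a k) * (real n * y - real k) \<le> b" for y b
    unfolding h_def
    by (subst Max_le_iff) (use finK that in \<open>auto simp: K_def line_def algebra_simps\<close>)
  have r_le: "a (Suc v) + s * (real i - real (Suc v)) \<le> a i" if i: "i \<le> n" for i
  proof -
    consider "i \<le> v" | "i = Suc v" | "Suc v < i" by linarith
    then show ?thesis
    proof cases
      case 1
      then have "s * (real i - real (Suc v)) \<le> s * (- 1)"
        using s' by (intro mult_left_mono) auto
      then show ?thesis using s' vmin[OF i] by simp
    next
      case 3
      then have "a (Suc v) + (a (Suc (Suc v)) - a (Suc v)) * (real i - real (Suc v)) \<le> a i"
        using i by (intro seq) auto
      moreover have "s * (real i - real (Suc v)) \<le> (a (Suc (Suc v)) - a (Suc v)) * (real i - real (Suc v))"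
        using 3 i s' by (intro mult_right_mono) auto
      ultimately show ?thesis by simp
    qed simp
  qed
  have grid: "h (real i / real n) = f (real i / real n)" if i: "i \<le> n" for i
  proof (rule antisym)
    have "h (real i / real n) \<le> a i"
      by (rule h_le) (use vmin[OF i] r_le[OF i] seq[OF _ i] n in auto)
    then show "h (real i / real n) \<le> f (real i / real n)" by (simp add: a_def)
    consider "i = v" | "i = Suc v" | "i < v" | "Suc v < i" by linarith
    then have "a i \<le> h (real i / real n)"
    proof cases
      case 1
      then show ?thesis using h_ge[of "a v" 0] by (simp add: K_def)
    next
      case 2
      then show ?thesis using h_ge[of "a (Suc v) - s * real (Suc v)" "s * real n" "real i / real n"] n
        by (simp add: K_def)
    next
      case 3
      then have "line i \<in> K" using v by (auto simp: K_def)
      then have "fst (line i) + snd (line i) * (real i / real n) \<le> h (real i / real n)"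
        by (intro h_ge) auto
      then show ?thesis using n by (simp add: line_def)
    next
      case 4
      then obtain m where m: "i = Suc m" by (cases i) auto
      then have "line m \<in> K" using 4 i by (auto simp: K_def)
      then have "fst (line m) + snd (line m) * (real i / real n) \<le> h (real i / real n)"
        by (intro h_ge) auto
      moreover have "fst (line m) + snd (line m) * (real i / real n)
          = a m + (a (Suc m) - a m) * (real i - real m)"
        using n by (simp add: line_def algebra_simps)
      ultimately show ?thesis using m by simp
    qed
    then show "f (real i / real n) \<le> h (real i / real n)" by (simp add: a_def)
  qed
  have u': "u = a (Suc v) + s * (real n * t - real (Suc v))"
    unfolding nt u(1) a_def by (simp add: algebra_simps)
  have r_le_h: "a (Suc v) + s * (real n * y - real (Suc v)) \<le> h y" for y
    using h_ge[of "a (Suc v) - s * real (Suc v)" "s * real n" y] by (simp add: K_def algebra_simps)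
  have ht: "h t = u"
  proof (rule antisym)
    show "h t \<le> u"
    proof (rule h_le)
      show "a v \<le> u" using u by (simp add: a_def)
      show "a (Suc v) + s * (real n * t - real (Suc v)) \<le> u" by (simp add: u')
      \<comment> \<open>Chords left of \<open>v\<close> do not increase, so to the right of
        \<open>v\<close> they stay below the grid minimum. Chords right of \<open>v + 1\<close> are
        at least as steep as \<open>r\<close>, so to the left of \<open>v + 1\<close> they stay
        below \<open>r\<close>.\<close>
      fix k assume k: "k < n" "k \<noteq> v"
      show "a k + (a (Suc k) - a k) * (real n * t - real k) \<le> u"
      proof (cases "k < v")
        case True
        have "a (Suc k) - a k \<le> a (Suc (v - 1)) - a (v - 1)" using True v by (intro inc) auto
        also have "\<dots> \<le> 0" using vmin[of "v - 1"] True v by simp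
        finally have "(a (Suc k) - a k) * d \<le> 0" using d by (simp add: mult_nonpos_nonneg)
        moreover have "a k + (a (Suc k) - a k) * (real v - real k) \<le> a v" using k v by (intro seq) auto
        ultimately show ?thesis using u unfolding nt by (simp add: a_def algebra_simps)
      next
        case False
        with k have vk: "Suc v \<le> k" by simp
        have "s \<le> a (Suc k) - a k" using inc[of "Suc v" k] s' vk k by simp
        then have "(a (Suc k) - a k) * (d - 1) \<le> s * (d - 1)" using d by (intro mult_right_mono_neg) auto
        moreover have "a k + (a (Suc k) - a k) * (real (Suc v) - real k) \<le> a (Suc v)"
          using k v by (intro seq) auto
        ultimately show ?thesis unfolding u' nt by (simp add: algebra_simps)
      qed
    qed
    show "u \<le> h t" using r_le_h[of t] by (simp add: u')
  qed
  have "h t < h y" if "1 * (y - t) > 0" for y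
  proof -
    have "u < a (Suc v) + s * (real n * y - real (Suc v))" unfolding u' using that s' n by simp
    then show ?thesis using r_le_h[of y] ht by simp
  qed
  then show ?thesis
    using radius_bound_truncate[OF rb h grid t, of 1] S ht unfolding t_def by simp
qed


text \<open>Truncating at the smallest grid value changes no observed value, so the data cannot
  exclude a minimizer at a grid point where this value is attained.\<close>

lemma radius_bound_grid_min:
  assumes f: "f \<in> convex_class" and rb: "radius_bound n \<sigma> f R" and pos: "\<sigma> > 0"
    and v: "v \<le> n" "n \<ge> 1" "\<And>i. i \<le> n \<Longrightarrow> f (real v / real n) \<le> f (real i / real n)"
  shows "\<bar>minimizer f - real v / real n\<bar> \<le> R"
proof (rule radius_bound_self[OF rb f])
  have "(\<Sum>i\<le>n. (max 0 (f (real v / real n) - f (real i / real n)))\<^sup>2) = 0"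
    using v(3) by (intro sum.neutral) auto
  then show "(\<Sum>i\<le>n. (max 0 (f (real v / real n) - f (real i / real n)))\<^sup>2) < (\<sigma> / 10)\<^sup>2"
    using pos by simp
qed (use v in auto)

text \<open>The first two conclusions hold because otherwise an indistinguishable function would
  have its minimizer at \<open>(v + d) / n\<close> with d > 1/4, whereas \<open>far\<close> gives d
  \<le> 2nR < 1/4. The third is \<open>increment_right\<close> for a single cell.\<close>

lemma gap_right:
  assumes f: "f \<in> convex_class" and rb: "radius_bound n \<sigma> f R" and pos: "\<sigma> > 0" "R > 0"
    and v: "v < n" "\<And>i. i \<le> n \<Longrightarrow> f (real v / real n) \<le> f (real i / real n)"
    and nR: "real n * R < 1 / 8"
  shows "v + 2 \<le> n"
    and "f (real (Suc v) / real n) - f (real v / real n)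
      \<ge> 3/4 * (f (real (v + 2) / real n) - f (real (Suc v) / real n))"
    and "f (real (v + 2) / real n) - f (real (Suc v) / real n) \<ge> \<sigma> / (60 * real n * R)"
proof -
  let ?a = "\<lambda>i. f (real i / real n)"
  let ?Z = "minimizer f"
  have n: "real n > 0" "n \<ge> 1" using v by auto
  have c: "convex_on {0..1} f" using f by (simp add: convex_class_def)
  have Zv: "\<bar>?Z - real v / real n\<bar> \<le> R"
    by (rule radius_bound_grid_min[OF f rb pos(1)]) (use v n in auto)
  have far: "d \<le> 2 * (real n * R)" if "\<bar>?Z - (real v + d) / real n\<bar> \<le> R" for d
  proof -
    have "(real v + d) / real n - real v / real n \<le> 2 * R" using that Zv by linarith
    then have "d / real n \<le> 2 * R" by (simp add: add_divide_distrib)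
    then have "d \<le> 2 * R * real n" using n by (simp only: pos_divide_le_eq)
    then show ?thesis by (simp add: mult_ac)
  qed
  have gt: "?a v < ?a (Suc v)"
  proof (rule ccontr)
    assume "\<not> ?thesis"
    then have eq: "?a (Suc v) = ?a v" using v(2)[of "Suc v"] v(1) by simp
    have "\<bar>?Z - real (Suc v) / real n\<bar> \<le> R"
      by (rule radius_bound_grid_min[OF f rb pos(1)]) (use v n in \<open>auto simp del: of_nat_Suc simp: eq\<close>)
    then show False using far[of 1] nR by (simp add: add.commute)
  qed
  have S0: "(\<Sum>i\<le>n. (max 0 (?a v - ?a i))\<^sup>2) < (\<sigma> / 10)\<^sup>2"
  proof -
    have "(\<Sum>i\<le>n. (max 0 (?a v - ?a i))\<^sup>2) = 0" using v(2) by (intro sum.neutral) auto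
    then show ?thesis using pos by simp
  qed
  show v2: "v + 2 \<le> n"
  proof (rule ccontr)
    assume "\<not> ?thesis"
    \<comment> \<open>If \<open>v + 1\<close> is the last grid point, no later chord limits the
      slope. A line twice as steep as the chord of the cell reaches the level of \<open>v\<close> in
      the middle of the cell.\<close>
    then have "\<bar>?Z - (real v + 1/2) / real n\<bar> \<le> R"
      using radius_bound_dip[OF f rb v, of "2 * (?a (Suc v) - ?a v)" "1/2" "?a v"] gt S0
      by (simp add: algebra_simps)
    then show False using far[of "1/2"] nR by simp
  qed
  have D: "?a (Suc v) - ?a v \<le> ?a (v + 2) - ?a (Suc v)"
    using convex_on_increments_mono[OF c, of v "Suc v" n] v2 by simp
  define D' where "D' = ?a (v + 2) - ?a (Suc v)"
  define G where "G = ?a (Suc v) - ?a v"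
  have DG: "0 < G" "G \<le> D'" using gt D by (auto simp: D'_def G_def)
  \<comment> \<open>The chord of the next cell, extended to the left, meets the level of
    \<open>v\<close> at distance \<open>G / D'\<close> cells from \<open>v + 1\<close>.\<close>
  have "\<bar>?Z - (real v + (1 - G / D')) / real n\<bar> \<le> R"
  proof (rule radius_bound_dip[OF f rb v, of D' _ "?a v"])
    show "?a v = ?a (Suc v) - D' * (1 - (1 - G / D'))" using DG by (simp add: G_def)
    show "D' \<le> ?a (v + 2) - ?a (Suc v)" by (simp add: D'_def)
    show "?a (Suc v) - D' \<le> ?a v" using DG by (simp add: G_def)
  qed (use DG S0 in auto)
  then have "1 - G / D' \<le> 1 / 4" using far[of "1 - G / D'"] nR by simp
  then have "3/4 * D' \<le> G" using DG by (simp add: field_simps)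
  then show "?a (Suc v) - ?a v \<ge> 3/4 * (?a (v + 2) - ?a (Suc v))" by (simp add: D'_def G_def)
  have "?Z \<le> real v / real n + R" using Zv by linarith
  also have "\<dots> \<le> real (Suc v) / real n" using n nR by (simp add: field_simps)
  finally have "\<sigma> * sqrt (real 1) / (60 * real n * R) \<le> ?a (Suc v + 1) - ?a (Suc v)"
    by (intro increment_right[OF f rb pos]) (use v2 nR in auto)
  then show "?a (v + 2) - ?a (Suc v) \<ge> \<sigma> / (60 * real n * R)" by simp
qed

text \<open>The chord of the next cell is extended down to the level
  \<open>a v + \<sigma>/20\<close>. Raising the single value at \<open>v\<close> by \<sigma>/20
  stays within the budget \<sigma>/10, and the line meets that level \<open>1 - G / D\<close> cells
  to the right of \<open>v\<close>, so this number is at most 2nR. Rewritten, it bounds the second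
  difference and \<sigma> together in units of the slope \<open>D\<close>; these are the two
  quantities that govern the refined interval.\<close>

lemma curvature_right:
  assumes f: "f \<in> convex_class" and rb: "radius_bound n \<sigma> f R" and pos: "\<sigma> > 0" "R > 0"
    and v: "v + 2 \<le> n" "\<And>i. i \<le> n \<Longrightarrow> i \<noteq> v \<Longrightarrow> f (real v / real n) + \<sigma> / 20 \<le> f (real i / real n)"
  shows "f (real v / real n) - 2 * f (real (Suc v) / real n) + f (real (v + 2) / real n) + \<sigma> / 20
      \<le> 2 * (real n * R) * (f (real (v + 2) / real n) - f (real (Suc v) / real n))"
proof -
  let ?a = "\<lambda>i. f (real i / real n)"
  let ?Z = "minimizer f"
  have n: "real n > 0" "n \<ge> 1" using v by auto
  have c: "convex_on {0..1} f" using f by (simp add: convex_class_def)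
  have vmin: "?a v \<le> ?a i" if "i \<le> n" for i
    using v(2)[OF that] pos by (cases "i = v") auto
  have Zv: "\<bar>?Z - real v / real n\<bar> \<le> R"
    by (rule radius_bound_grid_min[OF f rb pos(1)]) (use v(1) vmin n in auto)
  define D where "D = ?a (v + 2) - ?a (Suc v)"
  define G where "G = ?a (Suc v) - ?a v - \<sigma> / 20"
  have "?a (Suc v) - ?a v \<le> D"
    using convex_on_increments_mono[OF c, of v "Suc v" n] v by (simp add: D_def)
  then have DG: "0 \<le> G" "G \<le> D" "0 < D" using v(2)[of "Suc v"] v(1) pos by (auto simp: G_def)
  have S: "(\<Sum>i\<le>n. (max 0 (?a v + \<sigma> / 20 - ?a i))\<^sup>2) < (\<sigma> / 10)\<^sup>2"
  proof -
    have "(\<Sum>i\<le>n. (max 0 (?a v + \<sigma> / 20 - ?a i))\<^sup>2) = (\<Sum>i\<in>{v}. (max 0 (?a v + \<sigma> / 20 - ?a i))\<^sup>2)"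
    proof (rule sum.mono_neutral_right)
      show "\<forall>i\<in>{..n} - {v}. (max 0 (?a v + \<sigma> / 20 - ?a i))\<^sup>2 = 0"
      proof
        fix i assume "i \<in> {..n} - {v}"
        then have "?a v + \<sigma> / 20 \<le> ?a i" using v(2)[of i] by simp
        then show "(max 0 (?a v + \<sigma> / 20 - ?a i))\<^sup>2 = 0" by simp
      qed
    qed (use v in auto)
    also have "\<dots> < (\<sigma> / 10)\<^sup>2" using pos by (simp add: power2_eq_square)
    finally show ?thesis .
  qed
  have "\<bar>?Z - (real v + (1 - G / D)) / real n\<bar> \<le> R"
  proof (rule radius_bound_dip[OF f rb, of v D _ "?a v + \<sigma> / 20"])
    show "?a v + \<sigma> / 20 = ?a (Suc v) - D * (1 - (1 - G / D))" using DG by (simp add: G_def)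
    show "?a (Suc v) - D \<le> ?a v" using DG \<open>?a (Suc v) - ?a v \<le> D\<close> by simp
    show "D \<le> ?a (v + 2) - ?a (Suc v)" by (simp add: D_def)
  qed (use DG S v(1) pos vmin in auto)
  then have "(real v + (1 - G / D)) / real n - real v / real n \<le> 2 * R" using Zv by linarith
  then have "(1 - G / D) / real n \<le> 2 * R" by (simp add: add_divide_distrib)
  then have "1 - G / D \<le> 2 * R * real n" using n by (simp only: pos_divide_le_eq)
  then have "1 - G / D \<le> 2 * (real n * R)" by (simp add: mult_ac)
  then have "(1 - G / D) * D \<le> 2 * (real n * R) * D" using DG by (intro mult_right_mono) auto
  moreover have "(1 - G / D) * D = D - G" using DG by (simp add: left_diff_distrib)
  moreover have "D - G = ?a v - 2 * ?a (Suc v) + ?a (v + 2) + \<sigma> / 20" by (simp add: D_def G_def)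
  ultimately show ?thesis by (simp only: D_def)
qed

section \<open>Rotations of standard normal vectors\<close>

abbreviation std_normal :: "real measure" where
  "std_normal \<equiv> std_normal_distribution"

lemma prob_space_std_normal: "prob_space std_normal"
  using real_dist_normal_dist by (simp add: real_distribution_def)

lemma product_std_normal: "product_sigma_finite (\<lambda>_::'i. std_normal)"
  unfolding product_sigma_finite_def
  by (intro allI prob_space_imp_sigma_finite prob_space_std_normal)

lemma prob_space_PiM_std_normal: "prob_space (Pi\<^sub>M I (\<lambda>_. std_normal))"
  by (intro prob_space_PiM prob_space_std_normal)

text \<open>The map is an orthogonal involution, and the joint density depends only on
  \<open>u^2 + v^2\<close>. The variables are changed one at a time, first \<open>u\<close> and then
  \<open>v\<close>; the factors 1/|c| and |c| cancel, and the first substitution divides by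
  \<open>c\<close>.\<close>

lemma nn_integral_std_normal_rotation:
  fixes F :: "real \<Rightarrow> real \<Rightarrow> ennreal"
  assumes cs: "c\<^sup>2 + s\<^sup>2 = 1" "c \<noteq> 0" and F[measurable]: "case_prod F \<in> borel_measurable (borel \<Otimes>\<^sub>M borel)"
  shows "(\<integral>\<^sup>+u. \<integral>\<^sup>+v. F (c * u + s * v) (s * u - c * v) \<partial>std_normal \<partial>std_normal)
    = (\<integral>\<^sup>+u. \<integral>\<^sup>+v. F u v \<partial>std_normal \<partial>std_normal)"
proof -
  let ?\<phi> = "\<lambda>x. ennreal (std_normal_density x)"
  have inv: "?\<phi> (c * u + s * v) * ?\<phi> (s * u - c * v) = ?\<phi> u * ?\<phi> v" for u v
  proof -
    have "(c * u + s * v)\<^sup>2 + (s * u - c * v)\<^sup>2 = (c\<^sup>2 + s\<^sup>2) * (u\<^sup>2 + v\<^sup>2)" by algebra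
    then have e: "(c * u + s * v)\<^sup>2 + (s * u - c * v)\<^sup>2 = u\<^sup>2 + v\<^sup>2" using cs by simp
    have "std_normal_density (c * u + s * v) * std_normal_density (s * u - c * v)
        = (1 / sqrt (2 * pi))\<^sup>2 * exp (- ((c * u + s * v)\<^sup>2 + (s * u - c * v)\<^sup>2) / 2)"
      by (simp add: std_normal_density_def power2_eq_square exp_add[symmetric] add_divide_distrib)
    also have "\<dots> = std_normal_density u * std_normal_density v"
      unfolding e by (simp add: std_normal_density_def power2_eq_square exp_add[symmetric] add_divide_distrib)
    finally show ?thesis by (simp add: ennreal_mult[symmetric])
  qed
  have "(\<integral>\<^sup>+u. \<integral>\<^sup>+v. F (c * u + s * v) (s * u - c * v) \<partial>std_normal \<partial>std_normal)
      = (\<integral>\<^sup>+u. ?\<phi> u * (\<integral>\<^sup>+v. ?\<phi> v * F (c * u + s * v) (s * u - c * v) \<partial>lborel) \<partial>lborel)"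
    by (simp add: nn_integral_density)
  also have "\<dots> = (\<integral>\<^sup>+u. \<integral>\<^sup>+v. ?\<phi> u * (?\<phi> v * F (c * u + s * v) (s * u - c * v)) \<partial>lborel \<partial>lborel)"
    by (simp add: nn_integral_cmult)
  also have "\<dots> = (\<integral>\<^sup>+v. \<integral>\<^sup>+u. ?\<phi> u * (?\<phi> v * F (c * u + s * v) (s * u - c * v)) \<partial>lborel \<partial>lborel)"
    by (rule lborel_pair.Fubini') simp
  also have "\<dots> = (\<integral>\<^sup>+v. \<bar>1 / c\<bar> * (\<integral>\<^sup>+u. ?\<phi> (- s * v / c + 1 / c * u) * (?\<phi> v *
      F (c * (- s * v / c + 1 / c * u) + s * v) (s * (- s * v / c + 1 / c * u) - c * v)) \<partial>lborel) \<partial>lborel)"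
    by (intro nn_integral_cong nn_integral_real_affine) (use cs in auto)
  also have "\<dots> = (\<integral>\<^sup>+v. \<integral>\<^sup>+u. ennreal \<bar>1 / c\<bar> * (?\<phi> (- s * v / c + 1 / c * u) * (?\<phi> v *
      F (c * (- s * v / c + 1 / c * u) + s * v) (s * (- s * v / c + 1 / c * u) - c * v))) \<partial>lborel \<partial>lborel)"
    by (simp add: nn_integral_cmult)
  also have "\<dots> = (\<integral>\<^sup>+u. \<integral>\<^sup>+v. ennreal \<bar>1 / c\<bar> * (?\<phi> (- s * v / c + 1 / c * u) * (?\<phi> v *
      F (c * (- s * v / c + 1 / c * u) + s * v) (s * (- s * v / c + 1 / c * u) - c * v))) \<partial>lborel \<partial>lborel)"
    by (rule lborel_pair.Fubini') simp
  also have "\<dots> = (\<integral>\<^sup>+u. \<bar>- c\<bar> * (\<integral>\<^sup>+v. ennreal \<bar>1 / c\<bar> * (?\<phi> (- s * (s * u + - c * v) / c + 1 / c * u) *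
      (?\<phi> (s * u + - c * v) * F (c * (- s * (s * u + - c * v) / c + 1 / c * u) + s * (s * u + - c * v))
        (s * (- s * (s * u + - c * v) / c + 1 / c * u) - c * (s * u + - c * v)))) \<partial>lborel) \<partial>lborel)"
    by (intro nn_integral_cong nn_integral_real_affine) (use cs in auto)
  also have "\<dots> = (\<integral>\<^sup>+u. \<integral>\<^sup>+v. ?\<phi> u * (?\<phi> v * F u v) \<partial>lborel \<partial>lborel)"
  proof (rule nn_integral_cong)
    fix u :: real
    have 1: "- s * (s * u + - c * v) / c + 1 / c * u = c * u + s * v" for v
    proof -
      have "- s * (s * u + - c * v) + u = - s * (s * u + - c * v) + (c\<^sup>2 + s\<^sup>2) * u" using cs by simp
      also have "\<dots> = c * (c * u + s * v)" by algebra
      finally have "(- s * (s * u + - c * v) + u) / c = c * u + s * v" using cs by simp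
      then show ?thesis by (simp add: add_divide_distrib diff_divide_distrib)
    qed
    have 2: "c * (c * u + s * v) + s * (s * u + - c * v) = u" for v
    proof -
      have "c * (c * u + s * v) + s * (s * u + - c * v) = (c\<^sup>2 + s\<^sup>2) * u" by algebra
      then show ?thesis using cs by simp
    qed
    have 3: "s * (c * u + s * v) - c * (s * u + - c * v) = v" for v
    proof -
      have "s * (c * u + s * v) - c * (s * u + - c * v) = (c\<^sup>2 + s\<^sup>2) * v" by algebra
      then show ?thesis using cs by simp
    qed
    have "ennreal \<bar>c\<bar> * ennreal (1 / \<bar>c\<bar>) = 1"
      using cs by (simp add: ennreal_mult[symmetric])
    then have 4: "ennreal \<bar>c\<bar> * (ennreal (1 / \<bar>c\<bar>) * y) = y" for y
      by (simp add: mult.assoc[symmetric])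
    have "\<bar>- c\<bar> * (\<integral>\<^sup>+v. ennreal \<bar>1 / c\<bar> * (?\<phi> (- s * (s * u + - c * v) / c + 1 / c * u) *
      (?\<phi> (s * u + - c * v) * F (c * (- s * (s * u + - c * v) / c + 1 / c * u) + s * (s * u + - c * v))
        (s * (- s * (s * u + - c * v) / c + 1 / c * u) - c * (s * u + - c * v)))) \<partial>lborel)
      = (\<integral>\<^sup>+v. ?\<phi> (c * u + s * v) * (?\<phi> (s * u - c * v) * F u v) \<partial>lborel)"
      unfolding 1 2 3 by (subst nn_integral_cmult[symmetric]) (simp_all add: 4)
    also have "\<dots> = (\<integral>\<^sup>+v. ?\<phi> u * (?\<phi> v * F u v) \<partial>lborel)"
      unfolding mult.assoc[symmetric] inv ..
    finally show "\<bar>- c\<bar> * (\<integral>\<^sup>+v. ennreal \<bar>1 / c\<bar> * (?\<phi> (- s * (s * u + - c * v) / c + 1 / c * u) *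
      (?\<phi> (s * u + - c * v) * F (c * (- s * (s * u + - c * v) / c + 1 / c * u) + s * (s * u + - c * v))
        (s * (- s * (s * u + - c * v) / c + 1 / c * u) - c * (s * u + - c * v)))) \<partial>lborel)
      = (\<integral>\<^sup>+v. ?\<phi> u * (?\<phi> v * F u v) \<partial>lborel)" .
  qed
  also have "\<dots> = (\<integral>\<^sup>+u. \<integral>\<^sup>+v. F u v \<partial>std_normal \<partial>std_normal)"
    by (simp add: nn_integral_density nn_integral_cmult)
  finally show ?thesis .
qed

definition plane_rotation :: "real \<Rightarrow> real \<Rightarrow> 'i \<Rightarrow> 'i \<Rightarrow> ('i \<Rightarrow> real) \<Rightarrow> 'i \<Rightarrow> real" where
  "plane_rotation c s a b x = x(a := c * x a + s * x b, b := s * x a - c * x b)"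

lemma plane_rotation_measurable [measurable]:
  assumes "a \<in> I" "b \<in> I"
  shows "plane_rotation c s a b \<in> measurable (Pi\<^sub>M I (\<lambda>_. std_normal)) (Pi\<^sub>M I (\<lambda>_. std_normal))"
proof (rule measurable_PiM_single')
  fix i assume "i \<in> I"
  then show "(\<lambda>x. plane_rotation c s a b x i) \<in> measurable (Pi\<^sub>M I (\<lambda>_. std_normal)) std_normal"
    using assms unfolding plane_rotation_def by (cases "i = b"; cases "i = a") auto
next
  show "plane_rotation c s a b \<in> space (Pi\<^sub>M I (\<lambda>_. std_normal)) \<rightarrow> (\<Pi>\<^sub>E i\<in>I. space std_normal)"
    using assms by (auto simp: plane_rotation_def space_PiM PiE_def extensional_def)
qed

lemma distr_plane_rotation:
  fixes I :: "'i set"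
  assumes I: "finite I" "a \<in> I" "b \<in> I" "a \<noteq> b" and cs: "c\<^sup>2 + s\<^sup>2 = 1" "c \<noteq> 0"
  shows "distr (Pi\<^sub>M I (\<lambda>_. std_normal)) (Pi\<^sub>M I (\<lambda>_. std_normal)) (plane_rotation c s a b)
    = Pi\<^sub>M I (\<lambda>_. std_normal)"
proof (rule measure_eqI)
  interpret product_sigma_finite "\<lambda>_::'i. std_normal" by (rule product_std_normal)
  let ?G = "\<lambda>I. Pi\<^sub>M I (\<lambda>_. std_normal)"
  note rm[measurable] = plane_rotation_measurable[OF I(2,3), of c s]
  define J where "J = I - {a, b}"
  have J: "finite J" "a \<notin> insert b J" "b \<notin> J" "I = insert a (insert b J)"
    using I by (auto simp: J_def)
  interpret PJ: prob_space "?G J" by (rule prob_space_PiM_std_normal)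
  fix A assume "A \<in> sets (distr (?G I) (?G I) (plane_rotation c s a b))"
  then have A[measurable]: "A \<in> sets (?G I)" by simp
  have split: "(\<integral>\<^sup>+x. f x \<partial>?G I) = (\<integral>\<^sup>+u. \<integral>\<^sup>+v. \<integral>\<^sup>+x. f (x(b := v, a := u)) \<partial>?G J \<partial>std_normal \<partial>std_normal)"
    if f[measurable]: "f \<in> borel_measurable (?G I)" for f :: "('i \<Rightarrow> real) \<Rightarrow> ennreal"
  proof -
    have f': "f \<in> borel_measurable (?G (insert a (insert b J)))" using f J by simp
    have "(\<integral>\<^sup>+x. f x \<partial>?G I) = (\<integral>\<^sup>+u. \<integral>\<^sup>+x. f (x(a := u)) \<partial>?G (insert b J) \<partial>std_normal)"
      unfolding J(4) by (rule product_nn_integral_insert_rev) (use J f' in auto)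
    also have "\<dots> = (\<integral>\<^sup>+u. \<integral>\<^sup>+v. \<integral>\<^sup>+x. f (x(b := v, a := u)) \<partial>?G J \<partial>std_normal \<partial>std_normal)"
    proof (rule nn_integral_cong, rule product_nn_integral_insert_rev)
      fix u :: real
      have "(\<lambda>x. x(a := u)) \<in> measurable (?G (insert b J)) (?G (insert a (insert b J)))"
        by (intro measurable_fun_upd[where J = "insert b J"]) auto
      then show "(\<lambda>x. f (x(a := u))) \<in> borel_measurable (?G (insert b J))"
        using f' by (rule measurable_compose)
    qed (use J in auto)
    finally show ?thesis .
  qed
  have upd: "(\<lambda>(w, x). x(b := snd w, a := fst w)) \<in> measurable ((borel \<Otimes>\<^sub>M borel) \<Otimes>\<^sub>M ?G J) (?G I)"
    unfolding J(4) by (intro measurable_fun_upd[where J = "insert b J"] measurable_fun_upd[where J = J]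
        measurable_split_conv[THEN iffD2] measurable_snd) (auto simp: case_prod_beta')
  define F where "F u v = (\<integral>\<^sup>+x. indicator A (x(b := v, a := u)) \<partial>?G J)" for u v :: real
  have "(\<lambda>(w, x). (indicator A (x(b := snd w, a := fst w)) :: ennreal)) \<in> borel_measurable ((borel \<Otimes>\<^sub>M borel) \<Otimes>\<^sub>M ?G J)"
    using measurable_compose[OF upd, of "indicator A :: _ \<Rightarrow> ennreal" borel] by (simp add: case_prod_beta')
  then have F: "case_prod F \<in> borel_measurable (borel \<Otimes>\<^sub>M borel)"
    unfolding F_def case_prod_beta' by (intro PJ.borel_measurable_nn_integral) (simp add: case_prod_beta')
  have "emeasure (distr (?G I) (?G I) (plane_rotation c s a b)) A
      = (\<integral>\<^sup>+x. indicator A (plane_rotation c s a b x) \<partial>?G I)"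
    by (subst nn_integral_indicator[symmetric], simp, subst nn_integral_distr) auto
  also have "\<dots> = (\<integral>\<^sup>+u. \<integral>\<^sup>+v. \<integral>\<^sup>+x. indicator A (plane_rotation c s a b (x(b := v, a := u))) \<partial>?G J \<partial>std_normal \<partial>std_normal)"
    by (rule split) simp
  also have "\<dots> = (\<integral>\<^sup>+u. \<integral>\<^sup>+v. F (c * u + s * v) (s * u - c * v) \<partial>std_normal \<partial>std_normal)"
    using I(4) by (simp add: F_def plane_rotation_def fun_upd_twist)
  also have "\<dots> = (\<integral>\<^sup>+u. \<integral>\<^sup>+v. F u v \<partial>std_normal \<partial>std_normal)"
    by (rule nn_integral_std_normal_rotation[OF cs F])
  also have "\<dots> = (\<integral>\<^sup>+x. indicator A x \<partial>?G I)"
    unfolding F_def by (rule split[symmetric]) simp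
  finally show "emeasure (distr (?G I) (?G I) (plane_rotation c s a b)) A = emeasure (?G I) A" by simp
qed simp

definition row_rotation :: "real \<Rightarrow> real \<Rightarrow> nat \<Rightarrow> nat \<Rightarrow> nat \<Rightarrow> (nat \<times> nat \<Rightarrow> real) \<Rightarrow> nat \<times> nat \<Rightarrow> real" where
  "row_rotation c s a b m x = (\<lambda>(k, i).
     if i < m \<and> k = a then c * x (a, i) + s * x (b, i)
     else if i < m \<and> k = b then s * x (a, i) - c * x (b, i) else x (k, i))"

lemma distr_row_rotation:
  assumes ab: "a \<in> K" "b \<in> K" "a \<noteq> b" "finite K" and cs: "c\<^sup>2 + s\<^sup>2 = 1" "c \<noteq> 0" and m: "m \<le> Suc n"
  defines "G \<equiv> Pi\<^sub>M (K \<times> {0..n}) (\<lambda>_. std_normal)"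
  shows "row_rotation c s a b m \<in> measurable G G \<and> distr G G (row_rotation c s a b m) = G"
  using m
proof (induction m)
  case 0
  have "row_rotation c s a b 0 = (\<lambda>x. x)" by (auto simp: row_rotation_def fun_eq_iff)
  then show ?case by (simp add: distr_id2)
next
  case (Suc m)
  let ?r = "plane_rotation c s (a, m) (b, m)"
  have in_I: "(a, m) \<in> K \<times> {0..n}" "(b, m) \<in> K \<times> {0..n}" using ab Suc by auto
  have eq: "row_rotation c s a b (Suc m) = ?r \<circ> row_rotation c s a b m"
    using ab by (auto simp: row_rotation_def plane_rotation_def fun_eq_iff less_Suc_eq)
  have r: "?r \<in> measurable G G" unfolding G_def by (rule plane_rotation_measurable[OF in_I])
  have IH: "row_rotation c s a b m \<in> measurable G G" "distr G G (row_rotation c s a b m) = G"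
    using Suc by auto
  have "distr G G (row_rotation c s a b (Suc m)) = distr (distr G G (row_rotation c s a b m)) G ?r"
    unfolding eq by (rule distr_distr[symmetric, OF r IH(1)])
  also have "\<dots> = G"
    unfolding IH(2) unfolding G_def by (rule distr_plane_rotation) (use in_I ab cs in auto)
  finally show ?case using measurable_comp[OF IH(1) r] unfolding eq by blast
qed

section \<open>The law of the split samples\<close>

definition idx :: "nat \<Rightarrow> (nat \<times> nat) set" where
  "idx n = {0..3} \<times> {0..n}"

text \<open>The standardized noise of the four samples \<open>y\<^sub>l\<close>, \<open>p\<close>, \<open>y\<^sub>s\<close> and \<open>q\<close>, in this order.\<close>

definition noise :: "nat \<Rightarrow> real \<Rightarrow> (real \<Rightarrow> real) \<Rightarrow> nat \<times> nat \<Rightarrow> outcome \<Rightarrow> real" where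
  "noise n \<sigma> f = (\<lambda>(k, i) \<omega>. let e = f (real i / real n) in
     if k = 0 then (split_l \<sigma> \<omega> i - e) / (sqrt 3 * \<sigma>)
     else if k = 1 then (split_e \<sigma> \<omega> i + sqrt 3 * \<sigma> * snd \<omega> (3, i) - e) / (sqrt 6 * \<sigma>)
     else if k = 2 then (split_s \<sigma> \<omega> i - e) / (sqrt 3 * \<sigma>)
     else (split_e \<sigma> \<omega> i - sqrt 3 * \<sigma> * snd \<omega> (3, i) - e) / (sqrt 6 * \<sigma>))"

lemma split_l_noise: "\<sigma> > 0 \<Longrightarrow> split_l \<sigma> \<omega> i = f (real i / real n) + sqrt 3 * \<sigma> * noise n \<sigma> f (0, i) \<omega>"
  and split_s_noise: "\<sigma> > 0 \<Longrightarrow> split_s \<sigma> \<omega> i = f (real i / real n) + sqrt 3 * \<sigma> * noise n \<sigma> f (2, i) \<omega>"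
  and p_noise: "\<sigma> > 0 \<Longrightarrow> split_e \<sigma> \<omega> i + sqrt 3 * \<sigma> * snd \<omega> (3, i)
    = f (real i / real n) + sqrt 6 * \<sigma> * noise n \<sigma> f (1, i) \<omega>"
  and q_noise: "\<sigma> > 0 \<Longrightarrow> split_e \<sigma> \<omega> i - sqrt 3 * \<sigma> * snd \<omega> (3, i)
    = f (real i / real n) + sqrt 6 * \<sigma> * noise n \<sigma> f (3, i) \<omega>"
  by (simp_all add: noise_def)

lemma sets_PiM_std_normal: "sets (Pi\<^sub>M I (\<lambda>_. std_normal)) = sets (Pi\<^sub>M I (\<lambda>_. borel))"
  by (intro sets_PiM_cong) auto

lemma sets_aux_law: "sets (aux_law n) = sets (Pi\<^sub>M ({1..3} \<times> {0..n}) (\<lambda>_. borel))"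
  unfolding aux_law_def by (rule sets_PiM_std_normal)

lemma sets_model [measurable_cong]:
  "sets (model n \<sigma> f) = sets (Pi\<^sub>M {0..n} (\<lambda>_. borel) \<Otimes>\<^sub>M Pi\<^sub>M ({1..3} \<times> {0..n}) (\<lambda>_. borel))"
  unfolding model_def obs_law_def by (intro sets_pair_measure_cong) (simp_all add: sets_aux_law)

lemma measurable_obs [measurable]:
  "(\<lambda>\<xi>. \<lambda>i\<in>{0..n}. f (real i / real n) + \<sigma> * \<xi> i)
     \<in> measurable (Pi\<^sub>M {0..n} (\<lambda>_. std_normal)) (Pi\<^sub>M {0..n} (\<lambda>_. borel))"
  by measurable

lemma prob_space_model: "prob_space (model n \<sigma> f)"
proof -
  interpret A: prob_space "obs_law n \<sigma> f"
    unfolding obs_law_def by (intro prob_space.prob_space_distr prob_space_PiM_std_normal measurable_obs)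
  interpret B: prob_space "aux_law n" unfolding aux_law_def by (rule prob_space_PiM_std_normal)
  interpret pair_prob_space "obs_law n \<sigma> f" "aux_law n" ..
  show ?thesis unfolding model_def by (rule P.prob_space_axioms)
qed

lemma space_model_obs: "i \<le> n \<Longrightarrow> (\<lambda>\<omega>. fst \<omega> i) \<in> borel_measurable (model n \<sigma> f)"
  unfolding measurable_cong_sets[OF sets_model refl]
  by (rule measurable_compose[OF measurable_fst measurable_component_singleton]) simp

lemma space_model_aux: "k \<in> {1..3} \<Longrightarrow> i \<le> n \<Longrightarrow> (\<lambda>\<omega>. snd \<omega> (k, i)) \<in> borel_measurable (model n \<sigma> f)"
  unfolding measurable_cong_sets[OF sets_model refl]
  by (rule measurable_compose[OF measurable_snd measurable_component_singleton]) simp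

lemma noise_measurable:
  assumes "j \<in> idx n"
  shows "noise n \<sigma> f j \<in> borel_measurable (model n \<sigma> g)"
proof -
  obtain k i where j: "j = (k, i)" "i \<le> n" using assms by (auto simp: idx_def)
  define y where "y \<omega> = fst \<omega> i" for \<omega> :: outcome
  define z where "z m \<omega> = snd \<omega> (m, i)" for m and \<omega> :: outcome
  have [measurable]: "y \<in> borel_measurable (model n \<sigma> g)"
    using space_model_obs[OF j(2), of \<sigma> g] by (simp add: y_def[abs_def])
  have [measurable]: "z m \<in> borel_measurable (model n \<sigma> g)" if "m \<in> {1..3}" for m
    using space_model_aux[OF that j(2), of \<sigma> g] by (simp add: z_def[abs_def])
  have "noise n \<sigma> f j = (\<lambda>\<omega>. let e = f (real i / real n) in
     if k = 0 then (y \<omega> + sqrt 2 / 2 * \<sigma> * z 1 \<omega> + sqrt 6 / 2 * \<sigma> * z 2 \<omega> - e) / (sqrt 3 * \<sigma>)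
     else if k = 1 then (y \<omega> - sqrt 2 * \<sigma> * z 1 \<omega> + sqrt 3 * \<sigma> * z 3 \<omega> - e) / (sqrt 6 * \<sigma>)
     else if k = 2 then (y \<omega> + sqrt 2 / 2 * \<sigma> * z 1 \<omega> - sqrt 6 / 2 * \<sigma> * z 2 \<omega> - e) / (sqrt 3 * \<sigma>)
     else (y \<omega> - sqrt 2 * \<sigma> * z 1 \<omega> - sqrt 3 * \<sigma> * z 3 \<omega> - e) / (sqrt 6 * \<sigma>))"
    by (simp add: j noise_def split_l_def split_s_def split_e_def case_prod_beta' Let_def y_def z_def
        cong: if_cong)
  also have "\<dots> \<in> borel_measurable (model n \<sigma> g)" unfolding Let_def by measurable
  finally show ?thesis .
qed

text \<open>In the input, row 0 is the observation noise and rows 1 to 3 are the auxiliary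
  variables. The first map turns rows 0 and 1 into the standardized noises of (y_l + y_s)/2 and y_e,
  whose variances 3/2 and 3 (in units of \<sigma>^2) explain the coefficients. The second map splits
  the former with row 2 into y_l and y_s, the third splits the latter with row 3 into p and
  q.\<close>

definition rotate_noise :: "nat \<Rightarrow> (nat \<times> nat \<Rightarrow> real) \<Rightarrow> nat \<times> nat \<Rightarrow> real" where
  "rotate_noise n = row_rotation (1 / sqrt 2) (1 / sqrt 2) 1 3 (Suc n) \<circ>
     row_rotation (1 / sqrt 2) (1 / sqrt 2) 0 2 (Suc n) \<circ>
     row_rotation (sqrt 2 / sqrt 3) (1 / sqrt 3) 0 1 (Suc n)"

lemma distr_rotate_noise:
  defines "G \<equiv> \<lambda>n. Pi\<^sub>M (idx n) (\<lambda>_. std_normal)"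
  shows "rotate_noise n \<in> measurable (G n) (G n)" "distr (G n) (G n) (rotate_noise n) = G n"
proof -
  let ?r1 = "row_rotation (sqrt 2 / sqrt 3) (1 / sqrt 3) 0 1 (Suc n)"
  let ?r2 = "row_rotation (1 / sqrt 2) (1 / sqrt 2) 0 2 (Suc n)"
  let ?r3 = "row_rotation (1 / sqrt 2) (1 / sqrt 2) 1 3 (Suc n)"
  have 1: "?r1 \<in> measurable (G n) (G n) \<and> distr (G n) (G n) ?r1 = G n"
    and 2: "?r2 \<in> measurable (G n) (G n) \<and> distr (G n) (G n) ?r2 = G n"
    and 3: "?r3 \<in> measurable (G n) (G n) \<and> distr (G n) (G n) ?r3 = G n"
    unfolding G_def idx_def by (rule distr_row_rotation; simp add: power_divide)+
  have 12: "?r2 \<circ> ?r1 \<in> measurable (G n) (G n)" by (rule measurable_comp[of _ _ "G n"]) (use 1 2 in auto)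
  show "rotate_noise n \<in> measurable (G n) (G n)"
    unfolding rotate_noise_def comp_assoc by (rule measurable_comp[of _ _ "G n"]) (use 12 3 in auto)
  have "distr (G n) (G n) (?r2 \<circ> ?r1) = distr (distr (G n) (G n) ?r1) (G n) ?r2"
    by (rule distr_distr[symmetric]) (use 1 2 in auto)
  then have "distr (G n) (G n) (?r2 \<circ> ?r1) = G n" using 1 2 by simp
  moreover have "distr (G n) (G n) (rotate_noise n) = distr (distr (G n) (G n) (?r2 \<circ> ?r1)) (G n) ?r3"
    unfolding rotate_noise_def comp_assoc by (rule distr_distr[symmetric]) (use 12 3 in auto)
  ultimately show "distr (G n) (G n) (rotate_noise n) = G n" using 3 by simp
qed

text \<open>The noises of the four samples are an orthogonal image of an array of independent
  standard normal variables, hence again such an array. All independence statements about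
  localization, stopping and refinement come from here.\<close>

lemma noise_law:
  assumes \<sigma>: "\<sigma> > 0"
  shows "distr (model n \<sigma> f) (Pi\<^sub>M (idx n) (\<lambda>_. borel)) (\<lambda>\<omega>. \<lambda>j\<in>idx n. noise n \<sigma> f j \<omega>)
    = Pi\<^sub>M (idx n) (\<lambda>_. std_normal)"
proof -
  interpret product_sigma_finite "\<lambda>_::nat \<times> nat. std_normal" by (rule product_std_normal)
  interpret N0: product_sigma_finite "\<lambda>_::nat. std_normal" by (rule product_std_normal)
  let ?G = "Pi\<^sub>M (idx n) (\<lambda>_. std_normal)"
  let ?X = "Pi\<^sub>M {0..n} (\<lambda>_. std_normal)" and ?Y = "Pi\<^sub>M ({1..3::nat} \<times> {0..n}) (\<lambda>_. std_normal)"
  let ?X' = "Pi\<^sub>M {0..n} (\<lambda>_. borel)" and ?Y' = "Pi\<^sub>M ({1..3::nat} \<times> {0..n}) (\<lambda>_. borel :: real measure)"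
  let ?obs = "\<lambda>\<xi>. \<lambda>i\<in>{0..n}. f (real i / real n) + \<sigma> * \<xi> i"
  let ?A = "\<lambda>\<omega>. \<lambda>j\<in>idx n. noise n \<sigma> f j \<omega>"
  interpret X: prob_space ?X by (rule prob_space_PiM_std_normal)
  interpret Y: prob_space ?Y by (rule prob_space_PiM_std_normal)
  \<comment> \<open>Writes the observation noise and the auxiliary variables into one array, the
    observation noise in row 0.\<close>
  define V where "V = (\<lambda>(\<xi>, z). \<lambda>(k, i)\<in>idx n. if k = 0 then \<xi> i else z (k, i) :: real)"
  have V: "V \<in> measurable (?X \<Otimes>\<^sub>M ?Y) ?G"
    unfolding V_def case_prod_beta'
  proof (rule measurable_restrict)
    fix j assume j: "j \<in> idx n"
    have 1: "(\<lambda>x. fst x (snd j)) \<in> measurable (?X \<Otimes>\<^sub>M ?Y) std_normal"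
      by (rule measurable_compose[OF measurable_fst measurable_component_singleton])
        (use j in \<open>auto simp: idx_def\<close>)
    have 2: "(\<lambda>x. snd x (fst j, snd j)) \<in> measurable (?X \<Otimes>\<^sub>M ?Y) std_normal" if "fst j \<noteq> 0"
      by (rule measurable_compose[OF measurable_snd measurable_component_singleton])
        (use j that in \<open>auto simp: idx_def\<close>)
    show "(\<lambda>x. if fst j = 0 then fst x (snd j) else snd x (fst j, snd j)) \<in> measurable (?X \<Otimes>\<^sub>M ?Y) std_normal"
      using 1 2 by (cases "fst j = 0") auto
  qed
  have dV: "distr (?X \<Otimes>\<^sub>M ?Y) ?G V = ?G"
  proof (rule PiM_eqI)
    fix A :: "nat \<times> nat \<Rightarrow> real set" assume A: "\<And>j. j \<in> idx n \<Longrightarrow> A j \<in> sets std_normal"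
    have A': "Pi\<^sub>E (idx n) A \<in> sets ?G" using A by (intro sets_PiM_I_finite) (auto simp: idx_def)
    have "V -` Pi\<^sub>E (idx n) A \<inter> space (?X \<Otimes>\<^sub>M ?Y)
        = Pi\<^sub>E {0..n} (\<lambda>i. A (0, i)) \<times> Pi\<^sub>E ({1..3} \<times> {0..n}) A"
    proof (intro set_eqI iffI)
      fix w assume w: "w \<in> V -` Pi\<^sub>E (idx n) A \<inter> space (?X \<Otimes>\<^sub>M ?Y)"
      have "V w j \<in> A j" if "j \<in> idx n" for j using w that by auto
      then have "(if fst j = 0 then fst w (snd j) else snd w j) \<in> A j" if "j \<in> idx n" for j
        using that by (fastforce simp: V_def case_prod_beta')
      from this[of "(0, _)"] this[of "(_, _)"] show "w \<in> Pi\<^sub>E {0..n} (\<lambda>i. A (0, i)) \<times> Pi\<^sub>E ({1..3} \<times> {0..n}) A"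
        using w by (fastforce simp: idx_def space_pair_measure space_PiM PiE_def Pi_def extensional_def)
    next
      fix w assume w: "w \<in> Pi\<^sub>E {0..n} (\<lambda>i. A (0, i)) \<times> Pi\<^sub>E ({1..3} \<times> {0..n}) A"
      then show "w \<in> V -` Pi\<^sub>E (idx n) A \<inter> space (?X \<Otimes>\<^sub>M ?Y)"
        by (fastforce simp: V_def idx_def space_pair_measure space_PiM PiE_def Pi_def extensional_def split: if_splits)
    qed
    then have "emeasure (distr (?X \<Otimes>\<^sub>M ?Y) ?G V) (Pi\<^sub>E (idx n) A)
        = emeasure (?X \<Otimes>\<^sub>M ?Y) (Pi\<^sub>E {0..n} (\<lambda>i. A (0, i)) \<times> Pi\<^sub>E ({1..3} \<times> {0..n}) A)"
      using emeasure_distr[OF V A'] by simp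
    also have "\<dots> = emeasure ?X (Pi\<^sub>E {0..n} (\<lambda>i. A (0, i))) * emeasure ?Y (Pi\<^sub>E ({1..3} \<times> {0..n}) A)"
      by (rule Y.emeasure_pair_measure_Times) (intro sets_PiM_I_finite; use A in \<open>auto simp: idx_def\<close>)+
    also have "\<dots> = (\<Prod>i\<in>{0..n}. emeasure std_normal (A (0, i))) * (\<Prod>j\<in>{1..3} \<times> {0..n}. emeasure std_normal (A j))"
      using A by (subst N0.emeasure_PiM, simp, simp add: idx_def, subst emeasure_PiM) (auto simp: idx_def)
    also have "(\<Prod>i\<in>{0..n}. emeasure std_normal (A (0, i))) = (\<Prod>j\<in>{0} \<times> {0..n}. emeasure std_normal (A j))"
      by (rule prod.reindex_bij_witness[of _ snd "\<lambda>i. (0, i)"]) auto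
    also have "\<dots> * (\<Prod>j\<in>{1..3} \<times> {0..n}. emeasure std_normal (A j))
        = (\<Prod>j\<in>({0} \<times> {0..n}) \<union> ({1..3} \<times> {0..n}). emeasure std_normal (A j))"
      by (rule prod.union_disjoint[symmetric]) auto
    also have "({0} \<times> {0..n}) \<union> ({1..3} \<times> {0..n}) = idx n" by (auto simp: idx_def)
    finally show "emeasure (distr (?X \<Otimes>\<^sub>M ?Y) ?G V) (Pi\<^sub>E (idx n) A) = (\<Prod>j\<in>idx n. emeasure std_normal (A j))" .
  qed (auto simp: idx_def)
  define \<Phi> where "\<Phi> = (\<lambda>(\<xi>, z). (?obs \<xi>, z :: nat \<times> nat \<Rightarrow> real))"
  have idY: "distr ?Y ?Y (\<lambda>z. z) = ?Y" by (rule distr_id2) simp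
  have "model n \<sigma> f = distr ?X ?X' ?obs \<Otimes>\<^sub>M distr ?Y ?Y (\<lambda>z. z)"
    unfolding model_def obs_law_def aux_law_def idY ..
  also have "\<dots> = distr (?X \<Otimes>\<^sub>M ?Y) (?X' \<Otimes>\<^sub>M ?Y) \<Phi>"
    unfolding \<Phi>_def
  proof (rule pair_measure_distr)
    show "sigma_finite_measure (distr ?Y ?Y (\<lambda>z. z))"
      unfolding idY by (rule Y.sigma_finite_measure_axioms)
  qed simp_all
  finally have model: "model n \<sigma> f = distr (?X \<Otimes>\<^sub>M ?Y) (?X' \<Otimes>\<^sub>M ?Y) \<Phi>" .
  have \<Phi>: "\<Phi> \<in> measurable (?X \<Otimes>\<^sub>M ?Y) (?X' \<Otimes>\<^sub>M ?Y)" unfolding \<Phi>_def by measurable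
  have A: "?A \<in> measurable (model n \<sigma> f) (Pi\<^sub>M (idx n) (\<lambda>_. borel))"
    by (intro measurable_restrict noise_measurable)
  have sm: "sets (model n \<sigma> f) = sets (?X' \<Otimes>\<^sub>M ?Y)" by (simp add: model)
  have eq: "?A (\<Phi> w) = rotate_noise n (V w)" if w: "w \<in> space (?X \<Otimes>\<^sub>M ?Y)" for w
  proof
    fix j :: "nat \<times> nat"
    obtain \<xi> z where w': "w = (\<xi>, z)" by (cases w)
    obtain k i where j: "j = (k, i)" by (cases j)
    have s: "sqrt 6 = sqrt 2 * sqrt 3" "sqrt 2 * sqrt 2 = 2" "sqrt 3 * sqrt 3 = 3"
      by (simp_all add: real_sqrt_mult[symmetric])
    have s': "sqrt 2 * (sqrt 2 * x) = 2 * x" "sqrt 3 * (sqrt 3 * x) = 3 * x" for x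
      unfolding mult.assoc[symmetric] s(2,3) by simp_all
    have nz: "sqrt 2 \<noteq> 0" "sqrt 3 \<noteq> 0" "\<sigma> \<noteq> 0" using \<sigma> by auto
    show "?A (\<Phi> w) j = rotate_noise n (V w) j"
    proof (cases "j \<in> idx n")
      case False
      then show ?thesis
        by (auto simp: rotate_noise_def row_rotation_def V_def w' j idx_def)
    next
      case True
      then have i: "i \<le> n" and "k = 0 \<or> k = 1 \<or> k = 2 \<or> k = 3" by (auto simp: j idx_def)
      then consider "k = 0" | "k = 1" | "k = 2" | "k = 3" by blast
      then show ?thesis
        by cases (use i nz s in \<open>simp_all add: s' j w' idx_def noise_def \<Phi>_def V_def split_l_def split_s_def
          split_e_def rotate_noise_def row_rotation_def field_simps\<close>)
    qed
  qed
  have "distr (model n \<sigma> f) (Pi\<^sub>M (idx n) (\<lambda>_. borel)) ?A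
      = distr (?X \<Otimes>\<^sub>M ?Y) (Pi\<^sub>M (idx n) (\<lambda>_. borel)) (?A \<circ> \<Phi>)"
    using A unfolding model by (intro distr_distr \<Phi>) (simp add: measurable_cong_sets[OF sm[unfolded model]])
  also have "\<dots> = distr (?X \<Otimes>\<^sub>M ?Y) ?G (rotate_noise n \<circ> V)"
    by (rule distr_cong) (use eq in \<open>auto simp: sets_PiM_std_normal\<close>)
  also have "\<dots> = distr (distr (?X \<Otimes>\<^sub>M ?Y) ?G V) ?G (rotate_noise n)"
    by (rule distr_distr[symmetric, OF distr_rotate_noise(1) V])
  also have "\<dots> = ?G" unfolding dV by (rule distr_rotate_noise(2))
  finally show ?thesis .
qed

lemma noise_distr:
  assumes \<sigma>: "\<sigma> > 0" and j: "j \<in> idx n"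
  shows "distr (model n \<sigma> f) borel (noise n \<sigma> f j) = std_normal"
proof -
  let ?A = "\<lambda>\<omega>. \<lambda>j\<in>idx n. noise n \<sigma> f j \<omega>"
  have A: "?A \<in> measurable (model n \<sigma> f) (Pi\<^sub>M (idx n) (\<lambda>_. borel))"
    by (intro measurable_restrict noise_measurable)
  have "distr (model n \<sigma> f) borel (noise n \<sigma> f j) = distr (model n \<sigma> f) borel ((\<lambda>x. x j) \<circ> ?A)"
    by (rule distr_cong) (use j in auto)
  also have "\<dots> = distr (distr (model n \<sigma> f) (Pi\<^sub>M (idx n) (\<lambda>_. borel)) ?A) borel (\<lambda>x. x j)"
    by (rule distr_distr[symmetric, OF measurable_component_singleton A]) (use j in auto)
  also have "\<dots> = distr (Pi\<^sub>M (idx n) (\<lambda>_. std_normal)) std_normal (\<lambda>x. x j)"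
    unfolding noise_law[OF \<sigma>] by (rule distr_cong) auto
  also have "\<dots> = std_normal" by (rule distr_PiM_component[OF prob_space_std_normal j])
  finally show ?thesis .
qed

lemma noise_indep:
  assumes \<sigma>: "\<sigma> > 0"
  shows "prob_space.indep_vars (model n \<sigma> f) (\<lambda>_. borel) (noise n \<sigma> f) (idx n)"
proof -
  interpret prob_space "model n \<sigma> f" by (rule prob_space_model)
  have "distr (model n \<sigma> f) (Pi\<^sub>M (idx n) (\<lambda>_. borel)) (\<lambda>\<omega>. \<lambda>j\<in>idx n. noise n \<sigma> f j \<omega>)
      = (\<Pi>\<^sub>M j\<in>idx n. distr (model n \<sigma> f) borel (noise n \<sigma> f j))"
    unfolding noise_law[OF \<sigma>] by (rule PiM_cong) (auto simp: noise_distr[OF \<sigma>])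
  then show ?thesis
    by (subst indep_vars_iff_distr_eq_PiM') (auto simp: idx_def intro!: noise_measurable)
qed

lemma noise_linear_distr:
  assumes \<sigma>: "\<sigma> > 0" and J: "J \<subseteq> idx n" "J \<noteq> {}" and c: "\<And>j. j \<in> J \<Longrightarrow> c j \<noteq> 0"
  shows "distr (model n \<sigma> f) borel (\<lambda>\<omega>. (\<Sum>j\<in>J. c j * noise n \<sigma> f j \<omega>) / sqrt (\<Sum>j\<in>J. (c j)\<^sup>2)) = std_normal"
proof -
  interpret prob_space "model n \<sigma> f" by (rule prob_space_model)
  have fin: "finite J" using J(1) by (rule finite_subset) (simp add: idx_def)
  have pos: "0 < (\<Sum>j\<in>J. (c j)\<^sup>2)" using fin J c by (intro sum_pos) auto
  have dj: "distributed (model n \<sigma> f) lborel (\<lambda>\<omega>. c j * noise n \<sigma> f j \<omega>) (normal_density 0 \<bar>c j\<bar>)"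
    if j: "j \<in> J" for j
  proof -
    have "distributed (model n \<sigma> f) lborel (noise n \<sigma> f j) (normal_density 0 1)"
    proof -
      have "distr (model n \<sigma> f) lborel (noise n \<sigma> f j) = distr (model n \<sigma> f) borel (noise n \<sigma> f j)"
        by (rule distr_cong) auto
      then show ?thesis
        using noise_distr[OF \<sigma>, of j n f] noise_measurable[of j n \<sigma> f f] j J
        by (auto simp: distributed_def)
    qed
    then have "distributed (model n \<sigma> f) lborel (\<lambda>\<omega>. 0 + c j * noise n \<sigma> f j \<omega>)
        (normal_density (0 + c j * 0) (\<bar>c j\<bar> * 1))"
      by (rule normal_density_affine) (use c[OF j] in auto)
    then show ?thesis by simp
  qed
  have ind: "indep_vars (\<lambda>_. borel) (\<lambda>j \<omega>. c j * noise n \<sigma> f j \<omega>) J"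
    using indep_vars_subset[OF noise_indep[OF \<sigma>, of n f] J(1)]
    by (rule indep_vars_compose2) auto
  have "distributed (model n \<sigma> f) lborel (\<lambda>\<omega>. \<Sum>j\<in>J. c j * noise n \<sigma> f j \<omega>)
      (normal_density (\<Sum>j\<in>J. 0) (sqrt (\<Sum>j\<in>J. \<bar>c j\<bar>\<^sup>2)))"
    by (rule sum_indep_normal[OF fin J(2) ind]) (use c dj in auto)
  then have "distributed (model n \<sigma> f) lborel (\<lambda>\<omega>. ((\<Sum>j\<in>J. c j * noise n \<sigma> f j \<omega>) - 0) / sqrt (\<Sum>j\<in>J. (c j)\<^sup>2))
      std_normal_density"
    using pos by (subst (asm) normal_standard_normal_convert) auto
  then have "distr (model n \<sigma> f) lborel (\<lambda>\<omega>. (\<Sum>j\<in>J. c j * noise n \<sigma> f j \<omega>) / sqrt (\<Sum>j\<in>J. (c j)\<^sup>2)) = std_normal"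
    by (simp add: distributed_def)
  moreover have "distr (model n \<sigma> f) lborel (\<lambda>\<omega>. (\<Sum>j\<in>J. c j * noise n \<sigma> f j \<omega>) / sqrt (\<Sum>j\<in>J. (c j)\<^sup>2))
    = distr (model n \<sigma> f) borel (\<lambda>\<omega>. (\<Sum>j\<in>J. c j * noise n \<sigma> f j \<omega>) / sqrt (\<Sum>j\<in>J. (c j)\<^sup>2))"
    by (rule distr_cong) auto
  ultimately show ?thesis by simp
qed

lemma noise_linear_measurable:
  "J \<subseteq> idx n \<Longrightarrow> (\<lambda>\<omega>. \<Sum>j\<in>J. c j * noise n \<sigma> f j \<omega>) \<in> borel_measurable (model n \<sigma> g)"
  by (intro borel_measurable_sum borel_measurable_times borel_measurable_const noise_measurable) auto

lemma nn_integral_noise_linear_square: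
  assumes \<sigma>: "\<sigma> > 0" and J: "J \<subseteq> idx n" "J \<noteq> {}" and c: "\<And>j. j \<in> J \<Longrightarrow> c j \<noteq> 0"
  shows "(\<integral>\<^sup>+\<omega>. ennreal ((\<Sum>j\<in>J. c j * noise n \<sigma> f j \<omega>)\<^sup>2) \<partial>model n \<sigma> f) = ennreal (\<Sum>j\<in>J. (c j)\<^sup>2)"
proof -
  let ?v = "\<Sum>j\<in>J. (c j)\<^sup>2" and ?X = "\<lambda>\<omega>. \<Sum>j\<in>J. c j * noise n \<sigma> f j \<omega>"
  have fin: "finite J" using J(1) by (rule finite_subset) (simp add: idx_def)
  have pos: "0 < ?v" using fin J c by (intro sum_pos) auto
  have X: "?X \<in> borel_measurable (model n \<sigma> f)" by (rule noise_linear_measurable[OF J(1)])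
  have "(\<integral>\<^sup>+x. ennreal (x\<^sup>2) \<partial>std_normal) = ennreal (LINT x|std_normal. x\<^sup>2)"
    using std_normal_distribution_even_moments(2)[of 1] by (intro nn_integral_eq_integral) auto
  also have "\<dots> = 1" using std_normal_distribution_even_moments(1)[of 1] by simp
  finally have "(\<integral>\<^sup>+x. ennreal (x\<^sup>2) \<partial>distr (model n \<sigma> f) borel (\<lambda>\<omega>. ?X \<omega> / sqrt ?v)) = 1"
    using noise_linear_distr[OF \<sigma> J c] by simp
  then have "(\<integral>\<^sup>+\<omega>. ennreal ((?X \<omega> / sqrt ?v)\<^sup>2) \<partial>model n \<sigma> f) = 1"
    using X by (subst (asm) nn_integral_distr) auto
  then have "ennreal ?v * (\<integral>\<^sup>+\<omega>. ennreal ((?X \<omega> / sqrt ?v)\<^sup>2) \<partial>model n \<sigma> f) = ennreal ?v" by simp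
  also have "ennreal ?v * (\<integral>\<^sup>+\<omega>. ennreal ((?X \<omega> / sqrt ?v)\<^sup>2) \<partial>model n \<sigma> f)
      = (\<integral>\<^sup>+\<omega>. ennreal ?v * ennreal ((?X \<omega> / sqrt ?v)\<^sup>2) \<partial>model n \<sigma> f)"
    using X by (subst nn_integral_cmult) auto
  also have "(\<lambda>\<omega>. ennreal ?v * ennreal ((?X \<omega> / sqrt ?v)\<^sup>2)) = (\<lambda>\<omega>. ennreal ((?X \<omega>)\<^sup>2))"
    using pos by (auto simp: ennreal_mult[symmetric] power_divide)
  finally show ?thesis .
qed

section \<open>The normal distribution function\<close>

lemma prob_noise_linear_greater:
  assumes \<sigma>: "\<sigma> > 0" and J: "J \<subseteq> idx n" "J \<noteq> {}" and c: "\<And>j. j \<in> J \<Longrightarrow> c j \<noteq> 0"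
  shows "measure (model n \<sigma> f) {\<omega> \<in> space (model n \<sigma> f).
      (\<Sum>j\<in>J. c j * noise n \<sigma> f j \<omega>) > t * sqrt (\<Sum>j\<in>J. (c j)\<^sup>2)} = 1 - Phi t"
proof -
  interpret N: prob_space std_normal by (rule prob_space_std_normal)
  let ?v = "\<Sum>j\<in>J. (c j)\<^sup>2" and ?X = "\<lambda>\<omega>. \<Sum>j\<in>J. c j * noise n \<sigma> f j \<omega>"
  have fin: "finite J" using J(1) by (rule finite_subset) (simp add: idx_def)
  have pos: "0 < sqrt ?v" using fin J c by (intro real_sqrt_gt_zero sum_pos) auto
  have X[measurable]: "?X \<in> borel_measurable (model n \<sigma> f)" by (rule noise_linear_measurable[OF J(1)])
  have "1 - Phi t = measure std_normal {t<..}"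
    using N.prob_compl[of "{..t}"] by (simp add: cdf_def Compl_eq_Diff_UNIV[symmetric])
  also have "\<dots> = measure (distr (model n \<sigma> f) borel (\<lambda>\<omega>. ?X \<omega> / sqrt ?v)) {t<..}"
    using noise_linear_distr[OF \<sigma> J c] by simp
  also have "\<dots> = measure (model n \<sigma> f) {\<omega> \<in> space (model n \<sigma> f). ?X \<omega> > t * sqrt ?v}"
    by (subst measure_distr) (use pos in \<open>auto intro!: arg_cong2[where f = measure] simp: field_simps\<close>)
  finally show ?thesis ..
qed

lemma Phi_uminus: "Phi (- t) = 1 - Phi t"
proof -
  interpret N: prob_space std_normal by (rule prob_space_std_normal)
  have "emeasure std_normal {..- t} = (\<integral>\<^sup>+x. ennreal (std_normal_density x) * indicator {..- t} x \<partial>lborel)"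
    by (simp add: emeasure_density)
  also have "\<dots> = ennreal \<bar>- 1\<bar> * (\<integral>\<^sup>+x. ennreal (std_normal_density (0 + - 1 * x)) * indicator {..- t} (0 + - 1 * x) \<partial>lborel)"
    by (rule nn_integral_real_affine) auto
  also have "\<dots> = (\<integral>\<^sup>+x. ennreal (std_normal_density x) * indicator {t..} x \<partial>lborel)"
    by (simp, rule nn_integral_cong) (auto simp: std_normal_density_def indicator_def)
  also have "\<dots> = (\<integral>\<^sup>+x. ennreal (std_normal_density x) * indicator {t<..} x \<partial>lborel)"
    by (rule nn_integral_cong_AE) (use AE_lborel_singleton[of t] in \<open>auto simp: indicator_def elim: eventually_mono\<close>)
  also have "\<dots> = emeasure std_normal {t<..}" by (simp add: emeasure_density)
  finally have "Phi (- t) = measure std_normal {t<..}" by (simp add: cdf_def measure_def)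
  also have "\<dots> = 1 - Phi t"
    using N.prob_compl[of "{..t}"] by (simp add: cdf_def Compl_eq_Diff_UNIV[symmetric])
  finally show ?thesis .
qed

lemma Phi_mono: "s \<le> t \<Longrightarrow> Phi s \<le> Phi t"
proof -
  interpret real_distribution std_normal by (rule real_dist_normal_dist)
  show "s \<le> t \<Longrightarrow> Phi s \<le> Phi t" by (rule cdf_nondecreasing)
qed

lemma Phi_zero: "Phi 0 = 1 / 2"
  using Phi_uminus[of 0] by simp

text \<open>Since \<open>z_quantile\<close> is given by \<open>inv\<close>, what has to be shown is
  that the value \<open>1 - \<beta>\<close> is attained; this is the intermediate value theorem
  between two points supplied by the limits of the distribution function.\<close>

lemma Phi_z_quantile:
  assumes "0 < \<beta>" "\<beta> < 1"
  shows "Phi (z_quantile \<beta>) = 1 - \<beta>"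
proof -
  interpret real_distribution std_normal by (rule real_dist_normal_dist)
  have "isCont Phi x" for x
  proof -
    have "emeasure std_normal {x} = 0"
      by (subst emeasure_density) (auto simp: nn_integral_0_iff_AE intro!: AE_I[of _ _ "{x}"] split: split_indicator)
    then show ?thesis by (simp add: isCont_cdf measure_def)
  qed
  then have cont: "continuous_on A Phi" for A by (simp add: continuous_at_imp_continuous_on)
  have "eventually (\<lambda>x. 1 - \<beta> < Phi x) at_top"
    by (rule order_tendstoD[OF cdf_lim_at_top_prob]) (use assms in auto)
  then obtain b where b: "1 - \<beta> < Phi b" by (auto simp: eventually_at_top_linorder)
  have "eventually (\<lambda>x. Phi x < 1 - \<beta>) at_bot"
    by (rule order_tendstoD[OF cdf_lim_at_bot]) (use assms in auto)
  then obtain a where a: "Phi a < 1 - \<beta>" by (auto simp: eventually_at_bot_linorder)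
  have "a \<le> b" using a b Phi_mono[of b a] by (cases "a \<le> b") auto
  then have "\<exists>x. a \<le> x \<and> x \<le> b \<and> Phi x = 1 - \<beta>"
    by (intro IVT') (use a b cont in auto)
  then have "1 - \<beta> \<in> range Phi" by (metis rangeI)
  then show ?thesis unfolding z_quantile_def by (rule f_inv_into_f)
qed

lemma z_quantile_pos:
  assumes "0 < \<beta>" "\<beta> < 1 / 2"
  shows "z_quantile \<beta> > 0"
proof (rule ccontr)
  assume "\<not> ?thesis"
  then have "Phi (z_quantile \<beta>) \<le> Phi 0" by (intro Phi_mono) simp
  then show False using Phi_z_quantile[of \<beta>] Phi_zero assms by simp
qed

lemma Phi_pos: "Phi t > 0"
proof -
  interpret N: prob_space std_normal by (rule prob_space_std_normal)
  have "emeasure std_normal {..t} \<noteq> 0"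
  proof
    assume "emeasure std_normal {..t} = 0"
    then have "(\<integral>\<^sup>+x. ennreal (std_normal_density x) * indicator {..t} x \<partial>lborel) = 0"
      by (simp add: emeasure_density)
    then have "AE x in lborel. ennreal (std_normal_density x) * indicator {..t} x = 0"
      by (subst (asm) nn_integral_0_iff_AE) auto
    then have "AE x in lborel. x \<notin> {..t}"
    proof (rule eventually_mono)
      fix x assume "ennreal (std_normal_density x) * indicator {..t} x = 0"
      moreover have "ennreal (std_normal_density x) \<noteq> 0"
        using normal_density_pos[of 1 0 x] by (simp add: ennreal_eq_0_iff not_le)
      ultimately show "x \<notin> {..t}" by (auto simp: indicator_def)
    qed
    then have "emeasure lborel {..t} = 0"
      by (subst (asm) AE_iff_measurable[of "{..t}"]) auto
    moreover have "emeasure lborel {t - 1..t} \<le> emeasure lborel {..t}" by (rule emeasure_mono) auto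
    ultimately show False by simp
  qed
  then have "measure std_normal {..t} \<noteq> 0" by (simp add: N.emeasure_eq_measure)
  then show ?thesis by (simp add: cdf_def zero_less_measure_iff)
qed

text \<open>For an integer K, the condition K \<ge> ln \<beta> / ln \<Phi>(-2) turns into
  \<Phi>(-2)^K \<le> \<beta> upon multiplication by the negative logarithm of \<Phi>(-2).\<close>

lemma K_const_power:
  assumes "0 < \<beta>" "\<beta> < 1"
  shows "K_const \<beta> \<ge> 1" "Phi (- 2) ^ nat (K_const \<beta>) \<le> \<beta>"
proof -
  let ?q = "Phi (- 2)"
  have q: "0 < ?q" "?q < 1" using Phi_pos[of "-2"] Phi_uminus[of 2] Phi_pos[of 2] Phi_mono[of "-2" 0] Phi_zero by auto
  then have lq: "ln ?q < 0" by simp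
  have "0 < ln \<beta> / ln ?q" using lq assms by (intro divide_neg_neg) auto
  then show K: "K_const \<beta> \<ge> 1" unfolding K_const_def by linarith
  have "ln \<beta> / ln ?q \<le> of_int (K_const \<beta>)" unfolding K_const_def by simp
  then have "real (nat (K_const \<beta>)) * ln ?q \<le> ln \<beta>"
    using lq K by (simp add: neg_divide_le_eq mult.commute)
  then have "ln (?q ^ nat (K_const \<beta>)) \<le> ln \<beta>" using q by (simp add: ln_realpow)
  then show "?q ^ nat (K_const \<beta>) \<le> \<beta>" using q assms by (subst (asm) ln_le_cancel_iff) auto
qed

section \<open>The lower bound for the benchmark\<close>

abbreviation normal :: "real \<Rightarrow> real \<Rightarrow> real measure" where
  "normal \<mu> \<sigma> \<equiv> density lborel (normal_density \<mu> \<sigma>)"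

lemma product_normal: "\<sigma> > 0 \<Longrightarrow> product_sigma_finite (\<lambda>i. normal (\<mu> i) \<sigma>)"
  unfolding product_sigma_finite_def
  by (intro allI prob_space_imp_sigma_finite prob_space_normal_density)

lemma emeasure_std_normal_affine:
  assumes "\<sigma> > 0" and A[measurable]: "A \<in> sets borel"
  shows "emeasure std_normal {x. \<mu> + \<sigma> * x \<in> A} = emeasure (normal \<mu> \<sigma>) A"
proof -
  have "emeasure (normal \<mu> \<sigma>) A = (\<integral>\<^sup>+x. ennreal (normal_density \<mu> \<sigma> x) * indicator A x \<partial>lborel)"
    by (simp add: emeasure_density)
  also have "\<dots> = ennreal \<bar>\<sigma>\<bar> * (\<integral>\<^sup>+x. ennreal (normal_density \<mu> \<sigma> (\<mu> + \<sigma> * x)) * indicator A (\<mu> + \<sigma> * x) \<partial>lborel)"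
    by (rule nn_integral_real_affine) (use assms in auto)
  also have "\<dots> = (\<integral>\<^sup>+x. ennreal \<sigma> * (ennreal (normal_density \<mu> \<sigma> (\<mu> + \<sigma> * x)) * indicator A (\<mu> + \<sigma> * x)) \<partial>lborel)"
    using assms by (subst nn_integral_cmult) auto
  also have "\<dots> = (\<integral>\<^sup>+x. ennreal (std_normal_density x) * indicator {x. \<mu> + \<sigma> * x \<in> A} x \<partial>lborel)"
  proof (rule nn_integral_cong)
    fix x
    have "\<sigma> * normal_density \<mu> \<sigma> (\<mu> + \<sigma> * x) = std_normal_density x"
      using assms by (simp add: normal_density_def power_mult_distrib real_sqrt_mult)
    then have "ennreal \<sigma> * ennreal (normal_density \<mu> \<sigma> (\<mu> + \<sigma> * x)) = ennreal (std_normal_density x)"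
      using assms by (simp add: ennreal_mult[symmetric])
    then show "ennreal \<sigma> * (ennreal (normal_density \<mu> \<sigma> (\<mu> + \<sigma> * x)) * indicator A (\<mu> + \<sigma> * x))
        = ennreal (std_normal_density x) * indicator {x. \<mu> + \<sigma> * x \<in> A} x"
      by (simp add: mult.assoc[symmetric] indicator_def)
  qed
  also have "\<dots> = emeasure std_normal {x. \<mu> + \<sigma> * x \<in> A}" by (subst emeasure_density) auto
  finally show ?thesis ..
qed

lemma obs_law_eq_PiM:
  assumes \<sigma>: "\<sigma> > 0"
  shows "obs_law n \<sigma> h = Pi\<^sub>M {0..n} (\<lambda>i. normal (h (real i / real n)) \<sigma>)"
proof -
  interpret N: product_sigma_finite "\<lambda>_::nat. std_normal" by (rule product_std_normal)
  interpret H: product_sigma_finite "\<lambda>i. normal (h (real i / real n)) \<sigma>" by (rule product_normal[OF \<sigma>])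
  show ?thesis
  proof (rule H.PiM_eqI)
    show "sets (obs_law n \<sigma> h) = sets (Pi\<^sub>M {0..n} (\<lambda>i. normal (h (real i / real n)) \<sigma>))"
      unfolding obs_law_def sets_distr by (intro sets_PiM_cong) auto
    fix A assume "\<And>i. i \<in> {0..n} \<Longrightarrow> A i \<in> sets (normal (h (real i / real n)) \<sigma>)"
    then have A: "A i \<in> sets borel" if "i \<le> n" for i using that by auto
    let ?B = "\<lambda>i. {x. h (real i / real n) + \<sigma> * x \<in> A i}"
    have B: "?B i \<in> sets borel" if "i \<le> n" for i
      using measurable_sets[of "\<lambda>x. h (real i / real n) + \<sigma> * x" borel borel "A i"] A[OF that] by (simp add: vimage_def)
    have "emeasure (obs_law n \<sigma> h) (Pi\<^sub>E {0..n} A) = emeasure (Pi\<^sub>M {0..n} (\<lambda>_. std_normal)) (Pi\<^sub>E {0..n} ?B)"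
      unfolding obs_law_def
    proof (subst emeasure_distr)
      show "Pi\<^sub>E {0..n} A \<in> sets (Pi\<^sub>M {0..n} (\<lambda>_. borel))" using A by (intro sets_PiM_I_finite) auto
      show "emeasure (Pi\<^sub>M {0..n} (\<lambda>_. std_normal))
          ((\<lambda>\<xi>. \<lambda>i\<in>{0..n}. h (real i / real n) + \<sigma> * \<xi> i) -` Pi\<^sub>E {0..n} A \<inter> space (Pi\<^sub>M {0..n} (\<lambda>_. std_normal)))
          = emeasure (Pi\<^sub>M {0..n} (\<lambda>_. std_normal)) (Pi\<^sub>E {0..n} ?B)"
        by (intro arg_cong2[where f = emeasure] refl) (fastforce simp: space_PiM PiE_def Pi_def extensional_def)
    qed (rule measurable_obs)
    also have "\<dots> = (\<Prod>i\<in>{0..n}. emeasure std_normal (?B i))"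
      by (rule N.emeasure_PiM) (use B in auto)
    also have "\<dots> = (\<Prod>i\<in>{0..n}. emeasure (normal (h (real i / real n)) \<sigma>) (A i))"
      by (intro prod.cong refl emeasure_std_normal_affine[OF \<sigma>]) (use A in auto)
    finally show "emeasure (obs_law n \<sigma> h) (Pi\<^sub>E {0..n} A)
        = (\<Prod>i\<in>{0..n}. emeasure (normal (h (real i / real n)) \<sigma>) (A i))" .
  qed simp
qed

text \<open>Completing the square: the squared density with mean \<open>b\<close>, divided by the
  density with mean \<open>a\<close>, is the stated constant times the density with mean
  \<open>2 * b - a\<close>.\<close>

lemma likelihood_ratio_square:
  assumes "\<sigma> > 0"
  shows "(\<integral>\<^sup>+x. (ennreal (normal_density b \<sigma> x / normal_density a \<sigma> x))\<^sup>2 \<partial>normal a \<sigma>)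
    = ennreal (exp (((b - a) / \<sigma>)\<^sup>2))"
proof -
  interpret prob_space "normal (2 * b - a) \<sigma>" by (rule prob_space_normal_density[OF assms])
  have eq: "normal_density a \<sigma> x * (normal_density b \<sigma> x / normal_density a \<sigma> x)\<^sup>2
      = exp (((b - a) / \<sigma>)\<^sup>2) * normal_density (2 * b - a) \<sigma> x" for x
  proof -
    have pos: "normal_density a \<sigma> x > 0" using assms by (rule normal_density_pos)
    have "normal_density b \<sigma> x * normal_density b \<sigma> x
        = exp (((b - a) / \<sigma>)\<^sup>2) * normal_density (2 * b - a) \<sigma> x * normal_density a \<sigma> x"
      using assms by (simp add: normal_density_def exp_add[symmetric] power2_eq_square field_simps)
    then show ?thesis using pos by (simp add: power2_eq_square field_simps)
  qed
  have "(\<integral>\<^sup>+x. (ennreal (normal_density b \<sigma> x / normal_density a \<sigma> x))\<^sup>2 \<partial>normal a \<sigma>)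
      = (\<integral>\<^sup>+x. ennreal (normal_density a \<sigma> x * (normal_density b \<sigma> x / normal_density a \<sigma> x)\<^sup>2) \<partial>lborel)"
    by (subst nn_integral_density) (auto simp: ennreal_power ennreal_mult)
  also have "\<dots> = (\<integral>\<^sup>+x. ennreal (exp (((b - a) / \<sigma>)\<^sup>2)) * ennreal (normal_density (2 * b - a) \<sigma> x) \<partial>lborel)"
    unfolding eq by (simp add: ennreal_mult)
  also have "\<dots> = ennreal (exp (((b - a) / \<sigma>)\<^sup>2)) * emeasure (normal (2 * b - a) \<sigma>) UNIV"
    by (simp add: nn_integral_cmult emeasure_density)
  also have "\<dots> = ennreal (exp (((b - a) / \<sigma>)\<^sup>2))" using emeasure_space_1 by simp
  finally show ?thesis .
qed

definition likelihood_ratio :: "nat \<Rightarrow> real \<Rightarrow> (real \<Rightarrow> real) \<Rightarrow> (real \<Rightarrow> real) \<Rightarrow> (nat \<Rightarrow> real) \<Rightarrow> ennreal" where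
  "likelihood_ratio n \<sigma> f g y = (\<Prod>i\<in>{0..n}.
     ennreal (normal_density (g (real i / real n)) \<sigma> (y i) / normal_density (f (real i / real n)) \<sigma> (y i)))"

lemma likelihood_ratio_measurable:
  "\<sigma> > 0 \<Longrightarrow> likelihood_ratio n \<sigma> f g \<in> borel_measurable (obs_law n \<sigma> h)"
  unfolding obs_law_eq_PiM likelihood_ratio_def by measurable

lemma obs_law_density:
  assumes \<sigma>: "\<sigma> > 0"
  shows "obs_law n \<sigma> g = density (obs_law n \<sigma> f) (likelihood_ratio n \<sigma> f g)"
proof -
  let ?f = "\<lambda>i. normal (f (real i / real n)) \<sigma>" and ?g = "\<lambda>i. normal (g (real i / real n)) \<sigma>"
  let ?r = "\<lambda>i x. ennreal (normal_density (g (real i / real n)) \<sigma> x / normal_density (f (real i / real n)) \<sigma> x)"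
  interpret F: product_sigma_finite ?f by (rule product_normal[OF \<sigma>])
  interpret G: product_sigma_finite ?g by (rule product_normal[OF \<sigma>])
  have "density (Pi\<^sub>M {0..n} ?f) (likelihood_ratio n \<sigma> f g) = Pi\<^sub>M {0..n} ?g"
  proof (rule G.PiM_eqI)
    show "sets (density (Pi\<^sub>M {0..n} ?f) (likelihood_ratio n \<sigma> f g)) = sets (Pi\<^sub>M {0..n} ?g)"
      unfolding sets_density by (intro sets_PiM_cong) auto
    fix A assume "\<And>i. i \<in> {0..n} \<Longrightarrow> A i \<in> sets (?g i)"
    then have A: "A i \<in> sets borel" if "i \<le> n" for i using that by auto
    have AE: "Pi\<^sub>E {0..n} A \<in> sets (Pi\<^sub>M {0..n} ?f)" using A by (intro sets_PiM_I_finite) auto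
    have "emeasure (density (Pi\<^sub>M {0..n} ?f) (likelihood_ratio n \<sigma> f g)) (Pi\<^sub>E {0..n} A)
        = (\<integral>\<^sup>+y. likelihood_ratio n \<sigma> f g y * indicator (Pi\<^sub>E {0..n} A) y \<partial>Pi\<^sub>M {0..n} ?f)"
      using likelihood_ratio_measurable[OF \<sigma>, of n f g f, unfolded obs_law_eq_PiM[OF \<sigma>]] AE
      by (rule emeasure_density)
    also have "\<dots> = (\<integral>\<^sup>+y. (\<Prod>i\<in>{0..n}. ?r i (y i) * indicator (A i) (y i)) \<partial>Pi\<^sub>M {0..n} ?f)"
    proof (rule nn_integral_cong)
      fix y assume "y \<in> space (Pi\<^sub>M {0..n} ?f)"
      then have "y \<in> extensional {0..n}" by (simp add: space_PiM PiE_def)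
      then have "(indicator (Pi\<^sub>E {0..n} A) y :: ennreal) = (\<Prod>i\<in>{0..n}. indicator (A i) (y i))"
        by (auto simp: indicator_def PiE_def Pi_def prod_zero_iff)
      then show "likelihood_ratio n \<sigma> f g y * indicator (Pi\<^sub>E {0..n} A) y
          = (\<Prod>i\<in>{0..n}. ?r i (y i) * indicator (A i) (y i))"
        by (simp add: likelihood_ratio_def prod.distrib)
    qed
    also have "\<dots> = (\<Prod>i\<in>{0..n}. \<integral>\<^sup>+x. ?r i x * indicator (A i) x \<partial>?f i)"
      by (rule F.product_nn_integral_prod) (use A in auto)
    also have "\<dots> = (\<Prod>i\<in>{0..n}. emeasure (?g i) (A i))"
    proof (rule prod.cong[OF refl])
      fix i assume "i \<in> {0..n}"
      then have [measurable]: "A i \<in> sets borel" using A by simp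
      have pos: "normal_density (f (real i / real n)) \<sigma> x > 0" for x using \<sigma> by (rule normal_density_pos)
      have "(\<integral>\<^sup>+x. ?r i x * indicator (A i) x \<partial>?f i)
          = (\<integral>\<^sup>+x. ennreal (normal_density (f (real i / real n)) \<sigma> x) * (?r i x * indicator (A i) x) \<partial>lborel)"
        by (subst nn_integral_density) auto
      also have "\<dots> = (\<integral>\<^sup>+x. ennreal (normal_density (g (real i / real n)) \<sigma> x) * indicator (A i) x \<partial>lborel)"
        using pos by (intro nn_integral_cong)
          (simp add: mult.assoc[symmetric] ennreal_mult[symmetric] less_imp_le order.strict_implies_not_eq[symmetric])
      also have "\<dots> = emeasure (?g i) (A i)" by (simp add: emeasure_density)
      finally show "(\<integral>\<^sup>+x. ?r i x * indicator (A i) x \<partial>?f i) = emeasure (?g i) (A i)" .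
    qed
    finally show "emeasure (density (Pi\<^sub>M {0..n} ?f) (likelihood_ratio n \<sigma> f g)) (Pi\<^sub>E {0..n} A)
        = (\<Prod>i\<in>{0..n}. emeasure (?g i) (A i))" .
  qed simp
  then show ?thesis by (simp add: obs_law_eq_PiM[OF \<sigma>])
qed

lemma nn_integral_likelihood_ratio_square:
  assumes \<sigma>: "\<sigma> > 0"
  shows "(\<integral>\<^sup>+y. (likelihood_ratio n \<sigma> f g y)\<^sup>2 \<partial>obs_law n \<sigma> f)
    = ennreal (exp (\<Sum>i\<le>n. ((g (real i / real n) - f (real i / real n)) / \<sigma>)\<^sup>2))"
proof -
  interpret F: product_sigma_finite "\<lambda>i. normal (f (real i / real n)) \<sigma>" by (rule product_normal[OF \<sigma>])
  have "(\<integral>\<^sup>+y. (likelihood_ratio n \<sigma> f g y)\<^sup>2 \<partial>obs_law n \<sigma> f)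
      = (\<Prod>i\<in>{0..n}. \<integral>\<^sup>+x. (ennreal (normal_density (g (real i / real n)) \<sigma> x /
          normal_density (f (real i / real n)) \<sigma> x))\<^sup>2 \<partial>normal (f (real i / real n)) \<sigma>)"
    unfolding obs_law_eq_PiM[OF \<sigma>] likelihood_ratio_def prod_power_distrib
    by (rule F.product_nn_integral_prod) auto
  also have "\<dots> = (\<Prod>i\<in>{0..n}. ennreal (exp (((g (real i / real n) - f (real i / real n)) / \<sigma>)\<^sup>2)))"
    by (simp add: likelihood_ratio_square[OF \<sigma>])
  finally show ?thesis by (simp add: prod_ennreal exp_sum atMost_atLeast0)
qed

text \<open>With the likelihood ratio \<open>\<Lambda>\<close> and \<open>\<kappa> = 1/10\<close>, the bound follows by integrating
  \<open>\<Lambda> - 1 \<le> \<kappa>/2 + (\<Lambda> - 1)\<^sup>2 / (2\<kappa>)\<close>.\<close>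

lemma model_close:
  assumes \<sigma>: "\<sigma> > 0" and E: "E \<in> sets (model n \<sigma> f)"
    and close: "(\<Sum>i\<le>n. (f (real i / real n) - g (real i / real n))\<^sup>2) \<le> (\<sigma> / 10)\<^sup>2"
  shows "measure (model n \<sigma> g) E \<le> measure (model n \<sigma> f) E + 1 / 5"
proof -
  interpret F: prob_space "model n \<sigma> f" by (rule prob_space_model)
  interpret G: prob_space "model n \<sigma> g" by (rule prob_space_model)
  interpret OF: prob_space "obs_law n \<sigma> f"
    unfolding obs_law_def by (intro prob_space.prob_space_distr prob_space_PiM_std_normal measurable_obs)
  interpret OG: prob_space "obs_law n \<sigma> g"
    unfolding obs_law_def by (intro prob_space.prob_space_distr prob_space_PiM_std_normal measurable_obs)
  interpret X: prob_space "aux_law n" unfolding aux_law_def by (rule prob_space_PiM_std_normal)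
  define l where "l \<omega> = likelihood_ratio n \<sigma> f g (fst \<omega>)" for \<omega> :: outcome
  have lr[measurable]: "likelihood_ratio n \<sigma> f g \<in> borel_measurable (obs_law n \<sigma> f)"
    by (rule likelihood_ratio_measurable[OF \<sigma>])
  have l[measurable]: "l \<in> borel_measurable (model n \<sigma> f)"
    unfolding l_def model_def by measurable
  have dens: "model n \<sigma> g = density (model n \<sigma> f) l"
  proof -
    have "density (obs_law n \<sigma> f) (likelihood_ratio n \<sigma> f g) \<Otimes>\<^sub>M density (aux_law n) (\<lambda>_. 1)
        = density (obs_law n \<sigma> f \<Otimes>\<^sub>M aux_law n) (\<lambda>(x, y). likelihood_ratio n \<sigma> f g x * 1)"
      by (rule pair_measure_density) (auto simp: density_1 intro: X.sigma_finite_measure_axioms)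
    then show ?thesis
      unfolding model_def obs_law_density[OF \<sigma>, of n g f] density_1 l_def by (simp add: case_prod_beta')
  qed
  have fst_int: "(\<integral>\<^sup>+\<omega>. h (fst \<omega>) \<partial>model n \<sigma> f) = (\<integral>\<^sup>+y. h y \<partial>obs_law n \<sigma> f)"
    if "h \<in> borel_measurable (obs_law n \<sigma> f)" for h :: "_ \<Rightarrow> ennreal"
  proof -
    have "(\<integral>\<^sup>+\<omega>. h (fst \<omega>) \<partial>model n \<sigma> f) = (\<integral>\<^sup>+y. \<integral>\<^sup>+z. h y \<partial>aux_law n \<partial>obs_law n \<sigma> f)"
      unfolding model_def using that by (subst X.nn_integral_fst[symmetric]) auto
    then show ?thesis by (simp add: X.emeasure_space_1)
  qed
  have l1: "(\<integral>\<^sup>+\<omega>. l \<omega> \<partial>model n \<sigma> f) = 1"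
  proof -
    have "(\<integral>\<^sup>+\<omega>. l \<omega> \<partial>model n \<sigma> f) = emeasure (density (model n \<sigma> f) l) (space (model n \<sigma> f))"
      by (subst emeasure_density) (auto intro!: nn_integral_cong)
    also have "\<dots> = emeasure (model n \<sigma> g) (space (model n \<sigma> g))"
      unfolding dens by simp
    finally show ?thesis using G.emeasure_space_1 by simp
  qed
  have l2: "(\<integral>\<^sup>+\<omega>. (l \<omega>)\<^sup>2 \<partial>model n \<sigma> f) \<le> ennreal (102 / 100)"
  proof -
    have "(\<integral>\<^sup>+\<omega>. (l \<omega>)\<^sup>2 \<partial>model n \<sigma> f)
        = ennreal (exp (\<Sum>i\<le>n. ((g (real i / real n) - f (real i / real n)) / \<sigma>)\<^sup>2))"
      unfolding l_def by (subst fst_int[of "\<lambda>y. (likelihood_ratio n \<sigma> f g y)\<^sup>2"])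
        (auto simp: nn_integral_likelihood_ratio_square[OF \<sigma>])
    also have "(\<Sum>i\<le>n. ((g (real i / real n) - f (real i / real n)) / \<sigma>)\<^sup>2)
        = (\<Sum>i\<le>n. (f (real i / real n) - g (real i / real n))\<^sup>2) / \<sigma>\<^sup>2"
      by (simp add: power_divide sum_divide_distrib power2_commute)
    also have "ennreal (exp \<dots>) \<le> ennreal (exp (1 / 100))"
      using close \<sigma> by (intro ennreal_leI) (simp add: field_simps power_divide)
    also have "\<dots> \<le> ennreal (102 / 100)"
      using exp_bound[of "1 / 100"] by (intro ennreal_leI) (simp add: power2_eq_square)
    finally show ?thesis .
  qed
  \<comment> \<open>This is (\<Lambda> - 1) 1_E \<le> 1/20 + 5 (\<Lambda> - 1)^2, expanded and
    rearranged so that nothing is subtracted in \<open>ennreal\<close>. With mean 1 and second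
    moment at most 1.02 of \<Lambda>, integration gives an excess of 5.05 + 5.1 - 10 = 0.15.\<close>
  have pt: "l \<omega> * indicator E \<omega> + 10 * l \<omega> \<le> indicator E \<omega> + (ennreal (505 / 100) + 5 * (l \<omega>)\<^sup>2)" for \<omega>
  proof (cases "l \<omega>" rule: ennreal_cases)
    case (real x)
    have ineq: "11 * x \<le> 605 / 100 + 5 * x\<^sup>2" "10 * x \<le> 505 / 100 + 5 * x\<^sup>2"
      using zero_le_power2[of "x - 11 / 10"] zero_le_power2[of "x - 1"]
      by (simp_all add: power2_eq_square algebra_simps)
    show ?thesis
    proof (cases "\<omega> \<in> E")
      case True
      have "l \<omega> * indicator E \<omega> + 10 * l \<omega> = ennreal x + ennreal (10 * x)"
        using True real by (simp add: ennreal_mult)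
      also have "\<dots> = ennreal (x + 10 * x)" using real by (intro ennreal_plus[symmetric]) auto
      also have "x + 10 * x = 11 * x" by simp
      also have "\<dots> \<le> ennreal (605 / 100 + 5 * x\<^sup>2)" using ineq by (intro ennreal_leI)
      also have "\<dots> = indicator E \<omega> + (ennreal (505 / 100) + 5 * (l \<omega>)\<^sup>2)"
      proof -
        have "605 / 100 + 5 * x\<^sup>2 = 1 + (505 / 100 + 5 * x\<^sup>2)" by simp
        then have "ennreal (605 / 100 + 5 * x\<^sup>2) = ennreal (1 + (505 / 100 + 5 * x\<^sup>2))" by simp
        also have "\<dots> = ennreal 1 + ennreal (505 / 100 + 5 * x\<^sup>2)" by (rule ennreal_plus) auto
        also have "ennreal (505 / 100 + 5 * x\<^sup>2) = ennreal (505 / 100) + ennreal (5 * x\<^sup>2)"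
          by (rule ennreal_plus) auto
        finally show ?thesis using True real by (simp add: ennreal_mult ennreal_power)
      qed
      finally show ?thesis .
    next
      case False
      have "l \<omega> * indicator E \<omega> + 10 * l \<omega> = ennreal (10 * x)"
        using False real by (simp add: ennreal_mult)
      also have "\<dots> \<le> ennreal (505 / 100 + 5 * x\<^sup>2)" using ineq by (intro ennreal_leI)
      also have "\<dots> = indicator E \<omega> + (ennreal (505 / 100) + 5 * (l \<omega>)\<^sup>2)"
        using False real by (simp add: ennreal_plus ennreal_mult ennreal_power)
      finally show ?thesis .
    qed
  qed (auto simp: power2_eq_square ennreal_mult_top)
  have "emeasure (model n \<sigma> g) E + 10 = (\<integral>\<^sup>+\<omega>. l \<omega> * indicator E \<omega> + 10 * l \<omega> \<partial>model n \<sigma> f)"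
    using E l1 by (subst nn_integral_add) (auto simp: dens emeasure_density nn_integral_cmult)
  also have "\<dots> \<le> (\<integral>\<^sup>+\<omega>. indicator E \<omega> + (ennreal (505 / 100) + 5 * (l \<omega>)\<^sup>2) \<partial>model n \<sigma> f)"
    by (intro nn_integral_mono pt)
  also have "\<dots> = emeasure (model n \<sigma> f) E + (ennreal (505 / 100) + 5 * (\<integral>\<^sup>+\<omega>. (l \<omega>)\<^sup>2 \<partial>model n \<sigma> f))"
    using E by (simp add: nn_integral_add nn_integral_cmult F.emeasure_space_1)
  also have "\<dots> \<le> emeasure (model n \<sigma> f) E + (ennreal (505 / 100) + 5 * ennreal (102 / 100))"
    using l2 by (intro add_left_mono mult_left_mono) auto
  also have "\<dots> = ennreal (measure (model n \<sigma> f) E + (505 / 100 + 5 * (102 / 100)))"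
    by (simp add: F.emeasure_eq_measure ennreal_mult[symmetric] ennreal_plus[symmetric] ennreal_numeral[symmetric]
      del: ennreal_plus ennreal_numeral)
  finally have "ennreal (measure (model n \<sigma> g) E + 10) \<le> ennreal (measure (model n \<sigma> f) E + (505 / 100 + 5 * (102 / 100)))"
    by (simp add: G.emeasure_eq_measure ennreal_plus)
  then have "measure (model n \<sigma> g) E + 10 \<le> measure (model n \<sigma> f) E + (505 / 100 + 5 * (102 / 100))"
    by (subst (asm) ennreal_le_iff) auto
  then show ?thesis by simp
qed

text \<open>Under \<open>f\<close> the interval covers the minimizer of \<open>f\<close> with
  probability at least 1 - \<alpha> and, by \<open>model_close\<close>, that of \<open>g\<close>
  with probability at least 4/5 - \<alpha>. Both happen with probability at least 4/5 - 2 \<alpha>,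
  which is at least 1/5 for \<alpha> < 0.3, and then the interval is at least as long as the
  distance of the minimizers.\<close>

lemma benchmark_ge:
  assumes \<sigma>: "\<sigma> > 0" and \<alpha>: "0 < \<alpha>" "\<alpha> < 0.3" and fg: "f \<in> convex_class" "g \<in> convex_class"
    and close: "(\<Sum>i\<le>n. (f (real i / real n) - g (real i / real n))\<^sup>2) \<le> (\<sigma> / 10)\<^sup>2"
  shows "ennreal (\<bar>minimizer f - minimizer g\<bar> / 5) \<le> benchmark n \<sigma> \<alpha> f"
  unfolding benchmark_def
proof (rule SUP_upper2[OF fg(2)], rule INF_greatest)
  fix CI assume CI: "CI \<in> conf_intervals n \<sigma> \<alpha> {f, g}"
  interpret F: prob_space "model n \<sigma> f" by (rule prob_space_model)
  let ?E = "\<lambda>h. {\<omega> \<in> space (model n \<sigma> f). minimizer h \<in> {fst (CI \<omega>)..snd (CI \<omega>)}}"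
  have sp: "space (model n \<sigma> g) = space (model n \<sigma> f)"
    by (rule sets_eq_imp_space_eq) (simp add: sets_model)
  have CIm: "CI \<in> borel_measurable (model n \<sigma> f)" using CI by (simp add: conf_intervals_def)
  then have [measurable]: "(\<lambda>\<omega>. fst (CI \<omega>)) \<in> borel_measurable (model n \<sigma> f)"
    "(\<lambda>\<omega>. snd (CI \<omega>)) \<in> borel_measurable (model n \<sigma> f)"
    unfolding borel_prod[symmetric] by measurable
  have E: "?E h \<in> sets (model n \<sigma> f)" for h by simp
  have f: "measure (model n \<sigma> f) (?E f) \<ge> 1 - \<alpha>" and "measure (model n \<sigma> g) (?E g) \<ge> 1 - \<alpha>"
    using CI sp by (auto simp: conf_intervals_def)
  then have g: "measure (model n \<sigma> f) (?E g) \<ge> 8 / 10 - \<alpha>"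
    using model_close[OF \<sigma> E close, of g] by simp
  have "measure (model n \<sigma> f) (?E f \<union> ?E g) \<le> 1" by (rule F.prob_le_1)
  then have fg: "1 / 5 \<le> measure (model n \<sigma> f) (?E f \<inter> ?E g)"
  proof -
    have "measure (model n \<sigma> f) (?E f \<union> ?E g) = measure (model n \<sigma> f) (?E f)
        + measure (model n \<sigma> f) (?E g) - measure (model n \<sigma> f) (?E f \<inter> ?E g)"
      by (rule measure_Un3) (simp_all only: F.fmeasurable_eq_sets E)
    moreover have "\<alpha> < 3 / 10" using \<alpha> by simp
    ultimately show ?thesis using f g \<open>measure (model n \<sigma> f) (?E f \<union> ?E g) \<le> 1\<close> by linarith
  qed
  let ?d = "\<bar>minimizer f - minimizer g\<bar>"
  have "ennreal (?d / 5) = ennreal ?d * ennreal (1 / 5)" by (subst ennreal_mult[symmetric]) auto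
  also have "\<dots> \<le> ennreal ?d * emeasure (model n \<sigma> f) (?E f \<inter> ?E g)"
    using fg by (intro mult_left_mono) (auto simp: F.emeasure_eq_measure ennreal_leI)
  also have "\<dots> = (\<integral>\<^sup>+\<omega>. ennreal ?d * indicator (?E f \<inter> ?E g) \<omega> \<partial>model n \<sigma> f)"
    using E by (subst nn_integral_cmult_indicator) auto
  also have "\<dots> \<le> expected_length n \<sigma> f CI"
    unfolding expected_length_def
    by (intro nn_integral_mono) (auto simp: indicator_def intro!: ennreal_leI)
  finally show "ennreal (?d / 5) \<le> expected_length n \<sigma> f CI" .
qed

lemma radius_bound_benchmark:
  assumes "\<sigma> > 0" "0 < \<alpha>" "\<alpha> < 0.3" "f \<in> convex_class"
    and "benchmark n \<sigma> \<alpha> f \<le> ennreal b" "0 \<le> b" "5 * b \<le> R"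
  shows "radius_bound n \<sigma> f R"
  unfolding radius_bound_def
proof (intro ballI impI)
  fix g assume "g \<in> convex_class" "(\<Sum>i\<le>n. (f (real i / real n) - g (real i / real n))\<^sup>2) \<le> (\<sigma> / 10)\<^sup>2"
  then have "ennreal (\<bar>minimizer f - minimizer g\<bar> / 5) \<le> ennreal b"
    using benchmark_ge[OF assms(1-4)] assms(5) by (meson order_trans)
  then show "\<bar>minimizer f - minimizer g\<bar> \<le> R" using assms by (subst (asm) ennreal_le_iff) auto
qed

section \<open>Blocks and localization\<close>

lemma max_level_bounds: "2 ^ max_level n \<le> n + 1" "n + 1 < 2 ^ Suc (max_level n)"
proof -
  let ?l = "log 2 (real n + 1)"
  have l: "0 \<le> ?l" by simp
  have J: "real (max_level n) \<le> ?l" "?l < real (max_level n) + 1"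
    unfolding max_level_def using l by linarith+
  have "2 powr real (max_level n) \<le> real n + 1" using J(1) by (subst (asm) le_log_iff) auto
  then have "real (2 ^ max_level n) \<le> real (n + 1)" by (simp add: powr_realpow)
  then show "2 ^ max_level n \<le> n + 1" by (simp only: of_nat_le_iff)
  have "real n + 1 < 2 powr (real (Suc (max_level n)))" using J(2) by (subst (asm) log_less_iff) (auto simp: add.commute)
  then have "real (n + 1) < real (2 ^ Suc (max_level n))" by (subst (asm) powr_realpow) auto
  then show "n + 1 < 2 ^ Suc (max_level n)" by (simp only: of_nat_less_iff)
qed

abbreviation width :: "nat \<Rightarrow> nat \<Rightarrow> int" where
  "width n j \<equiv> 2 ^ (max_level n - j)"

lemma width_Suc: "j < max_level n \<Longrightarrow> width n j = 2 * width n (Suc j)"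
  by (simp add: Suc_diff_Suc flip: power_Suc)

lemma block_sum_finite:
  assumes "1 \<le> i" "i * width n j \<le> int n + 1"
  shows "block_sum n u j i = ereal (\<Sum>k\<in>{(i - 1) * width n j..i * width n j - 1}. u (nat k))"
proof -
  have "0 \<le> k \<and> k \<le> int n" if "k \<in> {(i - 1) * width n j..i * width n j - 1}" for k
  proof -
    have "0 \<le> (i - 1) * width n j" using assms by simp
    then show ?thesis using that assms by (simp only: atLeastAtMost_iff) linarith
  qed
  then show ?thesis unfolding block_sum_def by (simp add: extend_def)
qed

lemma block_sum_infinite:
  assumes "\<not> (1 \<le> i \<and> i * width n j \<le> int n + 1)"
  shows "block_sum n u j i = \<infinity>"
proof -
  let ?w = "width n j"
  have w: "?w > 0" by simp
  have "(i - 1) * ?w \<in> {(i - 1) * ?w..i * ?w - 1}" "i * ?w - 1 \<in> {(i - 1) * ?w..i * ?w - 1}"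
    using w by (auto simp: left_diff_distrib)
  moreover have "(i - 1) * ?w < 0 \<or> i * ?w - 1 > int n"
    using assms w by (auto simp: mult_less_0_iff)
  ultimately have "\<exists>k\<in>{(i - 1) * ?w..i * ?w - 1}. extend n u k = \<infinity>"
    unfolding extend_def by (metis not_le)
  then show ?thesis unfolding block_sum_def by (subst sum_Pinfty) auto
qed


definition candidates :: "nat \<Rightarrow> nat \<Rightarrow> int \<Rightarrow> int set" where
  "candidates n j i =
     {max (2 * i - 2) 1..min (2 * i + 1) \<lfloor>(real n + 1) / 2 ^ (max_level n - Suc j)\<rfloor>}"

text \<open>Localization as a function of one real vector, so that it can be evaluated on the noise
  of the localization sample alone and separated from the other samples by independence.\<close>

primrec loc_of :: "nat \<Rightarrow> (nat \<Rightarrow> real) \<Rightarrow> nat \<Rightarrow> int" where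
  "loc_of n u 0 = 1"
| "loc_of n u (Suc j) = arg_min_on (block_sum n u (Suc j)) (candidates n j (loc_of n u j))"

lemma loc_index_eq: "loc_index n \<sigma> \<omega> j = loc_of n (split_l \<sigma> \<omega>) j"
  by (induction j) (simp_all add: candidates_def)

lemma candidates_iff:
  "k \<in> candidates n j i \<longleftrightarrow> 2 * i - 2 \<le> k \<and> 1 \<le> k \<and> k \<le> 2 * i + 1 \<and> k * width n (Suc j) \<le> int n + 1"
proof -
  let ?w = "2 ^ (max_level n - Suc j) :: real"
  have "k \<le> \<lfloor>(real n + 1) / ?w\<rfloor> \<longleftrightarrow> real_of_int k \<le> (real n + 1) / ?w" by (simp add: le_floor_iff)
  also have "\<dots> \<longleftrightarrow> real_of_int k * ?w \<le> real n + 1" by (simp add: field_simps)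
  also have "\<dots> \<longleftrightarrow> real_of_int (k * width n (Suc j)) \<le> real_of_int (int n + 1)" by simp
  also have "\<dots> \<longleftrightarrow> k * width n (Suc j) \<le> int n + 1" by (simp only: of_int_le_iff)
  finally show ?thesis by (auto simp: candidates_def)
qed

lemma candidates_nonempty:
  assumes "j < max_level n" "1 \<le> i" "i * width n j \<le> int n + 1"
  shows "2 * i - 1 \<in> candidates n j i"
proof -
  have "(2 * i - 1) * width n (Suc j) \<le> 2 * i * width n (Suc j)" by simp
  also have "\<dots> \<le> int n + 1" using assms width_Suc[OF assms(1)] by simp
  finally show ?thesis using assms by (simp add: candidates_iff)
qed

lemma loc_of_range:
  "j \<le> max_level n \<Longrightarrow> 1 \<le> loc_of n u j \<and> loc_of n u j * width n j \<le> int n + 1"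
proof (induction j)
  case 0
  have "int (2 ^ max_level n) \<le> int (n + 1)" using max_level_bounds(1)[of n] by (simp only: of_nat_le_iff)
  then show ?case by simp
next
  case (Suc j)
  then have "candidates n j (loc_of n u j) \<noteq> {}" using candidates_nonempty[of j n "loc_of n u j"] by auto
  moreover have "finite (candidates n j (loc_of n u j))" by (simp add: candidates_def)
  ultimately have "loc_of n u (Suc j) \<in> candidates n j (loc_of n u j)"
    by (simp add: arg_min_if_finite(1))
  then show ?case by (simp add: candidates_iff)
qed

lemma loc_of_step:
  assumes "j < max_level n"
  shows "loc_of n u (Suc j) \<in> candidates n j (loc_of n u j)"
    and "k \<in> candidates n j (loc_of n u j) \<Longrightarrow> block_sum n u (Suc j) (loc_of n u (Suc j)) \<le> block_sum n u (Suc j) k"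
proof -
  have ne: "candidates n j (loc_of n u j) \<noteq> {}"
    using candidates_nonempty[of j n "loc_of n u j"] loc_of_range[of j n u] assms by auto
  have fin: "finite (candidates n j (loc_of n u j))" by (simp add: candidates_def)
  show "loc_of n u (Suc j) \<in> candidates n j (loc_of n u j)"
    using arg_min_if_finite(1)[OF fin ne] by simp
  show "block_sum n u (Suc j) (loc_of n u (Suc j)) \<le> block_sum n u (Suc j) k"
    if "k \<in> candidates n j (loc_of n u j)"
    using arg_min_if_finite(2)[OF fin ne, of "block_sum n u (Suc j)"] that by (auto simp: not_less)
qed

definition level_stops :: "nat \<Rightarrow> real \<Rightarrow> outcome \<Rightarrow> nat \<Rightarrow> bool" where
  "level_stops n \<sigma> \<omega> j \<longleftrightarrow> stop_stat n \<sigma> \<omega> j \<le> ereal (2 * sigma_level n \<sigma> j)"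

lemma check_j_stopped:
  assumes "check_j n \<sigma> \<omega> < \<infinity>"
  shows "hat_j n \<sigma> \<omega> \<le> max_level n" "level_stops n \<sigma> \<omega> (hat_j n \<sigma> \<omega>)"
    "\<And>j. j < hat_j n \<sigma> \<omega> \<Longrightarrow> \<not> level_stops n \<sigma> \<omega> j"
proof -
  let ?A = "enat ` {j. j \<le> max_level n \<and> level_stops n \<sigma> \<omega> j}"
  have c: "check_j n \<sigma> \<omega> = Inf ?A" by (simp add: check_j_def level_stops_def)
  have "?A \<noteq> {}"
  proof
    assume "?A = {}"
    then have "check_j n \<sigma> \<omega> = \<infinity>" unfolding c by (simp only: Inf_empty top_enat_def)
    then show False using assms by simp
  qed
  then obtain x where "x \<in> ?A" by blast
  then have "(LEAST x. x \<in> ?A) \<in> ?A" by (rule LeastI[of "\<lambda>x. x \<in> ?A"])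
  moreover have "Inf ?A = (LEAST x. x \<in> ?A)" using \<open>?A \<noteq> {}\<close> unfolding Inf_enat_def by (rule if_not_P)
  ultimately have "Inf ?A \<in> ?A" by simp
  then obtain j where j: "check_j n \<sigma> \<omega> = enat j" "j \<le> max_level n" "level_stops n \<sigma> \<omega> j"
    unfolding c by auto
  then have h: "hat_j n \<sigma> \<omega> = j" by (simp add: hat_j_def min_def)
  show "hat_j n \<sigma> \<omega> \<le> max_level n" "level_stops n \<sigma> \<omega> (hat_j n \<sigma> \<omega>)" using j h by auto
  fix i assume i: "i < hat_j n \<sigma> \<omega>"
  show "\<not> level_stops n \<sigma> \<omega> i"
  proof
    assume "level_stops n \<sigma> \<omega> i"
    then have "enat i \<in> ?A" using i h j by auto
    then have "Inf ?A \<le> enat i" by (rule Inf_lower)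
    then show False using i j h unfolding c[symmetric] by simp
  qed
qed

lemma check_j_unstopped:
  assumes "\<not> check_j n \<sigma> \<omega> < \<infinity>"
  shows "hat_j n \<sigma> \<omega> = max_level n" "\<And>j. j \<le> max_level n \<Longrightarrow> \<not> level_stops n \<sigma> \<omega> j"
proof -
  let ?A = "enat ` {j. j \<le> max_level n \<and> level_stops n \<sigma> \<omega> j}"
  have c: "check_j n \<sigma> \<omega> = Inf ?A" by (simp add: check_j_def level_stops_def)
  have i: "check_j n \<sigma> \<omega> = \<infinity>" using assms by simp
  then show "hat_j n \<sigma> \<omega> = max_level n" by (simp add: hat_j_def)
  fix j assume "j \<le> max_level n"
  show "\<not> level_stops n \<sigma> \<omega> j"
  proof
    assume "level_stops n \<sigma> \<omega> j"
    then have "Inf ?A \<le> enat j" using \<open>j \<le> max_level n\<close> by (intro Inf_lower) auto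
    then show False using i c by auto
  qed
qed

text \<open>A block outside the sample makes its side of the statistic infinite, even if the
  subtracted block is outside as well, since \<infinity> - \<infinity> = \<infinity> in
  \<open>ereal\<close>. Such a side never causes a stop, and on the others the sums are
  real.\<close>

lemma level_stops_iff:
  fixes \<sigma> :: real and \<omega> :: outcome
  assumes j: "j \<le> max_level n"
  defines "i \<equiv> loc_of n (split_l \<sigma> \<omega>) j" and "B \<equiv> \<lambda>i. \<Sum>k\<in>{(i - 1) * width n j..i * width n j - 1}. split_s \<sigma> \<omega> (nat k)"
  shows "level_stops n \<sigma> \<omega> j \<longleftrightarrow>
    ((i + 6) * width n j \<le> int n + 1 \<and> B (i + 6) - B (i + 5) \<le> 2 * sigma_level n \<sigma> j)
    \<or> (7 \<le> i \<and> B (i - 6) - B (i - 5) \<le> 2 * sigma_level n \<sigma> j)"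
proof -
  let ?Y = "block_sum n (split_s \<sigma> \<omega>) j"
  have i: "1 \<le> i" "i * width n j \<le> int n + 1" using loc_of_range[OF j] unfolding i_def by auto
  have right: "?Y (i + 6) - ?Y (i + 5) \<le> ereal (2 * sigma_level n \<sigma> j) \<longleftrightarrow>
    (i + 6) * width n j \<le> int n + 1 \<and> B (i + 6) - B (i + 5) \<le> 2 * sigma_level n \<sigma> j"
  proof (cases "(i + 6) * width n j \<le> int n + 1")
    case True
    have "(i + 5) * width n j \<le> (i + 6) * width n j" by (intro mult_right_mono) auto
    then have "(i + 5) * width n j \<le> int n + 1" using True by linarith
    then show ?thesis
      using True i block_sum_finite[of "i + 6" n j] block_sum_finite[of "i + 5" n j] by (simp add: B_def)
  next
    case False
    then show ?thesis using block_sum_infinite[of "i + 6" n j] by simp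
  qed
  have left: "?Y (i - 6) - ?Y (i - 5) \<le> ereal (2 * sigma_level n \<sigma> j) \<longleftrightarrow>
    7 \<le> i \<and> B (i - 6) - B (i - 5) \<le> 2 * sigma_level n \<sigma> j"
  proof (cases "7 \<le> i")
    case True
    have "(i - 5) * width n j \<le> i * width n j" by (intro mult_right_mono) auto
    moreover have "(i - 6) * width n j \<le> i * width n j" by (intro mult_right_mono) auto
    ultimately have "(i - 5) * width n j \<le> int n + 1" "(i - 6) * width n j \<le> int n + 1" using i by linarith+
    then show ?thesis
      using True i block_sum_finite[of "i - 6" n j] block_sum_finite[of "i - 5" n j] by (simp add: B_def)
  next
    case False
    then show ?thesis using block_sum_infinite[of "i - 6" n j] by simp
  qed
  show ?thesis unfolding level_stops_def stop_stat_def loc_index_eq i_def[symmetric] Let_def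
    by (simp only: min_le_iff_disj left right)
qed


section \<open>Measurability\<close>

text \<open>The random subset takes finitely many values, so any function \<open>F\<close> of it is
  measurable. This serves the first stopping level, the extreme indices of the refinement and the
  choice hidden in \<open>arg_min_on\<close>.\<close>

lemma measurable_finite_choice:
  assumes "finite A" "\<And>k. k \<in> A \<Longrightarrow> Measurable.pred M (P k)"
  shows "(\<lambda>\<omega>. F {k \<in> A. P k \<omega>}) \<in> measurable M (count_space UNIV)"
proof -
  have "(\<lambda>\<omega>. {k \<in> A. P k \<omega>}) \<in> measurable M (count_space (Pow A))"
  proof (subst measurable_count_space_eq2)
    show "finite (Pow A)" using assms by simp
    show "(\<lambda>\<omega>. {k \<in> A. P k \<omega>}) \<in> space M \<rightarrow> Pow A \<and>
      (\<forall>T\<in>Pow A. (\<lambda>\<omega>. {k \<in> A. P k \<omega>}) -` {T} \<inter> space M \<in> sets M)"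
    proof (intro conjI ballI)
      fix T assume T: "T \<in> Pow A"
      have "Measurable.pred M (\<lambda>\<omega>. \<forall>k\<in>A. (k \<in> T) = P k \<omega>)"
        using assms by (intro pred_intros_finite) auto
      then have "{\<omega> \<in> space M. \<forall>k\<in>A. (k \<in> T) = P k \<omega>} \<in> sets M" by (simp add: pred_def)
      also have "{\<omega> \<in> space M. \<forall>k\<in>A. (k \<in> T) = P k \<omega>} = (\<lambda>\<omega>. {k \<in> A. P k \<omega>}) -` {T} \<inter> space M"
        using T by auto
      finally show "(\<lambda>\<omega>. {k \<in> A. P k \<omega>}) -` {T} \<inter> space M \<in> sets M" .
    qed auto
  qed
  then show ?thesis by (rule measurable_compose) simp
qed

lemma block_sum_measurable:
  assumes "\<And>i. i \<le> n \<Longrightarrow> (\<lambda>\<omega>. u \<omega> i) \<in> borel_measurable M"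
  shows "(\<lambda>\<omega>. block_sum n (u \<omega>) j i) \<in> borel_measurable M"
proof (cases "1 \<le> i \<and> i * width n j \<le> int n + 1")
  case True
  have "nat k \<le> n" if "k \<in> {(i - 1) * width n j..i * width n j - 1}" for k
    using that True by auto
  then show ?thesis
    using True assms by (simp add: block_sum_finite)
next
  case False
  then show ?thesis by (simp add: block_sum_infinite)
qed

lemma arg_min_on_eq_Eps: "arg_min_on f S = (SOME x. x \<in> {k \<in> S. \<forall>y\<in>S. \<not> f y < f k})"
  unfolding arg_min_on_def arg_min_def is_arg_min_def by (intro arg_cong[where f = Eps]) auto

text \<open>The index at the previous level is an integer. With its value frozen, only finitely many
  block sums are compared, and \<open>measurable_compose_countable\<close> puts the random index
  back.\<close>

lemma loc_of_measurable:
  assumes "\<And>i. i \<le> n \<Longrightarrow> (\<lambda>\<omega>. u \<omega> i) \<in> borel_measurable M"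
  shows "(\<lambda>\<omega>. loc_of n (u \<omega>) j) \<in> measurable M (count_space UNIV)"
proof (induction j)
  case (Suc j)
  have "(\<lambda>\<omega>. arg_min_on (block_sum n (u \<omega>) (Suc j)) (candidates n j i)) \<in> measurable M (count_space UNIV)" for i
    unfolding arg_min_on_eq_Eps
  proof (rule measurable_finite_choice[where F = "\<lambda>S. SOME x. x \<in> S"])
    show fin: "finite (candidates n j i)" by (simp add: candidates_def)
    fix k
    note [measurable] = block_sum_measurable[OF assms]
    have "Measurable.pred M (\<lambda>\<omega>. \<not> block_sum n (u \<omega>) (Suc j) y < block_sum n (u \<omega>) (Suc j) k)" for y
      by measurable
    then show "Measurable.pred M (\<lambda>\<omega>. \<forall>y\<in>candidates n j i. \<not> block_sum n (u \<omega>) (Suc j) y < block_sum n (u \<omega>) (Suc j) k)"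
      using fin by (intro pred_intros_finite) auto
  qed
  then show ?case unfolding loc_of.simps
    by (rule measurable_compose_countable[OF _ Suc])
qed simp

lemma split_measurable:
  assumes "\<sigma> > 0" "i \<le> n"
  shows "(\<lambda>\<omega>. split_l \<sigma> \<omega> i) \<in> borel_measurable (model n \<sigma> f)"
    "(\<lambda>\<omega>. split_s \<sigma> \<omega> i) \<in> borel_measurable (model n \<sigma> f)"
    "(\<lambda>\<omega>. split_e \<sigma> \<omega> i + sqrt 3 * \<sigma> * snd \<omega> (3, i)) \<in> borel_measurable (model n \<sigma> f)"
    "(\<lambda>\<omega>. split_e \<sigma> \<omega> i - sqrt 3 * \<sigma> * snd \<omega> (3, i)) \<in> borel_measurable (model n \<sigma> f)"
  unfolding split_l_noise[OF assms(1), of _ i f n] split_s_noise[OF assms(1), of _ i f n]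
    p_noise[OF assms(1), of _ i f n] q_noise[OF assms(1), of _ i f n]
  by (intro borel_measurable_add borel_measurable_times borel_measurable_const noise_measurable;
      use assms in \<open>simp add: idx_def\<close>)+

lemma level_stops_measurable:
  assumes \<sigma>: "\<sigma> > 0"
  shows "Measurable.pred (model n \<sigma> f) (\<lambda>\<omega>. level_stops n \<sigma> \<omega> j)"
proof -
  note [measurable] = block_sum_measurable[of n "split_s \<sigma>" "model n \<sigma> f", OF split_measurable(2)[OF \<sigma>]]
  have "Measurable.pred (model n \<sigma> f) (\<lambda>\<omega>. let Y = block_sum n (split_s \<sigma> \<omega>) j in
      min (Y (i + 6) - Y (i + 5)) (Y (i - 6) - Y (i - 5)) \<le> ereal (2 * sigma_level n \<sigma> j))" for i
    unfolding Let_def by measurable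
  then have "(\<lambda>\<omega>. let Y = block_sum n (split_s \<sigma> \<omega>) j; i = loc_of n (split_l \<sigma> \<omega>) j in
      min (Y (i + 6) - Y (i + 5)) (Y (i - 6) - Y (i - 5)) \<le> ereal (2 * sigma_level n \<sigma> j))
      \<in> measurable (model n \<sigma> f) (count_space UNIV)"
    unfolding Let_def
    by (rule measurable_compose_countable[OF _ loc_of_measurable[OF split_measurable(1)[OF \<sigma>]]])
  then show ?thesis by (simp add: level_stops_def stop_stat_def loc_index_eq Let_def)
qed

section \<open>The refined interval with window, indices and sample as separate arguments\<close>

definition left_index :: "int \<Rightarrow> int \<Rightarrow> (nat \<Rightarrow> real) \<Rightarrow> real \<Rightarrow> int" where
  "left_index L U p t = Min ({U} \<union> {k \<in> {L..U - 1}. p (nat k) - p (nat (k + 1)) \<le> t})"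

definition right_index :: "int \<Rightarrow> int \<Rightarrow> (nat \<Rightarrow> real) \<Rightarrow> real \<Rightarrow> int" where
  "right_index L U p t = Max ({L - 1} \<union> {k \<in> {L..U - 1}. p (nat k) - p (nat (k + 1)) \<ge> - t})"

definition window_radius :: "real \<Rightarrow> int" where
  "window_radius \<alpha> = 12 * 2 ^ nat (K_const (\<alpha> / 2))"

definition window_lower :: "real \<Rightarrow> int \<Rightarrow> int" where
  "window_lower \<alpha> i = max 1 (i - window_radius \<alpha>) - 1"

definition window_upper :: "nat \<Rightarrow> real \<Rightarrow> int \<Rightarrow> int" where
  "window_upper n \<alpha> i = min (int n + 1) (i + window_radius \<alpha>) - 1"

context
  fixes n :: nat and c :: real and L U il ir :: int and q :: "int \<Rightarrow> ereal"
begin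

text \<open>The data enter through the integers and the extended vector \<open>q\<close> only, so
  coverage, length and measurability can be treated for fixed integers.\<close>

definition fine_endpoints :: "real \<times> real" where
  "fine_endpoints =
     (let N = real n; ilo = max (il - 1) L; ihi = min (ir + 2) U
      in if ir = L - 1 then
           (if ir = -1 \<and> q 2 - q 1 + c > 0
            then (0, min (max (ratio (q 0 - q 1 + c) (N * (q 2 - q 1 + c)) + 1 / N) 0) (1 / N))
            else (0, 0))
         else if il = U then
           (if il = int n \<and> q (int n - 2) - q (int n - 1) + c > 0
            then (min (max (- ratio (q (int n) - q (int n - 1) + c)
                                    (N * (q (int n - 2) - q (int n - 1) + c)) + (N - 1) / N)
                           ((N - 1) / N)) 1, 1)
            else (of_int U / N, of_int U / N))
         else if ihi - ilo \<ge> 3 \<or> (ihi - int n) * ilo = 0 then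
           (of_int ilo / N, of_int ihi / N)
         else if q (ihi + 1) - q ihi \<le> - ereal c \<or> q (ilo - 1) - q ilo \<le> - ereal c then
           (of_int (ihi + ilo) / (2 * N), of_int (ihi + ilo) / (2 * N))
         else
           (min (max (- ratio (q (ilo + 1) - q ilo + c) (N * (q (ilo - 1) - q ilo + c))
                      + of_int ilo / N) (of_int ilo / N)) (of_int (ilo + 1) / N),
            min (max (ratio (q (ihi - 1) - q ihi + c) (N * (q (ihi + 1) - q ihi + c))
                      + of_int ihi / N) (of_int (ihi - 1) / N)) (of_int ihi / N)))"

end

definition p_sample :: "real \<Rightarrow> outcome \<Rightarrow> nat \<Rightarrow> real" where
  "p_sample \<sigma> \<omega> i = split_e \<sigma> \<omega> i + sqrt 3 * \<sigma> * snd \<omega> (3, i)"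

definition q_sample :: "real \<Rightarrow> outcome \<Rightarrow> nat \<Rightarrow> real" where
  "q_sample \<sigma> \<omega> i = split_e \<sigma> \<omega> i - sqrt 3 * \<sigma> * snd \<omega> (3, i)"

definition p_threshold :: "real \<Rightarrow> real \<Rightarrow> real" where
  "p_threshold \<sigma> \<alpha> = 2 * sqrt 3 * \<sigma> * z_quantile (\<alpha> / 8)"

definition q_slack :: "real \<Rightarrow> real \<Rightarrow> real" where
  "q_slack \<sigma> \<alpha> = 2 * sqrt 6 * \<sigma> * z_quantile (\<alpha> / 24)"

definition endpoints_at :: "nat \<Rightarrow> real \<Rightarrow> real \<Rightarrow> outcome \<Rightarrow> int \<Rightarrow> real \<times> real" where
  "endpoints_at n \<sigma> \<alpha> \<omega> i = fine_endpoints n (q_slack \<sigma> \<alpha>) (window_lower \<alpha> i) (window_upper n \<alpha> i)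
     (left_index (window_lower \<alpha> i) (window_upper n \<alpha> i) (p_sample \<sigma> \<omega>) (p_threshold \<sigma> \<alpha>))
     (right_index (window_lower \<alpha> i) (window_upper n \<alpha> i) (p_sample \<sigma> \<omega>) (p_threshold \<sigma> \<alpha>))
     (extend n (q_sample \<sigma> \<omega>))"

lemma endpoints_unstopped_eq:
  "endpoints_unstopped n \<sigma> \<alpha> \<omega> = endpoints_at n \<sigma> \<alpha> \<omega> (loc_of n (split_l \<sigma> \<omega>) (hat_j n \<sigma> \<omega>))"
  unfolding endpoints_unstopped_def endpoints_at_def fine_endpoints_def left_index_def right_index_def
    window_lower_def window_upper_def window_radius_def p_threshold_def q_slack_def loc_index_eq Let_def
    p_sample_def[abs_def] q_sample_def[abs_def] ..

definition stopped_at :: "nat \<Rightarrow> real \<Rightarrow> nat \<Rightarrow> int \<Rightarrow> real \<times> real" where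
  "stopped_at n \<alpha> j i = (let w = 2 ^ (max_level n - j) :: real;
      L = max 0 (i - window_radius \<alpha> + 1);
      U = min \<lceil>(real n + 1) / w\<rceil> (i + window_radius \<alpha> - 2)
    in (w / real n * of_int L - 1 / (2 * real n), w / real n * of_int U - 1 / (2 * real n)))"

lemma endpoints_stopped_eq:
  "endpoints_stopped n \<sigma> \<alpha> \<omega> = stopped_at n \<alpha> (hat_j n \<sigma> \<omega>) (loc_of n (split_l \<sigma> \<omega>) (hat_j n \<sigma> \<omega>))"
  by (simp add: endpoints_stopped_def stopped_at_def loc_index_eq window_radius_def Let_def)

lemma CI_z_eq:
  "CI_z n \<sigma> \<alpha> \<omega> =
     (let e = (if check_j n \<sigma> \<omega> < \<infinity> then stopped_at n \<alpha> (hat_j n \<sigma> \<omega>) (loc_of n (split_l \<sigma> \<omega>) (hat_j n \<sigma> \<omega>))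
        else endpoints_at n \<sigma> \<alpha> \<omega> (loc_of n (split_l \<sigma> \<omega>) (hat_j n \<sigma> \<omega>)))
      in (min (fst e) (snd e), snd e))"
  by (simp add: CI_z_def endpoints_stopped_eq endpoints_unstopped_eq Let_def case_prod_beta')

lemma fine_endpoints_measurable:
  assumes q[measurable]: "\<And>i. (\<lambda>\<omega>. q \<omega> i) \<in> borel_measurable M"
  shows "(\<lambda>\<omega>. fine_endpoints n c L U il ir (q \<omega>)) \<in> borel_measurable M"
  unfolding fine_endpoints_def Let_def ratio_def borel_prod[symmetric] by measurable

lemma window_bounds: "0 \<le> window_lower \<alpha> i" "window_upper n \<alpha> i \<le> int n"
  by (auto simp: window_lower_def window_upper_def)

lemma endpoints_at_measurable:
  assumes \<sigma>: "\<sigma> > 0"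
  shows "(\<lambda>\<omega>. endpoints_at n \<sigma> \<alpha> \<omega> i) \<in> borel_measurable (model n \<sigma> f)"
proof -
  let ?L = "window_lower \<alpha> i" and ?U = "window_upper n \<alpha> i" and ?M = "model n \<sigma> f"
  have q: "(\<lambda>\<omega>. extend n (q_sample \<sigma> \<omega>) k) \<in> borel_measurable ?M" for k
  proof (cases "0 \<le> k \<and> k \<le> int n")
    case True
    then have "nat k \<le> n" by auto
    from split_measurable(4)[OF \<sigma> this, of f] show ?thesis
      using True by (simp add: extend_def q_sample_def)
  next
    case False
    then show ?thesis by (auto simp: extend_def)
  qed
  have p: "(\<lambda>\<omega>. p_sample \<sigma> \<omega> (nat k) - p_sample \<sigma> \<omega> (nat (k + 1))) \<in> borel_measurable ?M"
    if "k \<in> {?L..?U - 1}" for k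
  proof -
    have k: "nat k \<le> n" "nat (k + 1) \<le> n" using that window_bounds(1)[of \<alpha> i] window_bounds(2)[of n \<alpha> i] by auto
    show ?thesis unfolding p_sample_def
      using split_measurable(3)[OF \<sigma> k(1), of f] split_measurable(3)[OF \<sigma> k(2), of f]
      by (rule borel_measurable_diff)
  qed
  have il: "(\<lambda>\<omega>. left_index ?L ?U (p_sample \<sigma> \<omega>) t) \<in> measurable ?M (count_space UNIV)" for t
    unfolding left_index_def
  proof (rule measurable_finite_choice[where F = "\<lambda>S. Min ({?U} \<union> S)"])
    fix k assume "k \<in> {?L..?U - 1}"
    note [measurable] = p[OF this]
    show "Measurable.pred ?M (\<lambda>\<omega>. p_sample \<sigma> \<omega> (nat k) - p_sample \<sigma> \<omega> (nat (k + 1)) \<le> t)"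
      by measurable
  qed simp
  have ir: "(\<lambda>\<omega>. right_index ?L ?U (p_sample \<sigma> \<omega>) t) \<in> measurable ?M (count_space UNIV)" for t
    unfolding right_index_def
  proof (rule measurable_finite_choice[where F = "\<lambda>S. Max ({?L - 1} \<union> S)"])
    fix k assume "k \<in> {?L..?U - 1}"
    note [measurable] = p[OF this]
    show "Measurable.pred ?M (\<lambda>\<omega>. - t \<le> p_sample \<sigma> \<omega> (nat k) - p_sample \<sigma> \<omega> (nat (k + 1)))"
      by measurable
  qed simp
  show ?thesis unfolding endpoints_at_def
    by (rule measurable_compose_countable[OF measurable_compose_countable[OF fine_endpoints_measurable[OF q] ir] il])
qed

lemma check_j_measurable:
  assumes \<sigma>: "\<sigma> > 0"
  shows "(\<lambda>\<omega>. check_j n \<sigma> \<omega>) \<in> measurable (model n \<sigma> f) (count_space UNIV)"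
proof -
  have "(\<lambda>\<omega>. Inf (enat ` {j \<in> {..max_level n}. level_stops n \<sigma> \<omega> j})) \<in> measurable (model n \<sigma> f) (count_space UNIV)"
    by (rule measurable_finite_choice) (use level_stops_measurable[OF \<sigma>] in auto)
  then show ?thesis by (simp add: check_j_def level_stops_def)
qed

lemma CI_z_measurable:
  assumes \<sigma>: "\<sigma> > 0"
  shows "CI_z n \<sigma> \<alpha> \<in> borel_measurable (model n \<sigma> f)"
proof -
  let ?M = "model n \<sigma> f"
  have ct: "(\<lambda>\<omega>. check_j n \<sigma> \<omega>) \<in> measurable ?M (count_space UNIV)" by (rule check_j_measurable[OF \<sigma>])
  have loc: "(\<lambda>\<omega>. loc_of n (split_l \<sigma> \<omega>) j) \<in> measurable ?M (count_space UNIV)" for j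
    by (intro loc_of_measurable split_measurable(1)[OF \<sigma>])
  define E where "E c i \<omega> = (if c < (\<infinity> :: enat) then stopped_at n \<alpha> (the_enat (min (enat (max_level n)) c)) i
    else endpoints_at n \<sigma> \<alpha> \<omega> i)" for c i \<omega>
  have "E c i \<in> borel_measurable ?M" for c i
    unfolding E_def using endpoints_at_measurable[OF \<sigma>] by (cases "c < \<infinity>") auto
  then have "(\<lambda>\<omega>. E c (loc_of n (split_l \<sigma> \<omega>) (the_enat (min (enat (max_level n)) c))) \<omega>) \<in> borel_measurable ?M" for c
    by (rule measurable_compose_countable[OF _ loc])
  then have E: "(\<lambda>\<omega>. E (check_j n \<sigma> \<omega>) (loc_of n (split_l \<sigma> \<omega>) (hat_j n \<sigma> \<omega>)) \<omega>) \<in> borel_measurable ?M"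
    unfolding hat_j_def by (rule measurable_compose_countable[OF _ ct])
  then have [measurable]: "(\<lambda>\<omega>. fst (E (check_j n \<sigma> \<omega>) (loc_of n (split_l \<sigma> \<omega>) (hat_j n \<sigma> \<omega>)) \<omega>)) \<in> borel_measurable ?M"
    "(\<lambda>\<omega>. snd (E (check_j n \<sigma> \<omega>) (loc_of n (split_l \<sigma> \<omega>) (hat_j n \<sigma> \<omega>)) \<omega>)) \<in> borel_measurable ?M"
    unfolding borel_prod[symmetric] by measurable
  have "CI_z n \<sigma> \<alpha> = (\<lambda>\<omega>. (min (fst (E (check_j n \<sigma> \<omega>) (loc_of n (split_l \<sigma> \<omega>) (hat_j n \<sigma> \<omega>)) \<omega>))
      (snd (E (check_j n \<sigma> \<omega>) (loc_of n (split_l \<sigma> \<omega>) (hat_j n \<sigma> \<omega>)) \<omega>)),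
      snd (E (check_j n \<sigma> \<omega>) (loc_of n (split_l \<sigma> \<omega>) (hat_j n \<sigma> \<omega>)) \<omega>)))"
    unfolding CI_z_eq[abs_def] E_def Let_def hat_j_def ..
  also have "\<dots> \<in> borel_measurable ?M" unfolding borel_prod[symmetric] by measurable
  finally show ?thesis .
qed

section \<open>Sums of noise over blocks\<close>

definition block :: "nat \<Rightarrow> nat \<Rightarrow> int \<Rightarrow> nat set" where
  "block n j b = nat ` {(b - 1) * width n j..b * width n j - 1}"

definition in_sample :: "nat \<Rightarrow> nat \<Rightarrow> int \<Rightarrow> bool" where
  "in_sample n j b \<longleftrightarrow> 1 \<le> b \<and> b * width n j \<le> int n + 1"

lemma mem_block: "1 \<le> b \<Longrightarrow> k \<in> block n j b \<longleftrightarrow> (b - 1) * width n j \<le> int k \<and> int k < b * width n j"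
proof -
  assume b: "1 \<le> b"
  then have "0 \<le> (b - 1) * width n j" by simp
  then show ?thesis unfolding block_def image_iff
    by (auto intro!: bexI[of _ "int k"])
qed

lemma sum_block:
  assumes "1 \<le> b"
  shows "(\<Sum>k\<in>{(b - 1) * width n j..b * width n j - 1}. u (nat k)) = (\<Sum>k\<in>block n j b. u k)"
proof -
  have "0 \<le> (b - 1) * width n j" using assms by simp
  then have "inj_on nat {(b - 1) * width n j..b * width n j - 1}"
    by (intro inj_onI) (simp only: atLeastAtMost_iff, linarith)
  then show ?thesis unfolding block_def by (simp add: sum.reindex)
qed

lemma finite_block [simp]: "finite (block n j b)"
  by (simp add: block_def)

lemma card_block: "1 \<le> b \<Longrightarrow> card (block n j b) = 2 ^ (max_level n - j)"
proof -
  assume "1 \<le> b"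
  from sum_block[OF this, where u = "\<lambda>_. 1 :: int" and n = n and j = j]
  have "int (card (block n j b)) = width n j" by (simp add: algebra_simps)
  then have "int (card (block n j b)) = int (2 ^ (max_level n - j))" by simp
  then show "card (block n j b) = 2 ^ (max_level n - j)" by (simp only: of_nat_eq_iff)
qed

lemma block_le: "in_sample n j b \<Longrightarrow> k \<in> block n j b \<Longrightarrow> k \<le> n"
  by (auto simp: mem_block in_sample_def)

lemma block_disjoint: "1 \<le> b \<Longrightarrow> 1 \<le> b' \<Longrightarrow> b \<noteq> b' \<Longrightarrow> block n j b \<inter> block n j b' = {}"
proof -
  assume b: "1 \<le> b" "1 \<le> b'" "b \<noteq> b'"
  have False if "k \<in> block n j b" "k \<in> block n j b'" for k
  proof -
    have *: "\<not> c < c'" if "int k < c * width n j" "(c' - 1) * width n j \<le> int k" for c c' :: int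
    proof
      assume "c < c'"
      then have "c * width n j \<le> (c' - 1) * width n j" by (intro mult_right_mono) auto
      then show False using that by linarith
    qed
    show False using that b *[of b b'] *[of b' b] by (auto simp: mem_block)
  qed
  then show ?thesis by blast
qed

text \<open>Lets two blocks of one level be compared term by term.\<close>

lemma sum_block_shift:
  assumes "1 \<le> b" "0 \<le> d"
  shows "(\<Sum>k\<in>block n j (b + d). u k) = (\<Sum>k\<in>block n j b. u (k + nat (d * width n j)))"
proof (rule sum.reindex_bij_witness[of _ "\<lambda>k. k + nat (d * width n j)" "\<lambda>k. k - nat (d * width n j)"])
  have d: "0 \<le> d * width n j" using assms by simp
  have e: "(b + d - 1) * width n j = (b - 1) * width n j + d * width n j" "(b + d) * width n j = b * width n j + d * width n j"
    "0 \<le> (b - 1) * width n j"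
    using assms by (simp_all add: algebra_simps)
  fix k
  show "k + nat (d * width n j) - nat (d * width n j) = k" by simp
  show "k + nat (d * width n j) \<in> block n j (b + d)" if "k \<in> block n j b"
  proof -
    have "int (k + nat (d * width n j)) = int k + d * width n j" using d by simp
    moreover have "1 \<le> b + d" using assms by simp
    ultimately show ?thesis using that assms(1) unfolding mem_block[OF \<open>1 \<le> b + d\<close>] mem_block[OF assms(1)] e(1,2) by auto
  qed
  assume k: "k \<in> block n j (b + d)"
  then have "(b + d - 1) * width n j \<le> int k" using assms by (simp add: mem_block)
  then have "(b - 1) * width n j + d * width n j \<le> int k" by (simp only: e(1))
  then have "int k \<ge> d * width n j" using e(3) by (meson add_increasing order_refl order_trans)
  then have le: "nat (d * width n j) \<le> k" by simp
  then show "k - nat (d * width n j) + nat (d * width n j) = k" by simp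
  then show "u (k - nat (d * width n j) + nat (d * width n j)) = u k" by simp
  show "k - nat (d * width n j) \<in> block n j b"
  proof -
    have i: "int (k - nat (d * width n j)) = int k - d * width n j" using d le by (simp add: of_nat_diff)
    have "1 \<le> b + d" using assms by simp
    then show ?thesis
      using k unfolding mem_block[OF \<open>1 \<le> b + d\<close>] mem_block[OF assms(1)] e(1,2) i by auto
  qed
qed

locale convex_regression =
  fixes n :: nat and \<sigma> :: real and f :: "real \<Rightarrow> real"
  assumes n1: "n \<ge> 1" and \<sigma>_pos: "\<sigma> > 0" and f_class: "f \<in> convex_class"
begin

abbreviation "M \<equiv> model n \<sigma> f"

abbreviation "J \<equiv> max_level n"

abbreviation "noi \<equiv> noise n \<sigma> f"


text \<open>Position of the minimizer in units of the grid spacing.\<close>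

definition "nZ = real n * minimizer f"

definition "a k = f (real k / real n)"

sublocale prob_space M by (rule prob_space_model)

lemma nZ_bounds: "0 \<le> nZ" "nZ \<le> real n"
  using minimizer_in[OF f_class] n1 by (auto simp: nZ_def mult_left_le)

lemma minimizer_eq: "minimizer f = nZ / real n"
  using n1 by (simp add: nZ_def)

lemma a_right: "nZ \<le> real k \<Longrightarrow> k \<le> l \<Longrightarrow> l \<le> n \<Longrightarrow> a k \<le> a l"
  unfolding a_def using n1 by (intro convex_class_mono_right[OF f_class]) (auto simp: minimizer_eq divide_right_mono)

lemma a_left: "k \<le> l \<Longrightarrow> real l \<le> nZ \<Longrightarrow> a l \<le> a k"
  unfolding a_def using n1 by (intro convex_class_mono_left[OF f_class]) (auto simp: minimizer_eq divide_right_mono)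

definition block_noise :: "nat \<Rightarrow> nat \<Rightarrow> int \<Rightarrow> int \<Rightarrow> outcome \<Rightarrow> real" where
  "block_noise u j b b' \<omega> = (\<Sum>k\<in>block n j b. noi (u, k) \<omega>) - (\<Sum>k\<in>block n j b'. noi (u, k) \<omega>)"

definition "block_idx u j b b' = {u} \<times> (block n j b \<union> block n j b')"

lemma block_noise_linear:
  assumes "1 \<le> b" "1 \<le> b'" "b \<noteq> b'"
  shows "block_noise u j b b' \<omega> = (\<Sum>i\<in>block_idx u j b b'. (if snd i \<in> block n j b then 1 else -1) * noi i \<omega>)"
    and "(\<Sum>i\<in>block_idx u j b b'. (if snd i \<in> block n j b then 1 else -1 :: real)\<^sup>2) = 2 * 2 ^ (J - j)"
    and "block_idx u j b b' \<noteq> {}"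
proof -
  have dis: "block n j b \<inter> block n j b' = {}" by (rule block_disjoint[OF assms])
  have "(\<Sum>i\<in>block_idx u j b b'. (if snd i \<in> block n j b then 1 else -1) * noi i \<omega>)
      = (\<Sum>k\<in>block n j b \<union> block n j b'. (if k \<in> block n j b then 1 else -1) * noi (u, k) \<omega>)"
    unfolding block_idx_def by (rule sum.reindex_bij_witness[of _ "\<lambda>k. (u, k)" snd]) auto
  also have "\<dots> = (\<Sum>k\<in>block n j b. (if k \<in> block n j b then 1 else -1) * noi (u, k) \<omega>)
      + (\<Sum>k\<in>block n j b'. (if k \<in> block n j b then 1 else -1) * noi (u, k) \<omega>)"
    by (rule sum.union_disjoint) (use dis in auto)
  also have "(\<Sum>k\<in>block n j b'. (if k \<in> block n j b then 1 else -1) * noi (u, k) \<omega>)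
      = (\<Sum>k\<in>block n j b'. - noi (u, k) \<omega>)"
    by (rule sum.cong) (use dis in auto)
  finally show "block_noise u j b b' \<omega> = (\<Sum>i\<in>block_idx u j b b'. (if snd i \<in> block n j b then 1 else -1) * noi i \<omega>)"
    by (simp add: block_noise_def sum_negf)
  have "card (block_idx u j b b') = 2 * 2 ^ (J - j)"
    using dis assms by (simp add: block_idx_def card_cartesian_product card_Un_disjoint card_block)
  then show "(\<Sum>i\<in>block_idx u j b b'. (if snd i \<in> block n j b then 1 else -1 :: real)\<^sup>2) = 2 * 2 ^ (J - j)"
    by (simp add: if_distrib[of "\<lambda>x. x\<^sup>2"] cong: if_cong)
  show "block_idx u j b b' \<noteq> {}"
    using card_block[OF assms(1), of n j] by (auto simp: block_idx_def)
qed

lemma block_idx_subset: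
  "u \<le> 3 \<Longrightarrow> in_sample n j b \<Longrightarrow> in_sample n j b' \<Longrightarrow> block_idx u j b b' \<subseteq> idx n"
  by (auto simp: block_idx_def idx_def dest: block_le)

lemma block_noise_measurable:
  assumes "u \<le> 3" "in_sample n j b" "in_sample n j b'"
  shows "block_noise u j b b' \<in> borel_measurable M"
  unfolding block_noise_def[abs_def]
  by (intro borel_measurable_diff borel_measurable_sum noise_measurable)
    (use assms block_le in \<open>auto simp: idx_def\<close>)

lemma block_noise_square:
  assumes "u \<le> 3" "in_sample n j b" "in_sample n j b'" "b \<noteq> b'"
  shows "(\<integral>\<^sup>+\<omega>. ennreal ((block_noise u j b b' \<omega>)\<^sup>2) \<partial>M) = ennreal (2 * 2 ^ (J - j))"
proof -
  have b: "1 \<le> b" "1 \<le> b'" using assms by (auto simp: in_sample_def)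
  show ?thesis unfolding block_noise_linear[OF b assms(4)]
    by (subst nn_integral_noise_linear_square[OF \<sigma>_pos block_idx_subset[OF assms(1-3)] block_noise_linear(3)[OF b assms(4)]])
      (simp_all only: block_noise_linear(2)[OF b assms(4)], auto)
qed

lemma block_noise_tail:
  assumes "u \<le> 3" "in_sample n j b" "in_sample n j b'" "b \<noteq> b'"
  shows "measure M {\<omega> \<in> space M. block_noise u j b b' \<omega> > t * sqrt (2 * 2 ^ (J - j))} = 1 - Phi t"
proof -
  have b: "1 \<le> b" "1 \<le> b'" using assms by (auto simp: in_sample_def)
  show ?thesis
    using prob_noise_linear_greater[OF \<sigma>_pos block_idx_subset[OF assms(1-3)] block_noise_linear(3)[OF b assms(4)],
        of "\<lambda>i. if snd i \<in> block n j b then 1 else -1" f t]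
    unfolding block_noise_linear[OF b assms(4)] by auto
qed

lemma split_s_block:
  assumes "1 \<le> b"
  shows "(\<Sum>k\<in>{(b - 1) * width n j..b * width n j - 1}. split_s \<sigma> \<omega> (nat k))
    = (\<Sum>k\<in>block n j b. a k) + sqrt 3 * \<sigma> * (\<Sum>k\<in>block n j b. noi (2, k) \<omega>)"
  using sum_block[OF assms, where n = n and j = j and u = "split_s \<sigma> \<omega>"]
  by (simp add: split_s_noise[OF \<sigma>_pos, of \<omega> _ f n] sum.distrib sum_distrib_left a_def)

lemma split_l_block:
  assumes "1 \<le> b"
  shows "(\<Sum>k\<in>{(b - 1) * width n j..b * width n j - 1}. split_l \<sigma> \<omega> (nat k))
    = (\<Sum>k\<in>block n j b. a k) + sqrt 3 * \<sigma> * (\<Sum>k\<in>block n j b. noi (0, k) \<omega>)"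
  using sum_block[OF assms, where n = n and j = j and u = "split_l \<sigma> \<omega>"]
  by (simp add: split_l_noise[OF \<sigma>_pos, of \<omega> _ f n] sum.distrib sum_distrib_left a_def)

text \<open>The stopping threshold is in units of the standard deviation of a difference of two
  block sums of \<open>y_s\<close>: the noise has variance 3 \<sigma>^2 per observation, and
  \<open>2 * 2 ^ (J - j)\<close> observations are involved.\<close>

lemma sigma_level_eq: "sigma_level n \<sigma> j = sqrt 3 * \<sigma> * sqrt (2 * 2 ^ (J - j))"
proof -
  have "6 * 2 ^ (J - j) * \<sigma>\<^sup>2 = 3 * \<sigma>\<^sup>2 * (2 * 2 ^ (J - j))" by simp
  then have "sigma_level n \<sigma> j = sqrt (3 * \<sigma>\<^sup>2 * (2 * 2 ^ (J - j)))" by (simp only: sigma_level_def)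
  also have "\<dots> = sqrt 3 * \<sigma> * sqrt (2 * 2 ^ (J - j))"
    using \<sigma>_pos by (simp only: real_sqrt_mult real_sqrt_abs abs_of_pos)
  finally show ?thesis .
qed


section \<open>The stopping rule does not fire late\<close>

text \<open>The minimizer lies beyond the block \<open>i + 6 d\<close>, so the difference that the stopping rule tests
  on the side \<open>d\<close> has nonpositive mean.\<close>

definition off :: "int \<Rightarrow> int \<Rightarrow> nat \<Rightarrow> bool" where
  "off d i j \<longleftrightarrow> (if d = 1 then of_int ((i + 6) * width n j) - 1 \<le> nZ else nZ \<le> of_int ((i - 7) * width n j))"

lemma off_right: "off 1 i j \<longleftrightarrow> of_int ((i + 6) * width n j) - 1 \<le> nZ"
  and off_left: "off (-1) i j \<longleftrightarrow> nZ \<le> of_int ((i - 7) * width n j)"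
  unfolding off_def by (rule if_P, rule refl) (rule if_not_P, simp)

abbreviation loc :: "outcome \<Rightarrow> nat \<Rightarrow> int" where
  "loc \<omega> \<equiv> loc_of n (split_l \<sigma> \<omega>)"

text \<open>In \<open>off\<close>, the numbers \<open>(i + 6) * width n j - 1\<close> and
  \<open>(i - 7) * width n j\<close> are the last grid index of block \<open>i + 6\<close> and the
  first one of block \<open>i - 6\<close>. As the minimizer lies beyond them and inside the grid, so
  do the blocks.\<close>

lemma off_in_sample:
  assumes d: "d = 1 \<or> d = -1" and i: "in_sample n j i" and off: "off d i j"
  shows "in_sample n j (i + 6 * d)" "in_sample n j (i + 5 * d)"
proof -
  have "in_sample n j (i + 6 * d) \<and> in_sample n j (i + 5 * d)"
  proof (cases "d = 1")
    case True
    then have "of_int ((i + 6) * width n j) \<le> nZ + 1" using off by (simp add: off_def)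
    also have "\<dots> \<le> of_int (int n + 1)" using nZ_bounds by simp
    finally have 1: "(i + 6) * width n j \<le> int n + 1" by (simp only: of_int_le_iff)
    have "(i + 5) * width n j \<le> (i + 6) * width n j" by (intro mult_right_mono) auto
    then have "(i + 5) * width n j \<le> int n + 1" using 1 by linarith
    then show ?thesis using True i 1 by (auto simp: in_sample_def)
  next
    case False
    then have "0 \<le> (of_int ((i - 7) * width n j) :: real)" using off nZ_bounds by (simp add: off_def)
    then have "0 \<le> (i - 7) * width n j" by (simp only: of_int_0_le_iff)
    then have i7: "7 \<le> i" by (simp add: zero_le_mult_iff)
    have "(i - 6) * width n j \<le> i * width n j" by (intro mult_right_mono) auto
    moreover have "(i - 5) * width n j \<le> i * width n j" by (intro mult_right_mono) auto
    moreover have "i * width n j \<le> int n + 1" using i by (simp add: in_sample_def)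
    ultimately have "(i - 6) * width n j \<le> int n + 1" "(i - 5) * width n j \<le> int n + 1" by linarith+
    then show ?thesis using False d i7 by (auto simp: in_sample_def)
  qed
  then show "in_sample n j (i + 6 * d)" "in_sample n j (i + 5 * d)" by auto
qed

text \<open>The outer of the two compared blocks is nearer to the minimizer, so the drift favours
  stopping. Going on therefore takes a noise difference of more than two standard
  deviations.\<close>

lemma off_not_stops:
  assumes j: "j \<le> J" and d: "d = 1 \<or> d = -1" and off: "off d (loc \<omega> j) j"
    and ns: "\<not> level_stops n \<sigma> \<omega> j"
  shows "block_noise 2 j (loc \<omega> j + 6 * d) (loc \<omega> j + 5 * d) \<omega> > 2 * sqrt (2 * 2 ^ (J - j))"
proof -
  let ?i = "loc \<omega> j"
  have i: "in_sample n j ?i" using loc_of_range[OF j] by (simp add: in_sample_def)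
  note s = off_in_sample[OF d i off]
  have b1: "1 \<le> ?i + 6 * d" "1 \<le> ?i + 5 * d" using s by (auto simp: in_sample_def)
  have gt: "(\<Sum>k\<in>{(?i + 6 * d - 1) * width n j..(?i + 6 * d) * width n j - 1}. split_s \<sigma> \<omega> (nat k))
      - (\<Sum>k\<in>{(?i + 5 * d - 1) * width n j..(?i + 5 * d) * width n j - 1}. split_s \<sigma> \<omega> (nat k))
      > 2 * sigma_level n \<sigma> j"
    using ns s d unfolding level_stops_iff[OF j] in_sample_def by (auto simp: not_le)
  have mean: "(\<Sum>k\<in>block n j (?i + 6 * d). a k) \<le> (\<Sum>k\<in>block n j (?i + 5 * d). a k)"
  proof (cases "d = 1")
    case True
    have e: "?i + 6 = (?i + 5) + 1" by simp
    have "(\<Sum>k\<in>block n j (?i + 6). a k) = (\<Sum>k\<in>block n j (?i + 5). a (k + nat (1 * width n j)))"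
      unfolding e by (rule sum_block_shift) (use b1 True in auto)
    also have "\<dots> \<le> (\<Sum>k\<in>block n j (?i + 5). a k)"
    proof (rule sum_mono)
      fix k assume "k \<in> block n j (?i + 5)"
      then have "int k < (?i + 5) * width n j" using b1 True by (simp add: mem_block)
      then have "int (k + nat (1 * width n j)) \<le> (?i + 6) * width n j - 1" by (simp add: algebra_simps)
      then have "real_of_int (int (k + nat (1 * width n j))) \<le> real_of_int ((?i + 6) * width n j - 1)"
        by (simp only: of_int_le_iff)
      also have "\<dots> \<le> nZ" using off True by (simp add: off_def)
      finally show "a (k + nat (1 * width n j)) \<le> a k" by (intro a_left) auto
    qed
    finally show ?thesis using True by simp
  next
    case False
    then have d: "d = -1" using d by simp
    have "(\<Sum>k\<in>block n j (?i - 6). a k) \<le> (\<Sum>k\<in>block n j (?i - 6). a (k + nat (1 * width n j)))"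
    proof (rule sum_mono)
      fix k assume k: "k \<in> block n j (?i - 6)"
      then have "(?i - 7) * width n j \<le> int k" "int k < (?i - 6) * width n j" using b1 d by (simp_all add: mem_block)
      then have 1: "(?i - 7) * width n j \<le> int k" "int (k + nat (1 * width n j)) < (?i - 5) * width n j"
        by (simp_all add: algebra_simps)
      have "nZ \<le> real_of_int ((?i - 7) * width n j)" using off d by (simp add: off_def)
      also have "\<dots> \<le> real_of_int (int k)" using 1 by (simp only: of_int_le_iff)
      finally have "nZ \<le> real k" by simp
      moreover have "(?i - 5) * width n j \<le> int n + 1" using s(2) d by (simp add: in_sample_def)
      then have "int (k + nat (1 * width n j)) \<le> int n" using 1(2) by linarith
      then have "k + nat (1 * width n j) \<le> n" by (simp only: of_nat_le_iff)
      ultimately show "a k \<le> a (k + nat (1 * width n j))" by (intro a_right) auto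
    qed
    also have "\<dots> = (\<Sum>k\<in>block n j (?i - 6 + 1). a k)"
      by (rule sum_block_shift[symmetric]) (use b1 d in auto)
    also have "?i - 6 + 1 = ?i - 5" by simp
    finally show ?thesis using d by simp
  qed
  have "sqrt 3 * \<sigma> * (2 * sqrt (2 * 2 ^ (J - j))) < sqrt 3 * \<sigma> * block_noise 2 j (?i + 6 * d) (?i + 5 * d) \<omega>"
    using gt mean unfolding split_s_block[OF b1(1)] split_s_block[OF b1(2)] sigma_level_eq block_noise_def
    by (simp add: algebra_simps)
  then show ?thesis using \<sigma>_pos by simp
qed

definition path_steps :: "(nat \<Rightarrow> int) \<Rightarrow> bool" where
  "path_steps \<pi> \<longleftrightarrow> (\<forall>j\<le>J. in_sample n j (\<pi> j)) \<and> (\<forall>j<J. 2 * \<pi> j - 2 \<le> \<pi> (Suc j) \<and> \<pi> (Suc j) \<le> 2 * \<pi> j + 1)"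

lemma path_steps_loc: "path_steps (loc \<omega>)"
  unfolding path_steps_def in_sample_def
  using loc_of_range loc_of_step(1) by (auto simp: candidates_iff)

text \<open>The extreme steps \<open>2 * i - 2\<close> and \<open>2 * i + 1\<close> have the fixed
  points 2 and -1. Measured from there, the index at least doubles, respectively at most doubles, at
  each level.\<close>

lemma path_range:
  assumes "path_steps \<pi>" "j + k \<le> J"
  shows "(\<pi> j - 2) * 2 ^ k \<le> \<pi> (j + k) - 2" "\<pi> (j + k) + 1 \<le> (\<pi> j + 1) * 2 ^ k"
proof -
  have "(\<pi> j - 2) * 2 ^ k \<le> \<pi> (j + k) - 2 \<and> \<pi> (j + k) + 1 \<le> (\<pi> j + 1) * 2 ^ k"
    using assms(2)
  proof (induction k)
    case (Suc k)
    then have "2 * \<pi> (j + k) - 2 \<le> \<pi> (Suc (j + k))" "\<pi> (Suc (j + k)) \<le> 2 * \<pi> (j + k) + 1"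
      using assms(1) by (auto simp: path_steps_def)
    moreover have "(\<pi> j - 2) * 2 ^ Suc k = 2 * ((\<pi> j - 2) * 2 ^ k)" "(\<pi> j + 1) * 2 ^ Suc k = 2 * ((\<pi> j + 1) * 2 ^ k)"
      by simp_all
    ultimately show ?case using Suc by (simp only: add_Suc_right) linarith
  qed simp
  then show "(\<pi> j - 2) * 2 ^ k \<le> \<pi> (j + k) - 2" "\<pi> (j + k) + 1 \<le> (\<pi> j + 1) * 2 ^ k" by auto
qed

lemma width_add: "j + k \<le> J \<Longrightarrow> width n j = 2 ^ k * width n (j + k)"
  by (simp flip: power_add)

text \<open>Relative to the fixed points in \<open>path_range\<close>, the offsets in
  \<open>off\<close> leave 5 blocks on either side, and 5 fine blocks are not longer than 5 coarse
  ones.\<close>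

lemma off_persists:
  assumes \<pi>: "path_steps \<pi>" and d: "d = 1 \<or> d = -1" and off: "off d (\<pi> j) j" and jk: "j + k \<le> J"
  shows "off d (\<pi> (j + k)) (j + k)"
proof -
  let ?w = "width n (j + k)"
  have w: "width n j = 2 ^ k * ?w" by (rule width_add[OF jk])
  have p: "(1::int) \<le> 2 ^ k" by simp
  show ?thesis
  proof (cases "d = 1")
    case True
    have "\<pi> (j + k) + 6 \<le> (\<pi> j + 1) * 2 ^ k + 5" using path_range(2)[OF \<pi> jk] by simp
    also have "\<dots> \<le> (\<pi> j + 6) * 2 ^ k" using p by (simp add: algebra_simps)
    finally have "(\<pi> (j + k) + 6) * ?w \<le> (\<pi> j + 6) * 2 ^ k * ?w" by (intro mult_right_mono) auto
    also have "\<dots> = (\<pi> j + 6) * width n j" using w by simp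
    finally have "real_of_int ((\<pi> (j + k) + 6) * ?w) \<le> real_of_int ((\<pi> j + 6) * width n j)"
      by (simp only: of_int_le_iff)
    then show ?thesis using off unfolding True off_right by linarith
  next
    case False
    have "(\<pi> j - 7) * 2 ^ k \<le> (\<pi> j - 2) * 2 ^ k - 5" using p by (simp add: algebra_simps)
    also have "\<dots> \<le> \<pi> (j + k) - 7" using path_range(1)[OF \<pi> jk] by simp
    finally have "(\<pi> j - 7) * 2 ^ k * ?w \<le> (\<pi> (j + k) - 7) * ?w" by (intro mult_right_mono) auto
    then have "(\<pi> j - 7) * width n j \<le> (\<pi> (j + k) - 7) * ?w" using w by simp
    then have "real_of_int ((\<pi> j - 7) * width n j) \<le> real_of_int ((\<pi> (j + k) - 7) * ?w)"
      by (simp only: of_int_le_iff)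
    moreover have "d = -1" using False d by simp
    ultimately show ?thesis using off by (simp only: off_left)
  qed
qed

text \<open>On the right, the blocks compared at the finer level end by
  \<open>((\<pi> j + 1) * 2 ^ k + 5) * ?w\<close>. This is at most
  \<open>(\<pi> j + 4) * width n j\<close>, where the coarser blocks begin, because 5 \<le> 3 * 2^k
  for k \<ge> 1. The left side is the mirror image. The offsets 5 and 6 of the stopping rule are
  large enough for this.\<close>

lemma off_blocks_disjoint:
  assumes \<pi>: "path_steps \<pi>" and d: "d = 1 \<or> d = -1" and off: "off d (\<pi> j) j" "off d (\<pi> j') j'"
    and jj: "j < j'" "j' \<le> J"
  shows "block_idx u j (\<pi> j + 6 * d) (\<pi> j + 5 * d) \<inter> block_idx u j' (\<pi> j' + 6 * d) (\<pi> j' + 5 * d) = {}"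
proof -
  obtain k where k: "j' = j + k" "k \<ge> 1" using jj by (metis add.commute le_add_diff_inverse less_imp_le_nat nat_less_le zero_less_diff Suc_leI One_nat_def)
  let ?w = "width n j'"
  have w: "width n j = 2 ^ k * ?w" unfolding k(1) by (rule width_add) (use k jj in simp)
  have "(2::int) ^ 1 \<le> 2 ^ k" by (rule power_increasing) (use k in auto)
  then have p: "(2::int) \<le> 2 ^ k" by simp
  have sj: "in_sample n j (\<pi> j + 6 * d)" "in_sample n j (\<pi> j + 5 * d)"
    by (rule off_in_sample[OF d _ off(1)]; use \<pi> jj in \<open>simp add: path_steps_def\<close>)+
  have sj': "in_sample n j' (\<pi> j' + 6 * d)" "in_sample n j' (\<pi> j' + 5 * d)"
    by (rule off_in_sample[OF d _ off(2)]; use \<pi> jj in \<open>simp add: path_steps_def\<close>)+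
  have b: "1 \<le> \<pi> j + 6 * d" "1 \<le> \<pi> j + 5 * d" "1 \<le> \<pi> j' + 6 * d" "1 \<le> \<pi> j' + 5 * d"
    using sj sj' by (auto simp: in_sample_def)
  have r: "(\<pi> j - 2) * 2 ^ k \<le> \<pi> j' - 2" "\<pi> j' + 1 \<le> (\<pi> j + 1) * 2 ^ k"
    using path_range[OF \<pi>, of j k] k jj by auto
  have mono: "x * ?w \<le> y * ?w" if "x \<le> y" for x y :: int using that by (intro mult_right_mono) auto
  have False if m: "m \<in> block n j (\<pi> j + 6 * d) \<union> block n j (\<pi> j + 5 * d)"
    "m \<in> block n j' (\<pi> j' + 6 * d) \<union> block n j' (\<pi> j' + 5 * d)" for m
  proof -
    obtain c where "c = \<pi> j + 6 * d \<or> c = \<pi> j + 5 * d" "m \<in> block n j c" using m(1) by auto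
    then have c: "c = \<pi> j + 6 * d \<or> c = \<pi> j + 5 * d" "m \<in> block n j c"
      "(c - 1) * width n j \<le> int m" "int m < c * width n j" using b by (auto simp: mem_block)
    obtain c' where "c' = \<pi> j' + 6 * d \<or> c' = \<pi> j' + 5 * d" "m \<in> block n j' c'" using m(2) by auto
    then have c': "c' = \<pi> j' + 6 * d \<or> c' = \<pi> j' + 5 * d" "m \<in> block n j' c'"
      "(c' - 1) * ?w \<le> int m" "int m < c' * ?w" using b by (auto simp: mem_block)
    show False
  proof (cases "d = 1")
    case True
    have "(\<pi> j + 4) * width n j \<le> (c - 1) * width n j" by (intro mult_right_mono) (use c(1) True in auto)
    then have 1: "(\<pi> j + 4) * width n j \<le> int m" using c(3) by linarith
    have "c' * ?w \<le> (\<pi> j' + 6) * ?w" by (intro mult_right_mono) (use c'(1) True in auto)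
    then have 2: "int m < (\<pi> j' + 6) * ?w" using c'(4) by linarith
    have "\<pi> j' + 6 \<le> (\<pi> j + 4) * 2 ^ k" using r(2) p by (simp add: algebra_simps)
    from mono[OF this] have "(\<pi> j' + 6) * ?w \<le> (\<pi> j + 4) * width n j" using w by simp
    then show False using 1 2 by linarith
  next
    case False
    then have d: "d = -1" using d by simp
    have "c * width n j \<le> (\<pi> j - 5) * width n j" by (intro mult_right_mono) (use c(1) d in auto)
    then have 1: "int m < (\<pi> j - 5) * width n j" using c(4) by linarith
    have "(\<pi> j' - 7) * ?w \<le> (c' - 1) * ?w" by (intro mult_right_mono) (use c'(1) d in auto)
    then have 2: "(\<pi> j' - 7) * ?w \<le> int m" using c'(3) by linarith
    have "(\<pi> j - 5) * 2 ^ k \<le> \<pi> j' - 7" using r(1) p by (simp add: algebra_simps)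
    from mono[OF this] have "(\<pi> j - 5) * width n j \<le> (\<pi> j' - 7) * ?w" using w by simp
    then show False using 1 2 by linarith
  qed
  qed
  then show ?thesis unfolding block_idx_def by blast
qed

end

lemma block_sum_cong: "(\<And>i. i \<le> n \<Longrightarrow> u i = u' i) \<Longrightarrow> block_sum n u j = block_sum n u' j"
  unfolding block_sum_def fun_eq_iff by (intro allI sum.cong) (auto simp: extend_def)

lemma loc_of_cong: "(\<And>i. i \<le> n \<Longrightarrow> u i = u' i) \<Longrightarrow> loc_of n u j = loc_of n u' j"
  by (induction j) (simp_all add: block_sum_cong[of n u u'])

section \<open>Late stopping, given the path of the localization\<close>

context convex_regression
begin

definition path_event :: "(nat \<Rightarrow> int) \<Rightarrow> outcome set" where
  "path_event \<pi> = {\<omega> \<in> space M. \<forall>j\<le>J. loc \<omega> j = \<pi> j}"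

definition passes :: "int \<Rightarrow> (nat \<Rightarrow> int) \<Rightarrow> nat \<Rightarrow> outcome \<Rightarrow> bool" where
  "passes d \<pi> j \<omega> \<longleftrightarrow> block_noise 2 j (\<pi> j + 6 * d) (\<pi> j + 5 * d) \<omega> > 2 * sqrt (2 * 2 ^ (J - j))"

lemma path_event_sets [measurable]: "path_event \<pi> \<in> sets M"
proof -
  have [measurable]: "(\<lambda>\<omega>. loc \<omega> j) \<in> measurable M (count_space UNIV)" for j
    by (intro loc_of_measurable split_measurable(1)[OF \<sigma>_pos])
  have "Measurable.pred M (\<lambda>\<omega>. \<forall>j\<in>{..J}. loc \<omega> j = \<pi> j)"
    by (intro pred_intros_finite) auto
  then show ?thesis by (simp add: path_event_def pred_def Ball_def)
qed

text \<open>The path is a function of the noise in row 0; each \<open>passes\<close> event involves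
  the noise in row 2 on the blocks compared at that level, and for a fixed path these blocks are
  disjoint between levels. So the probabilities multiply, each passing having probability 1 -
  \<Phi>(2) = \<Phi>(-2).\<close>

lemma prob_path_passes:
  assumes \<pi>: "path_steps \<pi>" and d: "d = 1 \<or> d = -1"
    and off: "\<And>j. j \<in> {j0..<j0 + K} \<Longrightarrow> j \<le> J \<and> off d (\<pi> j) j"
  shows "{\<omega> \<in> path_event \<pi>. \<forall>j\<in>{j0..<j0 + K}. passes d \<pi> j \<omega>} \<in> sets M"
    and "prob {\<omega> \<in> path_event \<pi>. \<forall>j\<in>{j0..<j0 + K}. passes d \<pi> j \<omega>} = prob (path_event \<pi>) * Phi (- 2) ^ K"
proof -
  let ?Js = "{j0..<j0 + K}"
  let ?b = "\<lambda>j. \<pi> j + 6 * d" and ?b' = "\<lambda>j. \<pi> j + 5 * d"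
  have sample: "in_sample n j (?b j)" "in_sample n j (?b' j)" if "j \<in> ?Js" for j
    by (rule off_in_sample[OF d]; use off[OF that] \<pi> in \<open>simp add: path_steps_def\<close>)+
  have b: "1 \<le> ?b j" "1 \<le> ?b' j" "?b j \<noteq> ?b' j" if "j \<in> ?Js" for j
    using sample[OF that] d by (auto simp: in_sample_def)
  \<comment> \<open>Group 0 carries the path, and group \<open>Suc j\<close> carries the two blocks
    compared at level \<open>j\<close>.\<close>
  define I :: "nat \<Rightarrow> (nat \<times> nat) set" where "I m = (case m of 0 \<Rightarrow> {0} \<times> {0..n} | Suc j \<Rightarrow> block_idx 2 j (?b j) (?b' j))" for m
  define L where "L = insert 0 (Suc ` ?Js)"
  define c where "c j i = (if snd i \<in> block n j (?b j) then 1 else -1 :: real)" for j and i :: "nat \<times> nat"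
  define B where "B m = (case m of
      0 \<Rightarrow> {x :: nat \<times> nat \<Rightarrow> real. x \<in> space (Pi\<^sub>M (I 0) (\<lambda>_. borel)) \<and> (\<forall>j\<in>{..J}. loc_of n (\<lambda>i. f (real i / real n) + sqrt 3 * \<sigma> * x (0, i)) j = \<pi> j)}
    | Suc j \<Rightarrow> {x \<in> space (Pi\<^sub>M (I (Suc j)) (\<lambda>_. borel)). (\<Sum>i\<in>I (Suc j). c j i * x i) > 2 * sqrt (2 * 2 ^ (J - j))})" for m
  let ?X = "\<lambda>m \<omega>. restrict (\<lambda>i. noi i \<omega>) (I m)"
  have I_sub: "I m \<subseteq> idx n" if "m \<in> L" for m
  proof (cases m)
    case 0
    then show ?thesis by (auto simp: I_def idx_def)
  next
    case (Suc j)
    then have "j \<in> ?Js" using that by (auto simp: L_def)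
    from block_idx_subset[OF _ sample[OF this], of 2] show ?thesis using Suc by (simp add: I_def)
  qed
  have ind: "indep_vars (\<lambda>m. Pi\<^sub>M (I m) (\<lambda>_. borel)) ?X L"
  proof (rule indep_vars_restrict[OF noise_indep[OF \<sigma>_pos] I_sub])
    show "disjoint_family_on I L"
      unfolding disjoint_family_on_def
    proof (intro ballI impI)
      fix m m' assume m: "m \<in> L" "m' \<in> L" "m \<noteq> m'"
      have dis: "I (Suc j) \<inter> I (Suc j') = {}" if "j \<in> ?Js" "j' \<in> ?Js" "j < j'" for j j'
        using off_blocks_disjoint[OF \<pi> d, of j j'] off[OF that(1)] off[OF that(2)] that(3) by (simp add: I_def)
      have dis0: "I 0 \<inter> I (Suc j) = {}" for j by (auto simp: I_def block_idx_def)
      show "I m \<inter> I m' = {}"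
      proof (cases m)
        case 0
        then obtain j where "m' = Suc j" using m by (cases m') auto
        then show ?thesis using dis0[of j] 0 by simp
      next
        case (Suc j)
        show ?thesis
        proof (cases m')
          case 0
          then show ?thesis using dis0[of j] Suc by auto
        next
          case (Suc j')
          then have "j \<in> ?Js" "j' \<in> ?Js" "j < j' \<or> j' < j" using m \<open>m = Suc j\<close> by (auto simp: L_def)
          then show ?thesis using dis[of j j'] dis[of j' j] Suc \<open>m = Suc j\<close> by auto
        qed
      qed
    qed
  qed auto
  have Bm: "B m \<in> sets (Pi\<^sub>M (I m) (\<lambda>_. borel))" if "m \<in> L" for m
  proof (cases m)
    case 0
    have loc_m[measurable]: "(\<lambda>x. loc_of n (\<lambda>i. f (real i / real n) + sqrt 3 * \<sigma> * x (0, i)) j)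
        \<in> measurable (Pi\<^sub>M (I 0) (\<lambda>_. borel)) (count_space UNIV)" for j
    proof (rule loc_of_measurable)
      fix i assume "i \<le> n"
      then have "(\<lambda>x. x (0, i)) \<in> borel_measurable (Pi\<^sub>M (I 0) (\<lambda>_. borel :: real measure))"
        by (intro measurable_component_singleton) (simp add: I_def)
      then show "(\<lambda>x. f (real i / real n) + sqrt 3 * \<sigma> * x (0, i)) \<in> borel_measurable (Pi\<^sub>M (I 0) (\<lambda>_. borel))"
        by measurable
    qed
    have "Measurable.pred (Pi\<^sub>M (I 0) (\<lambda>_. borel)) (\<lambda>x. \<forall>j\<in>{..J}. loc_of n (\<lambda>i. f (real i / real n) + sqrt 3 * \<sigma> * x (0, i)) j = \<pi> j)"
      by (intro pred_intros_finite) auto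
    then show ?thesis using 0 by (simp add: B_def pred_def)
  next
    case (Suc j)
    have "(\<lambda>x. \<Sum>i\<in>I (Suc j). c j i * x i) \<in> borel_measurable (Pi\<^sub>M (I (Suc j)) (\<lambda>_. borel :: real measure))"
      by (intro borel_measurable_sum borel_measurable_times borel_measurable_const measurable_component_singleton)
    note [measurable] = this
    show ?thesis using Suc by (simp add: B_def)
  qed
  have pre0: "?X 0 -` B 0 \<inter> space M = path_event \<pi>"
  proof -
    have "loc_of n (\<lambda>i. f (real i / real n) + sqrt 3 * \<sigma> * ?X 0 \<omega> (0, i)) j = loc \<omega> j" for \<omega> j
      by (rule loc_of_cong) (simp add: I_def split_l_noise[OF \<sigma>_pos, of \<omega> _ f n])
    then show ?thesis by (auto simp: B_def path_event_def space_PiM)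
  qed
  have preS: "?X (Suc j) -` B (Suc j) \<inter> space M = {\<omega> \<in> space M. passes d \<pi> j \<omega>}" if j: "j \<in> ?Js" for j
  proof -
    have "(\<Sum>i\<in>I (Suc j). c j i * ?X (Suc j) \<omega> i) = block_noise 2 j (?b j) (?b' j) \<omega>" for \<omega>
      unfolding block_noise_linear(1)[OF b[OF j]] by (simp add: I_def c_def)
    then show ?thesis by (auto simp: B_def passes_def space_PiM)
  qed
  have eq: "{\<omega> \<in> path_event \<pi>. \<forall>j\<in>?Js. passes d \<pi> j \<omega>} = (\<Inter>m\<in>L. ?X m -` B m \<inter> space M)"
  proof -
    have gen: "(\<Inter>m\<in>insert 0 (Suc ` ?Js). g m) = g 0 \<inter> (\<Inter>j\<in>?Js. g (Suc j))" for g :: "nat \<Rightarrow> outcome set"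
      by blast
    have "(\<Inter>m\<in>L. ?X m -` B m \<inter> space M) = path_event \<pi> \<inter> (\<Inter>j\<in>?Js. {\<omega> \<in> space M. passes d \<pi> j \<omega>})"
      unfolding L_def gen pre0 by (intro arg_cong2[where f = "(\<inter>)"] refl INF_cong preS)
    then show ?thesis by (auto simp: path_event_def)
  qed
  have rv: "?X m \<in> measurable M (Pi\<^sub>M (I m) (\<lambda>_. borel))" if "m \<in> L" for m
    using ind that by (simp add: indep_vars_def)
  show "{\<omega> \<in> path_event \<pi>. \<forall>j\<in>?Js. passes d \<pi> j \<omega>} \<in> sets M"
    unfolding eq by (intro sets.finite_INT measurable_sets[OF rv Bm]) (auto simp: L_def)
  have "prob {\<omega> \<in> path_event \<pi>. \<forall>j\<in>?Js. passes d \<pi> j \<omega>} = (\<Prod>m\<in>L. prob (?X m -` B m \<inter> space M))"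
    unfolding eq by (rule indep_varsD_finite[OF ind]) (auto simp: L_def intro: Bm[unfolded L_def])
  also have "\<dots> = prob (path_event \<pi>) * (\<Prod>m\<in>Suc ` ?Js. prob (?X m -` B m \<inter> space M))"
    unfolding L_def by (subst prod.insert) (auto simp: pre0)
  also have "(\<Prod>m\<in>Suc ` ?Js. prob (?X m -` B m \<inter> space M)) = (\<Prod>j\<in>?Js. prob (?X (Suc j) -` B (Suc j) \<inter> space M))"
    by (subst prod.reindex) (auto simp: comp_def)
  also have "\<dots> = (\<Prod>j\<in>?Js. Phi (- 2))"
  proof (rule prod.cong[OF refl])
    fix j assume j: "j \<in> ?Js"
    have "prob (?X (Suc j) -` B (Suc j) \<inter> space M) = 1 - Phi 2"
      unfolding preS[OF j] passes_def
      using block_noise_tail[OF _ sample[OF j], of 2 2] b[OF j] by simp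
    then show "prob (?X (Suc j) -` B (Suc j) \<inter> space M) = Phi (- 2)" using Phi_uminus[of 2] by simp
  qed
  finally show "prob {\<omega> \<in> path_event \<pi>. \<forall>j\<in>?Js. passes d \<pi> j \<omega>} = prob (path_event \<pi>) * Phi (- 2) ^ K"
    by simp
qed

definition first_off :: "int \<Rightarrow> (nat \<Rightarrow> int) \<Rightarrow> nat" where
  "first_off d \<pi> = (LEAST j. off d (\<pi> j) j)"

text \<open>Defined path by path because the first level that is off is then a fixed number, and so
  are the blocks compared from there on.\<close>

definition late_event :: "nat \<Rightarrow> int \<Rightarrow> (nat \<Rightarrow> int) \<Rightarrow> outcome set" where
  "late_event K d \<pi> = (if path_steps \<pi> \<and> (\<exists>j. off d (\<pi> j) j) \<and> first_off d \<pi> + K \<le> J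
     then {\<omega> \<in> path_event \<pi>. \<forall>j\<in>{first_off d \<pi>..<first_off d \<pi> + K}. passes d \<pi> j \<omega>} else {})"

definition late :: "nat \<Rightarrow> outcome set" where
  "late K = (\<Union>\<pi>\<in>Pi\<^sub>E {..J} (\<lambda>_. {1..int n + 1}). late_event K 1 \<pi> \<union> late_event K (-1) \<pi>)"

lemma first_off_persists:
  assumes "path_steps \<pi>" "d = 1 \<or> d = -1" "off d (\<pi> j) j" "first_off d \<pi> \<le> l" "l \<le> J"
  shows "off d (\<pi> l) l"
proof -
  have "off d (\<pi> (first_off d \<pi>)) (first_off d \<pi>)"
    unfolding first_off_def using assms(3) by (rule LeastI)
  then show ?thesis using off_persists[OF assms(1,2), of "first_off d \<pi>" "l - first_off d \<pi>"] assms(4,5) by simp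
qed

lemma late_event_bounds:
  assumes "d = 1 \<or> d = -1"
  shows "late_event K d \<pi> \<in> sets M" "prob (late_event K d \<pi>) \<le> prob (path_event \<pi>) * Phi (- 2) ^ K"
proof -
  have off: "j \<le> J \<and> off d (\<pi> j) j"
    if "path_steps \<pi>" "\<exists>j. off d (\<pi> j) j" "first_off d \<pi> + K \<le> J" "j \<in> {first_off d \<pi>..<first_off d \<pi> + K}" for j
    using that first_off_persists[OF that(1) assms, of _ j] by auto
  show "late_event K d \<pi> \<in> sets M"
    unfolding late_event_def using prob_path_passes(1)[OF _ assms off] by auto
  have "0 \<le> prob (path_event \<pi>) * Phi (- 2) ^ K" using Phi_pos[of "-2"] by simp
  then show "prob (late_event K d \<pi>) \<le> prob (path_event \<pi>) * Phi (- 2) ^ K"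
    unfolding late_event_def using prob_path_passes(2)[OF _ assms off] by auto
qed

text \<open>A path is off in at most one direction: being off persists to the finest level, where
  both directions would put the minimizer on both sides. So the two directions do not cost a factor
  2. The path events are disjoint, and their probabilities sum to at most 1.\<close>

lemma prob_late:
  assumes q: "Phi (- 2) ^ K \<le> q" and K: "K \<ge> 1"
  shows "late K \<in> sets M" "prob (late K) \<le> q"
proof -
  let ?P = "Pi\<^sub>E {..J} (\<lambda>_. {1..int n + 1})"
  let ?E = "\<lambda>\<pi>. late_event K 1 \<pi> \<union> late_event K (-1) \<pi>"
  have fin: "finite ?P" by (intro finite_PiE) auto
  have E: "?E \<pi> \<in> sets M" for \<pi> using late_event_bounds(1) by auto
  show "late K \<in> sets M" unfolding late_def using fin E by (intro sets.finite_UN) auto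
  have one: "prob (?E \<pi>) \<le> prob (path_event \<pi>) * Phi (- 2) ^ K" for \<pi>
  proof (cases "late_event K 1 \<pi> = {}")
    case True
    then show ?thesis using late_event_bounds(2)[of "-1" K \<pi>] by simp
  next
    case False
    have "late_event K (-1) \<pi> = {}"
    proof (rule ccontr)
      assume "\<not> ?thesis"
      with False have *: "path_steps \<pi>" "\<exists>j. off 1 (\<pi> j) j" "first_off 1 \<pi> + K \<le> J"
        "\<exists>j. off (-1) (\<pi> j) j" "first_off (-1) \<pi> + K \<le> J"
        by (auto simp: late_event_def split: if_splits)
      then have "off 1 (\<pi> J) J" "off (-1) (\<pi> J) J" using first_off_persists[OF *(1)] by auto
      then have "real_of_int (\<pi> J + 6) - 1 \<le> nZ" "nZ \<le> real_of_int (\<pi> J - 7)"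
        unfolding off_left off_right by simp_all
      then show False by simp
    qed
    then show ?thesis using late_event_bounds(2)[of 1 K \<pi>] by simp
  qed
  have "prob (late K) \<le> (\<Sum>\<pi>\<in>?P. prob (?E \<pi>))"
    unfolding late_def using fin E by (intro finite_measure_subadditive_finite) auto
  also have "\<dots> \<le> (\<Sum>\<pi>\<in>?P. prob (path_event \<pi>) * q)"
    using q by (intro sum_mono order_trans[OF one] mult_left_mono) auto
  also have "\<dots> = (\<Sum>\<pi>\<in>?P. prob (path_event \<pi>)) * q" by (simp add: sum_distrib_right)
  also have "\<dots> \<le> 1 * q"
  proof (rule mult_right_mono)
    have "disjoint_family_on path_event ?P"
      unfolding disjoint_family_on_def
    proof (intro ballI impI)
      fix \<pi> \<pi>' assume \<pi>: "\<pi> \<in> ?P" "\<pi>' \<in> ?P" "\<pi> \<noteq> \<pi>'"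
      then obtain j where "j \<le> J" "\<pi> j \<noteq> \<pi>' j" using PiE_ext[OF \<pi>(1,2)] by auto
      then show "path_event \<pi> \<inter> path_event \<pi>' = {}" by (auto simp: path_event_def)
    qed
    then have "(\<Sum>\<pi>\<in>?P. prob (path_event \<pi>)) = prob (\<Union>\<pi>\<in>?P. path_event \<pi>)"
      using fin by (intro finite_measure_finite_Union[symmetric]) auto
    then show "(\<Sum>\<pi>\<in>?P. prob (path_event \<pi>)) \<le> 1" by simp
    show "0 \<le> q" using q Phi_pos[of "-2"] by (meson less_imp_le order_trans zero_le_power)
  qed
  finally show "prob (late K) \<le> q" by simp
qed

text \<open>The only block of level 0 is never off. If the path is off for the first time at level
  \<open>j1\<close>, then reaching \<open>j1 + K\<close> without a stop takes K passes in a row,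
  which is membership in \<open>late K\<close>. Hence \<open>j1 - 1\<close>, the last level known
  not to be off, is at most K levels above \<open>j\<close>.\<close>

lemma not_late_distance:
  assumes \<omega>: "\<omega> \<in> space M" "\<omega> \<notin> late K" and d: "d = 1 \<or> d = -1" and K: "K \<ge> 1"
    and j: "j \<le> J" "\<And>l. l < j \<Longrightarrow> \<not> level_stops n \<sigma> \<omega> l"
  shows "\<exists>j0 k. j0 + k = j \<and> k \<le> K \<and> \<not> off d (loc \<omega> j0) j0"
proof (cases "\<exists>l\<le>j. off d (loc \<omega> l) l")
  case False
  then show ?thesis by (intro exI[of _ j] exI[of _ 0]) auto
next
  case True
  define j1 where "j1 = first_off d (loc \<omega>)"
  from True obtain l where l: "l \<le> j" "off d (loc \<omega> l) l" by blast
  then have j1: "j1 \<le> l" "off d (loc \<omega> j1) j1" unfolding j1_def first_off_def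
    by (auto intro: Least_le LeastI)
  have not0: "\<not> off d (loc \<omega> 0) 0"
  proof
    have J: "real (n + 1) < real (2 ^ Suc J)" using max_level_bounds(2)[of n] by (simp only: of_nat_less_iff)
    assume "off d (loc \<omega> 0) 0"
    then show False using d nZ_bounds J by (auto simp: off_right off_left)
  qed
  then obtain j0 where j0: "j1 = Suc j0" using j1(2) by (cases j1) auto
  have n0: "\<not> off d (loc \<omega> j0) j0"
    using j0 not_less_Least[of j0 "\<lambda>j. off d (loc \<omega> j) j"] by (auto simp: j1_def first_off_def)
  have "j < j1 + K"
  proof (rule ccontr)
    assume "\<not> ?thesis"
    then have le: "j1 + K \<le> j" by simp
    define \<pi> where "\<pi> = restrict (loc \<omega>) {..J}"
    have \<pi>j: "\<pi> l = loc \<omega> l" if "l \<le> J" for l using that by (simp add: \<pi>_def)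
    have steps: "path_steps \<pi>" using path_steps_loc[of \<omega>] by (simp add: path_steps_def \<pi>j)
    have fo: "first_off d \<pi> = j1"
      unfolding first_off_def
    proof (rule Least_equality)
      show "off d (\<pi> j1) j1" using j1 l j by (simp add: \<pi>j)
      fix m assume m: "off d (\<pi> m) m"
      show "j1 \<le> m"
      proof (rule ccontr)
        assume "\<not> j1 \<le> m"
        then have "m < j1" by simp
        then have "off d (loc \<omega> m) m" using m j1 l j by (simp add: \<pi>j)
        then show False using not_less_Least \<open>m < j1\<close> unfolding j1_def first_off_def by blast
      qed
    qed
    have ex: "\<exists>j. off d (\<pi> j) j" using j1 l j by (intro exI[of _ j1]) (simp add: \<pi>j)
    have mem: "\<pi> \<in> Pi\<^sub>E {..J} (\<lambda>_. {1..int n + 1})"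
    proof (rule PiE_I)
      fix l assume "l \<in> {..J}"
      then have "1 \<le> \<pi> l" "\<pi> l * width n l \<le> int n + 1" using steps by (auto simp: path_steps_def in_sample_def)
      moreover have "\<pi> l * 1 \<le> \<pi> l * width n l" using \<open>1 \<le> \<pi> l\<close> by (intro mult_left_mono) auto
      ultimately have "\<pi> l * 1 \<le> int n + 1" by linarith
      then show "\<pi> l \<in> {1..int n + 1}" using \<open>1 \<le> \<pi> l\<close> by simp
    qed (simp add: \<pi>_def)
    have "passes d \<pi> l \<omega>" if "l \<in> {j1..<j1 + K}" for l
    proof -
      have lJ: "l \<le> J" "l < j" using that le j by auto
      have "off d (\<pi> l) l"
        by (rule first_off_persists[OF steps d]) (use fo ex that lJ in \<open>auto simp: first_off_def intro: LeastI_ex\<close>)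
      then show ?thesis
        unfolding passes_def \<pi>j[OF lJ(1)] using lJ j by (intro off_not_stops d) auto
    qed
    then have "\<omega> \<in> late_event K d \<pi>"
      unfolding late_event_def fo using steps ex le j \<omega> by (auto simp: path_event_def \<pi>j)
    then have "\<omega> \<in> late K" unfolding late_def using mem d by auto
    then show False using \<omega> by simp
  qed
  then show ?thesis using n0 j0 j1 l by (intro exI[of _ j0] exI[of _ "j - j0"]) auto
qed

text \<open>The 8 is the offset in \<open>off\<close> plus the drift in \<open>path_range\<close>: 6
  + 2 on one side, 7 + 1 on the other. The window of the procedure has 12 in its place, which leaves
  a margin of \<open>4 * 2 ^ K\<close> blocks.\<close>

lemma not_late_localized:
  assumes \<omega>: "\<omega> \<in> space M" "\<omega> \<notin> late K" and K: "K \<ge> 1"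
    and j: "j \<le> J" "\<And>l. l < j \<Longrightarrow> \<not> level_stops n \<sigma> \<omega> l"
  shows "of_int ((loc \<omega> j + 1 - 8 * 2 ^ K) * width n j) < nZ"
    and "nZ < of_int ((loc \<omega> j - 2 + 8 * 2 ^ K) * width n j)"
proof -
  have mono: "real_of_int (x * width n j) \<le> of_int (y * width n j)" if "x \<le> y" for x y :: int
    using that by (simp only: of_int_le_iff) (intro mult_right_mono, auto)
  have pw: "(2::int) ^ k \<le> 2 ^ K" if "k \<le> K" for k using that by (intro power_increasing) auto
  obtain j0 k where k: "j0 + k = j" "k \<le> K" "\<not> off 1 (loc \<omega> j0) j0"
    using not_late_distance[OF \<omega> _ K j, of 1] by auto
  have w: "width n j0 = 2 ^ k * width n j" using width_add[of j0 k] k j by simp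
  have "(loc \<omega> j0 + 6) * 2 ^ k = (loc \<omega> j0 - 2) * 2 ^ k + 8 * 2 ^ k" by (simp add: algebra_simps)
  also have "\<dots> \<le> loc \<omega> j - 2 + 8 * 2 ^ K"
    using path_range(1)[OF path_steps_loc, of j0 k \<omega>, unfolded k(1), OF j(1)] pw[OF k(2)] by linarith
  finally have "real_of_int ((loc \<omega> j0 + 6) * 2 ^ k * width n j) \<le> of_int ((loc \<omega> j - 2 + 8 * 2 ^ K) * width n j)"
    by (rule mono)
  moreover have "nZ < of_int ((loc \<omega> j0 + 6) * 2 ^ k * width n j)"
    using k(3) w unfolding off_right by (simp add: mult.assoc)
  ultimately show "nZ < of_int ((loc \<omega> j - 2 + 8 * 2 ^ K) * width n j)" by linarith
  obtain j0 k where k: "j0 + k = j" "k \<le> K" "\<not> off (-1) (loc \<omega> j0) j0"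
    using not_late_distance[OF \<omega> _ K j, of "-1"] by auto
  have w: "width n j0 = 2 ^ k * width n j" using width_add[of j0 k] k j by simp
  have "loc \<omega> j + 1 - 8 * 2 ^ K \<le> (loc \<omega> j0 + 1) * 2 ^ k - 8 * 2 ^ k"
    using path_range(2)[OF path_steps_loc, of j0 k \<omega>, unfolded k(1), OF j(1)] pw[OF k(2)] by linarith
  also have "\<dots> = (loc \<omega> j0 - 7) * 2 ^ k" by (simp add: algebra_simps)
  finally have "real_of_int ((loc \<omega> j + 1 - 8 * 2 ^ K) * width n j) \<le> of_int ((loc \<omega> j0 - 7) * 2 ^ k * width n j)"
    by (rule mono)
  moreover have "of_int ((loc \<omega> j0 - 7) * 2 ^ k * width n j) < nZ"
    using k(3) w unfolding off_left by (simp add: mult.assoc not_le)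
  ultimately show "of_int ((loc \<omega> j + 1 - 8 * 2 ^ K) * width n j) < nZ" by linarith
qed

end

section \<open>Coverage\<close>

lemma extend_nat: "extend n u (int k) = (if k \<le> n then ereal (u k) else \<infinity>)"
  by (simp add: extend_def)


lemma ratio_real:
  assumes "N > 0" "u - v + c > 0"
  shows "ratio (ereal x - ereal y + ereal c) (ereal N * (ereal u - ereal v + ereal c)) = (x - y + c) / (N * (u - v + c))"
  using assms by (simp add: ratio_def)

lemma ratio_infinity:
  assumes "N > 0"
  shows "ratio (ereal x - ereal y + ereal c) (ereal N * (\<infinity> - ereal v + ereal c)) = 0"
  using assms by (simp add: ratio_def)

context convex_regression
begin

lemma value_at_min: "f (minimizer f) \<le> a k" if "k \<le> n" for k
  unfolding a_def using n1 that by (intro minimizer_le[OF f_class]) auto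

lemma convex_f: "convex_on {0..1} f"
  using f_class by (simp add: convex_class_def)

lemma scale_right: "real n * ((y / real n - x) * b) = (y - real n * x) * b"
proof -
  have "real n * ((y / real n - x) * b) = (real n * (y / real n) - real n * x) * b" by (simp only: right_diff_distrib left_diff_distrib mult.assoc)
  then show ?thesis using n1 by simp
qed

lemma scale_left: "real n * ((x - y / real n) * b) = (real n * x - y) * b"
proof -
  have "real n * ((x - y / real n) * b) = (real n * x - real n * (y / real n)) * b" by (simp only: right_diff_distrib left_diff_distrib mult.assoc)
  then show ?thesis using n1 by simp
qed

text \<open>The value at the minimizer lies between the extrapolated chord of the next cell and the grid
  values.\<close>

lemma extrapolate_right:
  assumes m: "real m \<le> nZ" "nZ \<le> real m + 1" "m + 2 \<le> n"
  shows "- ((a (m + 2) - a (m + 1)) * (real m + 1 - nZ)) \<le> a m - a (m + 1)"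
proof -
  let ?Z = "minimizer f"
  have n: "real n > 0" using n1 by simp
  have "(real (m + 2) / real n - ?Z) * f (real (m + 1) / real n)
      \<le> (real (m + 2) / real n - real (m + 1) / real n) * f ?Z + (real (m + 1) / real n - ?Z) * f (real (m + 2) / real n)"
    by (rule convex_on_three_points[OF convex_f])
      (use m n nZ_bounds in \<open>auto simp: minimizer_eq divide_right_mono\<close>)
  then have "real n * ((real (m + 2) / real n - ?Z) * a (m + 1))
      \<le> real n * ((real (m + 2) / real n - real (m + 1) / real n) * f ?Z + (real (m + 1) / real n - ?Z) * a (m + 2))"
    unfolding a_def using n by (intro mult_left_mono) auto
  moreover have "real n * ((real (m + 2) / real n - ?Z) * a (m + 1)) = (real m + 2 - nZ) * a (m + 1)"
    unfolding scale_right by (simp add: nZ_def)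
  moreover have "real n * ((real (m + 2) / real n - real (m + 1) / real n) * f ?Z + (real (m + 1) / real n - ?Z) * a (m + 2))
      = f ?Z + (real m + 1 - nZ) * a (m + 2)"
    unfolding distrib_left scale_right using n by (simp add: nZ_def)
  ultimately have "(real m + 2 - nZ) * a (m + 1) \<le> f ?Z + (real m + 1 - nZ) * a (m + 2)" by (simp only:)
  moreover have "f ?Z \<le> a m" using value_at_min m by simp
  ultimately show ?thesis by (simp add: algebra_simps)
qed

lemma extrapolate_left:
  assumes m: "real m \<le> nZ" "nZ \<le> real m + 1" "m + 1 \<le> n" "m \<ge> 1"
  shows "- ((a (m - 1) - a m) * (nZ - real m)) \<le> a (m + 1) - a m"
proof -
  let ?Z = "minimizer f"
  have n: "real n > 0" using n1 by simp
  have "(?Z - real (m - 1) / real n) * f (real m / real n)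
      \<le> (?Z - real m / real n) * f (real (m - 1) / real n) + (real m / real n - real (m - 1) / real n) * f ?Z"
    by (rule convex_on_three_points[OF convex_f])
      (use m n nZ_bounds in \<open>auto simp: minimizer_eq divide_right_mono\<close>)
  then have "real n * ((?Z - real (m - 1) / real n) * a m)
      \<le> real n * ((?Z - real m / real n) * a (m - 1) + (real m / real n - real (m - 1) / real n) * f ?Z)"
    unfolding a_def using n by (intro mult_left_mono) auto
  moreover have "real n * ((?Z - real (m - 1) / real n) * a m) = (nZ - real m + 1) * a m"
    unfolding scale_left using m by (simp add: nZ_def of_nat_diff)
  moreover have "real n * ((?Z - real m / real n) * a (m - 1) + (real m / real n - real (m - 1) / real n) * f ?Z)
      = (nZ - real m) * a (m - 1) + f ?Z"
    unfolding distrib_left scale_left using n m by (simp add: nZ_def of_nat_diff)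
  ultimately have "(nZ - real m + 1) * a m \<le> (nZ - real m) * a (m - 1) + f ?Z" by (simp only:)
  moreover have "f ?Z \<le> a (m + 1)" using value_at_min m by simp
  ultimately show ?thesis by (simp add: algebra_simps)
qed

text \<open>The true differences \<open>x\<close> and \<open>y\<close> are overestimated by
  \<open>B\<close> and \<open>D\<close>. Since the bound is nonpositive, enlarging the numerator and
  enlarging the denominator both go in the safe direction.\<close>

lemma ratio_ge:
  fixes B D s x y :: real
  assumes "x < B" "y < D" "0 \<le> y" "0 \<le> s" "- (y * s) \<le> x"
  shows "- s \<le> B / D"
proof -
  have "y * s \<le> D * s" using assms by (intro mult_right_mono) auto
  then have "- s * D \<le> B" using assms by (simp add: mult.commute)
  then show ?thesis using assms by (simp add: pos_le_divide_eq)
qed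

text \<open>The differences of \<open>q\<close> that have to be controlled if the minimizer lies in
  cell \<open>m\<close>. Near the ends of the grid some of them leave the sample, or become trivial
  through truncated subtraction; the side conditions discard these.\<close>

definition fine_pairs :: "nat \<Rightarrow> (nat \<times> nat) set" where
  "fine_pairs m = {(k, l) \<in> {(m, m + 1), (m + 2, m + 1), (m + 3, m + 2), (m + 1, m), (m - 1, m), (m - 2, m - 1)}.
     k \<le> n \<and> l \<le> n \<and> k \<noteq> l}"

text \<open>Where an end point is computed by extrapolation into cell \<open>m\<close>, the slack
  \<open>c\<close> pushes it outwards past the minimizer; where it falls into a neighbouring cell,
  clipping keeps it outside cell \<open>m\<close>. The distance 4 from the window boundary excludes
  the boundary branches unless the window ends at the end of the sample.\<close>

lemma fine_covers:
  assumes m: "real m \<le> nZ" "nZ \<le> real m + 1" "m + 1 \<le> n"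
    and Q: "\<And>k l. (k, l) \<in> fine_pairs m \<Longrightarrow> a k - a l < qv k - qv l + c"
    and L: "0 \<le> L" "L = 0 \<or> L + 4 \<le> int m" and U: "U \<le> int n" "U = int n \<or> int m + 4 \<le> U"
    and il: "il \<le> U" "il \<le> int m + 1" and ir: "L - 1 \<le> ir" "int m - 1 \<le> ir"
  defines "e \<equiv> fine_endpoints n c L U il ir (extend n qv)"
  shows "fst e \<le> nZ / real n" "nZ / real n \<le> snd e"
proof -
  let ?q = "extend n qv" and ?N = "real n"
  have N: "?N > 0" using n1 by simp
  have Lm: "L \<le> int m" using L by auto
  have Um: "int m + 1 \<le> U" using U m by auto
  have up: "a (m + 1) \<le> a (m + 2)" if "m + 2 \<le> n" using a_right[of "m + 1" "m + 2"] that m by simp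
  have up2: "a (m + 2) \<le> a (m + 3)" if "m + 3 \<le> n" using a_right[of "m + 2" "m + 3"] that m by simp
  have dn: "a m \<le> a (m - 1)" using a_left[of "m - 1" m] m by simp
  have dn2: "a (m - 1) \<le> a (m - 2)" using a_left[of "m - 2" "m - 1"] m by simp
  have rr: "- (real m + 1 - nZ) \<le> (qv m - qv (m + 1) + c) / (qv (m + 2) - qv (m + 1) + c)"
    "0 < qv (m + 2) - qv (m + 1) + c" if "m + 2 \<le> n"
  proof -
    have 1: "a m - a (m + 1) < qv m - qv (m + 1) + c" "a (m + 2) - a (m + 1) < qv (m + 2) - qv (m + 1) + c"
      using that by (auto intro!: Q simp: fine_pairs_def)
    show "0 < qv (m + 2) - qv (m + 1) + c" using 1 up[OF that] by simp
    show "- (real m + 1 - nZ) \<le> (qv m - qv (m + 1) + c) / (qv (m + 2) - qv (m + 1) + c)"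
      by (rule ratio_ge[OF 1 _ _ extrapolate_right[OF m(1,2) that]]) (use up[OF that] m in auto)
  qed
  have ll: "- (nZ - real m) \<le> (qv (m + 1) - qv m + c) / (qv (m - 1) - qv m + c)"
    "0 < qv (m - 1) - qv m + c" if "m \<ge> 1"
  proof -
    have 1: "a (m + 1) - a m < qv (m + 1) - qv m + c" "a (m - 1) - a m < qv (m - 1) - qv m + c"
      using that m by (auto intro!: Q simp: fine_pairs_def)
    show "0 < qv (m - 1) - qv m + c" using 1 dn by simp
    show "- (nZ - real m) \<le> (qv (m + 1) - qv m + c) / (qv (m - 1) - qv m + c)"
      by (rule ratio_ge[OF 1 _ _ extrapolate_left[OF m that]]) (use dn m in auto)
  qed
  define ilo where "ilo = max (il - 1) L"
  define ihi where "ihi = min (ir + 2) U"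
  have lo: "0 \<le> ilo" "ilo \<le> int m" using il Lm L by (auto simp: ilo_def)
  have hi: "ihi \<le> int n" "int m + 1 \<le> ihi" using ir Um U by (auto simp: ihi_def)
  have nat2: "?q 2 = ?q (int 2)" "?q 1 = ?q (int 1)" "?q 0 = ?q (int 0)" by simp_all
  have le_div: "x / ?N \<le> nZ / ?N \<longleftrightarrow> x \<le> nZ" "nZ / ?N \<le> x / ?N \<longleftrightarrow> nZ \<le> x" for x
    using N by (simp_all add: divide_le_cancel)
  have "fst e \<le> nZ / ?N \<and> nZ / ?N \<le> snd e"
  proof -
    consider (left) "ir = L - 1" | (right) "ir \<noteq> L - 1" "il = U"
      | (full) "ir \<noteq> L - 1" "il \<noteq> U" "ihi - ilo \<ge> 3 \<or> (ihi - int n) * ilo = 0"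
      | (inner) "ir \<noteq> L - 1" "il \<noteq> U" "\<not> (ihi - ilo \<ge> 3 \<or> (ihi - int n) * ilo = 0)" by blast
    then show ?thesis
    proof cases
      case left
      \<comment> \<open>From m - 1 \<le> ir = L - 1 the window starts at or after \<open>m\<close>,
        which is possible only if L = 0.\<close>
      then have m0: "m = 0" "ir = -1" using ir L by auto
      show ?thesis
      proof (cases "2 \<le> n")
        case True
        have q: "?q 2 = ereal (qv 2)" "?q 1 = ereal (qv 1)" "?q 0 = ereal (qv 0)"
          unfolding nat2 extend_nat using True by auto
        have D: "0 < qv 2 - qv 1 + c" using rr(2) True m0 by (simp add: numeral_2_eq_2)
        have e: "e = (0, min (max ((qv 0 - qv 1 + c) / (?N * (qv 2 - qv 1 + c)) + 1 / ?N) 0) (1 / ?N))"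
          unfolding e_def fine_endpoints_def Let_def q ratio_real[OF N D] using left m0 D by simp
        have "nZ \<le> (qv 0 - qv 1 + c) / (qv 2 - qv 1 + c) + 1" using rr(1) True m0 by (simp add: numeral_2_eq_2)
        then have "nZ / ?N \<le> ((qv 0 - qv 1 + c) / (qv 2 - qv 1 + c) + 1) / ?N" by (simp only: le_div)
        then have "nZ / ?N \<le> (qv 0 - qv 1 + c) / (?N * (qv 2 - qv 1 + c)) + 1 / ?N"
          by (simp add: add_divide_distrib mult.commute)
        moreover have "nZ / ?N \<le> 1 / ?N" unfolding le_div using m m0 by simp
        ultimately show ?thesis unfolding e using nZ_bounds N by simp
      next
        case False
        \<comment> \<open>Here n = 1. The grid point 2 does not exist, the denominator is infinite
          and the ratio counts as 0, so the interval is the whole cell.\<close>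
        have q: "?q 2 = \<infinity>" "?q 1 = ereal (qv 1)" "?q 0 = ereal (qv 0)"
          unfolding nat2 extend_nat using False m by auto
        have e: "e = (0, min (max (0 + 1 / ?N) 0) (1 / ?N))"
          unfolding e_def fine_endpoints_def Let_def q ratio_infinity[OF N] using left m0 by simp
        have "nZ / ?N \<le> 1 / ?N" unfolding le_div using m m0 by simp
        then show ?thesis unfolding e using nZ_bounds N by simp
      qed
    next
      case right
      then have U': "U = int n" and mn: "m + 1 = n" using il U m by auto
      have i: "int n - 1 = int m" "int n = int (m + 1)" using mn by simp_all
      have f: "(?N - 1) / ?N \<le> nZ / ?N" unfolding le_div using m mn by simp
      have z1: "nZ / ?N \<le> 1" using nZ_bounds N by simp
      show ?thesis
      proof (cases "m \<ge> 1")
        case True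
        then have i2: "int n - 2 = int (m - 1)" using mn by (simp add: of_nat_diff)
        have q1: "?q (int n - 2) = ereal (qv (m - 1))" unfolding i2 extend_nat using mn by simp
        have q2: "?q (int n - 1) = ereal (qv m)" unfolding i(1) extend_nat using mn by simp
        have q3: "?q (int n) = ereal (qv (m + 1))" unfolding extend_nat mn by simp
        note q = q1 q2 q3
        note D = ll(2)[OF True]
        have e: "e = (min (max (- ((qv (m + 1) - qv m + c) / (?N * (qv (m - 1) - qv m + c))) + (?N - 1) / ?N) ((?N - 1) / ?N)) 1, 1)"
          unfolding e_def fine_endpoints_def Let_def q ratio_real[OF N D] using right U' D by simp
        have "- ((qv (m + 1) - qv m + c) / (qv (m - 1) - qv m + c)) + real m \<le> nZ" using ll(1)[OF True] by simp
        then have "(- ((qv (m + 1) - qv m + c) / (qv (m - 1) - qv m + c)) + real m) / ?N \<le> nZ / ?N" by (simp only: le_div)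
        moreover have "real m = ?N - 1" using mn by simp
        ultimately have "- ((qv (m + 1) - qv m + c) / (?N * (qv (m - 1) - qv m + c))) + (?N - 1) / ?N \<le> nZ / ?N"
          by (simp add: add_divide_distrib diff_divide_distrib mult.commute)
        then show ?thesis unfolding e using f z1 by (simp add: min_le_iff_disj)
      next
        case False
        then have n: "n = 1" using mn by simp
        have q: "?q (int n - 2) = \<infinity>" "?q (int n - 1) = ereal (qv 0)" "?q (int n) = ereal (qv 1)"
          using n by (simp_all add: extend_def)
        have e: "e = (min (max (- 0 + (?N - 1) / ?N) ((?N - 1) / ?N)) 1, 1)"
          unfolding e_def fine_endpoints_def Let_def q ratio_infinity[OF N] using right U' by simp
        show ?thesis unfolding e using f z1 by (simp add: min_le_iff_disj)
      qed
    next
      case full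
      have e: "e = (of_int ilo / ?N, of_int ihi / ?N)"
        unfolding e_def fine_endpoints_def Let_def using full unfolding ilo_def ihi_def by simp
      have "real_of_int ilo \<le> nZ" using lo m by linarith
      moreover have "nZ \<le> real_of_int ihi" using hi m by linarith
      ultimately show ?thesis unfolding e fst_conv snd_conv le_div by simp
    next
      case inner
      then have nz: "ihi \<noteq> int n" "ilo \<noteq> 0" by auto
      define h where "h = nat ihi"
      define l where "l = nat ilo"
      have hl: "ihi = int h" "ilo = int l" using lo hi by (auto simp: h_def l_def)
      \<comment> \<open>The bracket has length at most 2 and contains cell \<open>m\<close>, so it
        exceeds the cell by at most one grid step in total.\<close>
      have hm: "h = m + 1 \<or> h = m + 2" and lm: "l = m \<or> l + 1 = m" and b: "h + 1 \<le> n" "1 \<le> l" "h \<ge> 1"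
        using inner lo hi nz unfolding hl by auto
      have Dh: "0 < qv (h + 1) - qv h + c"
        using hm
      proof
        assume "h = m + 1" then show ?thesis using rr(2) b by simp
      next
        assume h: "h = m + 2"
        have "a (m + 3) - a (m + 2) < qv (m + 3) - qv (m + 2) + c"
          using b h by (intro Q) (auto simp: fine_pairs_def)
        then have "0 < qv (m + 3) - qv (m + 2) + c" using up2 b h by simp
        then show ?thesis using h by (simp add: numeral_3_eq_3)
      qed
      have Dl: "0 < qv (l - 1) - qv l + c"
        using lm
      proof
        assume "l = m" then show ?thesis using ll(2) b by simp
      next
        assume l: "l + 1 = m"
        then have l': "l = m - 1" "l - 1 = m - 2" by auto
        have "a (m - 2) - a (m - 1) < qv (m - 2) - qv (m - 1) + c"
          using b l m by (intro Q) (auto simp: fine_pairs_def)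
        then show ?thesis using dn2 l' by simp
      qed
      have ints: "int h + 1 = int (h + 1)" "int h - 1 = int (h - 1)" "int l + 1 = int (l + 1)" "int l - 1 = int (l - 1)"
        using b by (auto simp: of_nat_diff)
      have q: "?q (int (h + 1)) = ereal (qv (h + 1))" "?q (int h) = ereal (qv h)" "?q (int (h - 1)) = ereal (qv (h - 1))"
        "?q (int (l + 1)) = ereal (qv (l + 1))" "?q (int l) = ereal (qv l)" "?q (int (l - 1)) = ereal (qv (l - 1))"
        unfolding extend_nat using b hm lm m by auto
      have not: "\<not> (ereal (qv (h + 1)) - ereal (qv h) \<le> - ereal c \<or> ereal (qv (l - 1)) - ereal (qv l) \<le> - ereal c)"
        using Dh Dl by simp
      have e: "e = (min (max (- ((qv (l + 1) - qv l + c) / (?N * (qv (l - 1) - qv l + c))) + real l / ?N) (real l / ?N)) (real (l + 1) / ?N),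
          min (max ((qv (h - 1) - qv h + c) / (?N * (qv (h + 1) - qv h + c)) + real h / ?N) (real (h - 1) / ?N)) (real h / ?N))"
      proof -
        have "e = (if ereal (qv (h + 1)) - ereal (qv h) \<le> - ereal c \<or> ereal (qv (l - 1)) - ereal (qv l) \<le> - ereal c
          then (of_int (ihi + ilo) / (2 * ?N), of_int (ihi + ilo) / (2 * ?N))
          else (min (max (- ratio (?q (ilo + 1) - ?q ilo + c) (?N * (?q (ilo - 1) - ?q ilo + c))
                      + of_int ilo / ?N) (of_int ilo / ?N)) (of_int (ilo + 1) / ?N),
            min (max (ratio (?q (ihi - 1) - ?q ihi + c) (?N * (?q (ihi + 1) - ?q ihi + c))
                      + of_int ihi / ?N) (of_int (ihi - 1) / ?N)) (of_int ihi / ?N)))"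
          unfolding e_def fine_endpoints_def Let_def ilo_def[symmetric] ihi_def[symmetric]
          using inner unfolding hl ints q by simp
        then show ?thesis unfolding if_not_P[OF not] hl ints q ratio_real[OF N Dh] ratio_real[OF N Dl]
          by (simp only: of_int_of_nat_eq)
      qed
      have lo': "fst e \<le> nZ / ?N"
      proof (cases "l = m")
        case True
        have "- ((qv (m + 1) - qv m + c) / (qv (m - 1) - qv m + c)) + real m \<le> nZ" using ll(1) b True by simp
        then have "(- ((qv (m + 1) - qv m + c) / (qv (m - 1) - qv m + c)) + real m) / ?N \<le> nZ / ?N" by (simp only: le_div)
        then have "- ((qv (l + 1) - qv l + c) / (?N * (qv (l - 1) - qv l + c))) + real l / ?N \<le> nZ / ?N"
          using True by (simp add: add_divide_distrib diff_divide_distrib mult.commute)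
        moreover have "real l / ?N \<le> nZ / ?N" unfolding le_div using True m by simp
        ultimately show ?thesis unfolding e by (simp add: min_le_iff_disj)
      next
        case False
        then have "real (l + 1) / ?N \<le> nZ / ?N" unfolding le_div using lm m by auto
        then show ?thesis unfolding e fst_conv by (rule min.coboundedI2)
      qed
      have hi': "nZ / ?N \<le> snd e"
      proof (cases "h = m + 1")
        case True
        have "nZ \<le> (qv m - qv (m + 1) + c) / (qv (m + 2) - qv (m + 1) + c) + real (m + 1)" using rr(1) b True by simp
        then have "nZ / ?N \<le> ((qv m - qv (m + 1) + c) / (qv (m + 2) - qv (m + 1) + c) + real (m + 1)) / ?N" by (simp only: le_div)
        moreover have "h - 1 = m" "h + 1 = m + 2" using True by auto
        ultimately have "nZ / ?N \<le> (qv (h - 1) - qv h + c) / (?N * (qv (h + 1) - qv h + c)) + real h / ?N"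
          using True by (simp add: add_divide_distrib mult.commute)
        moreover have "nZ / ?N \<le> real h / ?N" unfolding le_div using True m by simp
        ultimately show ?thesis unfolding e by (simp add: le_max_iff_disj)
      next
        case False
        then have "nZ / ?N \<le> real (h - 1) / ?N" "nZ / ?N \<le> real h / ?N" unfolding le_div using hm m by auto
        then show ?thesis unfolding e by (simp add: le_max_iff_disj)
      qed
      show ?thesis using lo' hi' by blast
    qed
  qed
  then show "fst e \<le> nZ / ?N" "nZ / ?N \<le> snd e" by auto
qed

end

section \<open>Exceptional events of the samples \<open>p\<close> and \<open>q\<close>, and the
  coverage probability\<close>

context convex_regression
begin


text \<open>Blocks of the finest level are single grid points, so the statements about block
  differences also serve for pairs of observations.\<close>

lemma block_noise_finest: "block_noise u J (int k + 1) (int l + 1) \<omega> = noi (u, k) \<omega> - noi (u, l) \<omega>"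
proof -
  have "block n J (int k + 1) = {k}" for k by (simp add: block_def)
  then show ?thesis by (simp add: block_noise_def)
qed

lemma in_sample_finest: "in_sample n J (int k + 1) \<longleftrightarrow> k \<le> n"
  by (simp add: in_sample_def)

lemma pair_noise_tail:
  assumes "u \<le> 3" "k \<le> n" "l \<le> n" "k \<noteq> l"
  shows "{\<omega> \<in> space M. noi (u, k) \<omega> - noi (u, l) \<omega> > t * sqrt 2} \<in> sets M"
    "prob {\<omega> \<in> space M. noi (u, k) \<omega> - noi (u, l) \<omega> > t * sqrt 2} = 1 - Phi t"
proof -
  have s: "in_sample n J (int k + 1)" "in_sample n J (int l + 1)" "int k + 1 \<noteq> int l + 1"
    using assms by (auto simp: in_sample_finest)
  have [measurable]: "(\<lambda>\<omega>. noi (u, k) \<omega> - noi (u, l) \<omega>) \<in> borel_measurable M"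
    using block_noise_measurable[OF assms(1) s(1,2)] by (simp add: block_noise_finest[abs_def])
  show "{\<omega> \<in> space M. noi (u, k) \<omega> - noi (u, l) \<omega> > t * sqrt 2} \<in> sets M" by measurable
  show "prob {\<omega> \<in> space M. noi (u, k) \<omega> - noi (u, l) \<omega> > t * sqrt 2} = 1 - Phi t"
    using block_noise_tail[OF assms(1) s, of t] by (simp add: block_noise_finest)
qed

text \<open>The cap assigns a minimizer at the right end of the unit interval to the last
  cell.\<close>

definition cell :: nat where
  "cell = min (nat \<lfloor>nZ\<rfloor>) (n - 1)"

lemma cell: "real cell \<le> nZ" "nZ \<le> real cell + 1" "cell + 1 \<le> n"
proof -
  have "real (nat \<lfloor>nZ\<rfloor>) \<le> nZ" "nZ < real (nat \<lfloor>nZ\<rfloor>) + 1" using nZ_bounds by linarith+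
  then show "real cell \<le> nZ" "nZ \<le> real cell + 1" "cell + 1 \<le> n"
    using nZ_bounds n1 unfolding cell_def min_def
    by (cases "nat \<lfloor>nZ\<rfloor> \<le> n - 1"; simp add: of_nat_diff; linarith)+
qed

text \<open>One difference on each side of the cell suffices. There the true increment has a known
  sign, so without a large noise difference \<open>cell + 1\<close> is admissible for the left index
  and \<open>cell - 1\<close> for the right index.\<close>

definition p_bad :: "real \<Rightarrow> outcome set" where
  "p_bad t = (\<Union>(k, l)\<in>{(k, l) \<in> {(cell + 1, cell + 2), (cell, cell - 1)}. k \<le> n \<and> l \<le> n \<and> k \<noteq> l}.
     {\<omega> \<in> space M. noi (1, k) \<omega> - noi (1, l) \<omega> > t * sqrt 2})"

definition q_bad :: "real \<Rightarrow> outcome set" where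
  "q_bad t = (\<Union>(k, l)\<in>fine_pairs cell. {\<omega> \<in> space M. noi (3, l) \<omega> - noi (3, k) \<omega> > t * sqrt 2})"

lemma prob_pair_union:
  assumes P: "finite P" "card P \<le> N" "\<And>k l. (k, l) \<in> P \<Longrightarrow> k \<le> n \<and> l \<le> n \<and> k \<noteq> l" and u: "u \<le> 3"
    and t: "1 - Phi t = q"
  shows "(\<Union>(k, l)\<in>P. {\<omega> \<in> space M. noi (u, k) \<omega> - noi (u, l) \<omega> > t * sqrt 2}) \<in> sets M"
    "prob (\<Union>(k, l)\<in>P. {\<omega> \<in> space M. noi (u, k) \<omega> - noi (u, l) \<omega> > t * sqrt 2}) \<le> real N * q"
proof -
  let ?E = "\<lambda>(k, l). {\<omega> \<in> space M. noi (u, k) \<omega> - noi (u, l) \<omega> > t * sqrt 2}"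
  have E: "?E x \<in> sets M" "prob (?E x) = q" if "x \<in> P" for x
    using pair_noise_tail[OF u, of "fst x" "snd x" t] P(3)[of "fst x" "snd x"] that t by (auto simp: case_prod_beta')
  show "(\<Union>(k, l)\<in>P. {\<omega> \<in> space M. noi (u, k) \<omega> - noi (u, l) \<omega> > t * sqrt 2}) \<in> sets M"
    using P(1) E(1) by (intro sets.finite_UN) auto
  have "prob (\<Union>x\<in>P. ?E x) \<le> (\<Sum>x\<in>P. prob (?E x))"
    using P(1) E(1) by (intro finite_measure_subadditive_finite) auto
  also have "\<dots> = real (card P) * q" using E(2) by simp
  also have "\<dots> \<le> real N * q"
    using P(2) t prob_le_1 Phi_uminus[of t] Phi_pos[of "- t"] by (intro mult_right_mono) auto
  finally show "prob (\<Union>(k, l)\<in>P. {\<omega> \<in> space M. noi (u, k) \<omega> - noi (u, l) \<omega> > t * sqrt 2}) \<le> real N * q" .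
qed

lemma card_insert_le': "card (insert x A) \<le> Suc (card A)"
  by (cases "finite A") (auto simp: card_insert_if)

lemma prob_p_bad: "1 - Phi t = q \<Longrightarrow> p_bad t \<in> sets M \<and> prob (p_bad t) \<le> 2 * q"
proof -
  assume t: "1 - Phi t = q"
  let ?P = "{(k, l) \<in> {(cell + 1, cell + 2), (cell, cell - 1)}. k \<le> n \<and> l \<le> n \<and> k \<noteq> l}"
  have "card ?P \<le> card {(cell + 1, cell + 2), (cell, cell - 1)}" by (rule card_mono) auto
  also have "\<dots> \<le> 2" by (rule order_trans[OF card_insert_le']) simp
  finally have c: "card ?P \<le> 2" .
  have f: "finite ?P" by (rule finite_subset[of _ "{(cell + 1, cell + 2), (cell, cell - 1)}"]) auto
  show ?thesis unfolding p_bad_def using prob_pair_union[OF f c _ _ t, of 1] by auto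
qed

lemma prob_q_bad: "1 - Phi t = q \<Longrightarrow> q_bad t \<in> sets M \<and> prob (q_bad t) \<le> 6 * q"
proof -
  assume t: "1 - Phi t = q"
  let ?m = cell
  let ?A = "{(?m, ?m + 1), (?m + 2, ?m + 1), (?m + 3, ?m + 2), (?m + 1, ?m), (?m - 1, ?m), (?m - 2, ?m - 1)}"
  let ?P = "prod.swap ` fine_pairs ?m"
  have f: "finite (fine_pairs ?m)" by (rule finite_subset[of _ ?A]) (auto simp: fine_pairs_def)
  have "card ?P \<le> card (fine_pairs ?m)" using f by (rule card_image_le)
  also have "\<dots> \<le> card ?A" by (rule card_mono) (auto simp: fine_pairs_def)
  also have "\<dots> \<le> 6"
    by (rule order_trans[OF card_insert_le'] order_refl | simp add: card_insert_if)+
  finally have c: "card ?P \<le> 6" .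
  have "q_bad t = (\<Union>(k, l)\<in>?P. {\<omega> \<in> space M. noi (3, k) \<omega> - noi (3, l) \<omega> > t * sqrt 2})"
    unfolding q_bad_def by (simp add: case_prod_beta')
  then show ?thesis using prob_pair_union[OF finite_imageI[OF f] c _ _ t, of 3] by (auto simp: fine_pairs_def)
qed

lemma not_p_bad:
  assumes "\<omega> \<in> space M" "\<omega> \<notin> p_bad t"
  shows "cell + 2 \<le> n \<Longrightarrow> p_sample \<sigma> \<omega> (cell + 1) - p_sample \<sigma> \<omega> (cell + 2) \<le> 2 * sqrt 3 * \<sigma> * t"
    and "cell \<ge> 1 \<Longrightarrow> p_sample \<sigma> \<omega> (cell - 1) - p_sample \<sigma> \<omega> cell \<ge> - (2 * sqrt 3 * \<sigma> * t)"
proof -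
  have p: "p_sample \<sigma> \<omega> k - p_sample \<sigma> \<omega> l = a k - a l + sqrt 6 * \<sigma> * (noi (1, k) \<omega> - noi (1, l) \<omega>)" for k l
    unfolding p_sample_def p_noise[OF \<sigma>_pos, of \<omega> _ f n] a_def by (simp add: algebra_simps)
  have "sqrt 6 * sqrt 2 = sqrt (3 * 4)" by (simp add: real_sqrt_mult[symmetric])
  also have "\<dots> = 2 * sqrt 3" by (simp only: real_sqrt_mult) simp
  finally have s: "sqrt 6 * \<sigma> * (t * sqrt 2) = 2 * sqrt 3 * \<sigma> * t" by (simp add: mult_ac)
  have n: "sqrt 6 * \<sigma> * (noi (1, k) \<omega> - noi (1, l) \<omega>) \<le> 2 * sqrt 3 * \<sigma> * t"
    if "(k, l) \<in> {(cell + 1, cell + 2), (cell, cell - 1)}" "k \<le> n" "l \<le> n" "k \<noteq> l" for k l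
  proof -
    have "noi (1, k) \<omega> - noi (1, l) \<omega> \<le> t * sqrt 2" using assms that unfolding p_bad_def by fastforce
    then show ?thesis unfolding s[symmetric] using \<sigma>_pos by (intro mult_left_mono) auto
  qed
  show "p_sample \<sigma> \<omega> (cell + 1) - p_sample \<sigma> \<omega> (cell + 2) \<le> 2 * sqrt 3 * \<sigma> * t" if "cell + 2 \<le> n"
  proof -
    have "a (cell + 1) \<le> a (cell + 2)" using a_right[of "cell + 1" "cell + 2"] that cell by simp
    then show ?thesis using n[of "cell + 1" "cell + 2"] that unfolding p by auto
  qed
  show "p_sample \<sigma> \<omega> (cell - 1) - p_sample \<sigma> \<omega> cell \<ge> - (2 * sqrt 3 * \<sigma> * t)" if "cell \<ge> 1"
  proof -
    have "a cell \<le> a (cell - 1)" using a_left[of "cell - 1" cell] that cell by simp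
    moreover have "sqrt 6 * \<sigma> * (noi (1, cell - 1) \<omega> - noi (1, cell) \<omega>) = - (sqrt 6 * \<sigma> * (noi (1, cell) \<omega> - noi (1, cell - 1) \<omega>))"
      by (simp add: algebra_simps)
    moreover have "sqrt 6 * \<sigma> * (noi (1, cell) \<omega> - noi (1, cell - 1) \<omega>) \<le> 2 * sqrt 3 * \<sigma> * t"
      using n[of cell "cell - 1"] that cell by auto
    ultimately show ?thesis unfolding p by linarith
  qed
qed

text \<open>The noise is bounded by sqrt 6 * sqrt 2 * \<sigma> t, whereas the slack has 2 in place
  of sqrt 2. The excess makes the inequality strict, which keeps the denominators of the refined end
  points positive.\<close>

lemma not_q_bad:
  assumes "\<omega> \<in> space M" "\<omega> \<notin> q_bad t" "t > 0" "(k, l) \<in> fine_pairs cell"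
  shows "a k - a l < q_sample \<sigma> \<omega> k - q_sample \<sigma> \<omega> l + 2 * sqrt 6 * \<sigma> * t"
proof -
  have q: "q_sample \<sigma> \<omega> k - q_sample \<sigma> \<omega> l = a k - a l - sqrt 6 * \<sigma> * (noi (3, l) \<omega> - noi (3, k) \<omega>)"
    unfolding q_sample_def q_noise[OF \<sigma>_pos, of \<omega> _ f n] a_def by (simp add: algebra_simps)
  have "sqrt 2 < 2" using sqrt2_less_2 by simp
  have "noi (3, l) \<omega> - noi (3, k) \<omega> \<le> t * sqrt 2" using assms unfolding q_bad_def by fastforce
  also have "\<dots> < t * 2" using \<open>sqrt 2 < 2\<close> assms(3) by simp
  finally have "sqrt 6 * \<sigma> * (noi (3, l) \<omega> - noi (3, k) \<omega>) < sqrt 6 * \<sigma> * (t * 2)"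
    using \<sigma>_pos by simp
  then show ?thesis unfolding q by (simp add: algebra_simps)
qed

lemma covers:
  assumes \<alpha>: "0 < \<alpha>" "\<alpha> < 1" and \<omega>: "\<omega> \<in> space M" "\<omega> \<notin> late (nat (K_const (\<alpha> / 2)))"
    "\<omega> \<notin> p_bad (z_quantile (\<alpha> / 8))" "\<omega> \<notin> q_bad (z_quantile (\<alpha> / 24))"
  shows "minimizer f \<in> {fst (CI_z n \<sigma> \<alpha> \<omega>)..snd (CI_z n \<sigma> \<alpha> \<omega>)}"
proof -
  define K where "K = nat (K_const (\<alpha> / 2))"
  have K: "K \<ge> 1" using K_const_power(1)[of "\<alpha> / 2"] \<alpha> by (simp add: K_def)
  have p1: "(1::int) \<le> 2 ^ K" by simp
  have r: "window_radius \<alpha> = 12 * 2 ^ K" by (simp add: window_radius_def K_def)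
  define j where "j = hat_j n \<sigma> \<omega>"
  define i where "i = loc \<omega> j"
  have N: "real n > 0" using n1 by simp
  have jJ: "j \<le> J" "\<And>l. l < j \<Longrightarrow> \<not> level_stops n \<sigma> \<omega> l"
    unfolding j_def using check_j_stopped[of n \<sigma> \<omega>] check_j_unstopped[of n \<sigma> \<omega>]
    by (cases "check_j n \<sigma> \<omega> < \<infinity>"; fastforce)+
  note nl = not_late_localized[OF \<omega>(1) \<omega>(2)[folded K_def] K jJ, folded i_def]
  have i1: "1 \<le> i" using loc_of_range[OF jJ(1)] by (simp add: i_def)
  show ?thesis
  proof (cases "check_j n \<sigma> \<omega> < \<infinity>")
    case True
    define w where "w = (2 ^ (J - j) :: real)"
    have w1: "1 \<le> w" by (simp add: w_def)
    define L where "L = max 0 (i - window_radius \<alpha> + 1)"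
    define U where "U = min \<lceil>(real n + 1) / w\<rceil> (i + window_radius \<alpha> - 2)"
    have CI: "snd (CI_z n \<sigma> \<alpha> \<omega>) = w / real n * of_int U - 1 / (2 * real n)"
      "fst (CI_z n \<sigma> \<alpha> \<omega>) \<le> w / real n * of_int L - 1 / (2 * real n)"
      using True unfolding CI_z_eq stopped_at_def j_def[symmetric] i_def[symmetric] Let_def w_def L_def U_def by simp_all
    have lo: "w * of_int L - 1 / 2 \<le> nZ"
    proof (cases "i - window_radius \<alpha> + 1 \<le> 0")
      case True
      then show ?thesis using nZ_bounds by (simp add: L_def)
    next
      case False
      have "real_of_int (i - window_radius \<alpha> + 1) \<le> of_int (i + 1 - 8 * 2 ^ K)" unfolding r of_int_le_iff by simp
      then have "w * of_int L \<le> w * of_int (i + 1 - 8 * 2 ^ K)" using w1 False by (intro mult_left_mono) (auto simp: L_def)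
      also have "\<dots> < nZ" using nl(1) by (simp add: w_def mult.commute)
      finally show ?thesis by simp
    qed
    \<comment> \<open>End points lie half a grid step before the first index of a block. On the
      right this half step is absorbed by a spare block of width at least 1, or by the distance
      between n and n + 1 at the end of the sample.\<close>
    have hi: "nZ \<le> w * of_int U - 1 / 2"
    proof -
      have "(real n + 1) / w \<le> of_int \<lceil>(real n + 1) / w\<rceil>" by simp
      then have "real n + 1 \<le> of_int \<lceil>(real n + 1) / w\<rceil> * w" using w1 by (subst (asm) pos_divide_le_eq) auto
      then have 1: "nZ \<le> w * of_int \<lceil>(real n + 1) / w\<rceil> - 1 / 2" using nZ_bounds by (simp add: mult.commute)
      have "real_of_int (i - 2 + 8 * 2 ^ K) + 1 \<le> of_int (i + window_radius \<alpha> - 2)"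
        using p1 unfolding r by (simp flip: of_int_1 of_int_add only: of_int_le_iff)
      then have "w * (real_of_int (i - 2 + 8 * 2 ^ K) + 1) \<le> w * of_int (i + window_radius \<alpha> - 2)"
        using w1 by (intro mult_left_mono) auto
      moreover have "nZ < w * of_int (i - 2 + 8 * 2 ^ K)" using nl(2) by (simp add: w_def mult.commute)
      moreover have "w * (real_of_int (i - 2 + 8 * 2 ^ K) + 1) = w * real_of_int (i - 2 + 8 * 2 ^ K) + w"
        by (simp only: distrib_left mult_1_right)
      ultimately have 2: "nZ \<le> w * of_int (i + window_radius \<alpha> - 2) - 1 / 2" using w1 by linarith
      show ?thesis unfolding U_def using 1 2 by (cases "\<lceil>(real n + 1) / w\<rceil> \<le> i + window_radius \<alpha> - 2") (simp_all only: min_def if_True if_False)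
    qed
    have "(w * of_int L - 1 / 2) / real n \<le> nZ / real n" "nZ / real n \<le> (w * of_int U - 1 / 2) / real n"
      using lo hi N by (simp_all add: divide_right_mono)
    then show ?thesis using CI unfolding minimizer_eq by (simp add: diff_divide_distrib)
  next
    case False
    define L where "L = window_lower \<alpha> i"
    define U where "U = window_upper n \<alpha> i"
    let ?t = "p_threshold \<sigma> \<alpha>" and ?p = "p_sample \<sigma> \<omega>"
    define il where "il = left_index L U ?p ?t"
    define ir where "ir = right_index L U ?p ?t"
    define e where "e = fine_endpoints n (q_slack \<sigma> \<alpha>) L U il ir (extend n (q_sample \<sigma> \<omega>))"
    have CI: "fst (CI_z n \<sigma> \<alpha> \<omega>) \<le> fst e" "snd (CI_z n \<sigma> \<alpha> \<omega>) = snd e"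
      using False unfolding CI_z_eq endpoints_at_def j_def[symmetric] i_def[symmetric] Let_def e_def L_def U_def il_def ir_def
      by simp_all
    have jj: "j = J" using check_j_unstopped(1)[OF False] by (simp add: j_def)
    have b: "real_of_int (i + 1 - 8 * 2 ^ K) < nZ" "nZ < real_of_int (i - 2 + 8 * 2 ^ K)"
      using nl unfolding jj by simp_all
    have c1: "i + 1 - 8 * 2 ^ K \<le> int cell + 1" 
    proof -
      have "real_of_int (i + 1 - 8 * 2 ^ K) < real_of_int (int cell + 1)" using b(1) cell by simp
      then show ?thesis by (simp only: of_int_less_iff)
    qed
    have c2: "int cell < i - 2 + 8 * 2 ^ K"
    proof -
      have "real_of_int (int cell) < real_of_int (i - 2 + 8 * 2 ^ K)" using b(2) cell by simp
      then show ?thesis by (simp only: of_int_less_iff)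
    qed
    \<comment> \<open>The margin \<open>4 * 2 ^ K\<close>, at least 4, between the radii 12 and 8
      supplies the distance 4 that \<open>fine_covers\<close> asks for.\<close>
    have c1': "i - 12 * 2 ^ K + 4 \<le> int cell" using c1 p1 by linarith
    have L: "0 \<le> L" "L = 0 \<or> L + 4 \<le> int cell"
      using c1' unfolding L_def window_lower_def r by auto
    have c2': "int cell + 5 \<le> i + 12 * 2 ^ K" using c2 p1 by linarith
    have U: "U \<le> int n" "U = int n \<or> int cell + 4 \<le> U"
      using c2' unfolding U_def window_upper_def r by auto
    have il: "il \<le> U" "il \<le> int cell + 1"
    proof -
      have fin: "finite {k \<in> {L..U - 1}. ?p (nat k) - ?p (nat (k + 1)) \<le> ?t}"
        by (rule finite_subset[of _ "{L..U - 1}"]) auto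
      show "il \<le> U" unfolding il_def left_index_def
        by (rule Min_le[OF finite_UnI[OF _ fin] UnI1]) simp_all
      show "il \<le> int cell + 1"
      proof (cases "int cell + 1 \<le> U - 1")
        case True
        then have c: "cell + 2 \<le> n" using U by simp
        have mem: "int cell + 1 \<in> {k \<in> {L..U - 1}. ?p (nat k) - ?p (nat (k + 1)) \<le> ?t}"
          using True L not_p_bad(1)[OF \<omega>(1,3) c] by (auto simp: p_threshold_def nat_add_distrib)
        show ?thesis unfolding il_def left_index_def
          by (rule Min_le[OF finite_UnI[OF _ fin] UnI2[OF mem]]) simp
      next
        case False
        then show ?thesis using \<open>il \<le> U\<close> by simp
      qed
    qed
    have ir: "L - 1 \<le> ir" "int cell - 1 \<le> ir"
    proof -
      have fin: "finite {k \<in> {L..U - 1}. ?p (nat k) - ?p (nat (k + 1)) \<ge> - ?t}"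
        by (rule finite_subset[of _ "{L..U - 1}"]) auto
      show "L - 1 \<le> ir" unfolding ir_def right_index_def
        by (rule Max_ge[OF finite_UnI[OF _ fin] UnI1]) simp_all
      show "int cell - 1 \<le> ir"
      proof (cases "L \<le> int cell - 1")
        case True
        then have c: "cell \<ge> 1" using L by simp
        have "int cell - 1 \<le> U - 1" using U cell(3) by auto
        then have mem: "int cell - 1 \<in> {k \<in> {L..U - 1}. ?p (nat k) - ?p (nat (k + 1)) \<ge> - ?t}"
          using True L not_p_bad(2)[OF \<omega>(1,3) c] by (auto simp: p_threshold_def nat_diff_distrib)
        show ?thesis unfolding ir_def right_index_def
          by (rule Max_ge[OF finite_UnI[OF _ fin] UnI2[OF mem]]) simp
      next
        case False
        then show ?thesis using \<open>L - 1 \<le> ir\<close> by simp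
      qed
    qed
    have z: "z_quantile (\<alpha> / 24) > 0" using \<alpha> by (intro z_quantile_pos) auto
    have Q: "a k - a l < q_sample \<sigma> \<omega> k - q_sample \<sigma> \<omega> l + q_slack \<sigma> \<alpha>" if "(k, l) \<in> fine_pairs cell" for k l
      using not_q_bad[OF \<omega>(1,4) z that] by (simp add: q_slack_def)
    have "fst e \<le> nZ / real n" "nZ / real n \<le> snd e"
      unfolding e_def using fine_covers[OF cell Q L U il ir] by blast+
    then show ?thesis using CI unfolding minimizer_eq by auto
  qed
qed

text \<open>The error budget is \<alpha>/2 for late stopping, two differences of \<open>p\<close> at
  \<alpha>/8 and six differences of \<open>q\<close> at \<alpha>/24, which add up to
  \<alpha>.\<close>

lemma coverage:
  assumes \<alpha>: "0 < \<alpha>" "\<alpha> < 1"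
  shows "prob {\<omega> \<in> space M. minimizer f \<in> {fst (CI_z n \<sigma> \<alpha> \<omega>)..snd (CI_z n \<sigma> \<alpha> \<omega>)}} \<ge> 1 - \<alpha>"
proof -
  let ?K = "nat (K_const (\<alpha> / 2))"
  let ?B = "late ?K \<union> (p_bad (z_quantile (\<alpha> / 8)) \<union> q_bad (z_quantile (\<alpha> / 24)))"
  let ?C = "{\<omega> \<in> space M. minimizer f \<in> {fst (CI_z n \<sigma> \<alpha> \<omega>)..snd (CI_z n \<sigma> \<alpha> \<omega>)}}"
  have K: "?K \<ge> 1" "Phi (- 2) ^ ?K \<le> \<alpha> / 2" using K_const_power[of "\<alpha> / 2"] \<alpha> by auto
  note B1 = prob_late[OF K(2,1)]
  have B2: "p_bad (z_quantile (\<alpha> / 8)) \<in> sets M \<and> prob (p_bad (z_quantile (\<alpha> / 8))) \<le> 2 * (\<alpha> / 8)"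
    by (rule prob_p_bad) (use \<alpha> in \<open>simp add: Phi_z_quantile\<close>)
  have B3: "q_bad (z_quantile (\<alpha> / 24)) \<in> sets M \<and> prob (q_bad (z_quantile (\<alpha> / 24))) \<le> 6 * (\<alpha> / 24)"
    by (rule prob_q_bad) (use \<alpha> in \<open>simp add: Phi_z_quantile\<close>)
  have sets: "?B \<in> sets M" using B1 B2 B3 by auto
  have "prob ?B \<le> prob (late ?K) + prob (p_bad (z_quantile (\<alpha> / 8)) \<union> q_bad (z_quantile (\<alpha> / 24)))"
    using B1 B2 B3 by (intro measure_Un_le) auto
  also have "prob (p_bad (z_quantile (\<alpha> / 8)) \<union> q_bad (z_quantile (\<alpha> / 24)))
      \<le> prob (p_bad (z_quantile (\<alpha> / 8))) + prob (q_bad (z_quantile (\<alpha> / 24)))"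
    using B2 B3 by (intro measure_Un_le) auto
  finally have "prob ?B \<le> \<alpha>" using B1 B2 B3 by simp
  then have "1 - \<alpha> \<le> prob (space M - ?B)" using prob_compl[OF sets] by simp
  also have "\<dots> \<le> prob ?C"
  proof (rule finite_measure_mono)
    show "space M - ?B \<subseteq> ?C" using covers[OF \<alpha>] by auto
    have [measurable]: "(\<lambda>\<omega>. fst (CI_z n \<sigma> \<alpha> \<omega>)) \<in> borel_measurable M" "(\<lambda>\<omega>. snd (CI_z n \<sigma> \<alpha> \<omega>)) \<in> borel_measurable M"
      using CI_z_measurable[OF \<sigma>_pos, of n \<alpha> f] unfolding borel_prod[symmetric] by measurable
    show "?C \<in> sets M" by simp
  qed
  finally show ?thesis .
qed

end

section \<open>Localization and stopping errors\<close>

locale convex_regression_radius = convex_regression +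
  fixes R :: real
  assumes rb: "radius_bound n \<sigma> f R" and R_pos: "R > 0"
begin

lemma nR_pos: "0 < real n * R"
  using n1 R_pos by simp

lemma a_increment_right:
  assumes "nZ \<le> real k" "k + w \<le> n" "2 * (real n * R) < real w"
  shows "\<sigma> * sqrt (real w) / (60 * (real n * R)) \<le> a (k + w) - a k"
  using increment_right[OF f_class rb \<sigma>_pos R_pos, of k w] assms n1
  unfolding a_def by (simp add: minimizer_eq divide_right_mono mult.assoc)

lemma a_increment_left:
  assumes "real (k + w) \<le> nZ" "2 * (real n * R) < real w"
  shows "\<sigma> * sqrt (real w) / (60 * (real n * R)) \<le> a k - a (k + w)"
proof -
  have "real (k + w) \<le> real n" using assms(1) nZ_bounds by linarith
  then have "k + w \<le> n" by (simp only: of_nat_le_iff)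
  moreover have "real (k + w) / real n \<le> minimizer f"
    unfolding minimizer_eq using assms(1) by (rule divide_right_mono) simp
  ultimately show ?thesis
    using increment_left[OF f_class rb \<sigma>_pos R_pos, of k w] assms(2)
    unfolding a_def by (simp add: mult.assoc)
qed


text \<open>Index of the block of level \<open>j\<close> that contains the minimizer. It may lie
  beyond the last complete block of the sample.\<close>

definition istar :: "nat \<Rightarrow> int" where
  "istar j = \<lfloor>nZ / 2 ^ (J - j)\<rfloor> + 1"

lemma istar_bounds:
  "real_of_int ((istar j - 1) * width n j) \<le> nZ" "nZ < real_of_int (istar j * width n j)" "1 \<le> istar j"
proof -
  let ?w = "2 ^ (J - j) :: real"
  have w: "?w > 0" by simp
  have "real_of_int (istar j - 1) \<le> nZ / ?w" "nZ / ?w < real_of_int (istar j)"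
    unfolding istar_def by simp_all
  then have "real_of_int (istar j - 1) * ?w \<le> nZ" "nZ < real_of_int (istar j) * ?w"
    by (simp_all only: pos_le_divide_eq[OF w] pos_divide_less_eq[OF w])
  then show "real_of_int ((istar j - 1) * width n j) \<le> nZ" "nZ < real_of_int (istar j * width n j)"
    by simp_all
  show "1 \<le> istar j" unfolding istar_def using nZ_bounds by simp
qed

lemma istar_0: "istar 0 \<le> 2"
proof -
  have J: "real (n + 1) < real (2 ^ Suc J)" using max_level_bounds(2)[of n] by (simp only: of_nat_less_iff)
  then have "nZ / 2 ^ J < 2" using nZ_bounds by (simp add: field_simps)
  then show ?thesis unfolding istar_def by (simp add: floor_less_iff add.commute)
qed

lemma istar_Suc:
  assumes "j < J"
  shows "2 * istar j - 1 \<le> istar (Suc j)" "istar (Suc j) \<le> 2 * istar j"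
proof -
  have "nZ / 2 ^ (J - Suc j) = 2 * (nZ / 2 ^ (J - j))"
  proof -
    have e: "J - j = Suc (J - Suc j)" using assms by simp
    show ?thesis unfolding e by simp
  qed
  moreover have "2 * (\<lfloor>z\<rfloor> + 1) - 1 \<le> \<lfloor>2 * z\<rfloor> + 1" "\<lfloor>2 * z\<rfloor> + 1 \<le> 2 * (\<lfloor>z\<rfloor> + 1)" for z :: real
  proof -
    have "2 * \<lfloor>z\<rfloor> \<le> \<lfloor>2 * z\<rfloor>" unfolding le_floor_iff by simp
    then show "2 * (\<lfloor>z\<rfloor> + 1) - 1 \<le> \<lfloor>2 * z\<rfloor> + 1" by simp
    have "\<lfloor>2 * z\<rfloor> < 2 * (\<lfloor>z\<rfloor> + 1)" unfolding floor_less_iff by simp linarith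
    then show "\<lfloor>2 * z\<rfloor> + 1 \<le> 2 * (\<lfloor>z\<rfloor> + 1)" by simp
  qed
  ultimately show "2 * istar j - 1 \<le> istar (Suc j)" "istar (Suc j) \<le> 2 * istar j"
    unfolding istar_def by (simp_all only:)
qed

text \<open>A nonrandom set that contains every pair occurring in a first error: the stopping rule
  looks 6 blocks away from an index that is off by at most 1, and the localization chooses at most 4
  blocks away.\<close>

definition pairs :: "nat \<Rightarrow> (int \<times> int) set" where
  "pairs j = {(b, b'). b \<in> {istar j - 8..istar j + 8} \<and> b' \<in> {istar j - 8..istar j + 8} \<and>
     b \<noteq> b' \<and> in_sample n j b \<and> in_sample n j b'}"

text \<open>Chebyshev's inequality before taking expectations: the right side is at least 1 if the
  blocks are short compared with R and also if the noise of some pair is large.\<close>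

definition error_at :: "nat \<Rightarrow> outcome \<Rightarrow> bool" where
  "error_at j \<omega> \<longleftrightarrow> (\<exists>u\<in>{0, 2}. \<exists>(b, b')\<in>pairs j.
     1 \<le> 360000 * (real n * R / 2 ^ (J - j))\<^sup>2 * (1 + (block_noise u j b b' \<omega>)\<^sup>2 / 2 ^ (J - j)))"

text \<open>Both blocks lie on the same side of the block with the minimizer, \<open>b\<close>
  farther out. Each term of \<open>b\<close> is at least one block width farther out than its
  counterpart in \<open>b'\<close>, and the increment over one width is bounded below by the choice
  of R.\<close>

lemma mean_difference:
  assumes b: "in_sample n j b" "in_sample n j b'"
    and dir: "istar j + 1 \<le> b' \<and> b' < b \<or> b' \<le> istar j - 1 \<and> b < b'"
    and w: "2 * (real n * R) < 2 ^ (J - j)"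
  shows "2 ^ (J - j) * (\<sigma> * sqrt (2 ^ (J - j)) / (60 * (real n * R))) \<le> (\<Sum>k\<in>block n j b. a k) - (\<Sum>k\<in>block n j b'. a k)"
proof -
  let ?\<gamma> = "\<sigma> * sqrt (2 ^ (J - j)) / (60 * (real n * R))"
  define w :: nat where "w = 2 ^ (J - j)"
  have wi: "width n j = int w" by (simp add: w_def)
  have wr: "real w = 2 ^ (J - j)" by (simp add: w_def)
  have b1: "1 \<le> b" "1 \<le> b'" and bn: "b * width n j \<le> int n + 1" "b' * width n j \<le> int n + 1"
    using b by (auto simp: in_sample_def)
  have w': "2 * (real n * R) < real w" using w wr by simp
  show ?thesis
    using dir
  proof
    assume d: "istar j + 1 \<le> b' \<and> b' < b"
    define e where "e = nat (b - b')"
    have e: "b = b' + int e" "e \<ge> 1" using d by (auto simp: e_def)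
    have "(\<Sum>k\<in>block n j b'. ?\<gamma>) \<le> (\<Sum>k\<in>block n j b'. a (k + nat (int e * width n j)) - a k)"
    proof (rule sum_mono)
      fix k assume k: "k \<in> block n j b'"
      then have kb: "(b' - 1) * width n j \<le> int k" "int k < b' * width n j" using b1 by (auto simp: mem_block)
      have "istar j * width n j \<le> (b' - 1) * width n j" using d by (intro mult_right_mono) auto
      then have "istar j * width n j \<le> int k" using kb by linarith
      then have "real_of_int (istar j * width n j) \<le> real_of_int (int k)" by (simp only: of_int_le_iff)
      then have kZ: "nZ \<le> real k" using istar_bounds(2)[of j] by simp
      have sh: "nat (int e * width n j) = e * w" unfolding wi by (metis nat_int of_nat_mult)
      have "int k + int e * width n j < b' * width n j + int e * width n j" using kb by simp
      also have "\<dots> = b * width n j" unfolding e(1) by (simp add: algebra_simps)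
      finally have "int (k + e * w) < int n + 1" using bn unfolding wi by simp
      then have kn: "k + e * w \<le> n" by linarith
      have wew: "w \<le> e * w" using e by simp
      have "?\<gamma> \<le> a (k + w) - a k"
        using a_increment_right[OF kZ _ w'] kn wew wr by simp
      also have "a (k + w) \<le> a (k + e * w)" using kZ kn wew by (intro a_right) auto
      finally show "?\<gamma> \<le> a (k + nat (int e * width n j)) - a k" using sh by simp
    qed
    also have "\<dots> = (\<Sum>k\<in>block n j b. a k) - (\<Sum>k\<in>block n j b'. a k)"
      unfolding e(1) sum_subtractf by (subst sum_block_shift) (use b1 in auto)
    finally show ?thesis using card_block[OF b1(2), of n j] by simp
  next
    assume d: "b' \<le> istar j - 1 \<and> b < b'"
    define e where "e = nat (b' - b)"
    have e: "b' = b + int e" "e \<ge> 1" using d by (auto simp: e_def)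
    have "(\<Sum>k\<in>block n j b. ?\<gamma>) \<le> (\<Sum>k\<in>block n j b. a k - a (k + nat (int e * width n j)))"
    proof (rule sum_mono)
      fix k assume k: "k \<in> block n j b"
      then have kb: "int k < b * width n j" using b1 by (auto simp: mem_block)
      have sh: "nat (int e * width n j) = e * w" unfolding wi by (metis nat_int of_nat_mult)
      have "int k + int e * width n j < b * width n j + int e * width n j" using kb by simp
      also have "\<dots> = b' * width n j" unfolding e(1) by (simp add: algebra_simps)
      also have "\<dots> \<le> (istar j - 1) * width n j" using d by (intro mult_right_mono) auto
      finally have "int (k + e * w) \<le> (istar j - 1) * width n j" unfolding wi by simp
      then have "real_of_int (int (k + e * w)) \<le> real_of_int ((istar j - 1) * width n j)" by (simp only: of_int_le_iff)
      then have kZ: "real (k + e * w) \<le> nZ" using istar_bounds(1)[of j] by simp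
      have wew: "w \<le> e * w" using e by simp
      then have kZ': "real (k + w) \<le> nZ" using kZ by (meson add_left_mono of_nat_mono order_trans)
      have "?\<gamma> \<le> a k - a (k + w)" using a_increment_left[OF kZ' w'] wr by simp
      moreover have "a (k + e * w) \<le> a (k + w)" using kZ wew by (intro a_left) auto
      ultimately show "?\<gamma> \<le> a k - a (k + nat (int e * width n j))" using sh by simp
    qed
    also have "\<dots> = (\<Sum>k\<in>block n j b. a k) - (\<Sum>k\<in>block n j b'. a k)"
      unfolding e(1) sum_subtractf by (subst sum_block_shift) (use b1 in auto)
    finally show ?thesis using card_block[OF b1(1), of n j] by simp
  qed
qed

text \<open>Put y = nR/w and B = 1/(60y). For y \<ge> 1/2 the claim is trivial. Otherwise the mean
  difference is at least \<sigma> B sqrt w, and the threshold is at most 5 \<sigma> sqrt w. If B <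
  10, then 3600 * 100 y^2 = 360000 y^2 exceeds 1; if B \<ge> 10, the noise has to cancel at least
  half of the mean difference.\<close>

lemma error_bound:
  assumes b: "in_sample n j b" "in_sample n j b'"
    and dir: "istar j + 1 \<le> b' \<and> b' < b \<or> b' \<le> istar j - 1 \<and> b < b'"
    and le: "(\<Sum>k\<in>block n j b. a k) - (\<Sum>k\<in>block n j b'. a k) + sqrt 3 * \<sigma> * block_noise u j b b' \<omega> \<le> 2 * sigma_level n \<sigma> j"
  shows "1 \<le> 360000 * (real n * R / 2 ^ (J - j))\<^sup>2 * (1 + (block_noise u j b b' \<omega>)\<^sup>2 / 2 ^ (J - j))"
proof -
  define w :: real where "w = 2 ^ (J - j)"
  define X where "X = block_noise u j b b' \<omega>"
  define y where "y = real n * R / w"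
  have w: "w > 0" and y: "y > 0" using nR_pos by (auto simp: w_def y_def)
  have X0: "0 \<le> X\<^sup>2 / w" using w by simp
  have "1 \<le> 360000 * y\<^sup>2 * (1 + X\<^sup>2 / w)"
  proof (cases "y < 1 / 2")
    case False
    then have "(1 / 2)\<^sup>2 \<le> y\<^sup>2" using y by (intro power_mono) auto
    then have "1 \<le> 360000 * y\<^sup>2 * 1" by (simp add: power_divide)
    also have "\<dots> \<le> 360000 * y\<^sup>2 * (1 + X\<^sup>2 / w)" using X0 by (intro mult_left_mono) auto
    finally show ?thesis .
  next
    case True
    define B where "B = 1 / (60 * y)"
    have B: "B > 0" using y by (simp add: B_def)
    have "2 * (real n * R) < w" using True w by (simp add: y_def field_simps)
    then have "w * (\<sigma> * sqrt w / (60 * (real n * R))) \<le> (\<Sum>k\<in>block n j b. a k) - (\<Sum>k\<in>block n j b'. a k)"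
      using mean_difference[OF b dir] by (simp add: w_def)
    moreover have "w * (\<sigma> * sqrt w / (60 * (real n * R))) = \<sigma> * (B * sqrt w)"
      using w nR_pos by (simp add: B_def y_def field_simps)
    moreover have "2 * sigma_level n \<sigma> j = \<sigma> * (2 * (sqrt 3 * (sqrt 2 * sqrt w)))"
      unfolding sigma_level_eq w_def[symmetric] by (simp add: real_sqrt_mult)
    moreover have "sqrt 3 * \<sigma> * X = \<sigma> * (sqrt 3 * X)" by simp
    ultimately have "\<sigma> * (B * sqrt w) + \<sigma> * (sqrt 3 * X) \<le> \<sigma> * (2 * (sqrt 3 * (sqrt 2 * sqrt w)))"
      using le by (simp only: X_def)
    then have "\<sigma> * (B * sqrt w + sqrt 3 * X) \<le> \<sigma> * (2 * (sqrt 3 * (sqrt 2 * sqrt w)))"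
      by (simp only: distrib_left)
    then have 1: "B * sqrt w + sqrt 3 * X \<le> 2 * (sqrt 3 * (sqrt 2 * sqrt w))"
      using \<sigma>_pos by (simp only: mult_le_cancel_left_pos)
    have "sqrt 3 * sqrt 2 = sqrt 6" by (simp add: real_sqrt_mult[symmetric])
    moreover have "sqrt 6 \<le> 5 / 2" by (rule real_le_lsqrt) (auto simp: power_divide)
    ultimately have s: "sqrt 3 * sqrt 2 \<le> 5 / 2" by simp
    have "2 * (sqrt 3 * (sqrt 2 * sqrt w)) = 2 * (sqrt 3 * sqrt 2) * sqrt w" by simp
    also have "\<dots> \<le> 5 * sqrt w" using s w by (intro mult_right_mono) auto
    finally have 2: "B * sqrt w + sqrt 3 * X \<le> 5 * sqrt w" using 1 by linarith
    show ?thesis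
    proof (cases "B \<ge> 10")
      case True
      have "10 * sqrt w \<le> B * sqrt w" using True w by (intro mult_right_mono) auto
      then have "B / 2 * sqrt w \<le> - (sqrt 3 * X)" using 2 by simp
      moreover have "0 \<le> B / 2 * sqrt w" using B w by simp
      ultimately have "(B / 2 * sqrt w)\<^sup>2 \<le> (- (sqrt 3 * X))\<^sup>2" by (intro power_mono) auto
      then have "B\<^sup>2 * w \<le> 12 * X\<^sup>2" using w by (simp add: power_mult_distrib power_divide)
      then have "B\<^sup>2 \<le> 12 * (X\<^sup>2 / w)" using w by (simp add: field_simps)
      then have "1 \<le> 12 * (X\<^sup>2 / w) * (3600 * y\<^sup>2)" using y by (simp add: B_def power_divide power_mult_distrib field_simps)
      also have "\<dots> = 43200 * y\<^sup>2 * (X\<^sup>2 / w)" by simp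
      also have "\<dots> \<le> 360000 * y\<^sup>2 * (1 + X\<^sup>2 / w)" using X0 by (intro mult_mono) auto
      finally show ?thesis .
    next
      case False
      then have "B\<^sup>2 \<le> 10\<^sup>2" using B by (intro power_mono) auto
      then have "1 \<le> 360000 * y\<^sup>2 * 1" using y by (simp add: B_def power_divide power_mult_distrib field_simps)
      also have "\<dots> \<le> 360000 * y\<^sup>2 * (1 + X\<^sup>2 / w)" using X0 by (intro mult_left_mono) auto
      finally show ?thesis .
    qed
  qed
  then show ?thesis by (simp only: y_def w_def X_def)
qed

lemma error_atI:
  assumes "u \<in> {0, 2}" "b \<in> {istar j - 8..istar j + 8}" "b' \<in> {istar j - 8..istar j + 8}"
    and "in_sample n j b" "in_sample n j b'"
    and "istar j + 1 \<le> b' \<and> b' < b \<or> b' \<le> istar j - 1 \<and> b < b'"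
    and "(\<Sum>k\<in>block n j b. a k) - (\<Sum>k\<in>block n j b'. a k) + sqrt 3 * \<sigma> * block_noise u j b b' \<omega> \<le> 2 * sigma_level n \<sigma> j"
  shows "error_at j \<omega>"
  unfolding error_at_def
proof (rule bexI[OF _ assms(1)], rule bexI[where x = "(b, b')"])
  show "case (b, b') of (b, b') \<Rightarrow>
    1 \<le> 360000 * (real n * R / 2 ^ (J - j))\<^sup>2 * (1 + (block_noise u j b b' \<omega>)\<^sup>2 / 2 ^ (J - j))"
    using error_bound[OF assms(4-7)] by simp
  show "(b, b') \<in> pairs j" using assms by (auto simp: pairs_def)
qed

definition near :: "outcome \<Rightarrow> nat \<Rightarrow> bool" where
  "near \<omega> j \<longleftrightarrow> \<bar>loc \<omega> j - istar j\<bar> \<le> 1"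

lemma near_0: "near \<omega> 0"
  using istar_0 istar_bounds(3)[of 0] by (simp add: near_def)

lemma sigma_level_nonneg: "0 \<le> sigma_level n \<sigma> j"
  by (simp add: sigma_level_def)

text \<open>Among the candidates is the neighbour of the block with the minimizer, on the side of
  the chosen block, and the choice of a block farther out is an error. The neighbour is used because
  the comparison of means takes blocks that lie entirely on one side of the minimizer.\<close>

lemma near_Suc:
  assumes j: "j < J" and near: "near \<omega> j" and not: "\<not> near \<omega> (Suc j)"
  shows "error_at (Suc j) \<omega>"
proof -
  define i where "i = loc \<omega> j"
  define i' where "i' = loc \<omega> (Suc j)"
  define s where "s = istar j"
  define s' where "s' = istar (Suc j)"
  have i: "\<bar>i - s\<bar> \<le> 1" using near by (simp add: near_def i_def s_def)
  have s': "2 * s - 1 \<le> s'" "s' \<le> 2 * s" using istar_Suc[OF j] by (auto simp: s_def s'_def)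
  have "i' \<in> candidates n j i" unfolding i_def i'_def by (rule loc_of_step(1)[OF j])
  then have i': "2 * i - 2 \<le> i'" "1 \<le> i'" "i' \<le> 2 * i + 1" "i' * width n (Suc j) \<le> int n + 1"
    by (auto simp: candidates_iff)
  have far: "s' + 2 \<le> i' \<or> i' \<le> s' - 2" using not by (auto simp: near_def i'_def s'_def)
  define b' where "b' = (if s' + 2 \<le> i' then s' + 1 else s' - 1)"
  have b'n: "b' * width n (Suc j) \<le> int n + 1"
  proof (cases "s' + 2 \<le> i'")
    case True
    then have "b' * width n (Suc j) \<le> i' * width n (Suc j)" by (intro mult_right_mono) (auto simp: b'_def)
    then show ?thesis using i' by linarith
  next
    case False
    have "real_of_int ((s' - 1) * width n (Suc j)) \<le> real_of_int (int n)"
      using istar_bounds(1)[of "Suc j"] nZ_bounds unfolding s'_def by simp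
    then have "(s' - 1) * width n (Suc j) \<le> int n" by (simp only: of_int_le_iff)
    then show ?thesis using False by (simp add: b'_def)
  qed
  have b': "1 \<le> b'" using far i' istar_bounds(3)[of "Suc j"] by (auto simp: b'_def s'_def)
  have "b' \<in> candidates n j i"
    unfolding candidates_iff using b'n b' far i s' i' by (auto simp: b'_def)
  then have "block_sum n (split_l \<sigma> \<omega>) (Suc j) i' \<le> block_sum n (split_l \<sigma> \<omega>) (Suc j) b'"
    unfolding i_def i'_def by (rule loc_of_step(2)[OF j])
  then have "(\<Sum>k\<in>block n (Suc j) i'. a k) + sqrt 3 * \<sigma> * (\<Sum>k\<in>block n (Suc j) i'. noi (0, k) \<omega>)
      \<le> (\<Sum>k\<in>block n (Suc j) b'. a k) + sqrt 3 * \<sigma> * (\<Sum>k\<in>block n (Suc j) b'. noi (0, k) \<omega>)"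
    unfolding block_sum_finite[OF i'(2,4)] block_sum_finite[OF b' b'n] ereal_less_eq
      split_l_block[OF i'(2)] split_l_block[OF b'] .
  \<comment> \<open>The localization gives the bound 0. Weakening it to the stopping threshold lets
    \<open>error_atI\<close> serve both kinds of error.\<close>
  then have "(\<Sum>k\<in>block n (Suc j) i'. a k) - (\<Sum>k\<in>block n (Suc j) b'. a k) + sqrt 3 * \<sigma> * block_noise 0 (Suc j) i' b' \<omega>
      \<le> 2 * sigma_level n \<sigma> (Suc j)"
    using sigma_level_nonneg[of "Suc j"] by (simp add: block_noise_def right_diff_distrib)
  then show ?thesis
    by (intro error_atI[of 0 i' "Suc j" b'])
      (use i' b' b'n far i s' in \<open>auto simp: in_sample_def b'_def s'_def[symmetric]\<close>)
qed

text \<open>From an index off by at most 1, the blocks 5 and 6 away lie entirely on one side of the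
  minimizer, so a stop contradicts their mean difference unless the noise is large.\<close>

lemma near_stops:
  assumes j: "j \<le> J" and near: "near \<omega> j" and stops: "level_stops n \<sigma> \<omega> j"
  shows "error_at j \<omega>"
proof -
  define i where "i = loc \<omega> j"
  have i: "\<bar>i - istar j\<bar> \<le> 1" using near by (simp add: near_def i_def)
  have smp: "1 \<le> i" "i * width n j \<le> int n + 1" using loc_of_range[OF j] by (auto simp: i_def)
  have mono: "x * width n j \<le> y * width n j" if "x \<le> y" for x y :: int using that by (intro mult_right_mono) auto
  have diff: "(\<Sum>k\<in>block n j b. a k) - (\<Sum>k\<in>block n j b'. a k) + sqrt 3 * \<sigma> * block_noise 2 j b b' \<omega>
      = (\<Sum>k\<in>{(b - 1) * width n j..b * width n j - 1}. split_s \<sigma> \<omega> (nat k))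
       - (\<Sum>k\<in>{(b' - 1) * width n j..b' * width n j - 1}. split_s \<sigma> \<omega> (nat k))" if "1 \<le> b" "1 \<le> b'" for b b'
    unfolding split_s_block[OF that(1)] split_s_block[OF that(2)] by (simp add: block_noise_def right_diff_distrib)
  define S where "S b = (\<Sum>k\<in>{(b - 1) * width n j..b * width n j - 1}. split_s \<sigma> \<omega> (nat k))" for b
  have "((i + 6) * width n j \<le> int n + 1 \<and> S (i + 6) - S (i + 5) \<le> 2 * sigma_level n \<sigma> j)
      \<or> (7 \<le> i \<and> S (i - 6) - S (i - 5) \<le> 2 * sigma_level n \<sigma> j)"
    using stops unfolding level_stops_iff[OF j] i_def S_def .
  then show ?thesis
  proof
    assume r: "(i + 6) * width n j \<le> int n + 1 \<and> S (i + 6) - S (i + 5) \<le> 2 * sigma_level n \<sigma> j"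
    have "(i + 5) * width n j \<le> int n + 1" using mono[of "i + 5" "i + 6"] r by linarith
    moreover have "(\<Sum>k\<in>block n j (i + 6). a k) - (\<Sum>k\<in>block n j (i + 5). a k) + sqrt 3 * \<sigma> * block_noise 2 j (i + 6) (i + 5) \<omega>
      \<le> 2 * sigma_level n \<sigma> j"
      using r smp by (subst diff) (auto simp: S_def)
    ultimately show ?thesis
      using r smp i by (intro error_atI[of 2 "i + 6" j "i + 5"]) (auto simp: in_sample_def)
  next
    assume l: "7 \<le> i \<and> S (i - 6) - S (i - 5) \<le> 2 * sigma_level n \<sigma> j"
    have "(i - 5) * width n j \<le> int n + 1" "(i - 6) * width n j \<le> int n + 1"
      using mono[of "i - 5" i] mono[of "i - 6" i] smp by linarith+
    moreover have "(\<Sum>k\<in>block n j (i - 6). a k) - (\<Sum>k\<in>block n j (i - 5). a k) + sqrt 3 * \<sigma> * block_noise 2 j (i - 6) (i - 5) \<omega>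
      \<le> 2 * sigma_level n \<sigma> j"
      using l smp by (subst diff) (auto simp: S_def)
    ultimately show ?thesis
      using l smp i by (intro error_atI[of 2 "i - 6" j "i - 5"]) (auto simp: in_sample_def)
  qed
qed

lemma near_or_error:
  assumes "j \<le> J"
  shows "near \<omega> j \<or> (\<exists>l\<le>j. error_at l \<omega>)"
  using assms
proof (induction j)
  case (Suc j)
  then show ?case using near_Suc[of j \<omega>] by (meson Suc_le_lessD le_SucI order_refl less_imp_le)
qed (simp add: near_0)


text \<open>Summing over all pairs removes the dependence on the random pair, at the price of a
  factor of at most 2 * 289.\<close>

definition error_cost :: "nat \<Rightarrow> outcome \<Rightarrow> real" where
  "error_cost j \<omega> = (\<Sum>(u, b, b')\<in>{0, 2} \<times> pairs j. 1 + (block_noise u j b b' \<omega>)\<^sup>2 / 2 ^ (J - j))"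

lemma finite_pairs: "finite (pairs j)" "card (pairs j) \<le> 289"
proof -
  let ?I = "{istar j - 8..istar j + 8}"
  have s: "pairs j \<subseteq> ?I \<times> ?I" by (auto simp: pairs_def)
  then show "finite (pairs j)" by (rule finite_subset) simp
  have "card (pairs j) \<le> card (?I \<times> ?I)" by (rule card_mono[OF _ s]) simp
  also have "\<dots> = 289" by (simp add: card_cartesian_product)
  finally show "card (pairs j) \<le> 289" .
qed

text \<open>Turns an error at length scale \<open>x\<close> into a bound for \<open>x\<close>
  itself. The weight is x * min(1, (R/x)^2), which is summable over dyadic scales.\<close>

lemma error_at_cost:
  assumes "error_at j \<omega>"
  defines "x \<equiv> 2 ^ (J - j) / real n"
  shows "x \<le> 360000 * min x (R\<^sup>2 / x) * error_cost j \<omega>"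
proof -
  let ?g = "\<lambda>(u, b, b'). 1 + (block_noise u j b b' \<omega>)\<^sup>2 / 2 ^ (J - j)"
  have x: "x > 0" using n1 by (simp add: x_def)
  obtain u b b' where u: "u \<in> {0, 2}" "(b, b') \<in> pairs j"
    and e: "1 \<le> 360000 * (real n * R / 2 ^ (J - j))\<^sup>2 * ?g (u, b, b')"
    using assms(1) unfolding error_at_def by auto
  have g1: "1 \<le> ?g p" for p by (cases p) (auto simp: case_prod_beta')
  have "sum ?g {(u, b, b')} \<le> sum ?g ({0, 2} \<times> pairs j)"
    by (rule sum_mono2) (use u finite_pairs g1 in \<open>auto intro: order_trans[OF zero_le_one]\<close>)
  then have gle: "?g (u, b, b') \<le> error_cost j \<omega>" by (simp add: error_cost_def)
  show ?thesis
  proof (cases "x \<le> R")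
    case True
    then have "x * x \<le> R * R" using x by (intro mult_mono) auto
    then have m: "min x (R\<^sup>2 / x) = x" using x by (simp add: min_def field_simps power2_eq_square)
    have "1 \<le> error_cost j \<omega>" using gle g1[of "(u, b, b')"] by linarith
    then have "x * 1 \<le> (360000 * x) * error_cost j \<omega>"
      using x by (intro mult_mono) auto
    then show ?thesis unfolding m by simp
  next
    case False
    then have "R * R \<le> x * x" using R_pos by (intro mult_mono) auto
    then have m: "min x (R\<^sup>2 / x) = R\<^sup>2 / x" using x by (simp add: min_def field_simps power2_eq_square)
    have y: "real n * R / 2 ^ (J - j) = R / x" by (simp add: x_def mult.commute)
    have "x * 1 \<le> x * (360000 * (R / x)\<^sup>2 * ?g (u, b, b'))" using e x unfolding y by (intro mult_left_mono) auto
    also have "\<dots> = 360000 * (R\<^sup>2 / x) * ?g (u, b, b')" using x by (simp add: power2_eq_square field_simps)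
    also have "\<dots> \<le> 360000 * (R\<^sup>2 / x) * error_cost j \<omega>" using gle x by (intro mult_left_mono) auto
    finally show ?thesis unfolding m by simp
  qed
qed

end

section \<open>The length of the refined interval\<close>

lemma fine_endpoints_length:
  fixes q :: "int \<Rightarrow> ereal" and c :: real
  assumes LU: "0 \<le> L" "L \<le> U" "U \<le> int n" "U - L \<le> d" and d: "1 \<le> d" and n: "n \<ge> 1"
    and il: "L \<le> il" "il \<le> U" and ir: "L - 1 \<le> ir" "ir \<le> U"
  defines "e \<equiv> fine_endpoints n c L U il ir q"
  shows "snd e - fst e \<le> of_int d / real n"
proof -
  have N: "real n > 0" using n by simp
  have d1: "1 / real n \<le> of_int d / real n" "0 \<le> of_int d / real n" using d N by (simp_all add: divide_right_mono)
  define ilo where "ilo = max (il - 1) L"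
  define ihi where "ihi = min (ir + 2) U"
  have "ihi - ilo \<le> d" using LU by (auto simp: ilo_def ihi_def)
  then have "real_of_int (ihi - ilo) / real n \<le> of_int d / real n"
    by (intro divide_right_mono) (auto simp only: of_int_le_iff)
  then have dd: "of_int ihi / real n - of_int ilo / real n \<le> of_int d / real n"
    by (simp add: diff_divide_distrib)
  have lo: "of_int ilo / real n \<le> min (max x (of_int ilo / real n)) (of_int (ilo + 1) / real n)" for x
    using N by (simp add: divide_right_mono)
  have one: "1 - (real n - 1) / real n = 1 / real n" using N by (simp add: diff_divide_distrib)
  have hi: "(real n - 1) / real n \<le> min (max x ((real n - 1) / real n)) 1" for x
    using N by simp
  have e: "e = (if ir = L - 1 then
           (if ir = -1 \<and> q 2 - q 1 + c > 0
            then (0, min (max (ratio (q 0 - q 1 + c) (real n * (q 2 - q 1 + c)) + 1 / real n) 0) (1 / real n))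
            else (0, 0))
         else if il = U then
           (if il = int n \<and> q (int n - 2) - q (int n - 1) + c > 0
            then (min (max (- ratio (q (int n) - q (int n - 1) + c)
                                    (real n * (q (int n - 2) - q (int n - 1) + c)) + (real n - 1) / real n)
                           ((real n - 1) / real n)) 1, 1)
            else (of_int U / real n, of_int U / real n))
         else if ihi - ilo \<ge> 3 \<or> (ihi - int n) * ilo = 0 then
           (of_int ilo / real n, of_int ihi / real n)
         else if q (ihi + 1) - q ihi \<le> - ereal c \<or> q (ilo - 1) - q ilo \<le> - ereal c then
           (of_int (ihi + ilo) / (2 * real n), of_int (ihi + ilo) / (2 * real n))
         else
           (min (max (- ratio (q (ilo + 1) - q ilo + c) (real n * (q (ilo - 1) - q ilo + c))
                      + of_int ilo / real n) (of_int ilo / real n)) (of_int (ilo + 1) / real n),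
            min (max (ratio (q (ihi - 1) - q ihi + c) (real n * (q (ihi + 1) - q ihi + c))
                      + of_int ihi / real n) (of_int (ihi - 1) / real n)) (of_int ihi / real n)))"
    unfolding e_def fine_endpoints_def Let_def ilo_def ihi_def ..
  have c1: "min a (1 / real n) - 0 \<le> of_int d / real n" for a using d1 by (simp add: min_le_iff_disj)
  have c2: "1 - min (max x ((real n - 1) / real n)) 1 \<le> of_int d / real n" for x
    using hi[of x] one d1 by linarith
  have c3: "min y (of_int ihi / real n) - min (max x (of_int ilo / real n)) (of_int (ilo + 1) / real n) \<le> of_int d / real n" for x y
    using lo[of x] dd min.cobounded2[of y "of_int ihi / real n"] by linarith
  show ?thesis unfolding e using c1 c2 c3 dd d1(2) by simp
qed

text \<open>\<open>num / den + 1\<close> is the fraction of a cell kept by the refined end point,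
  and \<open>num + den\<close> is a second difference \<open>A\<close> with noise \<open>X\<close>
  and twice the slack. If the noise \<open>W\<close> does not halve \<open>D\<close>, then the
  denominator is at least \<open>D / 2\<close>; otherwise \<open>4 * W^2 / D^2\<close> exceeds the
  trivial bound 1.\<close>

lemma clipped_ratio_le:
  fixes D A X W c num den :: real
  assumes D: "D > 0" and c: "c > 0" and den: "den = D + W + c" "den > 0" and num: "num + den = A + X + 2 * c"
    and A: "A \<ge> 0"
  shows "min 1 (max 0 (num / den + 1)) \<le> 2 * (A + \<bar>X\<bar> + 2 * c) / D + 4 * W\<^sup>2 / D\<^sup>2"
proof -
  have n1: "0 \<le> 2 * (A + \<bar>X\<bar> + 2 * c) / D" and n2: "0 \<le> 4 * W\<^sup>2 / D\<^sup>2" using D A c by simp_all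
  show ?thesis
  proof (cases "W \<ge> - D / 2")
    case True
    have eq: "num / den + 1 = (A + X + 2 * c) / den" using den num by (simp add: field_simps)
    have "(A + X + 2 * c) / den \<le> (A + \<bar>X\<bar> + 2 * c) / den" using den by (intro divide_right_mono) auto
    also have "\<dots> \<le> (A + \<bar>X\<bar> + 2 * c) / (D / 2)"
      using D A c den True by (intro divide_left_mono) auto
    also have "\<dots> = 2 * (A + \<bar>X\<bar> + 2 * c) / D" by simp
    finally have "max 0 (num / den + 1) \<le> 2 * (A + \<bar>X\<bar> + 2 * c) / D" unfolding eq using n1 by simp
    then show ?thesis using n2 by linarith
  next
    case False
    then have "D / 2 \<le> - W" by simp
    then have "(D / 2)\<^sup>2 \<le> (- W)\<^sup>2" using D by (intro power_mono) auto
    then have "1 \<le> 4 * W\<^sup>2 / D\<^sup>2" using D by (simp add: power_divide)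
    then show ?thesis using n1 by linarith
  qed
qed

text \<open>From \<open>small\<close>, A/D \<le> 2y and \<sigma>/D \<le> 40y. The linear terms give
  4, 200 and 160 c0. In the quadratic term y < 1/8 turns 1600 y^2 into 200 y, which gives 24 * 200 =
  4800; and 5100 covers 4 + 200 + 4800.\<close>

lemma ratio_bound_small:
  fixes y D \<sigma> A c0 s x1 x2 :: real
  assumes y: "0 < y" "y < 1 / 8" and D: "D > 0" and \<sigma>: "\<sigma> > 0" and A: "A \<ge> 0" and c0: "c0 > 0"
    and small: "A + \<sigma> / 20 \<le> 2 * y * D"
  shows "2 * (A + \<bar>sqrt 6 * \<sigma> * (x1 + x2)\<bar> + 2 * (\<sigma> * c0)) / D + 4 * (sqrt 6 * \<sigma> * x2)\<^sup>2 / D\<^sup>2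
    \<le> y * ((5100 + 160 * c0) * (1 + x1\<^sup>2 + x2\<^sup>2))"
proof -
  let ?s = "1 + x1\<^sup>2 + x2\<^sup>2"
  have s1: "1 \<le> ?s" by simp
  have AD: "A / D \<le> 2 * y"
    using small D \<sigma> by (simp add: pos_divide_le_eq)
  have sD: "\<sigma> / D \<le> 40 * y" "0 < \<sigma> / D"
    using small D \<sigma> A by (simp_all add: pos_divide_le_eq)
  have abs: "\<bar>x1 + x2\<bar> \<le> ?s"
  proof -
    have "0 \<le> (\<bar>x1\<bar> - 1 / 2)\<^sup>2" "0 \<le> (\<bar>x2\<bar> - 1 / 2)\<^sup>2" by simp_all
    then have "\<bar>x1\<bar> \<le> x1\<^sup>2 + 1 / 4" "\<bar>x2\<bar> \<le> x2\<^sup>2 + 1 / 4"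
      by (simp_all add: power2_diff power_divide)
    then show ?thesis by linarith
  qed
  have "sqrt 6 \<le> 5 / 2" by (rule real_le_lsqrt) (auto simp: power_divide)
  then have X: "sqrt 6 * \<bar>x1 + x2\<bar> \<le> 5 / 2 * ?s" using abs by (intro mult_mono) auto
  have "2 * (A + \<bar>sqrt 6 * \<sigma> * (x1 + x2)\<bar> + 2 * (\<sigma> * c0)) / D
      = 2 * (A / D) + 2 * (sqrt 6 * \<bar>x1 + x2\<bar>) * (\<sigma> / D) + 4 * c0 * (\<sigma> / D)"
    using \<sigma> by (simp add: abs_mult add_divide_distrib mult_ac)
  also have "\<dots> \<le> 2 * (2 * y) + 2 * (5 / 2 * ?s) * (40 * y) + 4 * c0 * (40 * y)"
  proof (intro add_mono)
    show "2 * (A / D) \<le> 2 * (2 * y)" using AD by simp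
    show "2 * (sqrt 6 * \<bar>x1 + x2\<bar>) * (\<sigma> / D) \<le> 2 * (5 / 2 * ?s) * (40 * y)"
    proof (rule mult_mono)
      show "2 * (sqrt 6 * \<bar>x1 + x2\<bar>) \<le> 2 * (5 / 2 * ?s)" using X by simp
    qed (use sD y in auto)
    show "4 * c0 * (\<sigma> / D) \<le> 4 * c0 * (40 * y)" using sD c0 by (intro mult_left_mono) auto
  qed
  finally have 1: "2 * (A + \<bar>sqrt 6 * \<sigma> * (x1 + x2)\<bar> + 2 * (\<sigma> * c0)) / D \<le> y * (4 + 200 * ?s + 160 * c0)"
    by (simp add: algebra_simps)
  have "(\<sigma> / D)\<^sup>2 \<le> (40 * y) * (40 * y)" unfolding power2_eq_square using sD y by (intro mult_mono) auto
  also have "\<dots> \<le> (40 * y) * 5" using y by (intro mult_left_mono) auto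
  finally have "(\<sigma> / D)\<^sup>2 \<le> 200 * y" by simp
  then have "24 * x2\<^sup>2 * (\<sigma> / D)\<^sup>2 \<le> 24 * x2\<^sup>2 * (200 * y)" by (intro mult_left_mono) auto
  moreover have "4 * (sqrt 6 * \<sigma> * x2)\<^sup>2 / D\<^sup>2 = 24 * x2\<^sup>2 * (\<sigma> / D)\<^sup>2"
    by (simp add: power_mult_distrib power_divide)
  ultimately have 2: "4 * (sqrt 6 * \<sigma> * x2)\<^sup>2 / D\<^sup>2 \<le> y * (4800 * x2\<^sup>2)" by simp
  have "4 + 200 * ?s + 160 * c0 + 4800 * x2\<^sup>2 \<le> (5100 + 160 * c0) * ?s"
  proof -
    define P where "P = 160 * c0 * ?s"
    have "160 * c0 * 1 \<le> 160 * c0 * ?s" using c0 by (intro mult_left_mono) auto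
    then have P: "160 * c0 \<le> P" by (simp add: P_def)
    have d: "(5100 + 160 * c0) * ?s = 5100 * ?s + P" unfolding P_def by (rule distrib_right)
    have "4 + 200 * (1 + u + v) + 160 * c0 + 4800 * v \<le> 5100 * (1 + u + v) + P" if "0 \<le> u" "0 \<le> v" for u v :: real
      using that P by simp
    then show ?thesis unfolding d by simp
  qed
  then have "y * (4 + 200 * ?s + 160 * c0 + 4800 * x2\<^sup>2) \<le> y * ((5100 + 160 * c0) * ?s)"
    using y by (intro mult_left_mono) auto
  then show ?thesis using 1 2 by (simp add: distrib_left)
qed

text \<open>\<open>\<sigma> / (80 * y)\<close> is a lower bound for a step of the true function next
  to the grid minimizer. If threshold and noise together hide it, then \<open>z\<close> or
  \<open>x\<close> is of order 1/y; squaring gives the constant 24 * 6400, half of the stated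
  one.\<close>

lemma step_error_bound:
  fixes y z x \<sigma> :: real
  assumes "0 < y" "\<sigma> > 0" "z > 0" and le: "\<sigma> / (80 * y) - 2 * sqrt 3 * \<sigma> * z \<le> sqrt 6 * \<sigma> * \<bar>x\<bar>"
  shows "1 \<le> 307200 * (1 + z\<^sup>2) * y\<^sup>2 * (1 + x\<^sup>2)"
proof -
  have "\<sigma> * (1 / (80 * y)) \<le> \<sigma> * (2 * sqrt 3 * z + sqrt 6 * \<bar>x\<bar>)" using le by (simp add: algebra_simps)
  then have 1: "1 / (80 * y) \<le> 2 * sqrt 3 * z + sqrt 6 * \<bar>x\<bar>" using assms by (simp only: mult_le_cancel_left_pos)
  have "(1 / (80 * y))\<^sup>2 \<le> (2 * sqrt 3 * z + sqrt 6 * \<bar>x\<bar>)\<^sup>2" using assms by (intro power_mono 1) auto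
  also have "\<dots> \<le> 2 * (2 * sqrt 3 * z)\<^sup>2 + 2 * (sqrt 6 * \<bar>x\<bar>)\<^sup>2"
    using zero_le_power2[of "2 * sqrt 3 * z - sqrt 6 * \<bar>x\<bar>"] by (simp add: power2_sum power2_diff)
  also have "\<dots> = 24 * z\<^sup>2 + 12 * x\<^sup>2" by (simp add: power_mult_distrib)
  also have "\<dots> \<le> 24 * (1 + z\<^sup>2) * (1 + x\<^sup>2)" by (simp add: algebra_simps)
  finally have "1 / (6400 * y\<^sup>2) \<le> 24 * (1 + z\<^sup>2) * (1 + x\<^sup>2)" by (simp add: power_divide power_mult_distrib)
  then have "1 \<le> 24 * (1 + z\<^sup>2) * (1 + x\<^sup>2) * (6400 * y\<^sup>2)" using assms by (simp add: pos_divide_le_eq)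
  also have "\<dots> = 153600 * ((1 + z\<^sup>2) * y\<^sup>2 * (1 + x\<^sup>2))" by simp
  also have "\<dots> \<le> 307200 * ((1 + z\<^sup>2) * y\<^sup>2 * (1 + x\<^sup>2))" by (intro mult_right_mono) auto
  finally show ?thesis by (simp only: mult.assoc)
qed

section \<open>Steps and curvature at the grid minimizer\<close>

context convex_regression_radius
begin

definition grid_min :: "nat \<Rightarrow> bool" where
  "grid_min v \<longleftrightarrow> v \<le> n \<and> (\<forall>i\<le>n. a v \<le> a i)"

lemma grid_min_ex: "\<exists>v. grid_min v"
proof -
  let ?v = "arg_min_on a {..n}"
  have "?v \<in> {..n}" "\<not> (\<exists>i\<in>{..n}. a i < a ?v)"
    using arg_min_if_finite[of "{..n}" a] by auto
  then have "grid_min ?v" by (auto simp: grid_min_def not_less)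
  then show ?thesis ..
qed

lemma grid_min_near: "grid_min v \<Longrightarrow> \<bar>nZ - real v\<bar> \<le> real n * R"
proof -
  assume v: "grid_min v"
  have "\<bar>minimizer f - real v / real n\<bar> \<le> R"
    by (rule radius_bound_grid_min[OF f_class rb \<sigma>_pos]) (use v n1 in \<open>auto simp: grid_min_def a_def\<close>)
  then have "real n * \<bar>minimizer f - real v / real n\<bar> \<le> real n * R" by (intro mult_left_mono) auto
  also have "real n * \<bar>minimizer f - real v / real n\<bar> = \<bar>real n * (minimizer f - real v / real n)\<bar>"
    by (simp add: abs_mult)
  also have "real n * (minimizer f - real v / real n) = nZ - real v"
    using n1 by (simp add: nZ_def right_diff_distrib)
  finally show ?thesis .
qed

lemma grid_min_right:
  assumes v: "grid_min v" "v < n" and small: "real n * R < 1 / 8"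
  shows "v + 2 \<le> n" "3/4 * (a (v + 2) - a (v + 1)) \<le> a (v + 1) - a v"
    "\<sigma> / (60 * (real n * R)) \<le> a (v + 2) - a (v + 1)"
  using gap_right[OF f_class rb \<sigma>_pos R_pos v(2) _ small] v(1)
  by (auto simp: grid_min_def a_def mult.assoc)

lemma f_reflect: "i \<le> n \<Longrightarrow> f (1 - real i / real n) = a (n - i)"
  using n1 by (simp add: a_def of_nat_diff diff_divide_distrib)

lemma grid_min_left:
  assumes v: "grid_min v" "0 < v" and small: "real n * R < 1 / 8"
  shows "2 \<le> v" "3/4 * (a (v - 2) - a (v - 1)) \<le> a (v - 1) - a v"
    "\<sigma> / (60 * (real n * R)) \<le> a (v - 2) - a (v - 1)"
proof -
  have vn: "v \<le> n" using v by (simp add: grid_min_def)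
  have lt: "n - v < n" using v vn by simp
  have e0: "f (1 - real (n - v) / real n) = a v" by (subst f_reflect) (use vn in auto)
  have min: "f (1 - real (n - v) / real n) \<le> f (1 - real i / real n)" if "i \<le> n" for i
    unfolding e0 f_reflect[OF that] using v(1) by (simp add: grid_min_def)
  note g = gap_right[OF convex_class_reflect(1)[OF f_class] radius_bound_reflect[OF rb f_class n1] \<sigma>_pos R_pos lt min small]
  show v2: "2 \<le> v" using g(1) vn by simp
  have nn: "n - (n - v) = v" "n - Suc (n - v) = v - 1" "n - (n - v + 2) = v - 2" using v2 vn by auto
  have e: "f (1 - real (n - v) / real n) = a v" "f (1 - real (Suc (n - v)) / real n) = a (v - 1)"
    "f (1 - real (n - v + 2) / real n) = a (v - 2)"
    using f_reflect[of "n - v"] f_reflect[of "Suc (n - v)"] f_reflect[of "n - v + 2"] v2 vn unfolding nn by auto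
  show "3/4 * (a (v - 2) - a (v - 1)) \<le> a (v - 1) - a v" using g(2) unfolding e .
  show "\<sigma> / (60 * (real n * R)) \<le> a (v - 2) - a (v - 1)" using g(3) unfolding e by (simp add: mult.assoc)
qed

lemma small_gap:
  assumes "real n * R < 1 / 8"
  shows "\<sigma> / 10 \<le> \<sigma> / (80 * (real n * R))"
proof (rule divide_left_mono)
  show "80 * (real n * R) \<le> 10" using assms by linarith
  show "0 < 10 * (80 * (real n * R))" using nR_pos by linarith
qed (use \<sigma>_pos in simp)

text \<open>The step next to the grid minimizer is at least 3/4 of the following one, hence 1/80 =
  3/4 * 1/60. Convexity carries the bound outwards.\<close>

lemma steps_from_grid_min:
  assumes v: "grid_min v" and small: "real n * R < 1 / 8"
  shows "v \<le> k \<Longrightarrow> k < n \<Longrightarrow> \<sigma> / (80 * (real n * R)) \<le> a (k + 1) - a k"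
    and "k < v \<Longrightarrow> \<sigma> / (80 * (real n * R)) \<le> a k - a (k + 1)"
proof -
  have vn: "v \<le> n" using v by (simp add: grid_min_def)
  have q: "\<sigma> / (80 * (real n * R)) = 3 / 4 * (\<sigma> / (60 * (real n * R)))" by simp
  show "\<sigma> / (80 * (real n * R)) \<le> a (k + 1) - a k" if "v \<le> k" "k < n"
  proof -
    have "v < n" using that by simp
    note g = grid_min_right[OF v this small]
    have "\<sigma> / (80 * (real n * R)) \<le> 3 / 4 * (a (v + 2) - a (v + 1))"
      unfolding q by (rule mult_left_mono[OF g(3)]) simp
    also have "\<dots> \<le> a (v + 1) - a v" by (rule g(2))
    also have "\<dots> \<le> a (k + 1) - a k"
      using convex_on_increments_mono[OF convex_f that] by (simp add: a_def)
    finally show ?thesis .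
  qed
  show "\<sigma> / (80 * (real n * R)) \<le> a k - a (k + 1)" if "k < v"
  proof -
    have "0 < v" using that by simp
    note g = grid_min_left[OF v this small]
    have "\<sigma> / (80 * (real n * R)) \<le> 3 / 4 * (a (v - 2) - a (v - 1))"
      unfolding q by (rule mult_left_mono[OF g(3)]) simp
    also have "\<dots> \<le> a (v - 1) - a v" by (rule g(2))
    also have "\<dots> \<le> a k - a (k + 1)"
    proof -
      have "k \<le> v - 1" "v - 1 < n" using that vn by auto
      from convex_on_increments_mono[OF convex_f this] have "a (Suc k) - a k \<le> a (Suc (v - 1)) - a (v - 1)"
        by (simp only: a_def)
      then show ?thesis using that by simp
    qed
    finally show ?thesis .
  qed
qed

text \<open>The minimizer is within 1/8 of a grid step from \<open>v\<close>, so the values are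
  monotone from the neighbours of \<open>v\<close> outwards and only the first step matters;
  \<open>small_gap\<close> bounds it by \<sigma>/10. The separation by \<sigma>/20 is the premise of
  \<open>curvature_right\<close>.\<close>

lemma separated:
  assumes v: "grid_min v" and small: "real n * R < 1 / 8" and i: "i \<le> n" "i \<noteq> v"
  shows "a v + \<sigma> / 20 \<le> a i"
proof -
  have near: "\<bar>nZ - real v\<bar> < 1" using grid_min_near[OF v] small by simp
  have vn: "v \<le> n" using v by (simp add: grid_min_def)
  have s: "\<sigma> / 20 \<le> \<sigma> / (80 * (real n * R))" using small_gap[OF small] \<sigma>_pos by simp
  show ?thesis
  proof (cases "v < i")
    case True
    have "a (v + 1) \<le> a i" using True i near by (intro a_right) auto
    moreover have "\<sigma> / (80 * (real n * R)) \<le> a (v + 1) - a v"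
      by (rule steps_from_grid_min(1)[OF v small]) (use True i in auto)
    ultimately show ?thesis using s by linarith
  next
    case False
    then have iv: "i < v" using i by simp
    have "a (v - 1) \<le> a i" using iv near by (intro a_left) (auto simp: of_nat_diff)
    moreover have "\<sigma> / (80 * (real n * R)) \<le> a (v - 1) - a (v - 1 + 1)"
      by (rule steps_from_grid_min(2)[OF v small]) (use iv in auto)
    moreover have "v - 1 + 1 = v" using iv by simp
    ultimately have "\<sigma> / (80 * (real n * R)) \<le> a (v - 1) - a v" "a (v - 1) \<le> a i" by (simp_all only:)
    then show ?thesis using s by linarith
  qed
qed

lemma curvature_at_grid_min:
  assumes v: "grid_min v" and small: "real n * R < 1 / 8"
  shows "v < n \<Longrightarrow> a v - 2 * a (v + 1) + a (v + 2) + \<sigma> / 20 \<le> 2 * (real n * R) * (a (v + 2) - a (v + 1))"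
    and "0 < v \<Longrightarrow> a v - 2 * a (v - 1) + a (v - 2) + \<sigma> / 20 \<le> 2 * (real n * R) * (a (v - 2) - a (v - 1))"
proof -
  have vn: "v \<le> n" using v by (simp add: grid_min_def)
  show "a v - 2 * a (v + 1) + a (v + 2) + \<sigma> / 20 \<le> 2 * (real n * R) * (a (v + 2) - a (v + 1))" if "v < n"
    using curvature_right[OF f_class rb \<sigma>_pos R_pos grid_min_right(1)[OF v that small]] separated[OF v small]
    by (auto simp: a_def)
  show "a v - 2 * a (v - 1) + a (v - 2) + \<sigma> / 20 \<le> 2 * (real n * R) * (a (v - 2) - a (v - 1))" if "0 < v"
  proof -
    have v2: "2 \<le> v" by (rule grid_min_left(1)[OF v that small])
    have sep: "f (1 - real (n - v) / real n) + \<sigma> / 20 \<le> f (1 - real i / real n)" if "i \<le> n" "i \<noteq> n - v" for i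
    proof -
      have "n - i \<noteq> v" using that vn by auto
      moreover have "f (1 - real (n - v) / real n) = a v" by (subst f_reflect) (use vn in auto)
      ultimately show ?thesis
        unfolding f_reflect[OF that(1)] using separated[OF v small, of "n - i"] by simp
    qed
    have le: "n - v + 2 \<le> n" using v2 vn by simp
    have nn: "n - (n - v) = v" "n - Suc (n - v) = v - 1" "n - (n - v + 2) = v - 2" using v2 vn by auto
    have e: "f (1 - real (n - v) / real n) = a v" "f (1 - real (Suc (n - v)) / real n) = a (v - 1)"
      "f (1 - real (n - v + 2) / real n) = a (v - 2)"
      using f_reflect[of "n - v"] f_reflect[of "Suc (n - v)"] f_reflect[of "n - v + 2"] v2 vn unfolding nn by auto
    show ?thesis
      using curvature_right[OF convex_class_reflect(1)[OF f_class] radius_bound_reflect[OF rb f_class n1] \<sigma>_pos R_pos le sep]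
      unfolding e .
  qed
qed

end

section \<open>The refined interval when both indices are found correctly\<close>

context convex_regression_radius
begin


lemma window_at_grid_min:
  assumes v: "grid_min v" and small: "real n * R < 1 / 8" and near: "near \<omega> J" and r: "24 \<le> window_radius \<alpha>"
  defines "L \<equiv> window_lower \<alpha> (loc \<omega> J)" and "U \<equiv> window_upper n \<alpha> (loc \<omega> J)"
  shows "0 \<le> L" "U \<le> int n" "L = 0 \<or> L < int v" "U = int n \<or> int v < U"
    "int v - 2 * window_radius \<alpha> \<le> L" "U \<le> int v + 2 * window_radius \<alpha>" "v = n \<Longrightarrow> U = int n"
proof -
  have nv: "\<bar>nZ - real v\<bar> < 1 / 8" using grid_min_near[OF v] small by linarith
  have vn: "v \<le> n" using v by (simp add: grid_min_def)
  have "\<lfloor>nZ\<rfloor> \<le> int v" "int v - 1 \<le> \<lfloor>nZ\<rfloor>" using nv by linarith+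
  then have "istar J \<le> int v + 1" "int v \<le> istar J" by (simp_all add: istar_def)
  then have i: "int v - 1 \<le> loc \<omega> J" "loc \<omega> J \<le> int v + 2" using near by (auto simp: near_def)
  show "0 \<le> L" "U \<le> int n" "L = 0 \<or> L < int v" "U = int n \<or> int v < U"
    "int v - 2 * window_radius \<alpha> \<le> L" "U \<le> int v + 2 * window_radius \<alpha>" "v = n \<Longrightarrow> U = int n"
    using i r vn unfolding L_def U_def window_lower_def window_upper_def by auto
qed

text \<open>The differences pass from above \<open>t\<close> to below \<open>- t\<close> exactly at
  \<open>v\<close>, so both tests switch there; away from the ends of the window, the refined
  interval is then bracketed by \<open>v - 1\<close> and \<open>v + 1\<close>.\<close>

lemma indices_at_grid_min:
  assumes v: "v \<le> n" and LU: "0 \<le> L" "U \<le> int n" "L = 0 \<or> L < int v" "U = int n \<or> int v < U" "v = n \<Longrightarrow> U = int n"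
    and t: "t \<ge> 0"
    and below: "\<And>k. k < v \<Longrightarrow> L \<le> int k \<Longrightarrow> p k - p (k + 1) > t"
    and above: "\<And>k. v \<le> k \<Longrightarrow> int k < U \<Longrightarrow> p k - p (k + 1) < - t"
  shows "left_index L U p t = int v" "right_index L U p t = int v - 1"
proof -
  have suc: "nat (k + 1) = nat k + 1" if "0 \<le> k" for k using that by (simp add: nat_add_distrib)
  have A: "{k \<in> {L..U - 1}. p (nat k) - p (nat (k + 1)) \<le> t} = {int v..U - 1}"
  proof (intro set_eqI iffI)
    fix k assume k: "k \<in> {k \<in> {L..U - 1}. p (nat k) - p (nat (k + 1)) \<le> t}"
    then have k0: "0 \<le> k" using LU by auto
    have "\<not> nat k < v" using below[of "nat k"] k k0 suc[OF k0] by auto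
    then show "k \<in> {int v..U - 1}" using k k0 by auto
  next
    fix k assume k: "k \<in> {int v..U - 1}"
    then have k0: "0 \<le> k" by auto
    have "p (nat k) - p (nat k + 1) < - t" using above[of "nat k"] k k0 by auto
    then show "k \<in> {k \<in> {L..U - 1}. p (nat k) - p (nat (k + 1)) \<le> t}"
      using k k0 LU t suc[OF k0] by auto
  qed
  have vU: "int v \<le> U" using LU v by auto
  show "left_index L U p t = int v"
    unfolding left_index_def A by (rule Min_eqI) (use vU LU v in auto)
  have B: "{k \<in> {L..U - 1}. p (nat k) - p (nat (k + 1)) \<ge> - t} = {L..int v - 1}"
  proof (intro set_eqI iffI)
    fix k assume k: "k \<in> {k \<in> {L..U - 1}. p (nat k) - p (nat (k + 1)) \<ge> - t}"
    then have k0: "0 \<le> k" using LU by auto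
    have "\<not> v \<le> nat k" using above[of "nat k"] k k0 suc[OF k0] by auto
    then show "k \<in> {L..int v - 1}" using k k0 by auto
  next
    fix k assume k: "k \<in> {L..int v - 1}"
    then have k0: "0 \<le> k" using LU by auto
    have "p (nat k) - p (nat k + 1) > t" using below[of "nat k"] k k0 by auto
    then show "k \<in> {k \<in> {L..U - 1}. p (nat k) - p (nat (k + 1)) \<ge> - t}"
      using k k0 LU t vU suc[OF k0] by auto
  qed
  show "right_index L U p t = int v - 1"
    unfolding right_index_def B by (rule Max_eqI) (use LU v in auto)
qed

text \<open>Fraction of the cell between \<open>v\<close> and its neighbour \<open>k\<close> that
  the refined interval keeps; \<open>l\<close> is the grid point beyond \<open>k\<close>.\<close>

definition clipped :: "(nat \<Rightarrow> real) \<Rightarrow> real \<Rightarrow> nat \<Rightarrow> nat \<Rightarrow> nat \<Rightarrow> real" where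
  "clipped q c v k l = min 1 (max 0 ((q v - q k + c) / (q l - q k + c) + 1))"

text \<open>The values v = 0 and v = n lead to the one-sided branches. For other \<open>v\<close>
  the bracket has length 2, and \<open>v2\<close> keeps it away from both ends, so the extrapolating
  branch applies. A nonpositive denominator yields an interval of length 0.\<close>

lemma fine_endpoints_at_grid_min:
  assumes v: "v \<le> n" and v2: "v < n \<Longrightarrow> v + 2 \<le> n" "0 < v \<Longrightarrow> 2 \<le> v"
    and LU: "0 \<le> L" "U \<le> int n" "L = 0 \<or> L < int v" "U = int n \<or> int v < U" "v = n \<Longrightarrow> U = int n"
    and right: "v < n \<Longrightarrow> q (v + 2) - q (v + 1) + c > 0 \<Longrightarrow> clipped q c v (v + 1) (v + 2) \<le> bR"
    and left: "0 < v \<Longrightarrow> q (v - 2) - q (v - 1) + c > 0 \<Longrightarrow> clipped q c v (v - 1) (v - 2) \<le> bL"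
    and b: "0 \<le> bR" "0 \<le> bL"
  defines "e \<equiv> fine_endpoints n c L U (int v) (int v - 1) (extend n q)"
  shows "snd e - fst e \<le> (bR + bL) / real n"
proof -
  let ?q = "extend n q" and ?N = "real n"
  have N: "?N > 0" using n1 by simp
  have scale: "min (max (x / (?N * y) + k / ?N) ((k - 1) / ?N)) (k / ?N) = (k - 1 + min 1 (max 0 (x / y + 1))) / ?N" for x y k
  proof -
    have "x / (?N * y) + k / ?N = (x / y + k) / ?N" by (simp add: add_divide_distrib mult.commute)
    moreover have "max (s / ?N) (t / ?N) = max s t / ?N" "min (s / ?N) (t / ?N) = min s t / ?N" for s t
      using N by (auto simp: max_def min_def divide_le_cancel)
    ultimately show ?thesis by (simp add: max_def min_def)
  qed
  have scale': "min (max (- (x / (?N * y)) + k / ?N) (k / ?N)) ((k + 1) / ?N) = (k + 1 - min 1 (max 0 (x / y + 1))) / ?N" for x y k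
  proof -
    have "- (x / (?N * y)) + k / ?N = (k - x / y) / ?N" by (simp add: diff_divide_distrib mult.commute)
    moreover have "max (s / ?N) (t / ?N) = max s t / ?N" "min (s / ?N) (t / ?N) = min s t / ?N" for s t
      using N by (auto simp: max_def min_def divide_le_cancel)
    ultimately show ?thesis by (simp add: max_def min_def)
  qed
  have bb: "0 \<le> (bR + bL) / ?N" using b N by simp
  have ext: "?q (int k) = ereal (q k)" if "k \<le> n" for k using that by (simp add: extend_nat)
  consider "v = 0" | "v = n" "0 < v" | "0 < v" "v < n" using v by linarith
  then show ?thesis
  proof cases
    case 1
    then have L: "L = 0" using LU by auto
    have n2: "2 \<le> n" using v2(1) 1 n1 by simp
    have q: "?q 2 = ereal (q 2)" "?q 1 = ereal (q 1)" "?q 0 = ereal (q 0)"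
      using ext[of 2] ext[of 1] ext[of 0] n2 by simp_all
    show ?thesis
    proof (cases "q 2 - q 1 + c > 0")
      case True
      have "e = (0, min (max ((q 0 - q 1 + c) / (?N * (q 2 - q 1 + c)) + 1 / ?N) ((1 - 1) / ?N)) (1 / ?N))"
        unfolding e_def fine_endpoints_def Let_def q ratio_real[OF N True] using 1 L True by simp
      then have "snd e - fst e = clipped q c 0 1 2 / ?N" unfolding scale by (simp add: clipped_def)
      also have "\<dots> \<le> (bR + bL) / ?N"
        using right 1 n1 True b N by (intro divide_right_mono) (auto simp: numeral_2_eq_2)
      finally show ?thesis .
    next
      case False
      then have "e = (0, 0)" unfolding e_def fine_endpoints_def Let_def q using 1 L by simp
      then show ?thesis using bb by simp
    qed
  next
    case 2
    then have U: "U = int n" and v2': "2 \<le> v" using LU v2 by auto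
    have Lv: "int v - 1 \<noteq> L - 1" using LU 2 by auto
    have q: "?q (int n - 2) = ereal (q (v - 2))" "?q (int n - 1) = ereal (q (v - 1))" "?q (int n) = ereal (q v)"
      using ext[of "v - 2"] ext[of "v - 1"] ext[of v] v2' 2 by (simp_all add: of_nat_diff)
    show ?thesis
    proof (cases "q (v - 2) - q (v - 1) + c > 0")
      case True
      have "e = (min (max (- ((q v - q (v - 1) + c) / (?N * (q (v - 2) - q (v - 1) + c))) + (?N - 1) / ?N)
                           ((?N - 1) / ?N)) ((?N - 1 + 1) / ?N), 1)"
        unfolding e_def fine_endpoints_def Let_def q ratio_real[OF N True] using 2 U Lv True N by simp
      then have "snd e - fst e = clipped q c v (v - 1) (v - 2) / ?N"
        unfolding scale' using N by (simp add: clipped_def diff_divide_distrib add_divide_distrib)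
      also have "\<dots> \<le> (bR + bL) / ?N"
        using left 2 True b N by (intro divide_right_mono) auto
      finally show ?thesis .
    next
      case False
      then have "e = (of_int U / ?N, of_int U / ?N)"
        unfolding e_def fine_endpoints_def Let_def q using 2 U Lv by simp
      then show ?thesis using bb by simp
    qed
  next
    case 3
    then have v2': "2 \<le> v" "v + 2 \<le> n" using v2 by auto
    have Lv: "int v - 1 \<noteq> L - 1" and Uv: "int v \<noteq> U" using LU 3 by auto
    have lo: "max (int v - 1) L = int (v - 1)" using LU 3 by auto
    have hi: "min (int v - 1 + 2) U = int (v + 1)" using LU 3 v2' by auto
    have not: "\<not> (int (v + 1) - int (v - 1) \<ge> 3 \<or> (int (v + 1) - int n) * int (v - 1) = 0)"
      using v2' by (simp add: of_nat_diff)
    have ints: "int (v + 1) + 1 = int (v + 2)" "int (v + 1) - 1 = int v" "int (v - 1) + 1 = int v" "int (v - 1) - 1 = int (v - 2)"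
      using v2' by (auto simp: of_nat_diff)
    have q: "?q (int (v + 2)) = ereal (q (v + 2))" "?q (int (v + 1)) = ereal (q (v + 1))" "?q (int v) = ereal (q v)"
      "?q (int (v - 1)) = ereal (q (v - 1))" "?q (int (v - 2)) = ereal (q (v - 2))"
      using v2' by (simp_all only: extend_nat) auto
    have e: "e = (if ereal (q (v + 2)) - ereal (q (v + 1)) \<le> - ereal c \<or> ereal (q (v - 2)) - ereal (q (v - 1)) \<le> - ereal c
      then (of_int (int (v + 1) + int (v - 1)) / (2 * ?N), of_int (int (v + 1) + int (v - 1)) / (2 * ?N))
      else (min (max (- ratio (ereal (q v) - ereal (q (v - 1)) + c) (?N * (ereal (q (v - 2)) - ereal (q (v - 1)) + c))
                      + of_int (int (v - 1)) / ?N) (of_int (int (v - 1)) / ?N)) (of_int (int v) / ?N),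
            min (max (ratio (ereal (q v) - ereal (q (v + 1)) + c) (?N * (ereal (q (v + 2)) - ereal (q (v + 1)) + c))
                      + of_int (int (v + 1)) / ?N) (of_int (int v) / ?N)) (of_int (int (v + 1)) / ?N)))"
      unfolding e_def fine_endpoints_def Let_def lo hi ints q if_not_P[OF Lv] if_not_P[OF Uv] if_not_P[OF not] ..
    show ?thesis
    proof (cases "q (v + 2) - q (v + 1) + c > 0 \<and> q (v - 2) - q (v - 1) + c > 0")
      case True
      then have D: "q (v + 2) - q (v + 1) + c > 0" "q (v - 2) - q (v - 1) + c > 0" by auto
      have nle: "\<not> (ereal (q (v + 2)) - ereal (q (v + 1)) \<le> - ereal c \<or> ereal (q (v - 2)) - ereal (q (v - 1)) \<le> - ereal c)"
        using D by simp
      have "e = (min (max (- ((q v - q (v - 1) + c) / (?N * (q (v - 2) - q (v - 1) + c))) + (real v - 1) / ?N)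
                           ((real v - 1) / ?N)) ((real v - 1 + 1) / ?N),
          min (max ((q v - q (v + 1) + c) / (?N * (q (v + 2) - q (v + 1) + c)) + (real v + 1) / ?N)
                           ((real v + 1 - 1) / ?N)) ((real v + 1) / ?N))"
        unfolding e if_not_P[OF nle] ratio_real[OF N D(1)] ratio_real[OF N D(2)]
        using 3 by (simp add: of_nat_diff add.commute)
      then have "snd e - fst e = (clipped q c v (v + 1) (v + 2) + clipped q c v (v - 1) (v - 2)) / ?N"
        unfolding scale scale' by (simp add: clipped_def diff_divide_distrib add_divide_distrib)
      also have "\<dots> \<le> (bR + bL) / ?N"
        using right left 3 D N by (intro divide_right_mono add_mono) auto
      finally show ?thesis .
    next
      case False
      then have le: "ereal (q (v + 2)) - ereal (q (v + 1)) \<le> - ereal c \<or> ereal (q (v - 2)) - ereal (q (v - 1)) \<le> - ereal c"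
        by auto
      show ?thesis unfolding e if_P[OF le] using bb by simp
    qed
  qed
qed


definition pair_cost :: "nat \<Rightarrow> nat \<Rightarrow> nat \<Rightarrow> outcome \<Rightarrow> real" where
  "pair_cost v k l \<omega> = 1 + (noi (3, v) \<omega> - noi (3, k) \<omega>)\<^sup>2 + (noi (3, l) \<omega> - noi (3, k) \<omega>)\<^sup>2"

lemma q_sample_eq: "q_sample \<sigma> \<omega> k = a k + sqrt 6 * \<sigma> * noi (3, k) \<omega>"
  unfolding q_sample_def q_noise[OF \<sigma>_pos, of \<omega> k f n] a_def ..

lemma p_sample_eq: "p_sample \<sigma> \<omega> k = a k + sqrt 6 * \<sigma> * noi (1, k) \<omega>"
  unfolding p_sample_def p_noise[OF \<sigma>_pos, of \<omega> k f n] a_def ..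

lemma clipped_bound:
  assumes small: "real n * R < 1 / 8" and D: "0 < a l - a k" and A: "0 \<le> a v - 2 * a k + a l"
    and curv: "a v - 2 * a k + a l + \<sigma> / 20 \<le> 2 * (real n * R) * (a l - a k)"
    and c0: "c0 > 0" and den: "q_sample \<sigma> \<omega> l - q_sample \<sigma> \<omega> k + \<sigma> * c0 > 0"
  shows "clipped (q_sample \<sigma> \<omega>) (\<sigma> * c0) v k l \<le> real n * R * ((5100 + 160 * c0) * pair_cost v k l \<omega>)"
proof -
  define x1 where "x1 = noi (3, v) \<omega> - noi (3, k) \<omega>"
  define x2 where "x2 = noi (3, l) \<omega> - noi (3, k) \<omega>"
  have "clipped (q_sample \<sigma> \<omega>) (\<sigma> * c0) v k l
      \<le> 2 * (a v - 2 * a k + a l + \<bar>sqrt 6 * \<sigma> * (x1 + x2)\<bar> + 2 * (\<sigma> * c0)) / (a l - a k)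
        + 4 * (sqrt 6 * \<sigma> * x2)\<^sup>2 / (a l - a k)\<^sup>2"
    unfolding clipped_def
    by (rule clipped_ratio_le[OF D _ _ den _ A])
      (use \<sigma>_pos c0 in \<open>auto simp: q_sample_eq x1_def x2_def algebra_simps\<close>)
  also have "\<dots> \<le> real n * R * ((5100 + 160 * c0) * (1 + x1\<^sup>2 + x2\<^sup>2))"
    by (rule ratio_bound_small[OF nR_pos small D \<sigma>_pos A c0]) (use curv in simp)
  finally show ?thesis by (simp add: pair_cost_def x1_def x2_def)
qed

definition step_error :: "real \<Rightarrow> nat \<Rightarrow> outcome \<Rightarrow> bool" where
  "step_error z k \<omega> \<longleftrightarrow> 1 \<le> 307200 * (1 + z\<^sup>2) * (real n * R)\<^sup>2 * (1 + (noi (1, k) \<omega> - noi (1, k + 1) \<omega>)\<^sup>2)"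

text \<open>Without a step error the sample \<open>p\<close> identifies \<open>v\<close> exactly.
  The length is then at most a sum of two kept fractions of cells, each of which is at most nR times
  a quadratic noise cost; division by n leaves R.\<close>

lemma refined_length:
  assumes v: "grid_min v" and small: "real n * R < 1 / 8" and near: "near \<omega> J" and r: "24 \<le> window_radius \<alpha>"
    and z: "z_quantile (\<alpha> / 8) > 0" "z_quantile (\<alpha> / 24) > 0"
    and no_err: "\<And>k. int v - 2 * window_radius \<alpha> \<le> int k \<Longrightarrow> int k < int v + 2 * window_radius \<alpha> \<Longrightarrow> k < n
      \<Longrightarrow> \<not> step_error (z_quantile (\<alpha> / 8)) k \<omega>"
  defines "e \<equiv> endpoints_at n \<sigma> \<alpha> \<omega> (loc \<omega> J)" and "c0 \<equiv> 2 * sqrt 6 * z_quantile (\<alpha> / 24)"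
  shows "snd e - fst e \<le> R * ((5100 + 160 * c0) * ((if v < n then pair_cost v (v + 1) (v + 2) \<omega> else 0)
      + (if 0 < v then pair_cost v (v - 1) (v - 2) \<omega> else 0)))"
proof -
  define L where "L = window_lower \<alpha> (loc \<omega> J)"
  define U where "U = window_upper n \<alpha> (loc \<omega> J)"
  note w = window_at_grid_min[OF v small near r, folded L_def U_def]
  have vn: "v \<le> n" using v by (simp add: grid_min_def)
  let ?z = "z_quantile (\<alpha> / 8)"
  let ?t = "p_threshold \<sigma> \<alpha>"
  have c0: "c0 > 0" using z by (simp add: c0_def)
  have c: "q_slack \<sigma> \<alpha> = \<sigma> * c0" by (simp add: q_slack_def c0_def)
  have t: "0 \<le> ?t" using z \<sigma>_pos by (simp add: p_threshold_def)
  have noise: "sqrt 6 * \<sigma> * \<bar>noi (1, k) \<omega> - noi (1, k + 1) \<omega>\<bar> < \<sigma> / (80 * (real n * R)) - ?t"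
    if k: "L \<le> int k" "int k < U" for k
  proof (rule ccontr)
    assume "\<not> ?thesis"
    then have "\<sigma> / (80 * (real n * R)) - 2 * sqrt 3 * \<sigma> * ?z \<le> sqrt 6 * \<sigma> * \<bar>noi (1, k) \<omega> - noi (1, k + 1) \<omega>\<bar>"
      by (simp add: p_threshold_def)
    then have "step_error ?z k \<omega>"
      unfolding step_error_def by (rule step_error_bound[OF nR_pos \<sigma>_pos z(1)])
    moreover have "\<not> step_error ?z k \<omega>" using w k by (intro no_err) auto
    ultimately show False by simp
  qed
  have diff: "p_sample \<sigma> \<omega> k - p_sample \<sigma> \<omega> (k + 1) = a k - a (k + 1) + sqrt 6 * \<sigma> * (noi (1, k) \<omega> - noi (1, k + 1) \<omega>)" for k
    by (simp add: p_sample_eq algebra_simps)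
  have absb: "\<bar>sqrt 6 * \<sigma> * (noi (1, k) \<omega> - noi (1, k + 1) \<omega>)\<bar> = sqrt 6 * \<sigma> * \<bar>noi (1, k) \<omega> - noi (1, k + 1) \<omega>\<bar>" for k
    using \<sigma>_pos by (simp add: abs_mult)
  have below: "p_sample \<sigma> \<omega> k - p_sample \<sigma> \<omega> (k + 1) > ?t" if k: "k < v" "L \<le> int k" for k
  proof -
    have "int k < U" using w k vn by auto
    then show ?thesis
      using noise[OF k(2)] steps_from_grid_min(2)[OF v small k(1)] absb[of k] unfolding diff by linarith
  qed
  have above: "p_sample \<sigma> \<omega> k - p_sample \<sigma> \<omega> (k + 1) < - ?t" if k: "v \<le> k" "int k < U" for k
  proof -
    have "L \<le> int k" using w k by auto
    moreover have "k < n" using k w by auto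
    ultimately show ?thesis
      using noise[OF _ k(2)] steps_from_grid_min(1)[OF v small k(1)] absb[of k] unfolding diff by linarith
  qed
  have idx: "left_index L U (p_sample \<sigma> \<omega>) ?t = int v" "right_index L U (p_sample \<sigma> \<omega>) ?t = int v - 1"
    by (rule indices_at_grid_min[OF vn w(1-4) _ t]; use w(7) below above in auto)+
  have e: "e = fine_endpoints n (\<sigma> * c0) L U (int v) (int v - 1) (extend n (q_sample \<sigma> \<omega>))"
    unfolding e_def endpoints_at_def L_def[symmetric] U_def[symmetric] idx c ..
  let ?bR = "if v < n then real n * R * ((5100 + 160 * c0) * pair_cost v (v + 1) (v + 2) \<omega>) else 0"
  let ?bL = "if 0 < v then real n * R * ((5100 + 160 * c0) * pair_cost v (v - 1) (v - 2) \<omega>) else 0"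
  have pc: "0 \<le> pair_cost i k l \<omega>" for i k l by (simp add: pair_cost_def)
  have cpos: "0 < \<sigma> / (60 * (real n * R))" using \<sigma>_pos nR_pos by simp
  have right: "clipped (q_sample \<sigma> \<omega>) (\<sigma> * c0) v (v + 1) (v + 2) \<le> ?bR"
    if "v < n" "q_sample \<sigma> \<omega> (v + 2) - q_sample \<sigma> \<omega> (v + 1) + \<sigma> * c0 > 0"
  proof -
    note g = grid_min_right[OF v that(1) small]
    have "a (Suc v) - a v \<le> a (Suc (Suc v)) - a (Suc v)"
      using convex_on_increments_mono[OF convex_f, of v "Suc v" n] g(1) by (simp add: a_def)
    then have A: "0 \<le> a v - 2 * a (v + 1) + a (v + 2)" by simp
    have D: "0 < a (v + 2) - a (v + 1)" using g(3) cpos by linarith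
    show ?thesis
      using clipped_bound[OF small D A curvature_at_grid_min(1)[OF v small that(1)] c0 that(2)] that(1) by simp
  qed
  have left: "clipped (q_sample \<sigma> \<omega>) (\<sigma> * c0) v (v - 1) (v - 2) \<le> ?bL"
    if "0 < v" "q_sample \<sigma> \<omega> (v - 2) - q_sample \<sigma> \<omega> (v - 1) + \<sigma> * c0 > 0"
  proof -
    note g = grid_min_left[OF v that(1) small]
    have s: "Suc (v - 2) = v - 1" "Suc (v - 1) = v" using g(1) by auto
    have "v - 2 \<le> v - 1" "v - 1 < n" using g(1) vn by auto
    from convex_on_increments_mono[OF convex_f this] have "a (v - 1) - a (v - 2) \<le> a v - a (v - 1)"
      unfolding s by (simp only: a_def)
    then have A: "0 \<le> a v - 2 * a (v - 1) + a (v - 2)" by linarith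
    have D: "0 < a (v - 2) - a (v - 1)" using g(3) cpos by linarith
    show ?thesis
      using clipped_bound[OF small D A curvature_at_grid_min(2)[OF v small that(1)] c0 that(2)] that(1) by simp
  qed
  have "snd e - fst e \<le> (?bR + ?bL) / real n"
    unfolding e
    by (rule fine_endpoints_at_grid_min[OF vn grid_min_right(1)[OF v _ small] grid_min_left(1)[OF v _ small] w(1-4,7) right left])
      (use pc c0 nR_pos in auto)
  also have "\<dots> = R * ((5100 + 160 * c0) * ((if v < n then pair_cost v (v + 1) (v + 2) \<omega> else 0)
      + (if 0 < v then pair_cost v (v - 1) (v - 2) \<omega> else 0)))"
    using n1 by (auto simp: field_simps)
  finally show ?thesis .
qed

end

section \<open>The expected length\<close>

text \<open>Each summand is at most \<open>6\<close> times the increment of \<open>t \<mapsto> - R\<^sup>2 / (t + R)\<close> from \<open>2\<^sup>i x\<close> to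
  \<open>2\<^sup>i\<^sup>+\<^sup>1 x\<close>, so the sum telescopes.\<close>

lemma sum_dyadic_min_le:
  fixes R x :: real
  assumes R: "R > 0" and x: "x > 0"
  shows "(\<Sum>i<m. min (2 ^ i * x) (R\<^sup>2 / (2 ^ i * x))) \<le> 6 * R"
proof -
  let ?g = "\<lambda>t. R\<^sup>2 / (t + R)"
  have step: "min t (R\<^sup>2 / t) \<le> 6 * (?g t - ?g (2 * t))" if t: "t > 0" for t
  proof -
    have d: "?g t - ?g (2 * t) = R\<^sup>2 * t / ((t + R) * (2 * t + R))"
      using t R by (simp add: field_simps)
    show ?thesis
    proof (cases "t \<le> R")
      case True
      have "(t + R) * (2 * t + R) \<le> (2 * R) * (3 * R)" using True t R by (intro mult_mono) auto
      then have "R\<^sup>2 * t / ((2 * R) * (3 * R)) \<le> ?g t - ?g (2 * t)"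
        unfolding d using t R by (intro divide_left_mono) auto
      moreover have "R\<^sup>2 * t / ((2 * R) * (3 * R)) = t / 6" using R by (simp add: power2_eq_square)
      ultimately show ?thesis by simp
    next
      case False
      have "(t + R) * (2 * t + R) \<le> (2 * t) * (3 * t)" using False t R by (intro mult_mono) auto
      then have "R\<^sup>2 * t / ((2 * t) * (3 * t)) \<le> ?g t - ?g (2 * t)"
        unfolding d using t R by (intro divide_left_mono) auto
      moreover have "R\<^sup>2 * t / ((2 * t) * (3 * t)) = R\<^sup>2 / t / 6" using t by simp
      ultimately show ?thesis by simp
    qed
  qed
  have "(\<Sum>i<m. min (2 ^ i * x) (R\<^sup>2 / (2 ^ i * x))) \<le> (\<Sum>i<m. 6 * (?g (2 ^ i * x) - ?g (2 ^ Suc i * x)))"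
    by (intro sum_mono) (use step[of "2 ^ _ * x"] x in \<open>simp add: mult.assoc\<close>)
  also have "\<dots> = 6 * (?g (2 ^ 0 * x) - ?g (2 ^ m * x))"
    unfolding sum_distrib_left[symmetric] by (subst sum_lessThan_telescope') simp
  also have "\<dots> \<le> 6 * ?g (2 ^ 0 * x)" using x R by simp
  also have "\<dots> \<le> 6 * (R\<^sup>2 / R)" using x R by (intro mult_left_mono divide_left_mono) auto
  also have "\<dots> = 6 * R" using R by (simp add: power2_eq_square)
  finally show ?thesis .
qed

lemma left_index_range: "L \<le> U \<Longrightarrow> L \<le> left_index L U p t \<and> left_index L U p t \<le> U"
proof -
  assume LU: "L \<le> U"
  let ?A = "{U} \<union> {k \<in> {L..U - 1}. p (nat k) - p (nat (k + 1)) \<le> t}"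
  have "?A \<subseteq> {L..U}" using LU by auto
  moreover have "finite ?A" by (rule finite_subset[OF calculation]) simp
  then have "Min ?A \<in> ?A" by (rule Min_in) simp
  ultimately show ?thesis unfolding left_index_def by auto
qed

lemma right_index_range: "L \<le> U \<Longrightarrow> L - 1 \<le> right_index L U p t \<and> right_index L U p t \<le> U"
proof -
  assume LU: "L \<le> U"
  let ?A = "{L - 1} \<union> {k \<in> {L..U - 1}. p (nat k) - p (nat (k + 1)) \<ge> - t}"
  have "?A \<subseteq> {L - 1..U}" using LU by auto
  moreover have "finite ?A" by (rule finite_subset[OF calculation]) simp
  then have "Max ?A \<in> ?A" by (rule Max_in) simp
  ultimately show ?thesis unfolding right_index_def by auto
qed

definition CI_length :: "nat \<Rightarrow> real \<Rightarrow> real \<Rightarrow> outcome \<Rightarrow> real" where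
  "CI_length n \<sigma> \<alpha> \<omega> = snd (CI_z n \<sigma> \<alpha> \<omega>) - fst (CI_z n \<sigma> \<alpha> \<omega>)"

section \<open>A bound for the length that holds for every outcome\<close>

context convex_regression_radius
begin

lemma CI_length_stopped:
  assumes "check_j n \<sigma> \<omega> < \<infinity>" and r: "1 \<le> window_radius \<alpha>"
  shows "CI_length n \<sigma> \<alpha> \<omega> \<le> 2 * of_int (window_radius \<alpha>) * (2 ^ (J - hat_j n \<sigma> \<omega>) / real n)"
proof -
  define w where "w = (2 ^ (J - hat_j n \<sigma> \<omega>) :: real)"
  define i where "i = loc \<omega> (hat_j n \<sigma> \<omega>)"
  define L where "L = max 0 (i - window_radius \<alpha> + 1)"
  define U where "U = min \<lceil>(real n + 1) / w\<rceil> (i + window_radius \<alpha> - 2)"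
  have w: "w > 0" by (simp add: w_def)
  have len: "CI_length n \<sigma> \<alpha> \<omega> = max 0 (w / real n * of_int U - w / real n * of_int L)"
    using assms unfolding CI_length_def CI_z_eq stopped_at_def i_def[symmetric] Let_def w_def[symmetric] L_def[symmetric] U_def[symmetric]
    by simp
  have "U - L \<le> 2 * window_radius \<alpha>" by (simp add: U_def L_def)
  then have "real_of_int (U - L) \<le> 2 * of_int (window_radius \<alpha>)" by linarith
  then have "w / real n * real_of_int (U - L) \<le> w / real n * (2 * of_int (window_radius \<alpha>))"
    using w by (intro mult_left_mono) auto
  then have "w / real n * of_int U - w / real n * of_int L \<le> 2 * of_int (window_radius \<alpha>) * (w / real n)"
    by (simp add: right_diff_distrib mult_ac)
  moreover have "0 \<le> 2 * of_int (window_radius \<alpha>) * (w / real n)" using w r by simp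
  ultimately show ?thesis unfolding len w_def[symmetric] by simp
qed

lemma CI_length_unstopped:
  assumes "\<not> check_j n \<sigma> \<omega> < \<infinity>"
  shows "CI_length n \<sigma> \<alpha> \<omega> = max 0 (snd (endpoints_at n \<sigma> \<alpha> \<omega> (loc \<omega> J)) - fst (endpoints_at n \<sigma> \<alpha> \<omega> (loc \<omega> J)))"
  using assms check_j_unstopped(1)[OF assms] unfolding CI_length_def CI_z_eq Let_def by (auto simp: min_def max_def)

lemma CI_length_unstopped_coarse:
  assumes "\<not> check_j n \<sigma> \<omega> < \<infinity>" and r: "1 \<le> window_radius \<alpha>"
  shows "CI_length n \<sigma> \<alpha> \<omega> \<le> 2 * of_int (window_radius \<alpha>) / real n"
proof -
  let ?i = "loc \<omega> J"
  let ?L = "window_lower \<alpha> ?i" and ?U = "window_upper n \<alpha> ?i"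
  have i: "1 \<le> ?i" "?i \<le> int n + 1" using loc_of_range[of J n "split_l \<sigma> \<omega>"] by auto
  have LU: "0 \<le> ?L" "?L \<le> ?U" "?U \<le> int n" "?U - ?L \<le> 2 * window_radius \<alpha>"
    using i r unfolding window_lower_def window_upper_def by auto
  note il = left_index_range[OF LU(2), of "p_sample \<sigma> \<omega>" "p_threshold \<sigma> \<alpha>"]
  note ir = right_index_range[OF LU(2), of "p_sample \<sigma> \<omega>" "p_threshold \<sigma> \<alpha>"]
  have "snd (endpoints_at n \<sigma> \<alpha> \<omega> ?i) - fst (endpoints_at n \<sigma> \<alpha> \<omega> ?i) \<le> of_int (2 * window_radius \<alpha>) / real n"
    unfolding endpoints_at_def by (rule fine_endpoints_length[OF LU]) (use il ir r n1 in auto)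
  moreover have "0 \<le> 2 * of_int (window_radius \<alpha>) / real n" using r by simp
  ultimately show ?thesis unfolding CI_length_unstopped[OF assms(1)] by simp
qed

definition grid_argmin :: nat where
  "grid_argmin = (SOME v. grid_min v)"

lemma grid_argmin: "grid_min grid_argmin"
  unfolding grid_argmin_def by (rule someI_ex[OF grid_min_ex])

definition step_range :: "int \<Rightarrow> nat set" where
  "step_range r = {k. int grid_argmin - 2 * r \<le> int k \<and> int k < int grid_argmin + 2 * r \<and> k < n}"

definition step_cost :: "int \<Rightarrow> outcome \<Rightarrow> real" where
  "step_cost r \<omega> = (\<Sum>k\<in>step_range r. 1 + (noi (1, k) \<omega> - noi (1, k + 1) \<omega>)\<^sup>2)"

text \<open>The guards keep all indices inside the sample whatever R is. For nR < 1/8 they agree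
  with the guards in \<open>refined_length\<close>, by \<open>grid_min_right\<close> and
  \<open>grid_min_left\<close>.\<close>

definition pair_costs :: "outcome \<Rightarrow> real" where
  "pair_costs \<omega> = (let v = grid_argmin in (if v + 2 \<le> n then pair_cost v (v + 1) (v + 2) \<omega> else 0)
      + (if 2 \<le> v then pair_cost v (v - 1) (v - 2) \<omega> else 0))"

lemma finite_step_range: "finite (step_range r)"
  by (rule finite_subset[of _ "{..<n}"]) (auto simp: step_range_def)

lemma card_step_range: "0 \<le> r \<Longrightarrow> real (card (step_range r)) \<le> 4 * of_int r"
proof -
  assume r: "0 \<le> r"
  have "int ` step_range r \<subseteq> {int grid_argmin - 2 * r..<int grid_argmin + 2 * r}"
    by (auto simp: step_range_def)
  then have "card (int ` step_range r) \<le> card {int grid_argmin - 2 * r..<int grid_argmin + 2 * r}"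
    by (rule card_mono[rotated]) simp
  also have "card (int ` step_range r) = card (step_range r)" by (rule card_image) simp
  finally have "card (step_range r) \<le> nat (4 * r)" by simp
  then show ?thesis using r by linarith
qed

lemma error_cost_nonneg: "0 \<le> error_cost j \<omega>"
  unfolding error_cost_def by (intro sum_nonneg) (auto simp: case_prod_beta')

lemma step_cost_nonneg: "0 \<le> step_cost r \<omega>"
  unfolding step_cost_def by (intro sum_nonneg) auto

lemma pair_costs_nonneg: "0 \<le> pair_costs \<omega>"
  by (simp add: pair_costs_def pair_cost_def Let_def)

definition level_weight :: "nat \<Rightarrow> real" where
  "level_weight j = min (2 ^ (J - j) / real n) (R\<^sup>2 / (2 ^ (J - j) / real n))"

lemma level_weight_nonneg: "0 \<le> level_weight j"
  by (simp add: level_weight_def)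

lemma sum_level_weight: "(\<Sum>j\<le>J. level_weight j) \<le> 6 * R"
proof -
  have "(\<Sum>j\<le>J. level_weight j) = (\<Sum>i<Suc J. min (2 ^ i * (1 / real n)) (R\<^sup>2 / (2 ^ i * (1 / real n))))"
    unfolding level_weight_def
    by (rule sum.reindex_bij_witness[of _ "\<lambda>i. J - i" "\<lambda>i. J - i"]) auto
  also have "\<dots> \<le> 6 * R" by (rule sum_dyadic_min_le) (use R_pos n1 in auto)
  finally show ?thesis .
qed

text \<open>One term for each case: an error at some level; no error but nR \<ge> 1/8, so that the
  grid spacing itself is of order R; a step hidden in the sample \<open>p\<close>; the correctly
  refined interval. All terms are nonnegative, so the sum is valid in every case and no probability
  of a case has to be computed.\<close>

lemma CI_length_le:
  assumes r: "24 \<le> window_radius \<alpha>" and z: "z_quantile (\<alpha> / 8) > 0" "z_quantile (\<alpha> / 24) > 0"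
  defines "r \<equiv> real_of_int (window_radius \<alpha>)"
    and "Mp \<equiv> 307200 * (1 + (z_quantile (\<alpha> / 8))\<^sup>2)"
    and "Mq \<equiv> 5100 + 160 * (2 * sqrt 6 * z_quantile (\<alpha> / 24))"
  shows "CI_length n \<sigma> \<alpha> \<omega> \<le> (\<Sum>j\<le>J. 720000 * r * level_weight j * error_cost j \<omega>) + 16 * r * R
    + 2 * r * R * Mp * step_cost (window_radius \<alpha>) \<omega> + R * Mq * pair_costs \<omega>"
proof -
  have r0: "24 \<le> r" using assms(1) by (simp add: r_def)
  have r1: "1 \<le> window_radius \<alpha>" using assms(1) by simp
  have Mp: "Mp \<ge> 0" and Mq: "Mq \<ge> 0" using z by (auto simp: Mp_def Mq_def)
  have t: "0 \<le> 720000 * r * level_weight j * error_cost j \<omega>" for j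
    using r0 level_weight_nonneg[of j] error_cost_nonneg[of j \<omega>] by simp
  have T1: "0 \<le> (\<Sum>j\<le>J. 720000 * r * level_weight j * error_cost j \<omega>)" by (intro sum_nonneg t)
  have T2: "0 \<le> 16 * r * R" using r0 R_pos by simp
  have T3: "0 \<le> 2 * r * R * Mp * step_cost (window_radius \<alpha>) \<omega>" using r0 R_pos Mp step_cost_nonneg by simp
  have T4: "0 \<le> R * Mq * pair_costs \<omega>" using R_pos Mq pair_costs_nonneg by simp
  have n0: "real n > 0" using n1 by simp
  let ?x = "\<lambda>j. 2 ^ (J - j) / real n"
  have coarse: "CI_length n \<sigma> \<alpha> \<omega> \<le> 2 * r * ?x (hat_j n \<sigma> \<omega>)"
  proof (cases "check_j n \<sigma> \<omega> < \<infinity>")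
    case True
    then show ?thesis using CI_length_stopped[OF True r1] by (simp add: r_def)
  next
    case False
    then show ?thesis using CI_length_unstopped_coarse[OF False r1] check_j_unstopped(1)[OF False] by (simp add: r_def)
  qed
  have hJ: "hat_j n \<sigma> \<omega> \<le> J"
    using check_j_stopped(1)[of n \<sigma> \<omega>] check_j_unstopped(1)[of n \<sigma> \<omega>] by (cases "check_j n \<sigma> \<omega> < \<infinity>") auto
  show ?thesis
  proof (cases "\<exists>l\<le>hat_j n \<sigma> \<omega>. error_at l \<omega>")
    case True
    then obtain l where l: "l \<le> hat_j n \<sigma> \<omega>" "error_at l \<omega>" by blast
    \<comment> \<open>The error occurred at a level at least as coarse as the final one, so the cost
      at its scale pays for the final width.\<close>
    have "(2::real) ^ (J - hat_j n \<sigma> \<omega>) \<le> 2 ^ (J - l)" using l by (intro power_increasing) auto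
    then have "?x (hat_j n \<sigma> \<omega>) \<le> ?x l" using n0 by (intro divide_right_mono) auto
    also have "\<dots> \<le> 360000 * level_weight l * error_cost l \<omega>"
      unfolding level_weight_def by (rule error_at_cost[OF l(2)])
    finally have "2 * r * ?x (hat_j n \<sigma> \<omega>) \<le> 2 * r * (360000 * level_weight l * error_cost l \<omega>)"
      using r0 by (intro mult_left_mono) auto
    also have "\<dots> = 720000 * r * level_weight l * error_cost l \<omega>" by simp
    also have "\<dots> \<le> (\<Sum>j\<le>J. 720000 * r * level_weight j * error_cost j \<omega>)"
      by (rule member_le_sum[of l "{..J}" "\<lambda>j. 720000 * r * level_weight j * error_cost j \<omega>"]) (use t l hJ in auto)
    finally show ?thesis using coarse T2 T3 T4 by linarith
  next
    case False
    then have near: "near \<omega> (hat_j n \<sigma> \<omega>)" using near_or_error[OF hJ] by blast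
    have unst: "\<not> check_j n \<sigma> \<omega> < \<infinity>"
      using near_stops[OF hJ near] check_j_stopped(2)[of n \<sigma> \<omega>] False by blast
    then have hj: "hat_j n \<sigma> \<omega> = J" by (rule check_j_unstopped(1))
    have c': "CI_length n \<sigma> \<alpha> \<omega> \<le> 2 * r * (1 / real n)" using coarse hj by simp
    show ?thesis
    proof (cases "real n * R < 1 / 8")
      case False
      then have "1 / real n \<le> 8 * R" using n0 by (simp add: field_simps)
      then have "2 * r * (1 / real n) \<le> 2 * r * (8 * R)" using r0 by (intro mult_left_mono) auto
      then show ?thesis using c' T1 T3 T4 by linarith
    next
      case small: True
      show ?thesis
      proof (cases "\<exists>k\<in>step_range (window_radius \<alpha>). step_error (z_quantile (\<alpha> / 8)) k \<omega>")
        case True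
        then obtain k where k: "k \<in> step_range (window_radius \<alpha>)" "step_error (z_quantile (\<alpha> / 8)) k \<omega>" by blast
        define X where "X = 1 + (noi (1, k) \<omega> - noi (1, k + 1) \<omega>)\<^sup>2"
        have X: "1 \<le> X" by (simp add: X_def)
        have "X \<le> step_cost (window_radius \<alpha>) \<omega>"
          unfolding X_def step_cost_def
          by (rule member_le_sum[OF k(1), of "\<lambda>k. 1 + (noi (1, k) \<omega> - noi (1, k + 1) \<omega>)\<^sup>2"]) (use finite_step_range in auto)
        have "1 \<le> Mp * (real n * R)\<^sup>2 * X" using k(2) by (simp add: step_error_def Mp_def X_def)
        also have "\<dots> = (real n * R) * (Mp * (real n * R) * X)" by (simp add: power2_eq_square)
        \<comment> \<open>One factor nR is estimated by 1. The other is kept: after division by n it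
          is the R in the bound.\<close>
        also have "\<dots> \<le> (real n * R) * (Mp * 1 * X)"
          using nR_pos small Mp X by (intro mult_left_mono mult_right_mono) auto
        also have "\<dots> \<le> (real n * R) * (Mp * 1 * step_cost (window_radius \<alpha>) \<omega>)"
          using nR_pos Mp \<open>X \<le> _\<close> by (intro mult_left_mono) auto
        finally have "1 / real n \<le> R * Mp * step_cost (window_radius \<alpha>) \<omega>"
          using n0 by (simp add: field_simps)
        then have "2 * r * (1 / real n) \<le> 2 * r * (R * Mp * step_cost (window_radius \<alpha>) \<omega>)"
          using r0 by (intro mult_left_mono) auto
        then show ?thesis using c' T1 T2 T4 by (simp add: mult_ac) 
      next
        case no: False
        let ?v = grid_argmin
        let ?e = "endpoints_at n \<sigma> \<alpha> \<omega> (loc \<omega> J)"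
        have "snd ?e - fst ?e \<le> R * (Mq * ((if ?v < n then pair_cost ?v (?v + 1) (?v + 2) \<omega> else 0)
            + (if 0 < ?v then pair_cost ?v (?v - 1) (?v - 2) \<omega> else 0)))"
          unfolding Mq_def
          by (rule refined_length[OF grid_argmin small _ assms(1) z]) (use near hj no in \<open>auto simp: step_range_def\<close>)
        also have "(if ?v < n then pair_cost ?v (?v + 1) (?v + 2) \<omega> else 0)
            + (if 0 < ?v then pair_cost ?v (?v - 1) (?v - 2) \<omega> else 0) = pair_costs \<omega>"
          using grid_min_right(1)[OF grid_argmin _ small] grid_min_left(1)[OF grid_argmin _ small]
          by (auto simp: pair_costs_def Let_def)
        finally have "snd ?e - fst ?e \<le> R * Mq * pair_costs \<omega>" by (simp add: mult.assoc)
        then show ?thesis unfolding CI_length_unstopped[OF unst] using T1 T2 T3 T4 by (intro max.boundedI) linarith+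
      qed
    qed
  qed
qed

section \<open>Expected costs\<close>

lemma nn_integral_block_cost:
  assumes "u \<le> 3" "in_sample n j b" "in_sample n j b'" "b \<noteq> b'" and cd: "0 \<le> c" "0 \<le> d"
  shows "(\<integral>\<^sup>+\<omega>. ennreal (c + d * (block_noise u j b b' \<omega>)\<^sup>2) \<partial>M) = ennreal (c + d * (2 * 2 ^ (J - j)))"
proof -
  have [measurable]: "block_noise u j b b' \<in> borel_measurable M" by (rule block_noise_measurable[OF assms(1-3)])
  have "(\<integral>\<^sup>+\<omega>. ennreal (c + d * (block_noise u j b b' \<omega>)\<^sup>2) \<partial>M)
      = (\<integral>\<^sup>+\<omega>. ennreal c + ennreal d * ennreal ((block_noise u j b b' \<omega>)\<^sup>2) \<partial>M)"
    using cd by (simp add: ennreal_plus ennreal_mult)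
  also have "\<dots> = ennreal c + ennreal d * (\<integral>\<^sup>+\<omega>. ennreal ((block_noise u j b b' \<omega>)\<^sup>2) \<partial>M)"
    by (simp add: nn_integral_add nn_integral_cmult emeasure_space_1)
  also have "\<dots> = ennreal c + ennreal d * ennreal (2 * 2 ^ (J - j))"
    unfolding block_noise_square[OF assms(1-4)] ..
  also have "\<dots> = ennreal (c + d * (2 * 2 ^ (J - j)))" using cd
    by (subst ennreal_mult[symmetric], simp, simp, subst ennreal_plus[symmetric], simp_all)
  finally show ?thesis .
qed

lemma nn_integral_error_cost:
  "error_cost j \<in> borel_measurable M" "(\<integral>\<^sup>+\<omega>. ennreal (error_cost j \<omega>) \<partial>M) \<le> ennreal 1734"
proof -
  let ?P = "{0, 2::nat} \<times> pairs j"
  let ?g = "\<lambda>(u, b, b') \<omega>. 1 + 1 / 2 ^ (J - j) * (block_noise u j b b' \<omega>)\<^sup>2"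
  have ec: "error_cost j \<omega> = (\<Sum>p\<in>?P. ?g p \<omega>)" for \<omega>
    unfolding error_cost_def by (intro sum.cong) auto
  have fin: "finite ?P" using finite_pairs by auto
  have gm: "?g p \<in> borel_measurable M" if "p \<in> ?P" for p
  proof -
    obtain u b b' where p: "p = (u, b, b')" by (cases p)
    have [measurable]: "block_noise u j b b' \<in> borel_measurable M"
      using that p by (intro block_noise_measurable) (auto simp: pairs_def)
    show ?thesis unfolding p by simp
  qed
  show "error_cost j \<in> borel_measurable M"
    unfolding ec[abs_def] by (intro borel_measurable_sum gm)
  have "(\<integral>\<^sup>+\<omega>. ennreal (error_cost j \<omega>) \<partial>M) = (\<integral>\<^sup>+\<omega>. (\<Sum>p\<in>?P. ennreal (?g p \<omega>)) \<partial>M)"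
    unfolding ec by (intro nn_integral_cong sum_ennreal[symmetric]) (auto simp: case_prod_beta')
  also have "\<dots> = (\<Sum>p\<in>?P. \<integral>\<^sup>+\<omega>. ennreal (?g p \<omega>) \<partial>M)"
    using gm by (intro nn_integral_sum) auto
  \<comment> \<open>The squared noise of a pair, divided by the block width, has mean 2. With at
    most 2 * 289 summands this gives 578 * 3 = 1734.\<close>
  also have "\<dots> = (\<Sum>p\<in>?P. ennreal 3)"
  proof (rule sum.cong[OF refl])
    fix p assume p: "p \<in> ?P"
    obtain u b b' where e: "p = (u, b, b')" by (cases p)
    have "(\<integral>\<^sup>+\<omega>. ennreal (1 + 1 / 2 ^ (J - j) * (block_noise u j b b' \<omega>)\<^sup>2) \<partial>M)
        = ennreal (1 + 1 / 2 ^ (J - j) * (2 * 2 ^ (J - j)))"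
      by (rule nn_integral_block_cost) (use p e in \<open>auto simp: pairs_def\<close>)
    then show "(\<integral>\<^sup>+\<omega>. ennreal (?g p \<omega>) \<partial>M) = ennreal 3" unfolding e by simp
  qed
  also have "\<dots> = ennreal (real (card ?P) * 3)" by (simp add: ennreal_mult ennreal_of_nat_eq_real_of_nat)
  also have "\<dots> \<le> ennreal 1734"
    using finite_pairs by (intro ennreal_leI) (simp add: card_cartesian_product)
  finally show "(\<integral>\<^sup>+\<omega>. ennreal (error_cost j \<omega>) \<partial>M) \<le> ennreal 1734" .
qed

lemma pair_square:
  assumes "u \<le> 3" "k \<le> n" "l \<le> n" "k \<noteq> l"
  shows "(\<lambda>\<omega>. noi (u, k) \<omega> - noi (u, l) \<omega>) \<in> borel_measurable M"
    and "0 \<le> c \<Longrightarrow> (\<integral>\<^sup>+\<omega>. ennreal (c + (noi (u, k) \<omega> - noi (u, l) \<omega>)\<^sup>2) \<partial>M) = ennreal (c + 2)"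
proof -
  have s: "in_sample n J (int k + 1)" "in_sample n J (int l + 1)" "int k + 1 \<noteq> int l + 1"
    using assms by (auto simp: in_sample_finest)
  show "(\<lambda>\<omega>. noi (u, k) \<omega> - noi (u, l) \<omega>) \<in> borel_measurable M"
    using block_noise_measurable[OF assms(1) s(1,2)] by (simp add: block_noise_finest[abs_def])
  show "(\<integral>\<^sup>+\<omega>. ennreal (c + (noi (u, k) \<omega> - noi (u, l) \<omega>)\<^sup>2) \<partial>M) = ennreal (c + 2)" if "0 \<le> c"
    for c
    using nn_integral_block_cost[OF assms(1) s that, of 1] by (simp add: block_noise_finest)
qed

lemma nn_integral_step_cost:
  assumes "0 \<le> r"
  shows "step_cost r \<in> borel_measurable M" "(\<integral>\<^sup>+\<omega>. ennreal (step_cost r \<omega>) \<partial>M) \<le> ennreal (12 * of_int r)"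
proof -
  let ?g = "\<lambda>k \<omega>. 1 + (noi (1, k) \<omega> - noi (1, k + 1) \<omega>)\<^sup>2"
  have kn: "k + 1 \<le> n" if "k \<in> step_range r" for k using that by (auto simp: step_range_def)
  have gm: "?g k \<in> borel_measurable M" if "k \<in> step_range r" for k
  proof -
    have [measurable]: "(\<lambda>\<omega>. noi (1, k) \<omega> - noi (1, k + 1) \<omega>) \<in> borel_measurable M"
      by (rule pair_square(1)) (use kn[OF that] in auto)
    show ?thesis by measurable
  qed
  show "step_cost r \<in> borel_measurable M"
    unfolding step_cost_def[abs_def] by (intro borel_measurable_sum gm)
  have "(\<integral>\<^sup>+\<omega>. ennreal (step_cost r \<omega>) \<partial>M) = (\<integral>\<^sup>+\<omega>. (\<Sum>k\<in>step_range r. ennreal (?g k \<omega>)) \<partial>M)"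
    unfolding step_cost_def by (intro nn_integral_cong sum_ennreal[symmetric]) auto
  also have "\<dots> = (\<Sum>k\<in>step_range r. \<integral>\<^sup>+\<omega>. ennreal (?g k \<omega>) \<partial>M)"
    by (rule nn_integral_sum, rule measurable_compose[OF gm measurable_ennreal])
  also have "\<dots> = (\<Sum>k\<in>step_range r. ennreal 3)"
    by (intro sum.cong refl, subst pair_square(2)) (use kn in \<open>auto intro: Suc_leD\<close>)
  also have "\<dots> = ennreal (real (card (step_range r)) * 3)" by (simp add: ennreal_mult ennreal_of_nat_eq_real_of_nat)
  also have "\<dots> \<le> ennreal (12 * of_int r)"
    using card_step_range[OF assms] by (intro ennreal_leI) simp
  finally show "(\<integral>\<^sup>+\<omega>. ennreal (step_cost r \<omega>) \<partial>M) \<le> ennreal (12 * of_int r)" .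
qed

lemma nn_integral_pair_cost:
  assumes "v \<le> n" "k \<le> n" "l \<le> n" "v \<noteq> k" "l \<noteq> k"
  shows "pair_cost v k l \<in> borel_measurable M" "(\<integral>\<^sup>+\<omega>. ennreal (pair_cost v k l \<omega>) \<partial>M) = ennreal 5"
proof -
  have [measurable]: "(\<lambda>\<omega>. noi (3, v) \<omega> - noi (3, k) \<omega>) \<in> borel_measurable M"
    "(\<lambda>\<omega>. noi (3, l) \<omega> - noi (3, k) \<omega>) \<in> borel_measurable M"
    by (rule pair_square(1); use assms in simp)+
  show "pair_cost v k l \<in> borel_measurable M" unfolding pair_cost_def[abs_def] by simp
  have "(\<integral>\<^sup>+\<omega>. ennreal (pair_cost v k l \<omega>) \<partial>M)
      = (\<integral>\<^sup>+\<omega>. ennreal (1 + (noi (3, v) \<omega> - noi (3, k) \<omega>)\<^sup>2) + ennreal (0 + (noi (3, l) \<omega> - noi (3, k) \<omega>)\<^sup>2) \<partial>M)"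
    unfolding pair_cost_def by (intro nn_integral_cong) (subst ennreal_plus[symmetric], auto)
  also have "\<dots> = ennreal (1 + 2) + ennreal (0 + 2)"
    using pair_square(2)[of 3 v k 1] pair_square(2)[of 3 l k 0] assms
    by (subst nn_integral_add) simp_all
  also have "\<dots> = ennreal 5" by (subst ennreal_plus[symmetric]) auto
  finally show "(\<integral>\<^sup>+\<omega>. ennreal (pair_cost v k l \<omega>) \<partial>M) = ennreal 5" .
qed

lemma nn_integral_pair_costs:
  "pair_costs \<in> borel_measurable M" "(\<integral>\<^sup>+\<omega>. ennreal (pair_costs \<omega>) \<partial>M) \<le> ennreal 10"
proof -
  let ?v = grid_argmin
  define g where "g \<omega> = (if ?v + 2 \<le> n then pair_cost ?v (?v + 1) (?v + 2) \<omega> else 0)" for \<omega>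
  define h where "h \<omega> = (if 2 \<le> ?v then pair_cost ?v (?v - 1) (?v - 2) \<omega> else 0)" for \<omega>
  have vn: "?v \<le> n" using grid_argmin by (simp add: grid_min_def)
  have g: "g \<in> borel_measurable M" "(\<integral>\<^sup>+\<omega>. ennreal (g \<omega>) \<partial>M) \<le> ennreal 5"
    using nn_integral_pair_cost[of ?v "?v + 1" "?v + 2"] vn unfolding g_def[abs_def] by (cases "?v + 2 \<le> n"; simp)+
  have h: "h \<in> borel_measurable M" "(\<integral>\<^sup>+\<omega>. ennreal (h \<omega>) \<partial>M) \<le> ennreal 5"
    using nn_integral_pair_cost[of ?v "?v - 1" "?v - 2"] vn unfolding h_def[abs_def] by (cases "2 \<le> ?v"; simp)+
  note [measurable] = g(1) h(1)
  have gh: "pair_costs \<omega> = g \<omega> + h \<omega>" for \<omega> by (simp add: pair_costs_def Let_def g_def h_def)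
  show "pair_costs \<in> borel_measurable M" unfolding gh[abs_def] by simp
  have "(\<integral>\<^sup>+\<omega>. ennreal (pair_costs \<omega>) \<partial>M) = (\<integral>\<^sup>+\<omega>. ennreal (g \<omega>) + ennreal (h \<omega>) \<partial>M)"
    unfolding gh by (intro nn_integral_cong ennreal_plus) (auto simp: g_def h_def pair_cost_def)
  also have "\<dots> = (\<integral>\<^sup>+\<omega>. ennreal (g \<omega>) \<partial>M) + (\<integral>\<^sup>+\<omega>. ennreal (h \<omega>) \<partial>M)" by (rule nn_integral_add) auto
  also have "\<dots> \<le> ennreal 5 + ennreal 5" by (intro add_mono g h)
  also have "\<dots> = ennreal 10" by (subst ennreal_plus[symmetric]) auto
  finally show "(\<integral>\<^sup>+\<omega>. ennreal (pair_costs \<omega>) \<partial>M) \<le> ennreal 10" .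
qed

end

text \<open>The expectations of the four terms in \<open>CI_length_le\<close>, divided by R: 1734
  bounds the cost of a level, 6 the sum of the level weights, 12 r the step costs and 10 the pair
  costs.\<close>

definition length_const :: "real \<Rightarrow> real" where
  "length_const \<alpha> = (let r = real_of_int (window_radius \<alpha>) in
     720000 * r * 1734 * 6 + 16 * r + 2 * r * (307200 * (1 + (z_quantile (\<alpha> / 8))\<^sup>2)) * (12 * r)
     + (5100 + 160 * (2 * sqrt 6 * z_quantile (\<alpha> / 24))) * 10)"

lemma window_radius_ge:
  assumes "0 < \<alpha>" "\<alpha> < 1"
  shows "24 \<le> window_radius \<alpha>"
proof -
  have "1 \<le> nat (K_const (\<alpha> / 2))" using K_const_power(1)[of "\<alpha> / 2"] assms by simp
  then have "(2::int) ^ 1 \<le> 2 ^ nat (K_const (\<alpha> / 2))" by (rule power_increasing) simp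
  then show ?thesis by (simp add: window_radius_def)
qed

lemma (in convex_regression_radius) expected_length_le:
  assumes \<alpha>: "0 < \<alpha>" "\<alpha> < 1"
  shows "expected_length n \<sigma> f (CI_z n \<sigma> \<alpha>) \<le> ennreal (length_const \<alpha> * R)"
proof -
  define r where "r = real_of_int (window_radius \<alpha>)"
  define Mp where "Mp = 307200 * (1 + (z_quantile (\<alpha> / 8))\<^sup>2)"
  define Mq where "Mq = 5100 + 160 * (2 * sqrt 6 * z_quantile (\<alpha> / 24))"
  have z: "z_quantile (\<alpha> / 8) > 0" "z_quantile (\<alpha> / 24) > 0" using \<alpha> by (auto intro!: z_quantile_pos)
  have wr: "24 \<le> window_radius \<alpha>" by (rule window_radius_ge[OF \<alpha>])
  have r: "24 \<le> r" using wr by (simp add: r_def)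
  have Mp: "Mp \<ge> 0" and Mq: "Mq \<ge> 0" using z by (auto simp: Mp_def Mq_def)
  let ?w = "window_radius \<alpha>"
  let ?c = "\<lambda>j. 720000 * r * level_weight j"
  note [measurable] = nn_integral_error_cost(1) nn_integral_pair_costs(1)
  have [measurable]: "step_cost ?w \<in> borel_measurable M" by (rule nn_integral_step_cost(1)) (use wr in simp)
  have c0: "0 \<le> ?c j" for j using r level_weight_nonneg[of j] by simp
  have c3: "0 \<le> 2 * r * R * Mp" and c4: "0 \<le> R * Mq" using r R_pos Mp Mq by auto
  have pt: "ennreal (CI_length n \<sigma> \<alpha> \<omega>) \<le> (\<Sum>j\<le>J. ennreal (?c j) * ennreal (error_cost j \<omega>)) + ennreal (16 * r * R)
      + ennreal (2 * r * R * Mp) * ennreal (step_cost ?w \<omega>) + ennreal (R * Mq) * ennreal (pair_costs \<omega>)" for \<omega>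
  proof -
    have n1234: "0 \<le> (\<Sum>j\<le>J. ?c j * error_cost j \<omega>)" "0 \<le> 16 * r * R"
      "0 \<le> 2 * r * R * Mp * step_cost ?w \<omega>" "0 \<le> R * Mq * pair_costs \<omega>"
      using c3 c4 r R_pos step_cost_nonneg[of ?w \<omega>] pair_costs_nonneg[of \<omega>]
      by (simp_all only: sum_nonneg mult_nonneg_nonneg[OF c0 error_cost_nonneg] mult_nonneg_nonneg[OF c3]
          mult_nonneg_nonneg[OF c4]) simp
    have "ennreal (CI_length n \<sigma> \<alpha> \<omega>) \<le> ennreal ((\<Sum>j\<le>J. ?c j * error_cost j \<omega>) + 16 * r * R
        + 2 * r * R * Mp * step_cost ?w \<omega> + R * Mq * pair_costs \<omega>)"
      using CI_length_le[OF wr z, of \<omega>] by (intro ennreal_leI) (simp add: r_def Mp_def Mq_def)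
    also have "ennreal ((\<Sum>j\<le>J. ?c j * error_cost j \<omega>) + 16 * r * R
        + 2 * r * R * Mp * step_cost ?w \<omega> + R * Mq * pair_costs \<omega>)
      = ennreal (\<Sum>j\<le>J. ?c j * error_cost j \<omega>) + ennreal (16 * r * R)
        + ennreal (2 * r * R * Mp * step_cost ?w \<omega>) + ennreal (R * Mq * pair_costs \<omega>)"
      using n1234 by (simp only: ennreal_plus add_nonneg_nonneg)
    also have "ennreal (\<Sum>j\<le>J. ?c j * error_cost j \<omega>) = (\<Sum>j\<le>J. ennreal (?c j) * ennreal (error_cost j \<omega>))"
      using c0 error_cost_nonneg by (subst sum_ennreal[symmetric]) (auto simp: ennreal_mult)
    finally show ?thesis
      using c3 c4 step_cost_nonneg pair_costs_nonneg by (simp add: ennreal_mult)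
  qed
  have "expected_length n \<sigma> f (CI_z n \<sigma> \<alpha>) = (\<integral>\<^sup>+\<omega>. ennreal (CI_length n \<sigma> \<alpha> \<omega>) \<partial>M)"
    by (simp add: expected_length_def CI_length_def)
  also have "\<dots> \<le> (\<integral>\<^sup>+\<omega>. (\<Sum>j\<le>J. ennreal (?c j) * ennreal (error_cost j \<omega>)) + ennreal (16 * r * R)
      + ennreal (2 * r * R * Mp) * ennreal (step_cost ?w \<omega>) + ennreal (R * Mq) * ennreal (pair_costs \<omega>) \<partial>M)"
    by (intro nn_integral_mono pt)
  also have "\<dots> = (\<Sum>j\<le>J. ennreal (?c j) * (\<integral>\<^sup>+\<omega>. ennreal (error_cost j \<omega>) \<partial>M)) + ennreal (16 * r * R)
      + ennreal (2 * r * R * Mp) * (\<integral>\<^sup>+\<omega>. ennreal (step_cost ?w \<omega>) \<partial>M) + ennreal (R * Mq) * (\<integral>\<^sup>+\<omega>. ennreal (pair_costs \<omega>) \<partial>M)"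
    by (simp add: nn_integral_add nn_integral_sum nn_integral_cmult emeasure_space_1)
  also have "\<dots> \<le> (\<Sum>j\<le>J. ennreal (?c j) * ennreal 1734) + ennreal (16 * r * R)
      + ennreal (2 * r * R * Mp) * ennreal (12 * r) + ennreal (R * Mq) * ennreal 10"
    using nn_integral_step_cost(2)[of ?w] wr
    by (intro add_mono sum_mono mult_left_mono nn_integral_error_cost(2) nn_integral_pair_costs(2)) (auto simp: r_def)
  also have "(\<Sum>j\<le>J. ennreal (?c j) * ennreal 1734) = ennreal (\<Sum>j\<le>J. ?c j * 1734)"
    by (rule trans[OF _ sum_ennreal], rule sum.cong[OF refl], rule ennreal_mult[symmetric, OF c0], simp,
        rule mult_nonneg_nonneg[OF c0], simp)
  also have "ennreal (\<Sum>j\<le>J. ?c j * 1734) \<le> ennreal (720000 * r * 1734 * (6 * R))"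
  proof (rule ennreal_leI)
    have "(\<Sum>j\<le>J. ?c j * 1734) = 720000 * r * 1734 * (\<Sum>j\<le>J. level_weight j)"
      unfolding sum_distrib_left by (intro sum.cong) auto
    also have "\<dots> \<le> 720000 * r * 1734 * (6 * R)" using r by (intro mult_left_mono sum_level_weight) auto
    finally show "(\<Sum>j\<le>J. ?c j * 1734) \<le> 720000 * r * 1734 * (6 * R)" .
  qed
  also have "ennreal (720000 * r * 1734 * (6 * R)) + ennreal (16 * r * R) + ennreal (2 * r * R * Mp) * ennreal (12 * r) + ennreal (R * Mq) * ennreal 10
      = ennreal (720000 * r * 1734 * (6 * R) + 16 * r * R + 2 * r * R * Mp * (12 * r) + R * Mq * 10)"
  proof -
    have m: "ennreal (2 * r * R * Mp) * ennreal (12 * r) = ennreal (2 * r * R * Mp * (12 * r))"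
      "ennreal (R * Mq) * ennreal 10 = ennreal (R * Mq * 10)"
      using c3 c4 r by - (rule ennreal_mult[symmetric]; simp)+
    have "0 \<le> 720000 * r * 1734 * (6 * R)" "0 \<le> 16 * r * R" "0 \<le> 2 * r * R * Mp * (12 * r)" "0 \<le> R * Mq * 10"
      using r R_pos Mp Mq by auto
    then show ?thesis unfolding m by (simp only: ennreal_plus add_nonneg_nonneg)
  qed
  also have "720000 * r * 1734 * (6 * R) + 16 * r * R + 2 * r * R * Mp * (12 * r) + R * Mq * 10 = length_const \<alpha> * R"
    unfolding length_const_def Let_def r_def[symmetric] Mp_def[symmetric] Mq_def[symmetric] by algebra
  finally show ?thesis by simp
qed

theorem theorem4p2:
  fixes \<alpha> :: real
  assumes "0 < \<alpha>" and "\<alpha> < 0.3"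
  shows "\<exists>C::real. C > 0 \<and>
    (\<forall>(n::nat) (\<sigma>::real). 1 \<le> n \<longrightarrow> 0 < \<sigma> \<longrightarrow>
       CI_z n \<sigma> \<alpha> \<in> conf_intervals n \<sigma> \<alpha> convex_class \<and>
       (\<forall>f\<in>convex_class.
          expected_length n \<sigma> f (CI_z n \<sigma> \<alpha>) \<le> ennreal C * benchmark n \<sigma> \<alpha> f))"
proof -
  have \<alpha>: "\<alpha> < 1" using assms by simp
  let ?C = "5 * length_const \<alpha>"
  have z: "z_quantile (\<alpha> / 24) > 0" using assms by (intro z_quantile_pos) auto
  have C: "0 < length_const \<alpha>"
    unfolding length_const_def Let_def using window_radius_ge[OF assms(1) \<alpha>] z
    by (intro add_nonneg_pos add_nonneg_nonneg mult_nonneg_nonneg mult_pos_pos add_pos_pos) auto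
  show ?thesis
  proof (intro exI[of _ ?C] conjI allI impI ballI)
    show "0 < ?C" using C by simp
    fix n :: nat and \<sigma> :: real assume n: "1 \<le> n" and \<sigma>: "0 < \<sigma>"
    have reg: "convex_regression n \<sigma> f" if "f \<in> convex_class" for f
      using n \<sigma> that by unfold_locales
    show "CI_z n \<sigma> \<alpha> \<in> conf_intervals n \<sigma> \<alpha> convex_class"
      unfolding conf_intervals_def
      using CI_z_measurable[OF \<sigma>] convex_regression.coverage[OF reg assms(1) \<alpha>]
      by (auto simp: CI_z_def Let_def case_prod_beta')
    fix f assume f: "f \<in> convex_class"
    interpret convex_regression n \<sigma> f by (rule reg[OF f])
    show "expected_length n \<sigma> f (CI_z n \<sigma> \<alpha>) \<le> ennreal ?C * benchmark n \<sigma> \<alpha> f"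
    proof (cases "benchmark n \<sigma> \<alpha> f" rule: ennreal_cases)
      case (real b)
      have "expected_length n \<sigma> f (CI_z n \<sigma> \<alpha>) \<le> ennreal (?C * b)"
      proof (rule ennreal_le_epsilon)
        fix e :: real assume e: "0 < e"
        \<comment> \<open>The additional summand keeps R positive even if the benchmark is 0, and
          its contribution to the bound is exactly \<open>e\<close>.\<close>
        define R where "R = 5 * b + e / length_const \<alpha>"
        have R: "R > 0" "5 * b \<le> R" using real e C by (auto simp: R_def intro: add_nonneg_pos)
        interpret convex_regression_radius n \<sigma> f R
          using radius_bound_benchmark[OF \<sigma> assms f, of n b R] real R by unfold_locales auto
        have "expected_length n \<sigma> f (CI_z n \<sigma> \<alpha>) \<le> ennreal (length_const \<alpha> * R)"
          by (rule expected_length_le[OF assms(1) \<alpha>])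
        also have "length_const \<alpha> * R = ?C * b + e" using C by (simp add: R_def distrib_left)
        also have "ennreal (?C * b + e) = ennreal (?C * b) + ennreal e"
          using C real e by (intro ennreal_plus) auto
        finally show "expected_length n \<sigma> f (CI_z n \<sigma> \<alpha>) \<le> ennreal (?C * b) + ennreal e" .
      qed
      also have "\<dots> = ennreal ?C * benchmark n \<sigma> \<alpha> f" using C real by (simp add: ennreal_mult)
      finally show ?thesis .
    next
      case top
      then show ?thesis using C by (simp add: ennreal_mult_top)
    qed
  qed
qed

end
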